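(* Let $Z$ be an irreducible continuous-time Markov chain on $\{e_1,\dots,e_d\}\subset\mathbb{R}^d$ with generator $Q$ and stationary distribution $\pi$; let $\beta>0$ and for $n\in\mathbb{N}$ let $Z^{n}$ be the Markov chain with generator $n^\beta Q$ (i.e. $Z^n_t=Z_{n^\beta t}$). Let $\lambda\in\mathbb{R}^d_+$, $\lambda_\infty=\lambda^{\mathrm T}\pi$, let $N^n$ be the Markov-modulated binomial counting process with $n$ obligors and intensity $\lambda^{\mathrm T}Z^n$, i.e. $\mathrm{d}N^n_t=\lambda^{\mathrm T}Z^n_t(n-N^n_t)\mathrm{d}t+\mathrm{d}M^n_t$, $N^n_0=0$, and let $\varrho_t=1-\exp(-\lambda_\infty t)$. Then $$\hat N^{n,\beta}_t:=n^{-\frac12(1+(1-\beta)^+)}(N^n_t-n\varrho_t)$$ converges weakly, as $n\to\infty$, to the solution $\hat N$ of $$\mathrm{d}\hat N_t=-\lambda_\infty\hat N_t\,\mathrm{d}t+\mathbf 1_{\{\beta\le1\}}\mathrm{d}G_t+\mathbf 1_{\{\beta\ge1\}}\mathrm{d}B_t,\qquad\hat N_0=0,$$ where $G$ is a Gaussian martingale with $\langle G\rangle_t=\frac{V}{2\lambda_\infty}(1-\exp(-2\lambda_\infty t))$, $V=\lambda^{\mathrm T}(\mathrm{diag}\{\pi\}D^{\mathrm T}+D\,\mathrm{diag}\{\pi\})\lambda$, and $B$ is a Gaussian martingale with $\langle B\rangle_t=1-\exp(-\lambda_\infty t)$, independent of $G$. Equivalently, $$\mathrm{d}\hat N_t=-\lambda_\infty\hat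 N_t\,\mathrm{d}t+\big(\mathbf 1_{\{\beta\le1\}}V e^{-2\lambda_\infty t}+\mathbf 1_{\{\beta\ge1\}}\lambda_\infty e^{-\lambda_\infty t}\big)^{1/2}\mathrm{d}W_t$$ with $W$ a standard Brownian motion.
   Context: Generator convention: $q_{ji}\ge0$ ($i\ne j$) is the jump rate from $e_i$ to $e_j$, $q_{ii}=-\sum_{j\ne i}q_{ji}$; $\pi$ is the column vector with $Q\pi=0$, $\mathbf 1^{\mathrm T}\pi=1$. With $\Pi=\pi\mathbf 1^{\mathrm T}$, the deviation matrix is $D=(\Pi-Q)^{-1}-\Pi$. $x^+=\max(x,0)$. The Markov-modulated binomial counting process: conditionally on the path of $Z^n$, the $n$ default times are independent with $\mathbb{P}(\tau^i>t\mid Z^n)=\exp(-\int_0^t\lambda^{\mathrm T}Z^n_s\mathrm{d}s)$, $N^n_t=\#\{i:\tau^i\le t\}$; $M^n$ is a martingale w.r.t. $\sigma(N^n_s,s\le t)\vee\sigma(Z^n)$. Standing assumption: $N^n$ and $Z^n$ never jump simultaneously. Convergence is in distribution in the Skorokhod space. *)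

theory Defs
  imports "HOL-Analysis.Analysis" "HOL-Probability.Probability"
begin

section \<open>Matrices: powers, exponential, diagonal\<close>

fun matpow :: "real^'n^'n \<Rightarrow> nat \<Rightarrow> real^'n^'n" where
  "matpow A 0 = mat 1"
| "matpow A (Suc k) = A ** matpow A k"

definition mat_exp :: "real^'n^'n \<Rightarrow> real^'n^'n" where
  "mat_exp A = (\<Sum>k. (1 / fact k) *\<^sub>R matpow A k)"

definition diag_mat :: "real^'n \<Rightarrow> real^'n^'n" where
  "diag_mat v = (\<chi> i j. if i = j then v $ i else 0)"

section \<open>Generators (column convention: Q $ j $ i = q_ji = rate from e_i to e_j)\<close>

definition is_generator :: "real^'s^'s \<Rightarrow> bool" where
  "is_generator Q \<longleftrightarrow>
     (\<forall>i j. i \<noteq> j \<longrightarrow> Q $ j $ i \<ge> 0) \<and>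
     (\<forall>i. Q $ i $ i = - (\<Sum>j\<in>UNIV - {i}. Q $ j $ i))"

definition irreducible_gen :: "real^'s^'s \<Rightarrow> bool" where
  "irreducible_gen Q \<longleftrightarrow> (\<forall>i j. (i, j) \<in> {(i, j). i \<noteq> j \<and> Q $ j $ i > 0}\<^sup>*)"

definition stationary_dist :: "real^'s^'s \<Rightarrow> real^'s \<Rightarrow> bool" where
  "stationary_dist Q \<pi> \<longleftrightarrow> Q *v \<pi> = 0 \<and> (\<Sum>i\<in>UNIV. \<pi> $ i) = 1 \<and> (\<forall>i. \<pi> $ i \<ge> 0)"

text \<open>Deviation matrix D = (Pi - Q)^{-1} - Pi with Pi = pi 1^T.\<close>
definition deviation_matrix :: "real^'s^'s \<Rightarrow> real^'s \<Rightarrow> real^'s^'s" where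
  "deviation_matrix Q \<pi> = (let P = (\<chi> i j. \<pi> $ i) in matrix_inv (P - Q) - P)"

section \<open>Continuous-time Markov chains (cadlag paths, transition matrices exp(tQ))\<close>

definition is_ctmc :: "'a measure \<Rightarrow> real^'s^'s \<Rightarrow> (real \<Rightarrow> 'a \<Rightarrow> 's) \<Rightarrow> bool" where
  "is_ctmc M Q Z \<longleftrightarrow>
     (\<forall>t\<ge>0. Z t \<in> M \<rightarrow>\<^sub>M count_space UNIV) \<and>
     (\<forall>\<omega>\<in>space M. \<forall>t\<ge>0. \<exists>e>0. \<forall>s\<in>{t..<t+e}. Z s \<omega> = Z t \<omega>) \<and>
     (\<forall>\<omega>\<in>space M. \<forall>t>0. \<exists>e>0. \<exists>j. \<forall>s\<in>{t-e<..<t}. Z s \<omega> = j) \<and>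
     (\<forall>(ts::real list) (ss::'s list). ts \<noteq> [] \<and> length ss = length ts \<and> sorted ts \<and> hd ts \<ge> 0 \<longrightarrow>
        measure M {\<omega>\<in>space M. \<forall>k<length ts. Z (ts ! k) \<omega> = ss ! k}
        = measure M {\<omega>\<in>space M. Z (hd ts) \<omega> = hd ss}
          * (\<Prod>k<length ts - 1. mat_exp ((ts ! (k+1) - ts ! k) *\<^sub>R Q) $ (ss ! (k+1)) $ (ss ! k)))"

section \<open>Skorokhod space D[0,oo) with Billingsley's J1 metric (Billingsley 1999, (16.4))\<close>

text \<open>Paths are represented as functions on the reals, constant on (-oo,0].\<close>
definition cadlag_paths :: "(real \<Rightarrow> real) set" where
  "cadlag_paths = {f. (\<forall>t<0. f t = f 0) \<and> (\<forall>t\<ge>0. continuous (at_right t) f) \<and>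
                      (\<forall>t>0. \<exists>l. (f \<longlongrightarrow> l) (at_left t))}"

definition path_from0 :: "(real \<Rightarrow> real) \<Rightarrow> real \<Rightarrow> real" where
  "path_from0 f = (\<lambda>t. f (max 0 t))"

definition skor_time_changes :: "real \<Rightarrow> (real \<Rightarrow> real) set" where
  "skor_time_changes u = {l. strict_mono_on {0..u} l \<and> continuous_on {0..u} l \<and> l ` {0..u} = {0..u}}"

definition skor_lnorm :: "real \<Rightarrow> (real \<Rightarrow> real) \<Rightarrow> ereal" where
  "skor_lnorm u l = (SUP st\<in>{(s, t). 0 \<le> s \<and> s < t \<and> t \<le> u}.
                       ereal \<bar>ln ((l (snd st) - l (fst st)) / (snd st - fst st))\<bar>)"

definition skor_dist_u :: "real \<Rightarrow> (real \<Rightarrow> real) \<Rightarrow> (real \<Rightarrow> real) \<Rightarrow> real" where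
  "skor_dist_u u x y = real_of_ereal
     (INF l\<in>skor_time_changes u. max (skor_lnorm u l) (SUP t\<in>{0..u}. ereal \<bar>x t - y (l t)\<bar>))"

definition skor_cutoff :: "real \<Rightarrow> real \<Rightarrow> real" where
  "skor_cutoff u t = (if t \<le> u - 1 then 1 else if t \<le> u then u - t else 0)"

definition skor_dist :: "(real \<Rightarrow> real) \<Rightarrow> (real \<Rightarrow> real) \<Rightarrow> real" where
  "skor_dist x y = (LBINT u:{0<..}. exp (- u) *
      min 1 (skor_dist_u u (\<lambda>t. skor_cutoff u t * x t) (\<lambda>t. skor_cutoff u t * y t)))"

definition skor_open :: "(real \<Rightarrow> real) set \<Rightarrow> bool" where
  "skor_open U \<longleftrightarrow> U \<subseteq> cadlag_paths \<and>
     (\<forall>x\<in>U. \<exists>e>0. \<forall>y\<in>cadlag_paths. skor_dist x y < e \<longrightarrow> y \<in> U)"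

definition skorokhod_borel :: "(real \<Rightarrow> real) measure" where
  "skorokhod_borel = sigma cadlag_paths {U. skor_open U}"

definition skor_continuous :: "((real \<Rightarrow> real) \<Rightarrow> real) \<Rightarrow> bool" where
  "skor_continuous f \<longleftrightarrow> (\<forall>x\<in>cadlag_paths. \<forall>e>0. \<exists>d>0. \<forall>y\<in>cadlag_paths.
       skor_dist x y < d \<longrightarrow> \<bar>f y - f x\<bar> < e)"

definition weak_conv_skorokhod :: "(nat \<Rightarrow> (real \<Rightarrow> real) measure) \<Rightarrow> (real \<Rightarrow> real) measure \<Rightarrow> bool" where
  "weak_conv_skorokhod \<mu>s \<mu> \<longleftrightarrow>
     (\<forall>f. skor_continuous f \<and> bounded (f ` cadlag_paths) \<longrightarrow>
        (\<lambda>n. integral\<^sup>L (\<mu>s n) f) \<longlonglongrightarrow> integral\<^sup>L \<mu> f)"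

text \<open>Convergence in distribution in the Skorokhod space of the random paths X n (on M)
  to the random path Y (on M').\<close>
definition conv_dist_skorokhod ::
  "'a measure \<Rightarrow> (nat \<Rightarrow> 'a \<Rightarrow> real \<Rightarrow> real) \<Rightarrow> 'b measure \<Rightarrow> ('b \<Rightarrow> real \<Rightarrow> real) \<Rightarrow> bool" where
  "conv_dist_skorokhod M X M' Y \<longleftrightarrow>
     (\<forall>n. X n \<in> M \<rightarrow>\<^sub>M skorokhod_borel) \<and> Y \<in> M' \<rightarrow>\<^sub>M skorokhod_borel \<and>
     weak_conv_skorokhod (\<lambda>n. distr M skorokhod_borel (X n)) (distr M' skorokhod_borel Y)"

section \<open>Continuous Gaussian martingales with deterministic bracket g\<close>

text \<open>G_0 = 0, continuous paths, independent increments, G_t - G_s ~ N(0, g t - g s)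
  (stated via the characteristic function, so that zero variance is allowed).\<close>
definition gaussian_martingale :: "'a measure \<Rightarrow> (real \<Rightarrow> 'a \<Rightarrow> real) \<Rightarrow> (real \<Rightarrow> real) \<Rightarrow> bool" where
  "gaussian_martingale M G g \<longleftrightarrow>
     (\<forall>t\<ge>0. G t \<in> borel_measurable M) \<and>
     (\<forall>\<omega>\<in>space M. G 0 \<omega> = 0 \<and> continuous_on {0..} (\<lambda>t. G t \<omega>)) \<and>
     (\<forall>s t \<theta>. 0 \<le> s \<and> s \<le> t \<longrightarrow>
        char (distr M borel (\<lambda>\<omega>. G t \<omega> - G s \<omega>)) \<theta>
          = complex_of_real (exp (- ((g t - g s) * \<theta>\<^sup>2 / 2)))) \<and>
     (\<forall>ts. sorted ts \<and> (\<forall>t\<in>set ts. t \<ge> 0) \<longrightarrow>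
        prob_space.indep_vars M (\<lambda>_. borel) (\<lambda>k \<omega>. G (ts ! (k+1)) \<omega> - G (ts ! k) \<omega>) {..<length ts - 1})"

end

theory Submission
  imports Defs
begin

text \<open>Multiplying by exp (lam_inf t) removes the drift: the increments of exp (lam_inf t) times the
scaled process are, conditionally on the chain, centred and scaled sums of n independent identically
distributed terms. Their conditional mean is an additive functional of the fast chain, whose Gaussian
limit follows from the Poisson equation for lam - lam_inf (solved by the deviation matrix), and their
conditional variance converges to a deterministic limit. This gives convergence of the characteristic
functions of the finite-dimensional distributions. Fourth moments of the increments and dyadic chaining
down to mesh 1/n, below which only the monotonicity of N is used, give asymptotic equicontinuity. Since
the limit is continuous, locally uniform approximation suffices: a Skorokhod-continuous functional is
bounded below by functionals that are Lipschitz for the uniform distance on compacts and that converge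
to it, so no compactness in the Skorokhod space is needed.\<close>

text \<open>The exponent of \<open>n\<close> decides which noise survives. With \<open>c\<close> the
  normalisation, default noise has variance of order \<open>n c^2\<close> and chain noise of order
  \<open>(n c)^2 / n^\<beta>\<close>; the exponent makes the larger one of order 1, and both survive
  only at \<open>\<beta> = 1\<close>. Information on the chain is extracted from its transition
  matrices over short steps: errors quadratic in the step vanish in a telescoping sum, so no
  differential equation occurs, and integrals against the limit noise are Riemann sums along
  refining grids. Two obstacles shape the rest. The sigma-algebra on paths is generated by all open
  sets of the metric, so measurability of the random paths is proved by covering each open set with
  countably many events described by rational data. And a single default moves the path by
  \<open>c\<close>, which over a gap \<open>d\<close> contributes \<open>c^4 n d\<close> to the
  fourth moment; this is below \<open>d^2\<close> only for gaps of at least \<open>1 / n\<close>,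
  where the chaining therefore stops. For \<open>lam_inf = 0\<close> the quotient
  \<open>V / (2 * lam_inf)\<close> is 0 by convention, and \<open>V = 0\<close> has to be derived
  separately.\<close>

lemma exp_taylor_bounds:
 fixes x :: real
 shows "\<bar>exp x - 1\<bar> <= \<bar>x\<bar> * exp \<bar>x\<bar>" "\<bar>exp x - 1 - x\<bar> <= x\<^sup>2 * exp \<bar>x\<bar>"
proof -
 have lo: "x <= exp x - 1" using exp_ge_add_one_self[of x] by linarith
 have "(1 - x) * exp x <= exp (- x) * exp x" using exp_ge_add_one_self[of "-x"] by (intro mult_right_mono) auto
 also have "... = 1" by (simp add: exp_minus)
 finally have hi: "exp x - 1 <= x * exp x" by (simp add: algebra_simps)
 have e: "exp x <= exp \<bar>x\<bar>" "1 <= exp \<bar>x\<bar>" by auto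
 have "x * exp x <= \<bar>x\<bar> * exp \<bar>x\<bar>" using e by (intro mult_mono) auto
 moreover have "\<bar>x\<bar> * 1 <= \<bar>x\<bar> * exp \<bar>x\<bar>" using e by (intro mult_left_mono) auto
 ultimately show 1: "\<bar>exp x - 1\<bar> <= \<bar>x\<bar> * exp \<bar>x\<bar>" using lo hi by linarith
 have "exp x - 1 - x <= x * (exp x - 1)" using hi by (simp add: algebra_simps)
 also have "... <= \<bar>x\<bar> * \<bar>exp x - 1\<bar>" by (metis abs_ge_self abs_mult)
 also have "... <= \<bar>x\<bar> * (\<bar>x\<bar> * exp \<bar>x\<bar>)" using 1 by (intro mult_left_mono) auto
 finally show "\<bar>exp x - 1 - x\<bar> <= x\<^sup>2 * exp \<bar>x\<bar>" using lo by (simp add: power2_eq_square)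
qed

section \<open>Poisson equation and deviation matrix\<close>

lemma matpow_entry_bound:
 fixes A :: "real^'n^'n"
 assumes A: "!!i j. \<bar>A $ i $ j\<bar> <= a"
 shows "\<bar>matpow A k $ i $ j\<bar> <= (real CARD('n) * a) ^ k"
proof (induction k arbitrary: i j)
 case 0 show ?case by (simp add: mat_def)
next
 case (Suc k)
 have a0: "0 <= a" using order_trans[OF abs_ge_zero A] .
 have "\<bar>matpow A (Suc k) $ i $ j\<bar> = \<bar>\<Sum>l\<in>UNIV. A$i$l * matpow A k $ l $ j\<bar>"
  by (simp add: matrix_matrix_mult_def)
 also have "... <= (\<Sum>l\<in>UNIV. \<bar>A$i$l\<bar> * \<bar>matpow A k$l$j\<bar>)"
  by (rule order_trans[OF sum_abs]) (simp add: abs_mult)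
 also have "... <= (\<Sum>l\<in>(UNIV::'n set). a * (real CARD('n)*a)^k)"
  by (intro sum_mono mult_mono A Suc) (use a0 in auto)
 also have "... = (real CARD('n) * a) ^ Suc k" by simp
 finally show ?case .
qed

lemma matpow_scaleR: "matpow (c *\<^sub>R A) k = (c ^ k) *\<^sub>R matpow A k" for A :: "real^'n^'n"
 by (induction k) (simp_all add: vec_eq_iff matrix_matrix_mult_def mult_ac sum_distrib_left)

lemma summable_exp_bound: "summable (%k. \<bar>q\<bar> ^ k / fact k :: real)"
 using summable_exp[of "\<bar>q\<bar>"] by (simp add: divide_inverse mult.commute)

lemma mat_exp_sums:
 fixes A :: "real^'n^'n"
 shows "(%k. matpow A k $ i $ j / fact k) sums (mat_exp A $ i $ j)"
proof -
 define a where "a = (\<Sum>i\<in>UNIV. \<Sum>j\<in>UNIV. \<bar>A$i$j\<bar>)"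
 have A: "\<bar>A $ i $ j\<bar> <= a" for i j
 proof -
  have "\<bar>A $ i $ j\<bar> <= (\<Sum>j\<in>UNIV. \<bar>A$i$j\<bar>)" by (rule member_le_sum) auto
  also have "... <= a" unfolding a_def
   by (rule member_le_sum[where f="%i. \<Sum>j\<in>UNIV. \<bar>A$i$j\<bar>"]) (auto intro: sum_nonneg)
  finally show ?thesis .
 qed
 have sm: "summable (%k. matpow A k $ i $ j / fact k)" for i j
 proof (rule summable_comparison_test'[OF summable_exp_bound[of "real CARD('n) * a"], of 0])
  fix k :: nat
  have "\<bar>matpow A k $ i $ j\<bar> <= (real CARD('n) * a) ^ k" by (rule matpow_entry_bound[OF A])
  also have "... <= \<bar>real CARD('n) * a\<bar> ^ k" using abs_ge_self[of "(real CARD('n) * a) ^ k"] by (simp only: power_abs)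
  finally show "norm (matpow A k $ i $ j / fact k) <= \<bar>real CARD('n) * a\<bar> ^ k / fact k"
   by (simp add: divide_right_mono)
 qed
 have "(%k. (1 / fact k) *\<^sub>R matpow A k) sums (\<chi> i j. \<Sum>k. matpow A k $ i $ j / fact k)"
  unfolding sums_def
 proof (intro vec_tendstoI)
  fix i j
  show "(%n. (\<Sum>k<n. (1 / fact k) *\<^sub>R matpow A k) $ i $ j)
    \<longlonglongrightarrow> (\<chi> i j. \<Sum>k. matpow A k $ i $ j / fact k) $ i $ j"
   using summable_LIMSEQ[OF sm[of i j]] by simp
 qed
 then have "mat_exp A $ i $ j = (\<Sum>k. matpow A k $ i $ j / fact k)"
  unfolding mat_exp_def by (simp add: sums_unique[symmetric])
 then show ?thesis using summable_sums[OF sm[of i j]] by simp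
qed

text \<open>The only analytic fact used about the transition matrices: the error is uniform in the
  entries and quadratic in the step, so it disappears when steps are summed over a fine partition.
  \<open>C\<close> is the exponential series at \<open>q\<close> without its first two terms, where
  \<open>q ^ k\<close> bounds the entries of the \<open>k\<close>-th power of
  \<open>Q\<close>.\<close>

lemma mat_exp_first_order:
 fixes Q :: "real^'n^'n"
 obtains C where "C >= 0" "!!\<delta> i j. 0 <= \<delta> ==> \<delta> <= 1 ==>
  \<bar>mat_exp (\<delta> *\<^sub>R Q) $ i $ j - (if i = j then 1 else 0) - \<delta> * Q $ i $ j\<bar> <= C * \<delta>\<^sup>2"
proof -
 define a where "a = (\<Sum>i\<in>UNIV. \<Sum>j\<in>UNIV. \<bar>Q$i$j\<bar>)"
 have A: "\<bar>Q $ i $ j\<bar> <= a" for i j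
 proof -
  have "\<bar>Q $ i $ j\<bar> <= (\<Sum>j\<in>UNIV. \<bar>Q$i$j\<bar>)" by (rule member_le_sum) auto
  also have "... <= a" unfolding a_def
   by (rule member_le_sum[where f="%i. \<Sum>j\<in>UNIV. \<bar>Q$i$j\<bar>"]) (auto intro: sum_nonneg)
  finally show ?thesis .
 qed
 define q where "q = \<bar>real CARD('n) * a\<bar>"
 define C where "C = (\<Sum>k. q ^ (k+2) / fact (k+2))"
 have sq: "summable (%k. q ^ (k+2) / fact (k+2))"
  using summable_ignore_initial_segment[OF summable_exp_bound[of q], of 2] by (simp add: q_def)
 have M: "\<bar>matpow Q k $ i $ j\<bar> <= q ^ k" for k i j
  unfolding q_def power_abs[symmetric] by (rule order_trans[OF matpow_entry_bound[OF A] abs_ge_self])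
 have "C >= 0" unfolding C_def by (rule suminf_nonneg[OF sq]) (simp add: q_def)
 moreover have "\<bar>mat_exp (\<delta> *\<^sub>R Q) $ i $ j - (if i = j then 1 else 0) - \<delta> * Q $ i $ j\<bar> <= C * \<delta>\<^sup>2"
  if \<delta>: "0 <= \<delta>" "\<delta> <= 1" for \<delta> i j
 proof -
  let ?f = "%k. \<delta> ^ k * matpow Q k $ i $ j / fact k"
  have s: "?f sums (mat_exp (\<delta> *\<^sub>R Q) $ i $ j)"
   using mat_exp_sums[of "\<delta> *\<^sub>R Q" i j] by (simp add: matpow_scaleR)
  have "(%k. ?f (k+2)) sums (mat_exp (\<delta> *\<^sub>R Q) $ i $ j - (\<Sum>k<2. ?f k))"
   using sums_split_initial_segment[OF s, of 2] .
  moreover have "(\<Sum>k<2. ?f k) = (if i = j then 1 else 0) + \<delta> * Q $ i $ j"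
   proof -
   have "matpow Q (Suc 0) = Q" by simp
   moreover have "matpow Q 0 $ i $ j = (if i = j then 1 else 0)" by (simp add: mat_def)
   ultimately show ?thesis by (simp add: numeral_2_eq_2 del: matpow.simps)
  qed
  ultimately have t: "(%k. ?f (k+2)) sums (mat_exp (\<delta> *\<^sub>R Q) $ i $ j - (if i = j then 1 else 0) - \<delta> * Q $ i $ j)"
   by (simp add: diff_diff_eq)
  have b: "norm (?f (k+2)) <= \<delta>\<^sup>2 * (q ^ (k+2) / fact (k+2))" for k
  proof -
   have "\<delta> ^ (k+2) <= \<delta>\<^sup>2" using \<delta> by (intro power_decreasing) auto
   then have "\<delta> ^ (k+2) * \<bar>matpow Q (k+2) $ i $ j\<bar> <= \<delta>\<^sup>2 * q ^ (k+2)"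
    using M[of "k+2" i j] \<delta> by (intro mult_mono) auto
   then show ?thesis using \<delta> by (simp add: abs_mult divide_right_mono del: power_Suc)
  qed
  have "\<bar>\<Sum>k. ?f (k+2)\<bar> <= (\<Sum>k. \<delta>\<^sup>2 * (q ^ (k+2) / fact (k+2)))"
   using norm_suminf_le[OF b summable_mult[OF sq]] by simp
  also have "... = C * \<delta>\<^sup>2" unfolding C_def suminf_mult[OF sq] by (rule mult.commute)
  finally show ?thesis using sums_unique[OF t] by simp
 qed
 ultimately show ?thesis by (rule that)
qed

text \<open>The transpose of \<open>Q\<close> acting on functions, that is, the backward generator:
  in the column convention \<open>Q $ j $ i\<close> is the rate from \<open>i\<close> to
  \<open>j\<close>.\<close>

definition gen_adj :: "real^'s^'s => ('s => real) => 's => real" where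
 "gen_adj Q h i = (\<Sum>j\<in>UNIV. Q $ j $ i * h j)"

lemma generator_col_sum: "is_generator Q ==> (\<Sum>j\<in>UNIV. Q $ j $ i) = 0"
 unfolding is_generator_def by (subst sum.remove[of _ i]) auto

text \<open>Maximum principle: at a state where \<open>h\<close> is maximal the equation is a
  vanishing sum of nonnegative terms, so every state reachable by one jump is maximal too;
  irreducibility spreads this to all states.\<close>

lemma harmonic_const:
 fixes Q :: "real^'s^'s"
 assumes Q: "is_generator Q" and irr: "irreducible_gen Q" and h: "!!i. gen_adj Q h i = 0"
 shows "h i = h j"
proof -
 obtain m where m: "!!j. h j <= h m"
 proof -
  have "Max (range h) \<in> range h" by (rule Max_in) auto
  then obtain m where "h m = Max (range h)" by force
  then show ?thesis using that[of m] by (simp add: Max_ge)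
 qed
 have step: "h j = h m" if "i ~= j" "Q $ j $ i > 0" "h i = h m" for i j
 proof -
  have "(\<Sum>l\<in>UNIV. Q$l$i * (h i - h l)) = h i * (\<Sum>l\<in>UNIV. Q$l$i) - gen_adj Q h i"
   by (simp add: gen_adj_def sum_subtractf sum_distrib_left right_diff_distrib mult.commute)
  also have "... = 0" using generator_col_sum[OF Q] h by simp
  finally have z: "(\<Sum>l\<in>UNIV. Q$l$i * (h i - h l)) = 0" .
  have "Q$l$i * (h i - h l) >= 0" for l
   using Q m[of l] that(3) unfolding is_generator_def by (cases "l = i") (auto intro!: mult_nonneg_nonneg)
  then have "Q$j$i * (h i - h j) = 0" using z by (subst (asm) sum_nonneg_eq_0_iff) auto
  then show ?thesis using that by auto
 qed
 have all: "h j = h m" for j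
 proof -
  have "(m, j) \<in> {(i, j). i ~= j \<and> Q $ j $ i > 0}\<^sup>*" using irr unfolding irreducible_gen_def by blast
  then show ?thesis by (induction rule: rtrancl_induct) (auto intro: step)
 qed
 show ?thesis using all[of i] all[of j] by simp
qed

lemma matrix_sub_rdistrib: "(A - B) ** C = A ** C - B ** C" for A B :: "real^'n^'m" and C :: "real^'k^'n"
 by (simp add: vec_eq_iff matrix_matrix_mult_def left_diff_distrib sum_subtractf)

lemma matrix_sub_ldistrib: "A ** (B - C) = A ** B - A ** C" for A :: "real^'n^'m" and B C :: "real^'k^'n"
 by (simp add: vec_eq_iff matrix_matrix_mult_def right_diff_distrib sum_subtractf)

text \<open>\<open>P - Q\<close> is inverted through the kernel of its transpose. A kernel vector
  satisfies \<open>gen_adj Q y = \<pi> \<bullet> y\<close> in every state; averaging against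
  \<open>\<pi>\<close> makes this constant zero, so \<open>y\<close> is harmonic, hence constant,
  hence zero. The identities then follow from \<open>P ** P = P\<close> and
  \<open>P ** Q = Q ** P = 0\<close>.\<close>

lemma deviation_matrix_props:
 fixes Q :: "real^'s^'s"
 assumes Q: "is_generator Q" and irr: "irreducible_gen Q" and st: "stationary_dist Q \<pi>"
 defines "D \<equiv> deviation_matrix Q \<pi>"
 shows "D ** Q = (\<chi> i j. \<pi> $ i) - mat 1" "D *v \<pi> = 0"
proof -
 define P :: "real^'s^'s" where "P = (\<chi> i j. \<pi> $ i)"
 define R where "R = matrix_inv (P - Q)"
 have Q\<pi>: "Q *v \<pi> = 0" and s1: "(\<Sum>i\<in>UNIV. \<pi> $ i) = 1" using st unfolding stationary_dist_def by auto
 have Q\<pi>': "(\<Sum>j\<in>UNIV. Q$i$j * \<pi>$j) = 0" for i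
  using arg_cong[OF Q\<pi>, of "%v. v $ i"] by (simp add: matrix_vector_mult_def)
 have "y = 0" if y: "transpose (P - Q) *v y = 0" for y
 proof -
  have e: "\<pi> \<bullet> y - gen_adj Q (($) y) j = 0" for j
   using arg_cong[OF y, of "%v. v $ j"]
   by (simp add: matrix_vector_mult_def transpose_def P_def gen_adj_def inner_vec_def left_diff_distrib sum_subtractf)
  have "(\<Sum>j\<in>UNIV. \<pi>$j * gen_adj Q (($) y) j) = (\<Sum>i\<in>UNIV. y$i * (\<Sum>j\<in>UNIV. Q$i$j * \<pi>$j))"
   unfolding gen_adj_def sum_distrib_left by (subst sum.swap) (simp add: mult_ac)
  then have "(\<Sum>j\<in>UNIV. \<pi>$j * gen_adj Q (($) y) j) = 0" using Q\<pi>' by simp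
  moreover have "(\<Sum>j\<in>UNIV. \<pi>$j * (\<pi> \<bullet> y - gen_adj Q (($) y) j)) = 0" using e by simp
  ultimately have "(\<pi> \<bullet> y) * (\<Sum>j\<in>UNIV. \<pi>$j) = 0"
   by (simp add: right_diff_distrib sum_subtractf sum_distrib_left mult.commute)
  then have py: "\<pi> \<bullet> y = 0" using s1 by simp
  then have "gen_adj Q (($) y) j = 0" for j using e[of j] by simp
  then have c: "y $ i = y $ j" for i j using harmonic_const[OF Q irr] by blast
  have "\<pi> \<bullet> y = y $ i * (\<Sum>j\<in>UNIV. \<pi>$j)" for i
   proof -
   have "\<pi> \<bullet> y = (\<Sum>j\<in>UNIV. y $ i * \<pi>$j)"
    unfolding inner_vec_def
   proof (rule sum.cong)
    fix j show "\<pi> $ j \<bullet> y $ j = y $ i * \<pi> $ j" using c[of j i] by simp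
   qed simp
   then show ?thesis by (simp add: sum_distrib_left)
  qed
  then show "y = 0" using py s1 by (simp add: vec_eq_iff)
 qed
 then have "invertible (transpose (P - Q))"
  using invertible_left_inverse matrix_left_invertible_ker by blast
 then obtain B where "transpose (P - Q) ** B = mat 1" "B ** transpose (P - Q) = mat 1"
  unfolding invertible_def by blast
 then have "transpose B ** (P - Q) = mat 1" "(P - Q) ** transpose B = mat 1"
  by (metis matrix_transpose_mul transpose_mat transpose_transpose)+
 then have inv: "invertible (P - Q)" unfolding invertible_def by blast
 have RA: "R ** (P - Q) = mat 1"
  using someI_ex[OF inv[unfolded invertible_def]] unfolding R_def matrix_inv_def by blast
 have PP: "P ** P = P"
  by (simp add: vec_eq_iff P_def matrix_matrix_mult_def sum_distrib_left[symmetric] s1)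
 have QP: "Q ** P = 0"
  by (simp add: vec_eq_iff P_def matrix_matrix_mult_def Q\<pi>')
 have PQ: "P ** Q = 0"
  by (simp add: vec_eq_iff P_def matrix_matrix_mult_def sum_distrib_left[symmetric] generator_col_sum[OF Q])
 have "R ** P = R ** ((P - Q) ** P)" by (simp add: matrix_sub_rdistrib PP QP)
 also have "... = P" by (simp add: matrix_mul_assoc RA)
 finally have RP: "R ** P = P" .
 have RQ: "R ** Q = P - mat 1" using RA RP by (simp add: matrix_sub_ldistrib algebra_simps)
 have D: "D = R - P" unfolding D_def deviation_matrix_def R_def P_def Let_def by (rule refl)
 show "D ** Q = (\<chi> i j. \<pi> $ i) - mat 1" unfolding D using RQ PQ by (simp add: matrix_sub_rdistrib P_def)
 have P\<pi>: "P *v \<pi> = \<pi>"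
  by (simp add: vec_eq_iff P_def matrix_vector_mult_def sum_distrib_left[symmetric] s1)
 have "R *v \<pi> = R *v ((P - Q) *v \<pi>)" by (simp add: matrix_vector_mult_diff_rdistrib P\<pi> Q\<pi>)
 also have "... = \<pi>" by (simp add: matrix_vector_mul_assoc RA)
 finally show "D *v \<pi> = 0" unfolding D by (simp add: matrix_vector_mult_diff_rdistrib P\<pi>)
qed

text \<open>Transposed form of \<open>deviation_matrix_props\<close>: \<open>u f\<close> is the
  transpose of the deviation matrix applied to \<open>f\<close>, and \<open>D *v \<pi> = 0\<close>
  makes it centred under \<open>\<pi>\<close>.\<close>

lemma poisson_equation:
 fixes Q :: "real^'s^'s"
 assumes Q: "is_generator Q" and irr: "irreducible_gen Q" and st: "stationary_dist Q \<pi>"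
 defines "u f i \<equiv> \<Sum>j\<in>UNIV. f j * deviation_matrix Q \<pi> $ j $ i"
 shows "gen_adj Q (u f) i = (\<Sum>j\<in>UNIV. \<pi> $ j * f j) - f i" "(\<Sum>i\<in>UNIV. \<pi> $ i * u f i) = 0"
proof -
 let ?D = "deviation_matrix Q \<pi>"
 have DQ: "(\<Sum>k\<in>UNIV. ?D$l$k * Q$k$i) = \<pi>$l - (if l = i then 1 else 0)" for l i
  using arg_cong[OF deviation_matrix_props(1)[OF Q irr st], of "%A. A $ l $ i"]
  by (simp add: matrix_matrix_mult_def mat_def)
 have D\<pi>: "(\<Sum>k\<in>UNIV. ?D$l$k * \<pi>$k) = 0" for l
  using arg_cong[OF deviation_matrix_props(2)[OF Q irr st], of "%A. A $ l"]
  by (simp add: matrix_vector_mult_def)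
 have "gen_adj Q (u f) i = (\<Sum>l\<in>UNIV. f l * (\<Sum>k\<in>UNIV. ?D$l$k * Q$k$i))"
  unfolding gen_adj_def u_def sum_distrib_left by (subst sum.swap) (simp add: mult_ac)
 also have "... = (\<Sum>j\<in>UNIV. \<pi> $ j * f j) - f i"
  unfolding DQ by (simp add: right_diff_distrib sum_subtractf mult.commute if_distrib[of "%x. _ * x"] cong: if_cong)
 finally show "gen_adj Q (u f) i = (\<Sum>j\<in>UNIV. \<pi> $ j * f j) - f i" .
 have "(\<Sum>i\<in>UNIV. \<pi> $ i * u f i) = (\<Sum>l\<in>UNIV. f l * (\<Sum>k\<in>UNIV. ?D$l$k * \<pi>$k))"
  unfolding u_def sum_distrib_left by (subst sum.swap) (simp add: mult_ac)
 then show "(\<Sum>i\<in>UNIV. \<pi> $ i * u f i) = 0" by (simp add: D\<pi>)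
qed

text \<open>\<open>g\<close> corrects the centred intensity; \<open>k\<close> corrects the
  fluctuation of \<open>(lam - lam \<bullet> \<pi>) * g\<close> around its stationary mean. That
  mean is \<open>V / 2\<close>, because the two summands of \<open>V\<close> give equal quadratic
  forms. The last conclusion serves the degenerate case: if \<open>lam \<bullet> \<pi> = 0\<close>
  with \<open>lam\<close> nonnegative, then \<open>lam\<close> vanishes wherever
  \<open>\<pi>\<close> is positive.\<close>

lemma poisson_correctors:
 fixes Q :: "real^'s^'s" and lam :: "real^'s"
 assumes Q: "is_generator Q" and irr: "irreducible_gen Q" and st: "stationary_dist Q \<pi>"
 defines "V \<equiv> lam \<bullet> ((diag_mat \<pi> ** transpose (deviation_matrix Q \<pi>) + deviation_matrix Q \<pi> ** diag_mat \<pi>) *v lam)"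
 obtains g k where "!!i. gen_adj Q g i = - (lam $ i - lam \<bullet> \<pi>)"
  "!!i. gen_adj Q k i = V / 2 - (lam $ i - lam \<bullet> \<pi>) * g i"
  "(\<forall>i. lam $ i >= 0) ==> lam \<bullet> \<pi> = 0 ==> V = 0"
proof -
 let ?D = "deviation_matrix Q \<pi>"
 define u where "u f i = (\<Sum>j\<in>UNIV. f j * ?D $ j $ i)" for f and i :: 's
 note P = poisson_equation[OF Q irr st, folded u_def]
 define g where "g = u (($) lam)"
 have g: "gen_adj Q g i = - (lam $ i - lam \<bullet> \<pi>)" for i
  unfolding g_def P by (simp add: inner_vec_def mult.commute)
 have "V = (\<Sum>i\<in>UNIV. \<Sum>j\<in>UNIV. lam$i * (\<pi>$i * ?D$j$i) * lam$j) + (\<Sum>i\<in>UNIV. \<Sum>j\<in>UNIV. lam$i * (?D$i$j * \<pi>$j) * lam$j)"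
  unfolding V_def by (simp add: inner_vec_def matrix_vector_mult_def matrix_matrix_mult_def diag_mat_def
    transpose_def sum_distrib_left sum.distrib[symmetric] distrib_left distrib_right
    if_distrib[of "%x. x * _"] if_distrib[of "%x. _ * x"] mult_ac cong: if_cong)
 also have "(\<Sum>i\<in>UNIV. \<Sum>j\<in>UNIV. lam$i * (?D$i$j * \<pi>$j) * lam$j) = (\<Sum>i\<in>UNIV. \<Sum>j\<in>UNIV. lam$i * (\<pi>$i * ?D$j$i) * lam$j)"
  by (subst sum.swap) (simp add: mult_ac)
 also have "(\<Sum>i\<in>UNIV. \<Sum>j\<in>UNIV. lam$i * (\<pi>$i * ?D$j$i) * lam$j) = (\<Sum>i\<in>UNIV. \<pi>$i * lam$i * g i)"
  unfolding g_def u_def by (simp add: sum_distrib_left mult_ac)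
 finally have V: "V = 2 * (\<Sum>i\<in>UNIV. \<pi>$i * lam$i * g i)" by simp
 define f where "f i = (lam $ i - lam \<bullet> \<pi>) * g i - V / 2" for i
 have s1: "(\<Sum>i\<in>UNIV. \<pi> $ i) = 1" using st unfolding stationary_dist_def by auto
 have "(\<Sum>i\<in>UNIV. \<pi> $ i * f i) = (\<Sum>i\<in>UNIV. \<pi>$i * lam$i * g i) - (lam \<bullet> \<pi>) * (\<Sum>i\<in>UNIV. \<pi>$i * g i) - V/2 * (\<Sum>i\<in>UNIV. \<pi> $ i)"
  unfolding f_def by (simp add: sum_subtractf sum.distrib sum_distrib_left sum_divide_distrib algebra_simps)
 also have "... = 0" using V P(2)[of "($) lam"] s1 unfolding g_def by simp
 finally have pf: "(\<Sum>i\<in>UNIV. \<pi> $ i * f i) = 0" .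
 have k: "gen_adj Q (u f) i = V / 2 - (lam $ i - lam \<bullet> \<pi>) * g i" for i
  unfolding P pf by (simp add: f_def)
 have "V = 0" if "\<forall>i. lam $ i >= 0" "lam \<bullet> \<pi> = 0"
 proof -
  have "(\<Sum>i\<in>UNIV. lam$i * \<pi>$i) = 0" using that by (simp add: inner_vec_def)
  moreover have "lam$i * \<pi>$i >= 0" for i using that st unfolding stationary_dist_def by auto
  ultimately have "lam$i * \<pi>$i = 0" for i by (subst (asm) sum_nonneg_eq_0_iff) auto
  then have "\<pi>$i * lam$i * g i = 0" for i by (metis mult.commute mult_zero_left)
  then show ?thesis unfolding V by (simp only: sum.neutral_const mult_zero_right)
 qed
 then show ?thesis using that[OF g k] by blast
qed

section \<open>Characteristic functions and vector convergence\<close>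

definition int_conv :: "'a measure => (nat => 'a => nat => real) => 'b measure => ('b => nat => real)
  => ((nat => real) => real) => bool" where
 "int_conv M V M' W F \<longleftrightarrow> (%n. LINT w|M. F (V n w)) \<longlonglongrightarrow> (LINT w|M'. F (W w))"

lemma borel_measurable_coord [measurable]: "(%x::nat => real. x j) \<in> borel_measurable borel"
 by (rule borel_measurable_continuous_onI) simp

text \<open>Random vectors are coded as sequences, so that the dimension can vary without changing
  types; the test functions of interest depend on finitely many coordinates.\<close>

locale vec_conv = M: prob_space M + M': prob_space M'
 for M :: "'a measure" and M' :: "'b measure" +
 fixes V :: "nat => 'a => nat => real" and W :: "'b => nat => real"
 assumes V_coord: "!!n j. (%w. V n w j) \<in> borel_measurable M"
  and W_coord: "!!j. (%w. W w j) \<in> borel_measurable M'"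
begin

lemma V_meas [measurable]: "V n \<in> borel_measurable M"
 by (rule measurable_coordinatewise_then_product) (rule V_coord)

lemma W_meas [measurable]: "W \<in> borel_measurable M'"
 by (rule measurable_coordinatewise_then_product) (rule W_coord)

abbreviation L :: "((nat => real) => real) => bool" where "L \<equiv> int_conv M V M' W"

lemma integrable_V: "F \<in> borel_measurable borel ==> (!!x. \<bar>F x\<bar> <= B) ==> integrable M (%w. F (V n w) :: real)"
 by (rule M.integrable_const_bound[of _ B]) (auto intro: measurable_compose[OF V_meas])

lemma integrable_W: "F \<in> borel_measurable borel ==> (!!x. \<bar>F x\<bar> <= B) ==> integrable M' (%w. F (W w) :: real)"
 by (rule M'.integrable_const_bound[of _ B]) (auto intro: measurable_compose[OF W_meas])

definition bm :: "((nat => real) => real) => bool" where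
 "bm F \<longleftrightarrow> F \<in> borel_measurable borel \<and> (\<exists>B. \<forall>x. \<bar>F x\<bar> <= B)"

lemma bm_int: "bm F ==> integrable M (%w. F (V n w))" "bm F ==> integrable M' (%w. F (W w))"
 unfolding bm_def using integrable_V integrable_W by blast+

lemma bm_add: "bm F ==> bm G ==> bm (%x. F x + G x)"
 unfolding bm_def by (auto intro!: exI[of _ "_ + _"] order_trans[OF abs_triangle_ineq] add_mono)

lemma bm_mult: assumes "bm F" "bm G" shows "bm (%x. F x * G x)"
proof -
 obtain A B where "!!x. \<bar>F x\<bar> <= A" "!!x. \<bar>G x\<bar> <= B" using assms unfolding bm_def by auto
 then have "\<bar>F x * G x\<bar> <= A * B" for x by (simp add: abs_mult mult_mono')
 then show ?thesis using assms unfolding bm_def by (auto intro: exI[of _ "A * B"])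
qed

lemma bm_const: "bm (%x. c)" unfolding bm_def by auto

lemma bm_prod: "finite A ==> (!!j. j \<in> A ==> bm (F j)) ==> bm (%x. \<Prod>j\<in>A. F j x)"
 by (induction A rule: finite_induct) (auto intro: bm_mult simp: bm_const)

lemma bm_sum: "finite A ==> (!!j. j \<in> A ==> bm (F j)) ==> bm (%x. \<Sum>j\<in>A. F j x)"
 by (induction A rule: finite_induct) (auto intro: bm_add simp: bm_const)

lemma bm_trig: "s \<in> borel_measurable borel ==> bm (%x. cos (s x))" "s \<in> borel_measurable borel ==> bm (%x. sin (s x))"
 unfolding bm_def by (auto intro: exI[of _ 1])

lemma L_const: "L (%x. c)"
 unfolding int_conv_def by (simp add: M.prob_space M'.prob_space)

lemma L_add: "bm F ==> bm G ==> L F ==> L G ==> L (%x. F x + G x)"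
 unfolding int_conv_def by (simp add: bm_int tendsto_add)

lemma L_cmult: "L F ==> L (%x. c * F x)"
 unfolding int_conv_def by (simp add: tendsto_mult_left)

lemma L_sum: "finite A ==> (!!j. j \<in> A ==> bm (F j)) ==> (!!j. j \<in> A ==> L (F j)) ==> L (%x. \<Sum>j\<in>A. F j x)"
proof (induction A rule: finite_induct)
 case (insert a A)
 then have "L (%x. F a x + (\<Sum>j\<in>A. F j x))" by (intro L_add bm_sum) auto
 then show ?case using insert by simp
qed (simp add: L_const)

text \<open>One-dimensional Levy continuity under a change of density, so that the exponentials in a joint
characteristic function can be replaced by test functions one coordinate at a time.\<close>

lemma weighted_levy:
 assumes ww: "ww \<in> borel_measurable borel" "!!x. 1 <= ww x" "!!x. ww x <= 3"
  and c: "!!t. L (%x. ww x * cos (t * x i))" and s: "!!t. L (%x. ww x * sin (t * x i))"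
  and h: "!!y. isCont h y" "!!y. \<bar>h y\<bar> <= (1::real)"
 shows "L (%x. ww x * h (x i))"
proof -
 note [measurable] = ww(1)
 have [measurable]: "h \<in> borel_measurable borel"
  using h(1) by (intro borel_measurable_continuous_onI) (simp add: continuous_at_imp_continuous_on)
 have w_bm: "bm ww" unfolding bm_def using ww by (auto intro!: exI[of _ 3] simp: abs_le_iff) (smt (verit) ww)
 define a where "a n = (LINT w|M. ww (V n w))" for n
 define b where "b = (LINT w|M'. ww (W w))"
 have a1: "a n >= 1" for n
 proof -
  have "(LINT w|M. 1) <= a n" unfolding a_def by (intro integral_mono bm_int w_bm) (auto simp: ww bm_const)
  then show ?thesis by (simp add: M.prob_space)
 qed
 have b1: "b >= 1"
 proof -
  have "(LINT w|M'. 1) <= b" unfolding b_def by (intro integral_mono bm_int w_bm) (auto simp: ww bm_const)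
  then show ?thesis by (simp add: M'.prob_space)
 qed
 have ab: "a \<longlonglongrightarrow> b" using c[of 0] unfolding int_conv_def a_def b_def by simp
 \<comment> \<open>Division by its mean turns the positive weight into a probability density. The
   bounds 1 and 3 keep the weight integrable and its means \<open>a n\<close> and \<open>b\<close>
   away from 0, so that the normalisation can be undone after Levy continuity has been applied to
   the reweighted laws.\<close>
 define \<mu> where "\<mu> n = distr (density M (%w. ennreal (ww (V n w) / a n))) borel (%w. V n w i)" for n
 define \<nu> where "\<nu> = distr (density M' (%w. ennreal (ww (W w) / b))) borel (%w. W w i)"
 have w0: "ww x >= 0" for x using ww(2)[of x] by linarith
 have ps: "prob_space (density M (%w. ennreal (ww (V n w) / a n)))" for n
 proof
  have "(\<integral>\<^sup>+w. ennreal (ww (V n w) / a n) \<partial>M) = ennreal (LINT w|M. ww (V n w) / a n)"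
   using a1[of n] w0 by (intro nn_integral_eq_integral integrable_divide bm_int w_bm) auto
  also have "... = 1" using a1[of n] by (simp add: a_def[symmetric])
  finally show "emeasure (density M (%w. ennreal (ww (V n w) / a n))) (space (density M (%w. ennreal (ww (V n w) / a n)))) = 1"
   by (simp add: emeasure_density cong: nn_integral_cong)
 qed
 have ps': "prob_space (density M' (%w. ennreal (ww (W w) / b)))"
 proof
  have "(\<integral>\<^sup>+w. ennreal (ww (W w) / b) \<partial>M') = ennreal (LINT w|M'. ww (W w) / b)"
   using b1 w0 by (intro nn_integral_eq_integral integrable_divide bm_int w_bm) auto
  also have "... = 1" using b1 by (simp add: b_def[symmetric])
  finally show "emeasure (density M' (%w. ennreal (ww (W w) / b))) (space (density M' (%w. ennreal (ww (W w) / b)))) = 1"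
   by (simp add: emeasure_density cong: nn_integral_cong)
 qed
 have rd: "real_distribution (\<mu> n)" for n unfolding \<mu>_def
  by (rule prob_space.real_distribution_distr[OF ps]) (simp add: V_coord)
 have rd': "real_distribution \<nu>" unfolding \<nu>_def
  by (rule prob_space.real_distribution_distr[OF ps']) (simp add: W_coord)
 have int\<mu>: "integral\<^sup>L (\<mu> n) f = (LINT w|M. (ww (V n w) / a n) *\<^sub>R f (V n w i))"
  if [measurable]: "f \<in> borel_measurable borel" for f :: "real => 'z :: {banach, second_countable_topology}" and n
  unfolding \<mu>_def using V_coord[of n i, measurable] a1[of n] w0
  by (subst integral_distr) (auto simp: integral_density)
 have int\<nu>: "integral\<^sup>L \<nu> f = (LINT w|M'. (ww (W w) / b) *\<^sub>R f (W w i))"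
  if [measurable]: "f \<in> borel_measurable borel" for f :: "real => 'z :: {banach, second_countable_topology}"
  unfolding \<nu>_def using W_coord[of i, measurable] b1 w0
  by (subst integral_distr) (auto simp: integral_density)
 have bmt: "bm (%x. ww x * cos (t * x i))" "bm (%x. ww x * sin (t * x i))" for t
  by (intro bm_mult w_bm bm_trig; measurable)+
 have iexp: "iexp x = complex_of_real (cos x) + \<i> * complex_of_real (sin x)" for x
  by (simp add: exp_Euler cos_of_real sin_of_real)
 have ch\<mu>: "char (\<mu> n) t = (complex_of_real (LINT w|M. ww (V n w) * cos (t * V n w i))
   + \<i> * complex_of_real (LINT w|M. ww (V n w) * sin (t * V n w i))) / a n" for n t
 proof -
  have "char (\<mu> n) t = (LINT w|M. (ww (V n w) / a n) *\<^sub>R iexp (t * V n w i))"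
   unfolding char_def by (subst int\<mu>) auto
  also have "... = (LINT w|M. (complex_of_real (ww (V n w) * cos (t * V n w i))
   + \<i> * complex_of_real (ww (V n w) * sin (t * V n w i))) / a n)"
   unfolding iexp by (rule Bochner_Integration.integral_cong) (simp_all add: scaleR_conv_of_real field_simps add_divide_distrib)
  also have "... = (complex_of_real (LINT w|M. ww (V n w) * cos (t * V n w i))
   + \<i> * complex_of_real (LINT w|M. ww (V n w) * sin (t * V n w i))) / a n"
   using bm_int(1)[OF bmt(1)[of t], of n] bm_int(1)[OF bmt(2)[of t], of n]
   by (simp only: integral_divide_zero Bochner_Integration.integral_add integrable_of_real integrable_mult_right integral_mult_right_zero integral_complex_of_real)
  finally show ?thesis .
 qed
 have ch\<nu>: "char \<nu> t = (complex_of_real (LINT w|M'. ww (W w) * cos (t * W w i))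
   + \<i> * complex_of_real (LINT w|M'. ww (W w) * sin (t * W w i))) / b" for t
 proof -
  have "char \<nu> t = (LINT w|M'. (ww (W w) / b) *\<^sub>R iexp (t * W w i))"
   unfolding char_def by (subst int\<nu>) auto
  also have "... = (LINT w|M'. (complex_of_real (ww (W w) * cos (t * W w i))
   + \<i> * complex_of_real (ww (W w) * sin (t * W w i))) / b)"
   unfolding iexp by (rule Bochner_Integration.integral_cong) (simp_all add: scaleR_conv_of_real field_simps add_divide_distrib)
  also have "... = (complex_of_real (LINT w|M'. ww (W w) * cos (t * W w i))
   + \<i> * complex_of_real (LINT w|M'. ww (W w) * sin (t * W w i))) / b"
   using bm_int(2)[OF bmt(1)[of t]] bm_int(2)[OF bmt(2)[of t]]
   by (simp only: integral_divide_zero Bochner_Integration.integral_add integrable_of_real integrable_mult_right integral_mult_right_zero integral_complex_of_real)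
  finally show ?thesis .
 qed
 have "(%n. char (\<mu> n) t) \<longlonglongrightarrow> char \<nu> t" for t
  unfolding ch\<mu> ch\<nu> using c[of t] s[of t] ab b1 unfolding int_conv_def
  by (intro tendsto_intros) auto
 then have "weak_conv_m \<mu> \<nu>" by (intro levy_continuity rd rd')
 then have "(%n. integral\<^sup>L (\<mu> n) h) \<longlonglongrightarrow> integral\<^sup>L \<nu> h"
  using h by (intro weak_conv_imp_integral_bdd_continuous_conv[where B=1] rd rd') auto
 then have "(%n. a n * integral\<^sup>L (\<mu> n) h) \<longlonglongrightarrow> b * integral\<^sup>L \<nu> h"
  by (intro tendsto_mult ab)
 moreover have "a n * integral\<^sup>L (\<mu> n) h = (LINT w|M. ww (V n w) * h (V n w i))" for n
  using a1[of n] by (simp add: int\<mu>)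
 moreover have "b * integral\<^sup>L \<nu> h = (LINT w|M'. ww (W w) * h (W w i))"
  using b1 by (simp add: int\<nu>)
 ultimately show ?thesis unfolding int_conv_def by simp
qed

text \<open>Induction on the number \<open>i\<close> of coordinates whose exponential has been
  replaced by \<open>h j\<close>. The accumulated weight times the trigonometric tail is signed and
  bounded by 1, so 2 is added to obtain a density between 1 and 3, and the contribution of the
  constant is subtracted at the end. The products of trigonometric functions that
  \<open>weighted_levy\<close> asks for are reduced to the induction hypothesis by the addition
  formulas.\<close>

lemma product_conv:
 assumes c: "!!\<theta>. L (%x. cos (\<Sum>j<K. \<theta> j * x j))" and s: "!!\<theta>. L (%x. sin (\<Sum>j<K. \<theta> j * x j))"
  and h: "!!j y. isCont (h j) y" "!!j y. \<bar>h j y\<bar> <= (1::real)" and "i <= K"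
 shows "L (%x. (\<Prod>j<i. h j (x j)) * cos (\<Sum>j\<in>{i..<K}. \<theta> j * x j))"
  "L (%x. (\<Prod>j<i. h j (x j)) * sin (\<Sum>j\<in>{i..<K}. \<theta> j * x j))"
 using \<open>i <= K\<close>
proof (induction i arbitrary: \<theta>)
 case 0
 { case 1 show ?case using c[of \<theta>] by (simp add: lessThan_atLeast0) }
 { case 2 show ?case using s[of \<theta>] by (simp add: lessThan_atLeast0) }
next
 case (Suc i)
 have hm [measurable]: "h j \<in> borel_measurable borel" for j
  using h(1) by (intro borel_measurable_continuous_onI) (simp add: continuous_at_imp_continuous_on)
 define P where "P x = (\<Prod>j<i. h j (x j))" for x
 have Pm [measurable]: "P \<in> borel_measurable borel" unfolding P_def by measurable
 have P1: "\<bar>P x\<bar> <= 1" for x unfolding P_def abs_prod using h(2) by (intro prod_le_1) auto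
 have bP: "bm P" unfolding bm_def using P1 by auto
 have bh: "bm (%x. h j (x j))" for j unfolding bm_def using h(2) by auto
 have eqs: "(\<Sum>j\<in>{i..<K}. (\<theta>(i := t)) j * x j) = (\<Sum>j\<in>{Suc i..<K}. \<theta> j * x j) + t * x i"
  if "Suc i <= K" for \<theta> t and x :: "nat => real"
  using that by (subst sum.atLeast_Suc_lessThan) auto
 have C: "L (%x. P x * cos ((\<Sum>j\<in>{Suc i..<K}. \<theta> j * x j) + t * x i))"
  and S: "L (%x. P x * sin ((\<Sum>j\<in>{Suc i..<K}. \<theta> j * x j) + t * x i))" if "Suc i <= K" for \<theta> t
  using Suc.IH(1)[of "\<theta>(i := t)"] Suc.IH(2)[of "\<theta>(i := t)"] that
  unfolding eqs[OF that] P_def by auto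
 have single: "(\<Sum>j<K. ((%_. 0)(i := t)) j * x j) = t * x i" if "Suc i <= K" for t and x :: "nat => real"
 proof -
  have "(\<Sum>j<K. ((%_. 0)(i := t)) j * x j) = (\<Sum>j<K. if j = i then t * x i else 0)"
   by (rule sum.cong) auto
  then show ?thesis using that by (simp add: sum.delta)
 qed
 have c1: "L (%x. cos (t * x i))" and s1: "L (%x. sin (t * x i))" if "Suc i <= K" for t
  using c[of "(%_. 0)(i := t)"] s[of "(%_. 0)(i := t)"] unfolding single[OF that] .
 have h1: "L (%x. h i (x i))" if "Suc i <= K"
  using weighted_levy[of "%_. 1" i "h i"] c1 s1 h that by simp
 have bC: "bm (%x. P x * cos ((\<Sum>j\<in>{Suc i..<K}. \<theta> j * x j) + t * x i))"
  and bS: "bm (%x. P x * sin ((\<Sum>j\<in>{Suc i..<K}. \<theta> j * x j) + t * x i))" for \<theta> t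
  by (intro bm_mult bP bm_trig; measurable)+
 have key: "L (%x. P x * T x * h i (x i))"
  if K: "Suc i <= K" and T: "T \<in> borel_measurable borel" "!!x. \<bar>T x\<bar> <= 1"
   and Tc: "!!t. L (%x. P x * T x * cos (t * x i))" and Ts: "!!t. L (%x. P x * T x * sin (t * x i))" for T
 proof -
  have bT: "bm T" using T unfolding bm_def by blast
  have PT: "\<bar>P x * T x\<bar> <= 1" for x using P1[of x] T(2)[of x] by (simp add: abs_mult mult_le_one)
  have bt: "bm (%x. cos (t * x i))" "bm (%x. sin (t * x i))" for t by (intro bm_trig; measurable)+
  have "L (%x. (2 + P x * T x) * h i (x i))"
  proof (rule weighted_levy)
   show "(%x. 2 + P x * T x) \<in> borel_measurable borel" using T by measurable
   show "1 <= 2 + P x * T x" "2 + P x * T x <= 3" for x using PT[of x] by linarith+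
   have "L (%x. 2 * cos (t * x i) + P x * T x * cos (t * x i))" for t
    by (intro L_add L_cmult c1 Tc bm_mult bP bT bt bm_const K)
   then show "L (%x. (2 + P x * T x) * cos (t * x i))" for t by (simp add: distrib_right)
   have "L (%x. 2 * sin (t * x i) + P x * T x * sin (t * x i))" for t
    by (intro L_add L_cmult s1 Ts bm_mult bP bT bt bm_const K)
   then show "L (%x. (2 + P x * T x) * sin (t * x i))" for t by (simp add: distrib_right)
  qed (use h in auto)
  then have "L (%x. (2 + P x * T x) * h i (x i) + (-2) * h i (x i))"
   by (intro L_add L_cmult h1 bm_mult bm_add bP bT bh bm_const K)
  then show ?thesis by (simp add: algebra_simps)
 qed
 let ?s = "%\<theta> x. \<Sum>j\<in>{Suc i..<K}. \<theta> j * x j"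
 have pull: "(\<Prod>j<Suc i. h j (x j)) * y = P x * y * h i (x i)" for x y by (simp add: P_def mult_ac)
 { case (1 \<theta>)
  have "L (%x. P x * cos (?s \<theta> x) * h i (x i))"
  proof (rule key)
   fix t
   have "L (%x. 1/2 * (P x * cos (?s \<theta> x + t * x i)) + 1/2 * (P x * cos (?s \<theta> x + (-t) * x i)))"
    by (intro L_add L_cmult C bm_mult[OF bm_const] bC 1)
   then show "L (%x. P x * cos (?s \<theta> x) * cos (t * x i))"
    by (simp add: cos_add cos_diff algebra_simps)
   have "L (%x. 1/2 * (P x * sin (?s \<theta> x + t * x i)) + (-1/2) * (P x * sin (?s \<theta> x + (-t) * x i)))"
    by (intro L_add L_cmult S bm_mult[OF bm_const] bS 1)
   then show "L (%x. P x * cos (?s \<theta> x) * sin (t * x i))"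
    by (simp add: sin_add sin_diff algebra_simps)
  qed (use 1 in auto)
  then show ?case unfolding pull . }
 { case (2 \<theta>)
  have "L (%x. P x * sin (?s \<theta> x) * h i (x i))"
  proof (rule key)
   fix t
   have "L (%x. 1/2 * (P x * sin (?s \<theta> x + t * x i)) + 1/2 * (P x * sin (?s \<theta> x + (-t) * x i)))"
    by (intro L_add L_cmult S bm_mult[OF bm_const] bS 2)
   then show "L (%x. P x * sin (?s \<theta> x) * cos (t * x i))"
    by (simp add: sin_add sin_diff algebra_simps)
   have "L (%x. 1/2 * (P x * cos (?s \<theta> x + (-t) * x i)) + (-1/2) * (P x * cos (?s \<theta> x + t * x i)))"
    by (intro L_add L_cmult C bm_mult[OF bm_const] bC 2)
   then show "L (%x. P x * sin (?s \<theta> x) * sin (t * x i))"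
    by (simp add: cos_add cos_diff algebra_simps)
  qed (use 2 in auto)
  then show ?case unfolding pull . }
qed

end

section \<open>Partitions of unity by tents, and convergence for Lipschitz test functions\<close>

definition tent :: "int => real => real" where "tent z y = max 0 (1 - \<bar>y - of_int z\<bar>)"

text \<open>Only the tents at the floor of \<open>y\<close> and at its successor can be nonzero, and
  these two add up to 1. Truncation to \<open>{-R..R}\<close> may lose one of them; inside the range
  this happens only at \<open>y = R\<close>, where the lost tent vanishes.\<close>

lemma tent_sum:
 assumes "R >= 0"
 shows "(\<Sum>z\<in>{-R..R}. tent z y) <= 1" "\<bar>y\<bar> <= of_int R ==> (\<Sum>z\<in>{-R..R}. tent z y) = 1"
proof -
 let ?m = "\<lfloor>y\<rfloor>"
 have z: "tent z y = 0" if "z ~= ?m" "z ~= ?m + 1" for z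
 proof -
  have "z <= ?m - 1 \<or> z >= ?m + 2" using that by linarith
  then show ?thesis unfolding tent_def by (auto simp: max_def abs_if) linarith+
 qed
 have m: "tent ?m y = 1 - (y - of_int ?m)" "tent (?m + 1) y = y - of_int ?m"
  unfolding tent_def by (simp_all add: max_def abs_if) linarith+
 have s: "(\<Sum>z\<in>{-R..R}. tent z y) = (\<Sum>z\<in>{-R..R} \<inter> {?m, ?m+1}. tent z y)"
  by (rule sum.mono_neutral_right) (auto simp: z)
 have "(\<Sum>z\<in>{-R..R} \<inter> {?m, ?m+1}. tent z y) <= (\<Sum>z\<in>{?m, ?m+1}. tent z y)"
  by (rule sum_mono2) (auto simp: tent_def)
 then show "(\<Sum>z\<in>{-R..R}. tent z y) <= 1" using s m by simp
 assume y: "\<bar>y\<bar> <= of_int R"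
 then have a: "?m \<in> {-R..R}" by (auto simp: le_floor_iff floor_le_iff abs_le_iff)
 show "(\<Sum>z\<in>{-R..R}. tent z y) = 1"
 proof (cases "?m = R")
  case True
  then have "y = of_int R" using y of_int_floor_le[of y] by linarith
  then have "tent ?m y = 1" "tent (?m+1) y = 0" using m by simp_all
  moreover have "{-R..R} \<inter> {?m, ?m+1} = {?m}" using True a by auto
  ultimately show ?thesis using s by simp
 next
  case False
  then have "{-R..R} \<inter> {?m, ?m+1} = {?m, ?m+1}" using a by auto
  then show ?thesis using s m by simp
 qed
qed

lemma tent_bounds: "0 <= tent z y" "tent z y <= 1" "tent z y ~= 0 ==> \<bar>y - of_int z\<bar> <= 1"
 unfolding tent_def by auto

lemma isCont_tent: "isCont (tent z) y" unfolding tent_def by (intro continuous_intros)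

context vec_conv begin

text \<open>\<open>H\<close> is replaced by its tent interpolation \<open>G\<close> on a grid of
  mesh \<open>\<delta>\<close>, a finite combination of products to which
  \<open>product_conv\<close> applies. The error is at most \<open>C * \<delta>\<close> plus
  \<open>B\<close> times the mass \<open>1 - X R\<close> that the cutoff misses. Tightness is
  borrowed from the limit: the cutoff mean is close to 1 under the limit law for large
  \<open>R\<close>, and since that mean converges it is close to 1 along the sequence as
  well.\<close>

lemma lipschitz_conv:
 assumes c: "!!\<theta>. L (%x. cos (\<Sum>j<K. \<theta> j * x j))" and s: "!!\<theta>. L (%x. sin (\<Sum>j<K. \<theta> j * x j))"
  and Hm: "H \<in> borel_measurable borel" and HB: "!!x. \<bar>H x\<bar> <= B"
  and HC: "!!x y r. (!!j. j < K ==> \<bar>x j - y j\<bar> <= r) ==> r >= 0 ==> \<bar>H x - H y\<bar> <= C * r"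
 shows "L H"
 unfolding int_conv_def
proof (rule LIMSEQ_I)
 fix e :: real assume e: "e > 0"
 note [measurable] = Hm
 have B0: "B >= 0" using order_trans[OF abs_ge_zero HB] .
 have C0: "C >= 0" using HC[of "%_. 0" "%_. 0" 1] by auto
 define \<delta> where "\<delta> = e / (8 * (C + 1))"
 have \<delta>: "\<delta> > 0" "2 * (C * \<delta>) <= e / 4" unfolding \<delta>_def using e C0 by (auto simp: field_simps)
 have prodL: "L (%x. \<Prod>j<K. h j (x j))"
  if "!!j y. isCont (h j) y" "!!j y. \<bar>h j y\<bar> <= (1::real)" for h
  using product_conv(1)[OF c s that order_refl, where \<theta> = "%_. 0"] by simp
 define ch where "ch R y = (\<Sum>z\<in>{-int R..int R}. tent z (y / \<delta>))" for R y
 have chc: "isCont (ch R) y" for R y unfolding ch_def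
  by (intro continuous_intros isCont_o2[OF _ isCont_tent]) (use \<delta> in auto)
 have ch0: "0 <= ch R y" "ch R y <= 1" for R y
  unfolding ch_def using tent_sum(1)[of "int R"] by (auto intro: sum_nonneg tent_bounds)
 have chm [measurable]: "ch R \<in> borel_measurable borel" for R
  using chc by (intro borel_measurable_continuous_onI) (simp add: continuous_at_imp_continuous_on)
 define X where "X R x = (\<Prod>j<K. ch R (x j))" for R and x :: "nat => real"
 have X01: "0 <= X R x" "X R x <= 1" for R x unfolding X_def using ch0 by (auto intro: prod_nonneg prod_le_1)
 have Xm [measurable]: "X R \<in> borel_measurable borel" for R unfolding X_def by measurable
 have bX: "bm (X R)" for R unfolding bm_def using X01 by (auto intro!: exI[of _ 1])
 have LX: "L (X R)" for R unfolding X_def using ch0 by (intro prodL chc) (auto simp: abs_le_iff intro: order_trans[of _ 0])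
 have "(%R. LINT w|M'. X R (W w)) \<longlonglongrightarrow> (LINT w|M'. 1)"
 proof (rule integral_dominated_convergence[where w = "%_. 1"])
  have "(%R. X R x) \<longlonglongrightarrow> 1" for x
  proof -
   obtain R0 where R0: "!!j. j < K ==> \<bar>x j / \<delta>\<bar> <= real R0"
   proof -
    obtain R0 :: nat where "(\<Sum>j<K. \<bar>x j / \<delta>\<bar>) <= real R0" using real_arch_simple by blast
    then show ?thesis by (intro that[of R0] order_trans[OF member_le_sum[of _ "{..<K}" "%j. \<bar>x j / \<delta>\<bar>"]]) auto
   qed
   have "X R x = 1" if "R >= R0" for R
    unfolding X_def
   proof (rule prod.neutral, intro ballI)
    fix j assume j: "j \<in> {..<K}"
    have "\<bar>x j / \<delta>\<bar> <= of_int (int R)" using R0[of j] j that by simp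
    then show "ch R (x j) = 1" unfolding ch_def using tent_sum(2)[of "int R"] by auto
   qed
   then show ?thesis by (intro tendsto_eventually) (auto simp: eventually_sequentially)
  qed
  then show "AE x in M'. (%i. X i (W x)) \<longlonglongrightarrow> 1" by simp
  show "AE x in M'. norm (X i (W x)) <= 1" for i using X01 by simp
 qed (auto intro: measurable_compose[OF W_meas Xm])
 then have "(%R. LINT w|M'. X R (W w)) \<longlonglongrightarrow> 1" by (simp add: M'.prob_space)
 moreover define \<eta> where "\<eta> = e / (8 * (B + 1))"
 ultimately obtain R where R: "\<bar>(LINT w|M'. X R (W w)) - 1\<bar> < \<eta>"
  using LIMSEQ_D[of "%R. LINT w|M'. X R (W w)" 1 \<eta>] e B0 unfolding \<eta>_def by fastforce
 have \<eta>: "\<eta> > 0" "B * \<eta> <= e / 8" unfolding \<eta>_def using e B0 by (auto simp: field_simps)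
 define I where "I = {..<K} \<rightarrow>\<^sub>E {-int R..int R}"
 have finI: "finite I" unfolding I_def by (intro finite_PiE) auto
 define T where "T z x = (\<Prod>j<K. tent (z j) (x j / \<delta>))" for z and x :: "nat => real"
 have T0: "T z x >= 0" for z x unfolding T_def by (auto intro: prod_nonneg tent_bounds)
 have tentm [measurable]: "tent z \<in> borel_measurable borel" for z
  using isCont_tent by (intro borel_measurable_continuous_onI) (simp add: continuous_at_imp_continuous_on)
 have LT: "L (T z)" for z unfolding T_def
  by (rule prodL[of "%j y. tent (z j) (y / \<delta>)"]) (use \<delta> tent_bounds in \<open>auto intro!: continuous_intros isCont_o2[OF _ isCont_tent]\<close>)
 have bT: "bm (T z)" for z unfolding T_def
 proof (rule bm_prod)
  show "bm (%x. tent (z j) (x j / \<delta>))" for j unfolding bm_def using tent_bounds by (auto intro!: exI[of _ 1])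
 qed simp
 have XT: "X R x = (\<Sum>z\<in>I. T z x)" for x
  unfolding X_def ch_def T_def I_def by (rule prod_sum_PiE) auto
 define G where "G x = (\<Sum>z\<in>I. H (%j. \<delta> * z j) * T z x)" for x
 have bG: "bm G" unfolding G_def by (intro bm_sum finI bm_mult bm_const bT)
 have LG: "L G" unfolding G_def by (intro L_sum finI bm_mult bm_const bT L_cmult LT)
 have bH: "bm H" unfolding bm_def using HB by auto
 have HG: "\<bar>H x - G x\<bar> <= C * \<delta> + B * (1 - X R x)" for x
 proof -
  have "H x - G x = H x * (1 - X R x) + (\<Sum>z\<in>I. (H x - H (%j. \<delta> * z j)) * T z x)"
   unfolding G_def XT by (simp add: left_diff_distrib right_diff_distrib sum_subtractf sum_distrib_left)
  moreover have "\<bar>H x * (1 - X R x)\<bar> <= B * (1 - X R x)"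
   using HB[of x] X01[of R x] by (simp add: abs_mult mult_right_mono)
  moreover have "\<bar>\<Sum>z\<in>I. (H x - H (%j. \<delta> * z j)) * T z x\<bar> <= (\<Sum>z\<in>I. (C * \<delta>) * T z x)"
  proof (rule order_trans[OF sum_abs], rule sum_mono)
   fix z assume "z \<in> I"
   show "\<bar>(H x - H (%j. \<delta> * z j)) * T z x\<bar> <= C * \<delta> * T z x"
   proof (cases "T z x = 0")
    case False
    have "\<bar>x j - \<delta> * z j\<bar> <= \<delta>" if "j < K" for j
    proof -
     have "tent (z j) (x j / \<delta>) ~= 0" using False that unfolding T_def by auto
     then have "\<bar>x j / \<delta> - z j\<bar> <= 1" by (rule tent_bounds)
     then have "\<delta> * \<bar>x j / \<delta> - z j\<bar> <= \<delta> * 1" using \<delta> by (intro mult_left_mono) auto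
     moreover have "\<delta> * \<bar>x j / \<delta> - z j\<bar> = \<bar>x j - \<delta> * z j\<bar>"
      using \<delta> abs_mult[of \<delta> "x j / \<delta> - z j"] by (simp add: right_diff_distrib)
     ultimately show ?thesis by simp
    qed
    then have "\<bar>H x - H (%j. \<delta> * z j)\<bar> <= C * \<delta>" using \<delta> by (intro HC) auto
    then show ?thesis using T0[of z x] by (simp add: abs_mult mult_right_mono)
   qed simp
  qed
  moreover have "(\<Sum>z\<in>I. (C * \<delta>) * T z x) <= C * \<delta>"
   using X01[of R x] C0 \<delta> unfolding sum_distrib_left[symmetric] XT[symmetric] by (simp add: mult_left_le)
  ultimately show ?thesis by linarith
 qed
 have bHG: "bm (%x. \<bar>H x - G x\<bar>)"
 proof -
  have "\<bar>H x - G x\<bar> <= C * \<delta> + B" for x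
   using HG[of x] mult_left_mono[OF _ B0, of "1 - X R x" 1] X01[of R x] by simp
  moreover have [measurable]: "G \<in> borel_measurable borel" using bG unfolding bm_def by blast
  ultimately show ?thesis unfolding bm_def by auto
 qed
 have bE: "bm (%x. C * \<delta> + B * (1 - X R x))"
  using bm_add[OF bm_const[of "C * \<delta> + B"] bm_mult[OF bm_const[of "-B"] bX[of R]]] by (simp add: algebra_simps)
 have EV: "\<bar>(LINT w|M. H (V n w)) - (LINT w|M. G (V n w))\<bar> <= C * \<delta> + B * (1 - (LINT w|M. X R (V n w)))" for n
 proof -
  have "\<bar>(LINT w|M. H (V n w)) - (LINT w|M. G (V n w))\<bar> <= (LINT w|M. \<bar>H (V n w) - G (V n w)\<bar>)"
   by (subst Bochner_Integration.integral_diff[symmetric]) (auto intro: bm_int bH bG integral_abs_bound)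
  also have "... <= (LINT w|M. C * \<delta> + B * (1 - X R (V n w)))"
   by (intro integral_mono HG bm_int(1)[OF bE] bm_int(2)[OF bE] bm_int(1)[OF bHG] bm_int(2)[OF bHG])
  also have "... = C * \<delta> + B * (1 - (LINT w|M. X R (V n w)))"
   using bm_int(1)[OF bX] by (simp add: M.prob_space)
  finally show ?thesis .
 qed
 have EW: "\<bar>(LINT w|M'. H (W w)) - (LINT w|M'. G (W w))\<bar> <= C * \<delta> + B * (1 - (LINT w|M'. X R (W w)))"
 proof -
  have "\<bar>(LINT w|M'. H (W w)) - (LINT w|M'. G (W w))\<bar> <= (LINT w|M'. \<bar>H (W w) - G (W w)\<bar>)"
   by (subst Bochner_Integration.integral_diff[symmetric]) (auto intro: bm_int bH bG integral_abs_bound)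
  also have "... <= (LINT w|M'. C * \<delta> + B * (1 - X R (W w)))"
   by (intro integral_mono HG bm_int(1)[OF bE] bm_int(2)[OF bE] bm_int(1)[OF bHG] bm_int(2)[OF bHG])
  also have "... = C * \<delta> + B * (1 - (LINT w|M'. X R (W w)))"
   using bm_int(2)[OF bX] by (simp add: M'.prob_space)
  finally show ?thesis .
 qed
 obtain n1 where n1: "!!n. n >= n1 ==> \<bar>(LINT w|M. G (V n w)) - (LINT w|M'. G (W w))\<bar> < e / 8"
  using LIMSEQ_D[OF LG[unfolded int_conv_def], of "e/8"] e by auto
 obtain n2 where n2: "!!n. n >= n2 ==> \<bar>(LINT w|M. X R (V n w)) - (LINT w|M'. X R (W w))\<bar> < \<eta>"
  using LIMSEQ_D[OF LX[unfolded int_conv_def], of \<eta> R] \<eta> by auto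
 show "\<exists>no. \<forall>n\<ge>no. norm ((LINT w|M. H (V n w)) - (LINT w|M'. H (W w))) < e"
 proof (intro exI[of _ "max n1 n2"] allI impI)
  fix n assume n: "n >= max n1 n2"
  have "1 - (LINT w|M. X R (V n w)) <= 2 * \<eta>" using n2[of n] n R by linarith
  then have "B * (1 - (LINT w|M. X R (V n w))) <= B * (2 * \<eta>)" using B0 by (rule mult_left_mono)
  moreover have "1 - (LINT w|M'. X R (W w)) <= \<eta>" using R by linarith
  then have "B * (1 - (LINT w|M'. X R (W w))) <= B * \<eta>" using B0 by (rule mult_left_mono)
  ultimately show "norm ((LINT w|M. H (V n w)) - (LINT w|M'. H (W w))) < e"
   using EV[of n] EW n1[of n] n \<delta>(2) \<eta>(2) e unfolding real_norm_def by linarith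
 qed
qed

end

section \<open>Markov property\<close>

text \<open>Cutting \<open>[s, T]\<close> into \<open>N\<close> equal pieces leaves the quadratic
  error \<open>C (T - s)^2 / N\<close>, which vanishes, so only the linear rate \<open>a\<close>
  survives, whatever \<open>C\<close> is. This plays the role of integrating a bound on a
  derivative.\<close>

lemma telescope_bound:
 fixes ww :: "real => 'z::real_normed_vector"
 assumes st: "s <= T" and C: "C >= 0"
  and ww: "!!t t'. s <= t ==> t <= t' ==> t' <= T ==> t' - t <= 1 ==> norm (ww t' - ww t) <= a * (t' - t) + C * (t' - t)\<^sup>2"
 shows "norm (ww T - ww s) <= a * (T - s)"
proof -
 have b: "norm (ww T - ww s) <= a * (T - s) + C * (T - s)\<^sup>2 / real N" if N: "real N >= T - s" "N > 0" for N
 proof -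
  define h where "h = (T - s) / real N"
  define u where "u k = s + real k * h" for k
  have h: "h >= 0" "h <= 1" using st N by (auto simp: h_def)
  have uN: "u N = T" "u 0 = s" using N by (auto simp: u_def h_def)
  have le: "u k <= T" if "k <= N" for k
   using uN(1) mult_right_mono[of "real k" "real N" h] that h unfolding u_def by simp
  have "ww T - ww s = (\<Sum>k<N. ww (u (Suc k)) - ww (u k))" using sum_lessThan_telescope[of "%k. ww (u k)" N] uN by simp
  also have "norm ... <= (\<Sum>k<N. a * h + C * h\<^sup>2)"
  proof (rule sum_norm_le)
   fix k assume k: "k \<in> {..<N}"
   have d: "u (Suc k) - u k = h" unfolding u_def by (simp add: algebra_simps)
   show "norm (ww (u (Suc k)) - ww (u k)) <= a * h + C * h\<^sup>2"
    using ww[of "u k" "u (Suc k)"] le[of "Suc k"] k h d by (auto simp: u_def)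
  qed
  also have "... = a * (T - s) + C * (T - s)\<^sup>2 / real N"
   using N by (simp add: h_def field_simps power2_eq_square)
  finally show ?thesis .
 qed
 have "(%N. a * (T - s) + C * (T - s)\<^sup>2 / real N) \<longlonglongrightarrow> a * (T - s) + 0"
  by (intro tendsto_intros lim_const_over_n)
 moreover obtain N0 :: nat where "T - s <= real N0" using real_arch_simple by blast
 ultimately have "norm (ww T - ww s) <= a * (T - s) + 0"
  by (intro LIMSEQ_le_const) (auto intro!: exI[of _ "Suc N0"] b)
 then show ?thesis by simp
qed

locale ctmc = prob_space M for M :: "'a measure" +
 fixes Q :: "real^'s^'s" and Z :: "real => 'a => 's"
 assumes ctmc: "is_ctmc M Q Z" and gen: "is_generator Q"
begin

abbreviation Ptr :: "real => 's => 's => real" where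
 "Ptr t j i \<equiv> mat_exp (t *\<^sub>R Q) $ j $ i"

lemma Z_meas: "t >= 0 ==> Z t \<in> M \<rightarrow>\<^sub>M count_space UNIV"
 using ctmc unfolding is_ctmc_def by blast

lemma Z_right: "w \<in> space M ==> t >= 0 ==> \<exists>e>0. \<forall>s\<in>{t..<t+e}. Z s w = Z t w"
 using ctmc unfolding is_ctmc_def by blast

text \<open>Indexed by a set of time-state pairs rather than by two lists, so that intersecting
  cylinders means uniting index sets; contradictory pairs give the empty event.\<close>

definition cyl :: "(real \<times> 's) set => 'a set" where
 "cyl S = {w\<in>space M. \<forall>(r, j)\<in>S. Z r w = j}"

definition Gs :: "real => 'a set set" where
 "Gs s = {cyl S | S. finite S \<and> fst ` S \<subseteq> {0..s}}"

definition Ft :: "real => 'a measure" where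
 "Ft s = sigma (space M) (Gs s)"

lemma cyl_sets: "finite S ==> fst ` S \<subseteq> {0..} ==> cyl S \<in> sets M"
proof -
 assume S: "finite S" "fst ` S \<subseteq> {0..}"
 have "{w\<in>space M. Z (fst p) w = snd p} \<in> sets M" if "p \<in> S" for p
 proof -
  have "fst p >= 0" using S(2) that by auto
  from measurable_sets[OF Z_meas[OF this], of "{snd p}"]
  show ?thesis by (simp add: vimage_def Int_def conj_commute)
 qed
 then have "{w\<in>space M. \<forall>p\<in>S. Z (fst p) w = snd p} \<in> sets M"
  by (intro sets.sets_Collect_finite_All S)
 then show ?thesis by (simp add: cyl_def case_prod_unfold)
qed

lemma space_Ft [simp]: "space (Ft s) = space M" unfolding Ft_def by (rule space_measure_of) (auto simp: Gs_def cyl_def)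

lemma Gs_pow: "Gs s \<subseteq> Pow (space M)" unfolding Gs_def cyl_def by auto

lemma sets_Ft: "sets (Ft s) = sigma_sets (space M) (Gs s)" unfolding Ft_def by (rule sets_measure_of[OF Gs_pow])

lemma Gs_sets: "Gs s \<subseteq> sets M" unfolding Gs_def by (auto intro!: cyl_sets)

lemma Ft_subalg: "subalgebra M (Ft s)"
 unfolding subalgebra_def using sets.sigma_sets_subset[OF Gs_sets] by (simp add: sets_Ft)

lemma Ft_mono: "s <= t ==> subalgebra (Ft t) (Ft s)"
proof -
 assume st: "s <= t"
 have "Gs s \<subseteq> Gs t"
 proof
  fix A assume "A \<in> Gs s"
  then obtain S where S: "A = cyl S" "finite S" "fst ` S \<subseteq> {0..s}" unfolding Gs_def by blast
  moreover have "{0..s} \<subseteq> {0..t}" using st by auto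
  ultimately show "A \<in> Gs t" unfolding Gs_def by blast
 qed
 then show ?thesis unfolding subalgebra_def sets_Ft space_Ft by (simp add: sigma_sets_subseteq)
qed

lemma Ft_measD: "f \<in> Ft s \<rightarrow>\<^sub>M N ==> s <= t ==> f \<in> Ft t \<rightarrow>\<^sub>M N"
 by (rule measurable_from_subalg[OF Ft_mono])

lemma Ft_meas_M: "f \<in> Ft s \<rightarrow>\<^sub>M N ==> f \<in> M \<rightarrow>\<^sub>M N"
 by (rule measurable_from_subalg[OF Ft_subalg])

lemma Z_Ft: "0 <= r ==> r <= s ==> Z r \<in> Ft s \<rightarrow>\<^sub>M count_space UNIV"
proof (subst measurable_count_space_eq2, simp, intro conjI ballI)
 fix j assume r: "0 <= r" "r <= s"
 have "Z r -` {j} \<inter> space (Ft s) = cyl {(r, j)}" unfolding cyl_def by auto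
 also have "... \<in> sets (Ft s)" unfolding sets_Ft using r by (intro sigma_sets.Basic) (auto simp: Gs_def)
 finally show "Z r -` {j} \<inter> space (Ft s) \<in> sets (Ft s)" .
qed auto

lemma snoc_all: "length ys = length xs ==>
 (\<forall>k<length (xs@[x]). f ((xs@[x])!k) = (ys@[y])!k) \<longleftrightarrow> (\<forall>k<length xs. f (xs!k) = ys!k) \<and> f x = y"
 by (auto simp: nth_append less_Suc_eq)

text \<open>Appending one later time to a sorted list of times multiplies the product of transition
  probabilities by exactly one factor.\<close>

lemma markov_cyl:
 assumes S: "finite S" "fst ` S \<subseteq> {0..s}" and st: "0 <= s" "s <= t"
 shows "measure M (cyl (insert (t, k) (insert (s, i) S))) = measure M (cyl (insert (s, i) S)) * Ptr (t - s) k i"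
proof (cases "cyl S = {}")
 case True
 then have "cyl (insert (s, i) S) = {}" "cyl (insert (t, k) (insert (s, i) S)) = {}" unfolding cyl_def by auto
 then show ?thesis by simp
next
 case False
 then obtain w0 where w0: "w0 \<in> cyl S" by auto
 \<comment> \<open>A point of the nonempty cylinder supplies a single state for each time in
   \<open>S\<close>. The time \<open>s\<close> may already occur in \<open>S\<close>; it is then
   listed twice, which weakly sorted lists allow.\<close>
 define a where "a r = Z r w0" for r
 define L where "L = sorted_list_of_set (fst ` S)"
 have setL: "set L = fst ` S" unfolding L_def using S by simp
 have cylS: "w \<in> cyl S \<longleftrightarrow> w \<in> space M \<and> (\<forall>k<length L. Z (L!k) w = map a L ! k)" for w
 proof -
  have "w \<in> cyl S \<longleftrightarrow> w \<in> space M \<and> (\<forall>r\<in>fst ` S. Z r w = a r)"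
   using w0 unfolding cyl_def a_def by force
  then show ?thesis unfolding setL[symmetric] all_set_conv_all_nth by auto
 qed
 have sL: "sorted (L @ [s])" "hd (L @ [s]) >= 0" "sorted ((L @ [s]) @ [t])"
  using S st unfolding L_def by (auto simp: sorted_append hd_append sorted_list_of_set_nonempty)
 let ?f = "%ts ss k. Ptr (ts ! (k+1) - ts ! k) (ss ! (k+1)) (ss ! k)"
 have fdd: "measure M {w\<in>space M. \<forall>k<length ts. Z (ts ! k) w = ss ! k}
    = measure M {w\<in>space M. Z (hd ts) w = hd ss} * (\<Prod>k<length ts - 1. ?f ts ss k)"
  if "ts ~= [] \<and> length ss = length ts \<and> sorted ts \<and> hd ts >= 0" for ts ss
  using ctmc that unfolding is_ctmc_def by blast
 define ts where "ts = L @ [s]" define ss where "ss = map a L @ [i]"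
 have e1: "cyl (insert (s, i) S) = {w\<in>space M. \<forall>k<length ts. Z (ts ! k) w = ss ! k}"
 proof -
  have "cyl (insert (s, i) S) = {w\<in>cyl S. Z s w = i}" unfolding cyl_def by auto
  then show ?thesis unfolding ts_def ss_def by (subst snoc_all) (auto simp: cylS)
 qed
 have len: "length ss = length ts" unfolding ts_def ss_def by simp
 have e2: "cyl (insert (t, k) (insert (s, i) S)) = {w\<in>space M. \<forall>l<length (ts@[t]). Z ((ts@[t]) ! l) w = (ss@[k]) ! l}"
 proof -
  have "cyl (insert (t, k) (insert (s, i) S)) = {w\<in>cyl (insert (s, i) S). Z t w = k}" unfolding cyl_def by auto
  moreover have sn: "(\<forall>l<length (ts@[t]). Z ((ts@[t])!l) w = (ss@[k])!l) \<longleftrightarrow> (\<forall>l<length ts. Z (ts!l) w = ss!l) \<and> Z t w = k" for w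
   using snoc_all[OF len, where f = "%r. Z r w"] .
  ultimately show ?thesis unfolding sn e1 by blast
 qed
 have ne: "ts ~= []" "ss ~= []" unfolding ts_def ss_def by auto
 have "measure M (cyl (insert (t, k) (insert (s, i) S)))
   = measure M {w\<in>space M. Z (hd (ts@[t])) w = hd (ss@[k])} * (\<Prod>l<length (ts@[t]) - 1. ?f (ts@[t]) (ss@[k]) l)"
  unfolding e2 using sL ne len by (intro fdd) (auto simp: ts_def hd_append split: if_splits)
 also have "length (ts@[t]) - 1 = Suc (length ts - 1)" using ne by (cases ts) auto
 also have "(\<Prod>l<Suc (length ts - 1). ?f (ts@[t]) (ss@[k]) l) = (\<Prod>l<length ts - 1. ?f ts ss l) * Ptr (t - s) k i"
 proof -
  have "?f (ts@[t]) (ss@[k]) (length ts - 1) = Ptr (t - s) k i"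
   unfolding ts_def ss_def by (simp add: nth_append)
  moreover have "?f (ts@[t]) (ss@[k]) l = ?f ts ss l" if "l < length ts - 1" for l
  proof -
   have "Suc l < length ts" using that by simp
   then show ?thesis using len by (simp add: nth_append)
  qed
  ultimately show ?thesis by simp
 qed
 also have "hd (ts@[t]) = hd ts" using ne by auto
 also have "hd (ss@[k]) = hd ss" using ne by auto
 also have "measure M {w\<in>space M. Z (hd ts) w = hd ss} * ((\<Prod>l<length ts - 1. ?f ts ss l) * Ptr (t - s) k i)
   = measure M (cyl (insert (s, i) S)) * Ptr (t - s) k i"
  unfolding e1 using fdd[of ts ss] sL ne len by (simp add: ts_def)
 finally show ?thesis .
qed

lemma Z_eq_sets: "r >= 0 ==> {w\<in>space M. Z r w = j} \<in> sets M"
 using cyl_sets[of "{(r, j)}"] by (simp add: cyl_def)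

text \<open>Both sides are countably additive in \<open>A\<close>, so the identity extends from
  cylinders, which are closed under intersection, to the generated sigma-algebra. Complements use
  the case of the whole space, which is the empty cylinder condition.\<close>

lemma markov_set:
 assumes st: "0 <= s" "s <= t" and A: "A \<in> sets (Ft s)"
 shows "measure M (A \<inter> {w\<in>space M. Z s w = i \<and> Z t w = k}) = measure M (A \<inter> {w\<in>space M. Z s w = i}) * Ptr (t - s) k i"
proof -
 have Int: "Int_stable (Gs s)"
 proof (rule Int_stableI)
  fix a b assume "a \<in> Gs s" "b \<in> Gs s"
  then obtain S T where "a = cyl S" "b = cyl T" "finite S" "finite T" "fst ` S \<subseteq> {0..s}" "fst ` T \<subseteq> {0..s}"
   unfolding Gs_def by blast
  then have "a \<inter> b = cyl (S \<union> T)" "finite (S \<union> T)" "fst ` (S \<union> T) \<subseteq> {0..s}" by (auto simp: cyl_def case_prod_unfold)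
  then show "a \<inter> b \<in> Gs s" unfolding Gs_def by blast
 qed
 define E where "E = {w\<in>space M. Z s w = i \<and> Z t w = k}"
 define D where "D = {w\<in>space M. Z s w = i}"
 have ED: "E \<in> sets M" "D \<in> sets M"
  unfolding E_def D_def using Z_eq_sets[of s i] Z_eq_sets[of t k] st by auto
 have base: "measure M (cyl S \<inter> E) = measure M (cyl S \<inter> D) * Ptr (t - s) k i" if "finite S" "fst ` S \<subseteq> {0..s}" for S
 proof -
  have "cyl S \<inter> E = cyl (insert (t, k) (insert (s, i) S))" "cyl S \<inter> D = cyl (insert (s, i) S)"
   unfolding cyl_def E_def D_def by auto
  then show ?thesis using markov_cyl[OF that st, of k i] by simp
 qed
 have full: "measure M E = measure M D * Ptr (t - s) k i"
  using base[of "{}"] sets.sets_into_space[OF ED(1)] sets.sets_into_space[OF ED(2)]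
  by (simp add: cyl_def Int_absorb1)
 have "A \<in> sigma_sets (space M) (Gs s)" using A by (simp add: sets_Ft)
 with Int Gs_pow have "measure M (A \<inter> E) = measure M (A \<inter> D) * Ptr (t - s) k i"
 proof (induction rule: sigma_sets_induct_disjoint)
  case (basic A) then show ?case using base unfolding Gs_def by auto
 next
  case empty show ?case by simp
 next
  case (compl A)
  then have As: "A \<in> sets M" using Ft_subalg by (auto simp: subalgebra_def sets_Ft)
  have "measure M ((space M - A) \<inter> B) = measure M B - measure M (A \<inter> B)" if B: "B \<in> sets M" for B
  proof -
   have "(space M - A) \<inter> B = B - (A \<inter> B)" using sets.sets_into_space[OF B] by auto
   then show ?thesis using B As by (simp add: finite_measure_Diff)
  qed
  then show ?case using ED compl full by (simp add: left_diff_distrib)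
 next
  case (union A)
  then have As: "A n \<in> sets M" for n using Ft_subalg by (force simp: subalgebra_def sets_Ft)
  have su: "(%n. measure M (A n \<inter> B)) sums measure M ((\<Union>n. A n) \<inter> B)" if "B \<in> sets M" for B
  proof -
   have "(%n. measure M (A n \<inter> B)) sums measure M (\<Union>n. A n \<inter> B)"
    by (rule finite_measure_UNION) (use As that union(1) in \<open>auto simp: disjoint_family_on_def\<close>)
   then show ?thesis by simp
  qed
  have "(%n. measure M (A n \<inter> D) * Ptr (t - s) k i) sums (measure M ((\<Union>n. A n) \<inter> D) * Ptr (t - s) k i)"
   by (intro sums_mult2 su ED)
  then have "(%n. measure M (A n \<inter> E)) sums (measure M ((\<Union>n. A n) \<inter> D) * Ptr (t - s) k i)"
   using union by simp
  with su[OF ED(1)] show ?case using sums_unique2 by blast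
 qed
 then show ?thesis unfolding E_def D_def .
qed

text \<open>By \<open>markov_set\<close>, the transition probability evaluated at \<open>Z s\<close>
  is a version of the conditional expectation of the indicator of \<open>Z t = k\<close> given
  \<open>Ft s\<close>.\<close>

lemma markov_expectation_real:
 assumes st: "0 <= s" "s <= t" and \<Psi>: "\<Psi> \<in> borel_measurable (Ft s)" "!!w. w \<in> space M ==> \<bar>\<Psi> w\<bar> <= (B::real)"
 shows "(LINT w|M. \<Psi> w * indicator {k} (Z t w)) = (LINT w|M. \<Psi> w * Ptr (t - s) k (Z s w))"
proof -
 interpret S: finite_measure_subalgebra M "Ft s"
  by unfold_locales (rule Ft_subalg)
 have [measurable]: "Z t \<in> M \<rightarrow>\<^sub>M count_space UNIV" "Z s \<in> M \<rightarrow>\<^sub>M count_space UNIV" using st by (auto intro: Z_meas)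
 have [measurable]: "Z s \<in> Ft s \<rightarrow>\<^sub>M count_space UNIV" using st by (auto intro: Z_Ft)
 have \<Psi>M [measurable]: "\<Psi> \<in> borel_measurable M" by (rule Ft_meas_M[OF \<Psi>(1)])
 let ?f = "%w. indicator {k} (Z t w) :: real" and ?g = "%w. Ptr (t - s) k (Z s w)"
 define D where "D = Max (range (%i. \<bar>Ptr (t - s) k i\<bar>))"
 have D: "\<bar>Ptr (t - s) k i\<bar> <= D" for i unfolding D_def by (rule Max_ge) auto
 have if': "integrable M ?f" by (rule integrable_const_bound[of _ 1]) auto
 have ig: "integrable M ?g" by (rule integrable_const_bound[of _ D]) (auto simp: D)
 have "AE x in M. real_cond_exp M (Ft s) ?f x = ?g x"
 proof (rule S.real_cond_exp_charact)
  fix A assume A: "A \<in> sets (Ft s)"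
  then have As [measurable]: "A \<in> sets M" using Ft_subalg by (auto simp: subalgebra_def)
  have i1: "integrable M (indicat_real (A \<inter> {w\<in>space M. Z s w = i \<and> Z t w = k}))" for i
   by (rule integrable_const_bound[of _ 1]) (auto simp: indicator_def)
  have i2: "integrable M (indicat_real (A \<inter> {w\<in>space M. Z s w = i}))" for i
   by (rule integrable_const_bound[of _ 1]) (auto simp: indicator_def)
  have "set_lebesgue_integral M A ?f = (LINT w|M. (\<Sum>i\<in>UNIV. indicat_real (A \<inter> {w\<in>space M. Z s w = i \<and> Z t w = k}) w))"
   unfolding set_lebesgue_integral_def
  proof (rule Bochner_Integration.integral_cong)
   fix w assume w: "w \<in> space M"
   have "(\<Sum>i\<in>UNIV. indicat_real (A \<inter> {w\<in>space M. Z s w = i \<and> Z t w = k}) w)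
     = (\<Sum>i\<in>UNIV. if i = Z s w then indicat_real A w * indicator {k} (Z t w) else 0)"
    by (rule sum.cong) (use w in \<open>auto simp: indicator_def\<close>)
   then show "indicat_real A w *\<^sub>R indicat_real {k} (Z t w) = (\<Sum>i\<in>UNIV. indicat_real (A \<inter> {w\<in>space M. Z s w = i \<and> Z t w = k}) w)"
    by simp
  qed simp
  also have "... = (\<Sum>i\<in>UNIV. measure M (A \<inter> {w\<in>space M. Z s w = i \<and> Z t w = k}))"
   by (subst Bochner_Integration.integral_sum[OF i1]) (simp add: Int_absorb1 sets.sets_into_space Int_assoc)
  also have "... = (\<Sum>i\<in>UNIV. Ptr (t - s) k i * measure M (A \<inter> {w\<in>space M. Z s w = i}))"
   by (simp add: markov_set[OF st A] mult.commute)
  also have "... = (LINT w|M. (\<Sum>i\<in>UNIV. Ptr (t - s) k i * indicat_real (A \<inter> {w\<in>space M. Z s w = i}) w))"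
   by (subst Bochner_Integration.integral_sum) (auto intro!: integrable_mult_right i2 simp: Int_absorb1 Int_assoc)
  also have "... = set_lebesgue_integral M A ?g"
   unfolding set_lebesgue_integral_def
  proof (rule Bochner_Integration.integral_cong)
   fix w assume w: "w \<in> space M"
   have "(\<Sum>i\<in>UNIV. Ptr (t - s) k i * indicat_real (A \<inter> {w\<in>space M. Z s w = i}) w)
     = (\<Sum>i\<in>UNIV. if i = Z s w then Ptr (t - s) k i * indicat_real A w else 0)"
    by (rule sum.cong) (use w in \<open>auto simp: indicator_def\<close>)
   then show "(\<Sum>i\<in>UNIV. Ptr (t - s) k i * indicat_real (A \<inter> {w\<in>space M. Z s w = i}) w) = indicat_real A w *\<^sub>R ?g w"
    by simp
  qed simp
  finally show "set_lebesgue_integral M A ?f = set_lebesgue_integral M A ?g" .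
 qed (use if' ig in auto)
 moreover have "(LINT w|M. \<Psi> w * real_cond_exp M (Ft s) ?f w) = (LINT w|M. \<Psi> w * ?f w)"
 proof (rule S.real_cond_exp_intg(2))
  show "integrable M (%x. \<Psi> x * ?f x)"
   by (rule integrable_const_bound[of _ "max 0 B"]) (use \<Psi>(2) in \<open>auto intro!: AE_I2 simp: indicator_def intro: order_trans[OF _ max.cobounded2]\<close>)
 qed (use \<Psi> in auto)
 moreover from calculation(1) have "(LINT w|M. \<Psi> w * real_cond_exp M (Ft s) ?f w) = (LINT w|M. \<Psi> w * ?g w)"
  by (intro integral_cong_AE) (auto simp: borel_measurable_cond_exp2)
 ultimately show ?thesis by simp
qed

text \<open>The diagonal entries of the transition matrix differ from 1 by at most a multiple of the
  step, whatever the state at time \<open>u\<close>.\<close>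

lemma jump_prob:
 obtains C where "C >= 0" "!!u v. 0 <= u ==> u <= v ==> v - u <= 1 ==> measure M {w\<in>space M. Z u w ~= Z v w} <= C * (v - u)"
proof -
 obtain C0 where C0: "C0 >= 0" "!!\<delta> i j. 0 <= \<delta> ==> \<delta> <= 1 ==>
  \<bar>mat_exp (\<delta> *\<^sub>R Q) $ i $ j - (if i = j then 1 else 0) - \<delta> * Q $ i $ j\<bar> <= C0 * \<delta>\<^sup>2"
  using mat_exp_first_order[of Q] by blast
 define C where "C = C0 + (\<Sum>i\<in>UNIV. \<bar>Q$i$i\<bar>)"
 show ?thesis
 proof (rule that[of C])
  show "C >= 0" unfolding C_def using C0 by (simp add: sum_nonneg)
  fix u v :: real assume uv: "0 <= u" "u <= v" "v - u <= 1"
  have d: "1 - Ptr (v - u) i i <= C * (v - u)" for i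
  proof -
   have "(v - u)\<^sup>2 <= v - u" using uv by (simp add: power2_eq_square mult_left_le)
   then have "C0 * (v-u)\<^sup>2 <= C0 * (v - u)" using C0 by (simp add: mult_left_mono)
   moreover have "1 - Ptr (v - u) i i <= C0 * (v-u)\<^sup>2 - (v - u) * Q$i$i" using C0(2)[of "v-u" i i] uv by (simp add: abs_le_iff)
   moreover have "- Q$i$i <= (\<Sum>i\<in>UNIV. \<bar>Q$i$i\<bar>)"
    using member_le_sum[of i UNIV "%i. \<bar>Q$i$i\<bar>"] by auto
   then have "(v - u) * (- Q$i$i) <= (v - u) * (\<Sum>i\<in>UNIV. \<bar>Q$i$i\<bar>)" using uv by (intro mult_left_mono) auto
   ultimately show ?thesis unfolding C_def by (simp add: algebra_simps)
  qed
  have same: "measure M {w\<in>space M. Z u w = i \<and> Z v w = i} = measure M {w\<in>space M. Z u w = i} * Ptr (v - u) i i" for i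
   using markov_set[of u v "space M" i i] uv sets.top[of "Ft u"] by (simp add: Int_absorb1 Collect_conj_eq[symmetric] Int_def)
  have Zs: "{w\<in>space M. Z u w = i} \<in> sets M" "{w\<in>space M. Z u w = i \<and> Z v w = i} \<in> sets M" for i
   using Z_eq_sets[of u i] Z_eq_sets[of v i] uv by auto
  have "{w\<in>space M. Z u w ~= Z v w} = (\<Union>i. {w\<in>space M. Z u w = i} - {w\<in>space M. Z u w = i \<and> Z v w = i})"
   by auto
  also have "measure M ... <= (\<Sum>i\<in>UNIV. measure M ({w\<in>space M. Z u w = i} - {w\<in>space M. Z u w = i \<and> Z v w = i}))"
   using Zs by (intro finite_measure_subadditive_finite) auto
  also have "... = (\<Sum>i\<in>UNIV. measure M {w\<in>space M. Z u w = i} * (1 - Ptr (v - u) i i))"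
  proof (rule sum.cong)
   fix i
   have "measure M ({w\<in>space M. Z u w = i} - {w\<in>space M. Z u w = i \<and> Z v w = i})
    = measure M {w\<in>space M. Z u w = i} - measure M {w\<in>space M. Z u w = i \<and> Z v w = i}"
    using Zs by (intro finite_measure_Diff) auto
   then show "measure M ({w\<in>space M. Z u w = i} - {w\<in>space M. Z u w = i \<and> Z v w = i})
    = measure M {w\<in>space M. Z u w = i} * (1 - Ptr (v - u) i i)"
    unfolding same by (simp add: right_diff_distrib)
  qed simp
  also have "... <= (\<Sum>i\<in>UNIV. measure M {w\<in>space M. Z u w = i} * (C * (v - u)))"
   by (intro sum_mono mult_left_mono d) auto
  also have "... = (\<Sum>i\<in>UNIV. measure M {w\<in>space M. Z u w = i}) * (C * (v - u))" by (simp add: sum_distrib_right)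
  also have "(\<Sum>i\<in>UNIV. measure M {w\<in>space M. Z u w = i}) = measure M (\<Union>i. {w\<in>space M. Z u w = i})"
   using Zs by (intro finite_measure_finite_Union[symmetric]) (auto simp: disjoint_family_on_def)
  also have "(\<Union>i. {w\<in>space M. Z u w = i}) = space M" by auto
  finally show "measure M {w\<in>space M. Z u w ~= Z v w} <= C * (v - u)" by (simp add: prob_space)
 qed
qed

text \<open>At every dyadic level of \<open>[u, v]\<close> a union bound gives failure probability
  at most \<open>C * (v - u)\<close>: there are \<open>2^m\<close> steps, each contributing
  \<open>C * (v - u) / 2^m\<close>. The decreasing limit of these events is measurable although it
  controls all \<open>r\<close>, because right-continuity carries constancy from dyadic points to
  the whole interval.\<close>

lemma no_jump_event:
 obtains C where "C >= 0" "!!u v. 0 <= u ==> u <= v ==> v - u <= 1 ==>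
   \<exists>J\<in>sets M. measure M J <= C * (v - u) \<and> (\<forall>w\<in>space M - J. \<forall>r\<in>{u..v}. Z r w = Z u w)"
proof -
 obtain C where C: "C >= 0" "!!u v. 0 <= u ==> u <= v ==> v - u <= 1 ==> measure M {w\<in>space M. Z u w ~= Z v w} <= C * (v - u)"
  using jump_prob by blast
 show ?thesis
 proof (rule that[OF C(1)])
  fix u v :: real assume uv: "0 <= u" "u <= v" "v - u <= 1"
  define p where "p m k = u + real k * (v - u) / 2 ^ m" for m k :: nat
  have p0: "p m k >= 0" for m k using uv unfolding p_def by simp
  define G where "G m = {w\<in>space M. \<forall>k\<le>2^m. Z (p m k) w = Z u w}" for m :: nat
  have eqm: "{w\<in>space M. Z a w = Z b w} \<in> sets M" if "a >= 0" "b >= 0" for a b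
  proof -
   have "{w\<in>space M. Z a w = Z b w} = (\<Union>i. {w\<in>space M. Z a w = i} \<inter> {w\<in>space M. Z b w = i})" by auto
   then show ?thesis using Z_eq_sets that by auto
  qed
  have Gs: "G m \<in> sets M" for m
  proof -
   have "G m = {w\<in>space M. \<forall>k\<in>{..2^m}. Z (p m k) w = Z u w}" unfolding G_def by auto
   also have "... \<in> sets M" by (rule sets.sets_Collect_finite_All) (auto intro!: eqm p0 uv)
   finally show ?thesis .
  qed
  have neqm: "{w\<in>space M. Z a w ~= Z b w} \<in> sets M" if "a >= 0" "b >= 0" for a b
  proof -
   have "{w\<in>space M. Z a w ~= Z b w} = space M - {w\<in>space M. Z a w = Z b w}" by auto
   then show ?thesis using eqm[OF that] by auto
  qed
  have "measure M (space M - G m) <= C * (v - u)" for m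
  proof -
   have "space M - G m \<subseteq> (\<Union>k<2^m. {w\<in>space M. Z (p m k) w ~= Z (p m (Suc k)) w})"
   proof
    fix w assume w: "w \<in> space M - G m"
    show "w \<in> (\<Union>k<2^m. {w\<in>space M. Z (p m k) w ~= Z (p m (Suc k)) w})"
    proof (rule ccontr)
     assume "\<not> ?thesis"
     then have s: "Z (p m (Suc k)) w = Z (p m k) w" if "k < 2^m" for k using that w by auto
     have "Z (p m k) w = Z u w" if "k <= 2^m" for k
      using that by (induction k) (use s in \<open>auto simp: p_def\<close>)
     then show False using w unfolding G_def by auto
    qed
   qed
   then have "measure M (space M - G m) <= measure M (\<Union>k<2^m. {w\<in>space M. Z (p m k) w ~= Z (p m (Suc k)) w})"
    by (intro finite_measure_mono) (auto intro!: neqm p0)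
   also have "... <= (\<Sum>k<2^m. measure M {w\<in>space M. Z (p m k) w ~= Z (p m (Suc k)) w})"
    by (intro finite_measure_subadditive_finite) (auto intro!: neqm p0)
   also have "... <= (\<Sum>k<(2::nat)^m. C * ((v - u) / 2^m))"
   proof (rule sum_mono)
    fix k
    have d: "p m (Suc k) - p m k = (v - u) / 2^m" unfolding p_def by (simp add: field_simps)
    have le: "(v - u) / 2^m <= v - u" using divide_left_mono[of 1 "2^m" "v-u"] uv by simp
    have "(v - u) / 2^m <= 1" by (rule order_trans[OF le uv(3)])
    moreover have "0 <= (v - u) / 2^m" using uv by simp
    ultimately show "measure M {w\<in>space M. Z (p m k) w ~= Z (p m (Suc k)) w} <= C * ((v - u) / 2^m)"
     using C(2)[of "p m k" "p m (Suc k)"] p0 d by auto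
   qed
   also have "... = C * (v - u)" by simp
   finally show ?thesis .
  qed
  then have mG: "measure M (G m) >= 1 - C * (v - u)" for m
   using prob_compl[OF Gs[of m]] by (smt (verit))
  have dec: "decseq G"
  proof (rule decseq_SucI, rule subsetI)
   fix m w assume w: "w \<in> G (Suc m)"
   have p2: "p (Suc m) (2*k) = p m k" for k unfolding p_def by simp
   have "Z (p m k) w = Z u w" if "k <= 2 ^ m" for k
   proof -
    have "Z (p (Suc m) (2*k)) w = Z u w" using w that unfolding G_def by (simp del: power_Suc) simp
    then show ?thesis unfolding p2 .
   qed
   then show "w \<in> G m" using w unfolding G_def by blast
  qed
  have "(%m. measure M (G m)) \<longlonglongrightarrow> measure M (\<Inter>m. G m)"
   by (rule finite_Lim_measure_decseq) (use Gs dec in auto)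
  then have "1 - C * (v - u) <= measure M (\<Inter>m. G m)" using mG by (intro LIMSEQ_le_const) auto
  moreover have Is: "(\<Inter>m. G m) \<in> sets M" using Gs by auto
  ultimately have "measure M (space M - (\<Inter>m. G m)) <= C * (v - u)" using prob_compl[OF Is] by simp
  moreover have "Z r w = Z u w" if w: "w \<in> space M - (space M - (\<Inter>m. G m))" and r: "r \<in> {u..v}" for w r
  proof (cases "r = v")
   case True
   have "Z (p 0 1) w = Z u w" using w unfolding G_def by auto
   then show ?thesis using True by (simp add: p_def)
  next
   case False
   then have rv: "u <= r" "r < v" using r by auto
   have r0: "w \<in> space M" "r >= 0" using w rv uv by simp_all
   obtain e where e: "e > 0" "!!s. s \<in> {r..<r+e} ==> Z s w = Z r w"
    using Z_right[OF r0] by blast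
   obtain m :: nat where m: "(1/2) ^ m < e / (v - u)"
    using real_arch_pow_inv[of "e / (v - u)" "1/2"] e(1) rv by auto
   then have m': "(v - u) / 2 ^ m < e" using rv by (simp add: field_simps power_one_over)
   \<comment> \<open>The first dyadic point not before \<open>r\<close> lies within one mesh of
     \<open>r\<close>, hence in the interval to the right of \<open>r\<close> on which the path does
     not move.\<close>
   define y where "y = (r - u) * 2 ^ m / (v - u)"
   define k where "k = nat \<lceil>y\<rceil>"
   have y0: "y >= 0" unfolding y_def using rv by simp
   have k: "y <= real k" "real k < y + 1" unfolding k_def using y0 by linarith+
   have "y <= 2 ^ m" unfolding y_def using rv by (simp add: field_simps)
   then have "real k < 2 ^ m + 1" using k by linarith
   then have "real k < real (2 ^ m + 1)" by simp
   then have kk: "k <= 2 ^ m" unfolding of_nat_less_iff by simp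
   have yp: "u + y * (v - u) / 2 ^ m = r" unfolding y_def using rv by simp
   have "p m k >= r"
   proof -
    have "y * (v - u) / 2 ^ m <= real k * (v - u) / 2 ^ m" using k rv by (intro divide_right_mono mult_right_mono) auto
    then show ?thesis unfolding p_def using yp by linarith
   qed
   moreover have "real k * (v - u) < (y + 1) * (v - u)" using k rv by (intro mult_strict_right_mono) auto
   then have "u + real k * (v - u) / 2^m < u + (y + 1) * (v - u) / 2^m" by (simp add: divide_strict_right_mono)
   then have "p m k < r + e" using m' yp unfolding p_def by (simp add: distrib_right add_divide_distrib)
   ultimately have "Z (p m k) w = Z r w" by (intro e(2)) simp
   moreover have "Z (p m k) w = Z u w" using w kk unfolding G_def by blast
   ultimately show ?thesis by simp
  qed
  ultimately show "\<exists>J\<in>sets M. measure M J <= C * (v - u) \<and> (\<forall>w\<in>space M - J. \<forall>r\<in>{u..v}. Z r w = Z u w)"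
   using sets.compl_sets[OF Is] by blast
 qed
qed

definition Aint :: "('s => real) => real => real => 'a => real" where
 "Aint f s t w = integral {s..t} (%r. f (Z r w))"

text \<open>The discretised times approach \<open>r\<close> from the right, as right-continuity
  requires, and are clamped to \<open>[0, t]\<close>, so that the approximants look at the path up
  to time \<open>t\<close> only. This is what gives measurability with respect to
  \<open>Ft t\<close> in \<open>joint_meas\<close>.\<close>

lemma path_approx:
 assumes "w \<in> space M" "0 <= r" "r <= t"
 shows "(%m. f (Z (max 0 (min t (of_int \<lceil>real (Suc m) * r\<rceil> / real (Suc m)))) w) :: real) \<longlonglongrightarrow> f (Z r w)"
proof -
 obtain e where e: "e > 0" "!!s. s \<in> {r..<r+e} ==> Z s w = Z r w"
  using Z_right[of w r] assms(1,2) by blast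
 obtain m0 :: nat where m0: "1 / real (Suc m0) < e" using e(1) nat_approx_posE by blast
 have "Z (max 0 (min t (of_int \<lceil>real (Suc m) * r\<rceil> / real (Suc m)))) w = Z r w" if "m >= m0" for m
 proof (rule e(2))
  let ?q = "of_int \<lceil>real (Suc m) * r\<rceil> / real (Suc m)"
  have "real (Suc m) * r <= of_int \<lceil>real (Suc m) * r\<rceil>" "of_int \<lceil>real (Suc m) * r\<rceil> < real (Suc m) * r + 1" by linarith+
  then have "real (Suc m) * r / real (Suc m) <= ?q" "?q < (real (Suc m) * r + 1) / real (Suc m)"
   by (intro divide_right_mono divide_strict_right_mono; simp)+
  then have "r <= ?q" "?q < r + 1 / real (Suc m)" by (simp_all add: add_divide_distrib del: of_nat_Suc)
  moreover have "1 / real (Suc m) <= 1 / real (Suc m0)" using that by (intro divide_left_mono) auto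
  ultimately show "max 0 (min t ?q) \<in> {r..<r+e}" using assms m0 e(1) by auto
 qed
 then show ?thesis by (intro tendsto_eventually eventually_sequentiallyI[of m0]) (simp del: of_nat_Suc)
qed

text \<open>Progressive measurability: after discretisation the time argument takes countably many
  values, and at each of them the chain is measurable for \<open>Ft t\<close>.\<close>

lemma joint_meas:
 fixes f :: "'s => real"
 assumes "0 <= s" "s <= t"
 shows "(%(w, r). indicator {s..t} r * f (Z r w)) \<in> borel_measurable (Ft t \<Otimes>\<^sub>M lborel)"
proof (rule borel_measurable_LIMSEQ_real)
 let ?u = "%(m::nat) (w::'a, r::real). (indicator {s..t} r :: real) * f (Z (max 0 (min t (of_int \<lceil>real (Suc m) * r\<rceil> / real (Suc m)))) w)"
 fix x :: "'a \<times> real" assume x: "x \<in> space (Ft t \<Otimes>\<^sub>M lborel)"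
 obtain w r where [simp]: "x = (w, r)" by (cases x)
 have w: "w \<in> space M" using x by (simp add: space_pair_measure)
 show "(%m. ?u m x) \<longlonglongrightarrow> (case x of (w, r) => indicator {s..t} r * f (Z r w))"
 proof (cases "r \<in> {s..t}")
  case True
  then show ?thesis using path_approx[OF w, of r t f] assms by simp
 qed simp
next
 fix m
 have "(%x. f (Z (max 0 (min t (of_int \<lceil>real (Suc m) * snd x\<rceil> / real (Suc m)))) (fst x))) \<in> borel_measurable (Ft t \<Otimes>\<^sub>M lborel)"
 proof (rule measurable_compose_countable[where g = "%x. \<lceil>real (Suc m) * snd x\<rceil>"
   and f = "%i x. f (Z (max 0 (min t (of_int i / real (Suc m)))) (fst x))"])
  fix i :: int
  have "Z (max 0 (min t (of_int i / real (Suc m)))) \<in> Ft t \<rightarrow>\<^sub>M count_space UNIV" using assms by (intro Z_Ft) auto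
  then have "(%x. f (Z (max 0 (min t (of_int i / real (Suc m)))) x)) \<in> borel_measurable (Ft t)"
   by (rule measurable_compose) simp
  then show "(%x. f (Z (max 0 (min t (of_int i / real (Suc m)))) (fst x))) \<in> borel_measurable (Ft t \<Otimes>\<^sub>M lborel)"
   by (rule measurable_compose[OF measurable_fst])
 next
  show "(%x. \<lceil>real (Suc m) * snd x\<rceil>) \<in> Ft t \<Otimes>\<^sub>M lborel \<rightarrow>\<^sub>M count_space UNIV" by measurable
 qed
 note m1 = this
 show "(%(w, r). indicator {s..t} r * f (Z (max 0 (min t (of_int \<lceil>real (Suc m) * r\<rceil> / real (Suc m)))) w)) \<in> borel_measurable (Ft t \<Otimes>\<^sub>M lborel)"
  unfolding case_prod_unfold by (rule borel_measurable_times[OF _ m1]) measurable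
qed

lemma f_bound: "\<bar>f (i::'s)\<bar> <= (\<Sum>j\<in>UNIV. \<bar>f j :: real\<bar>)"
 by (rule member_le_sum) auto

lemma path_integrable:
 assumes "0 <= s" "w \<in> space M"
 shows "(%r. f (Z r w) :: real) integrable_on {s..t}" "Aint f s t w = (LINT r|lborel. indicator {s..t} r * f (Z r w))"
proof -
 have "set_integrable lborel {s..t} (%r. f (Z r w))"
 proof (cases "s <= t")
  case True
  have m: "(%r. indicator {s..t} r * f (Z r w)) \<in> borel_measurable lborel"
   using measurable_Pair2[OF joint_meas[OF assms(1) True, of f], of w] assms by simp
  show ?thesis unfolding set_integrable_def
  proof (rule Bochner_Integration.integrable_bound[where f = "%r. indicator {s..t} r * (\<Sum>j\<in>UNIV. \<bar>f j\<bar>)"])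
   show "integrable lborel (%r. indicator {s..t} r * (\<Sum>j\<in>UNIV. \<bar>f j\<bar>))"
    by (intro integrable_mult_left) (auto simp: emeasure_lborel_Icc_eq)
  qed (use m f_bound[of f] in \<open>auto simp: indicator_def intro: order_trans[OF _ abs_ge_self]\<close>)
 qed (simp add: set_integrable_def)
 from set_borel_integral_eq_integral[OF this]
 show "(%r. f (Z r w)) integrable_on {s..t}" "Aint f s t w = (LINT r|lborel. indicator {s..t} r * f (Z r w))"
  unfolding Aint_def set_lebesgue_integral_def by auto
qed

lemma Aint_Ft: "0 <= s ==> s <= t ==> Aint f s t \<in> borel_measurable (Ft t)"
proof -
 assume st: "0 <= s" "s <= t"
 have "(%w. LINT r|lborel. indicator {s..t} r * f (Z r w)) \<in> borel_measurable (Ft t)"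
  using lborel.borel_measurable_lebesgue_integral[OF joint_meas[OF st, of f]] by simp
 then show ?thesis by (rule measurable_cong[THEN iffD1, rotated]) (simp add: path_integrable(2) st)
qed

lemma Aint_add: "w \<in> space M ==> 0 <= s ==> s <= t ==> t <= u ==> Aint f s u w = Aint f s t w + Aint f t u w"
 unfolding Aint_def by (subst Henstock_Kurzweil_Integration.integral_combine[symmetric, where c = t]) (auto intro: path_integrable)

lemma Aint_bound:
 assumes w: "w \<in> space M" "0 <= s" "s <= t" and f: "!!i. \<bar>f i\<bar> <= D"
 shows "\<bar>Aint f s t w\<bar> <= D * (t - s)"
proof -
 have "norm (integral {s..t} (%r. f (Z r w))) <= integral {s..t} (%r. D)"
  by (rule integral_norm_bound_integral) (use path_integrable(1)[OF assms(2,1), of f t] f in auto)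
 then show ?thesis using assms(3) by (simp add: Aint_def mult.commute)
qed

lemma Aint_const: "s <= t ==> (\<forall>r\<in>{s..t}. Z r w = i) ==> Aint f s t w = f i * (t - s)"
 unfolding Aint_def by (subst Henstock_Kurzweil_Integration.integral_cong[where g = "%_. f i"]) auto

end

section \<open>Additive functionals of the chain\<close>

context prob_space begin

lemma integrable_bounded:
 fixes F :: "'a => 'z :: {banach, second_countable_topology}"
 assumes "F \<in> borel_measurable M" "!!w. w \<in> space M ==> norm (F w) <= B"
 shows "integrable M F"
 using assms by (intro integrable_const_bound[of _ B] AE_I2)

text \<open>\<open>J\<close> will be the rare event of a jump during a short step. Its probability
  is of the order of the step, so a cruder bound suffices on it.\<close>

lemma norm_integral_bounded:
 fixes F :: "'a => 'z :: {banach, second_countable_topology}"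
 assumes F: "F \<in> borel_measurable M" and J: "J \<in> sets M" and b: "b >= 0"
  and a: "!!w. w \<in> space M - J ==> norm (F w) <= a" "!!w. w \<in> J ==> norm (F w) <= a + b"
 shows "norm (LINT w|M. F w) <= a + b * measure M J"
proof -
 have p: "norm (F w) <= a + b * indicat_real J w" if "w \<in> space M" for w
  using that a by (cases "w \<in> J") auto
 have "norm (LINT w|M. F w) <= (LINT w|M. norm (F w))" by (rule integral_norm_bound)
 also have "... <= (LINT w|M. a + b * indicat_real J w)"
 proof (rule integral_mono)
  show "integrable M (%w. norm (F w))"
   by (rule integrable_bounded[of _ "a + b"]) (use F a b in \<open>force simp: indicator_def\<close>)+
  show "integrable M (%w. a + b * indicat_real J w)"
   using J by (intro Bochner_Integration.integrable_add integrable_mult_right) (auto simp: emeasure_eq_measure)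
 qed (rule p)
 also have "... = a + b * measure M J"
  using J sets.sets_into_space[OF J] by (simp add: prob_space Int_absorb1 emeasure_eq_measure)
 finally show ?thesis .
qed

lemma norm_integral_le:
 fixes F :: "'a => 'z :: {banach, second_countable_topology}"
 assumes "F \<in> borel_measurable M" "!!w. w \<in> space M ==> norm (F w) <= a"
 shows "norm (LINT w|M. F w) <= a"
 using norm_integral_bounded[of F "{}" 0 a] assms by simp

end

context ctmc begin

text \<open>\<open>gen_adj\<close> for complex functions; the test functions to come are
  perturbations of complex exponentials.\<close>

definition genc :: "('s => complex) => 's => complex" where
 "genc h i = (\<Sum>j\<in>UNIV. of_real (Q $ j $ i) * h j)"

text \<open>A sum instead of a maximum: the state space is finite and only upper bounds are
  taken.\<close>

definition nmax :: "('s => 'z::real_normed_vector) => real" where "nmax h = (\<Sum>j\<in>UNIV. norm (h j))"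

lemma nmax: "norm (h i) <= nmax h" "nmax h >= 0"
 unfolding nmax_def by (auto intro: member_le_sum sum_nonneg)

lemma fZ_meas: "0 <= r ==> r <= s ==> (%w. h (Z r w) :: 'z :: topological_space) \<in> borel_measurable (Ft s)"
 by (rule measurable_compose[OF Z_Ft]) auto

lemma fZ_measM: "0 <= r ==> (%w. h (Z r w) :: 'z :: topological_space) \<in> borel_measurable M"
 by (rule measurable_compose[OF Z_meas]) auto

lemma markov_expectation:
 assumes st: "0 <= s" "s <= t" and \<Psi>: "\<Psi> \<in> borel_measurable (Ft s)" "!!w. w \<in> space M ==> norm (\<Psi> w) <= (B::real)"
 shows "(LINT w|M. \<Psi> w * (h (Z t w) :: complex)) = (LINT w|M. \<Psi> w * (\<Sum>k\<in>UNIV. of_real (Ptr (t - s) k (Z s w)) * h k))"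
proof -
 have t0: "t >= 0" using st by simp
 note [measurable] = Ft_meas_M[OF \<Psi>(1)] Z_meas[OF t0] Z_meas[OF st(1)]
 have R: "(%w. Re (\<Psi> w)) \<in> borel_measurable (Ft s)" "(%w. Im (\<Psi> w)) \<in> borel_measurable (Ft s)" using \<Psi>(1) by measurable
 have Rb: "\<bar>Re (\<Psi> w)\<bar> <= B" "\<bar>Im (\<Psi> w)\<bar> <= B" if "w \<in> space M" for w
  using \<Psi>(2)[OF that] abs_Re_le_cmod[of "\<Psi> w"] abs_Im_le_cmod[of "\<Psi> w"] by linarith+
 define q where "q = nmax (%i. \<Sum>k\<in>UNIV. \<bar>Ptr (t - s) k i\<bar>)"
 have q: "\<bar>Ptr (t - s) k i\<bar> <= q" for k i
  using nmax(1)[of "%i. \<Sum>k\<in>UNIV. \<bar>Ptr (t - s) k i\<bar>" i] member_le_sum[of k UNIV "%k. \<bar>Ptr (t - s) k i\<bar>"]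
  unfolding q_def by auto
 have I1: "integrable M (%w. \<Psi> w * of_real (indicator {k} (Z t w)))" for k
  by (rule integrable_bounded[of _ B]) (use \<Psi>(2) in \<open>auto simp: norm_mult indicator_def intro: order_trans[OF norm_ge_zero]\<close>)
 have I2: "integrable M (%w. \<Psi> w * of_real (Ptr (t - s) k (Z s w)))" for k
 proof (rule integrable_bounded)
  show "norm (\<Psi> w * of_real (Ptr (t - s) k (Z s w))) <= B * q" if "w \<in> space M" for w
   unfolding norm_mult using \<Psi>(2)[OF that] q by (intro mult_mono') auto
 qed measurable
 have one: "(LINT w|M. \<Psi> w * of_real (indicator {k} (Z t w))) = (LINT w|M. \<Psi> w * of_real (Ptr (t - s) k (Z s w)))" for k
  using integral_Re[OF I1[of k]] integral_Re[OF I2[of k]] integral_Im[OF I1[of k]] integral_Im[OF I2[of k]]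
   markov_expectation_real[OF st R(1) Rb(1), of k] markov_expectation_real[OF st R(2) Rb(2), of k]
  by (intro complex_eqI) simp_all
 have "(LINT w|M. \<Psi> w * h (Z t w)) = (LINT w|M. (\<Sum>k\<in>UNIV. \<Psi> w * of_real (indicator {k} (Z t w)) * h k))"
 proof (rule Bochner_Integration.integral_cong)
  fix w assume "w \<in> space M"
  have "(\<Sum>k\<in>UNIV. \<Psi> w * of_real (indicator {k} (Z t w)) * h k) = (\<Sum>k\<in>UNIV. if k = Z t w then \<Psi> w * h k else 0)"
   by (rule sum.cong) (auto simp: indicator_def)
  then show "\<Psi> w * h (Z t w) = (\<Sum>k\<in>UNIV. \<Psi> w * of_real (indicator {k} (Z t w)) * h k)" by simp
 qed simp
 also have "... = (\<Sum>k\<in>UNIV. (LINT w|M. \<Psi> w * of_real (indicator {k} (Z t w))) * h k)"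
  by (subst Bochner_Integration.integral_sum) (auto intro!: integrable_mult_left I1)
 also have "... = (\<Sum>k\<in>UNIV. (LINT w|M. \<Psi> w * of_real (Ptr (t - s) k (Z s w))) * h k)" by (simp only: one)
 also have "... = (LINT w|M. (\<Sum>k\<in>UNIV. \<Psi> w * of_real (Ptr (t - s) k (Z s w)) * h k))"
  by (subst Bochner_Integration.integral_sum) (auto intro!: integrable_mult_left I2)
 finally show ?thesis by (simp add: sum_distrib_left mult_ac)
qed

text \<open>Dynkin's formula to first order over a short step, against any bounded weight that
  depends on the past. The constant depends on \<open>h\<close> alone, which is what allows steps to
  be summed.\<close>

lemma generator_step:
 fixes h :: "'s => complex"
 obtains C where "C >= 0" "!!s t (\<Phi>::'a => complex). 0 <= s ==> s <= t ==> t - s <= 1 ==> \<Phi> \<in> borel_measurable (Ft s) ==> (!!w. w \<in> space M ==> norm (\<Phi> w) <= 1)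
  ==> norm ((LINT w|M. \<Phi> w * h (Z t w)) - (LINT w|M. \<Phi> w * h (Z s w)) - of_real (t - s) * (LINT w|M. \<Phi> w * genc h (Z s w))) <= C * (t - s)\<^sup>2"
proof -
 obtain C0 where C0: "C0 >= 0" "!!\<delta> i j. 0 <= \<delta> ==> \<delta> <= 1 ==>
  \<bar>mat_exp (\<delta> *\<^sub>R Q) $ i $ j - (if i = j then 1 else 0) - \<delta> * Q $ i $ j\<bar> <= C0 * \<delta>\<^sup>2"
  using mat_exp_first_order[of Q] by blast
 show ?thesis
 proof (rule that)
  show "C0 * nmax h >= 0" using C0 nmax(2)[of h] by simp
  fix s t and \<Phi> :: "'a => complex" assume st: "0 <= s" "s <= t" "t - s <= 1" and \<Phi>: "\<Phi> \<in> borel_measurable (Ft s)" "!!w. w \<in> space M ==> norm (\<Phi> w) <= 1"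
  note [measurable] = Ft_meas_M[OF \<Phi>(1)] Z_meas[OF st(1)]
  let ?p = "%i. \<Sum>k\<in>UNIV. of_real (Ptr (t - s) k i) * h k"
  have I: "integrable M (%w. \<Phi> w * u (Z s w))" for u :: "'s => complex"
  proof (rule integrable_bounded)
   show "norm (\<Phi> w * u (Z s w)) <= 1 * nmax u" if "w \<in> space M" for w
    unfolding norm_mult using \<Phi>(2)[OF that] nmax by (intro mult_mono') auto
  qed measurable
  have p: "norm (?p i - h i - of_real (t - s) * genc h i) <= C0 * nmax h * (t - s)\<^sup>2" for i
  proof -
   have "?p i - h i - of_real (t - s) * genc h i = (\<Sum>k\<in>UNIV. of_real (Ptr (t - s) k i - (if k = i then 1 else 0) - (t - s) * Q$k$i) * h k)"
   proof -
    have "(\<Sum>k\<in>UNIV. of_real (if k = i then 1 else 0 :: real) * h k) = (\<Sum>k\<in>UNIV. if k = i then h k else 0)"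
     by (rule sum.cong) auto
    then show ?thesis unfolding genc_def by (simp add: left_diff_distrib sum_subtractf sum_distrib_left mult.assoc)
   qed
   also have "norm ... <= (\<Sum>k\<in>UNIV. (C0 * (t - s)\<^sup>2) * norm (h k))"
   proof (rule sum_norm_le)
    fix k
    show "norm (of_real (Ptr (t - s) k i - (if k = i then 1 else 0) - (t - s) * Q$k$i) * h k) <= (C0 * (t - s)\<^sup>2) * norm (h k)"
     unfolding norm_mult norm_of_real using C0(2)[of "t - s" k i] st by (intro mult_right_mono) auto
   qed
   also have "... = C0 * nmax h * (t - s)\<^sup>2" unfolding nmax_def by (simp add: sum_distrib_left mult_ac)
   finally show ?thesis .
  qed
  have E: "(LINT w|M. \<Phi> w * h (Z t w)) = (LINT w|M. \<Phi> w * ?p (Z s w))"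
   by (rule markov_expectation[OF st(1,2) \<Phi>])
  have "(LINT w|M. \<Phi> w * h (Z t w)) - (LINT w|M. \<Phi> w * h (Z s w)) - of_real (t - s) * (LINT w|M. \<Phi> w * genc h (Z s w))
    = (LINT w|M. \<Phi> w * ?p (Z s w) - \<Phi> w * h (Z s w) - of_real (t - s) * (\<Phi> w * genc h (Z s w)))"
   unfolding E
   by (simp only: Bochner_Integration.integral_diff Bochner_Integration.integrable_diff I[of ?p] I[of h] I[of "genc h"] integrable_mult_right integral_mult_right_zero)
  also have "... = (LINT w|M. \<Phi> w * (?p (Z s w) - h (Z s w) - of_real (t - s) * genc h (Z s w)))"
   by (rule Bochner_Integration.integral_cong) (simp_all add: algebra_simps)
  also have "norm ... <= C0 * nmax h * (t - s)\<^sup>2"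
  proof (rule norm_integral_le)
   fix w assume w: "w \<in> space M"
   have "norm (\<Phi> w * (?p (Z s w) - h (Z s w) - of_real (t - s) * genc h (Z s w))) <= 1 * (C0 * nmax h * (t - s)\<^sup>2)"
    unfolding norm_mult using \<Phi>(2)[OF w] p by (intro mult_mono') auto
   then show "norm (\<Phi> w * (?p (Z s w) - h (Z s w) - of_real (t - s) * genc h (Z s w))) <= C0 * nmax h * (t - s)\<^sup>2" by simp
  qed measurable
  finally show "norm ((LINT w|M. \<Phi> w * h (Z t w)) - (LINT w|M. \<Phi> w * h (Z s w)) - of_real (t - s) * (LINT w|M. \<Phi> w * genc h (Z s w))) <= C0 * nmax h * (t - s)\<^sup>2" .
 qed
qed

lemma AintM: "0 <= s ==> s <= t ==> Aint f s t \<in> borel_measurable M"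
 by (rule Ft_meas_M[OF Aint_Ft])

lemma Aint_nmax: "w \<in> space M ==> 0 <= s ==> s <= t ==> \<bar>Aint f s t w\<bar> <= nmax f * (t - s)"
 by (rule Aint_bound) (use nmax(1)[of f] in auto)

text \<open>First-order expansion with the Feynman-Kac generator
  \<open>genc h + \<i> \<eta> f h\<close>. Without a jump in \<open>[s, t]\<close> the integral is
  exactly \<open>f (Z s w)\<close> times the length, and the Taylor error is quadratic. With a jump
  the error is only linear, but a jump has probability linear in the length.\<close>

lemma exponential_step:
 fixes h :: "'s => complex" and f :: "'s => real" and \<eta> :: real
 obtains C where "C >= 0" "!!s t (\<Phi>::'a => complex). 0 <= s ==> s <= t ==> t - s <= 1 ==> \<Phi> \<in> borel_measurable (Ft s) ==> (!!w. w \<in> space M ==> norm (\<Phi> w) <= 1)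
  ==> norm ((LINT w|M. \<Phi> w * (iexp (\<eta> * Aint f s t w) * h (Z t w))) - (LINT w|M. \<Phi> w * h (Z s w))
    - of_real (t - s) * (LINT w|M. \<Phi> w * (\<i> * \<eta> * f (Z s w) * h (Z s w) + genc h (Z s w)))) <= C * (t - s)\<^sup>2"
proof -
 obtain C1 where C1: "C1 >= 0" "!!s t (\<Phi>::'a => complex). 0 <= s ==> s <= t ==> t - s <= 1 ==> \<Phi> \<in> borel_measurable (Ft s) ==> (!!w. w \<in> space M ==> norm (\<Phi> w) <= 1)
  ==> norm ((LINT w|M. \<Phi> w * h (Z t w)) - (LINT w|M. \<Phi> w * h (Z s w)) - of_real (t - s) * (LINT w|M. \<Phi> w * genc h (Z s w))) <= C1 * (t - s)\<^sup>2"
  using generator_step[of h] by blast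
 obtain CJ where CJ: "CJ >= 0" "!!u v. 0 <= u ==> u <= v ==> v - u <= 1 ==>
   \<exists>J\<in>sets M. measure M J <= CJ * (v - u) \<and> (\<forall>w\<in>space M - J. \<forall>r\<in>{u..v}. Z r w = Z u w)"
  using no_jump_event by blast
 define H where "H = nmax h"
 define D where "D = \<bar>\<eta>\<bar> * nmax f"
 have H: "norm (h i) <= H" "H >= 0" for i unfolding H_def using nmax by auto
 have D0: "D >= 0" unfolding D_def using nmax(2)[of f] by simp
 show ?thesis
 proof (rule that)
  show "C1 + D\<^sup>2 * H + 2 * D * H * CJ >= 0" using C1 H(2) D0 CJ(1) by simp
  fix s t and \<Phi> :: "'a => complex" assume st: "0 <= s" "s <= t" "t - s <= 1" and \<Phi>: "\<Phi> \<in> borel_measurable (Ft s)" "!!w. w \<in> space M ==> norm (\<Phi> w) <= 1"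
  have t0: "t >= 0" using st by simp
  define \<delta> where "\<delta> = t - s"
  have \<delta>: "0 <= \<delta>" "\<delta> <= 1" using st unfolding \<delta>_def by auto
  note [measurable] = Ft_meas_M[OF \<Phi>(1)] Z_meas[OF st(1)] Z_meas[OF t0] AintM[OF st(1,2), of f]
  obtain J where J: "J \<in> sets M" "measure M J <= CJ * \<delta>" "!!w r. w \<in> space M - J ==> r \<in> {s..t} ==> Z r w = Z s w"
   using CJ(2)[OF st] unfolding \<delta>_def by blast
  have \<eta>f: "\<bar>\<eta> * f i\<bar> <= D" for i unfolding D_def abs_mult using nmax(1)[of f i] by (intro mult_left_mono) auto
  have Ab: "\<bar>\<eta> * Aint f s t w\<bar> <= D * \<delta>" if "w \<in> space M" for w
   unfolding D_def \<delta>_def abs_mult using mult_left_mono[OF Aint_nmax[OF that st(1,2), of f], of "\<bar>\<eta>\<bar>"] by (simp add: mult.assoc)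
  let ?X = "%w. (iexp (\<eta> * Aint f s t w) - 1) * h (Z t w) - \<delta> * (\<i> * \<eta> * f (Z s w) * h (Z s w))"
  have e1: "norm ((iexp x - 1) * z) <= \<bar>x\<bar> * H" if "norm z <= H" for x z
   unfolding norm_mult using iexp_approx1[of x 0] that by (intro mult_mono) auto
  have n2: "norm (\<delta> * (\<i> * \<eta> * f i * h i)) <= D * \<delta> * H" for i
  proof -
   have "norm (\<delta> * (\<i> * \<eta> * f i * h i)) = (\<bar>\<eta> * f i\<bar> * \<delta>) * norm (h i)" using \<delta> by (simp add: norm_mult abs_mult)
   also have "... <= (D * \<delta>) * H" using \<eta>f[of i] H \<delta> D0 by (intro mult_mono) auto
   finally show ?thesis .
  qed
  have Xm: "?X \<in> borel_measurable M" by measurable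
  have Xall: "norm (?X w) <= 2 * D * H * \<delta>" if "w \<in> space M" for w
  proof -
   have "norm (?X w) <= \<bar>\<eta> * Aint f s t w\<bar> * H + D * \<delta> * H"
    by (intro order_trans[OF norm_triangle_ineq4] add_mono e1 H n2)
   also have "... <= D * \<delta> * H + D * \<delta> * H" using Ab[OF that] H \<delta> D0 by (intro add_mono mult_right_mono order_refl) auto
   finally show ?thesis by simp
  qed
  have Xgood: "norm (?X w) <= D\<^sup>2 * H * \<delta>\<^sup>2" if w: "w \<in> space M - J" for w
  proof -
   have Zt: "Z t w = Z s w" using J(3)[OF w, of t] st by auto
   have A: "Aint f s t w = f (Z s w) * \<delta>" unfolding \<delta>_def
    by (rule Aint_const[OF st(2)]) (use J(3)[OF w] in blast)
   define x where "x = \<eta> * Aint f s t w"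
   have x: "x = \<eta> * f (Z s w) * \<delta>" unfolding x_def A by simp
   have "?X w = (iexp x - 1 - \<i> * x) * h (Z s w)" unfolding Zt x_def[symmetric] by (simp add: x algebra_simps)
   also have "norm ... <= x\<^sup>2 * H" unfolding norm_mult
   proof (rule mult_mono)
    have "norm (iexp x - 1 - \<i> * x) <= \<bar>x\<bar>\<^sup>2 / 2" using iexp_approx1[of x 1] by (simp add: numeral_2_eq_2 diff_diff_eq)
    then have "norm (iexp x - 1 - \<i> * x) <= x\<^sup>2 / 2" by simp
    then show "norm (iexp x - 1 - \<i> * x) <= x\<^sup>2" using zero_le_power2[of x] by linarith
   qed (use H in auto)
   also have "... <= (D * \<delta>)\<^sup>2 * H"
   proof -
    have "\<bar>x\<bar> <= \<bar>D * \<delta>\<bar>" using Ab[of w] w D0 \<delta> unfolding x_def by auto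
    then show ?thesis using H by (intro mult_right_mono) (auto simp: abs_le_square_iff)
   qed
   finally show ?thesis by (simp add: power_mult_distrib mult_ac)
  qed
  have "norm (LINT w|M. \<Phi> w * ?X w) <= D\<^sup>2 * H * \<delta>\<^sup>2 + 2 * D * H * \<delta> * measure M J"
  proof (rule norm_integral_bounded[OF _ J(1)])
   show "(%w. \<Phi> w * ?X w) \<in> borel_measurable M" by (intro borel_measurable_times Xm) measurable
   show "2 * D * H * \<delta> >= 0" using D0 H \<delta> by simp
   fix w
   show "norm (\<Phi> w * ?X w) <= D\<^sup>2 * H * \<delta>\<^sup>2" if "w \<in> space M - J"
    using mult_mono'[OF \<Phi>(2)[of w] Xgood[OF that]] that by (simp only: norm_mult mult_1 norm_ge_zero DiffD1 if_True)
   show "norm (\<Phi> w * ?X w) <= D\<^sup>2 * H * \<delta>\<^sup>2 + 2 * D * H * \<delta>" if "w \<in> J"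
   proof -
    have w: "w \<in> space M" using that sets.sets_into_space[OF J(1)] by auto
    have "norm (\<Phi> w * ?X w) <= 1 * (2 * D * H * \<delta>)" unfolding norm_mult
     using \<Phi>(2)[OF w] Xall[OF w] by (intro mult_mono') auto
    moreover have "D\<^sup>2 * H * \<delta>\<^sup>2 >= 0" using H by simp
    ultimately show ?thesis by linarith
   qed
  qed
  also have "... <= D\<^sup>2 * H * \<delta>\<^sup>2 + 2 * D * H * \<delta> * (CJ * \<delta>)"
   using J(2) D0 H \<delta> by (intro add_mono mult_left_mono) auto
  finally have X: "norm (LINT w|M. \<Phi> w * ?X w) <= (D\<^sup>2 * H + 2 * D * H * CJ) * \<delta>\<^sup>2"
   by (simp add: power2_eq_square algebra_simps)
  have I: "integrable M (%w. \<Phi> w * u (Z r w))" if "r >= 0" for u :: "'s => complex" and r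
  proof (rule integrable_bounded)
   note [measurable] = fZ_measM[OF that, of u]
   show "(%w. \<Phi> w * u (Z r w)) \<in> borel_measurable M" by measurable
   show "norm (\<Phi> w * u (Z r w)) <= 1 * nmax u" if "w \<in> space M" for w
    unfolding norm_mult using \<Phi>(2)[OF that] nmax by (intro mult_mono') auto
  qed
  have IX: "integrable M (%w. \<Phi> w * ?X w)"
  proof (rule integrable_bounded)
   show "(%w. \<Phi> w * ?X w) \<in> borel_measurable M" by (intro borel_measurable_times Xm) measurable
   show "norm (\<Phi> w * ?X w) <= 1 * (2 * D * H * \<delta>)" if "w \<in> space M" for w unfolding norm_mult
     using \<Phi>(2)[OF that] Xall[OF that] by (intro mult_mono') auto
  qed
  have "(LINT w|M. \<Phi> w * (iexp (\<eta> * Aint f s t w) * h (Z t w)))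
    = (LINT w|M. \<Phi> w * h (Z t w) + \<Phi> w * ?X w + \<delta> * (\<Phi> w * (\<i> * \<eta> * f (Z s w) * h (Z s w))))"
   by (rule Bochner_Integration.integral_cong) (simp_all add: algebra_simps)
  also have "... = (LINT w|M. \<Phi> w * h (Z t w)) + (LINT w|M. \<Phi> w * ?X w) + \<delta> * (LINT w|M. \<Phi> w * (\<i> * \<eta> * f (Z s w) * h (Z s w)))"
   using I[OF t0, of h] IX I[OF st(1), of "%i. \<i> * \<eta> * f i * h i"]
   by (simp only: Bochner_Integration.integral_add Bochner_Integration.integrable_add integrable_mult_right integral_mult_right_zero)
  finally have e2: "(LINT w|M. \<Phi> w * (iexp (\<eta> * Aint f s t w) * h (Z t w))) = (LINT w|M. \<Phi> w * h (Z t w)) + (LINT w|M. \<Phi> w * ?X w) + \<delta> * (LINT w|M. \<Phi> w * (\<i> * \<eta> * f (Z s w) * h (Z s w)))" .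
  have e3: "(LINT w|M. \<Phi> w * (\<i> * \<eta> * f (Z s w) * h (Z s w) + genc h (Z s w))) = (LINT w|M. \<Phi> w * (\<i> * \<eta> * f (Z s w) * h (Z s w))) + (LINT w|M. \<Phi> w * genc h (Z s w))"
   unfolding distrib_left by (rule Bochner_Integration.integral_add[OF I[OF st(1), of "%i. \<i> * \<eta> * f i * h i"] I[OF st(1), of "genc h"]])
  have "(LINT w|M. \<Phi> w * (iexp (\<eta> * Aint f s t w) * h (Z t w))) - (LINT w|M. \<Phi> w * h (Z s w))
    - of_real (t - s) * (LINT w|M. \<Phi> w * (\<i> * \<eta> * f (Z s w) * h (Z s w) + genc h (Z s w)))
   = ((LINT w|M. \<Phi> w * h (Z t w)) - (LINT w|M. \<Phi> w * h (Z s w)) - of_real (t - s) * (LINT w|M. \<Phi> w * genc h (Z s w))) + (LINT w|M. \<Phi> w * ?X w)"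
   unfolding e2 e3 \<delta>_def by (simp add: algebra_simps)
  also have "norm ... <= C1 * (t - s)\<^sup>2 + (D\<^sup>2 * H + 2 * D * H * CJ) * \<delta>\<^sup>2"
   by (intro order_trans[OF norm_triangle_ineq] add_mono C1(2) st \<Phi> X)
  also have "... = (C1 + D\<^sup>2 * H + 2 * D * H * CJ) * (t - s)\<^sup>2" unfolding \<delta>_def by (simp add: algebra_simps)
  finally show "norm ((LINT w|M. \<Phi> w * (iexp (\<eta> * Aint f s t w) * h (Z t w))) - (LINT w|M. \<Phi> w * h (Z s w))
    - of_real (t - s) * (LINT w|M. \<Phi> w * (\<i> * \<eta> * f (Z s w) * h (Z s w) + genc h (Z s w)))) <= (C1 + D\<^sup>2 * H + 2 * D * H * CJ) * (t - s)\<^sup>2" .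
 qed
qed

end

section \<open>Characteristic functions of additive functionals\<close>

context ctmc begin

text \<open>With the corrector g, and k for the second-order term, the perturbed exponential is a martingale up
to an error of third order in the frequency.\<close>

lemma char_estimate:
 fixes f g k :: "'s => real" and V :: real
 assumes g: "!!i. gen_adj Q g i = - f i" and k: "!!i. gen_adj Q k i = V / 2 - f i * g i"
 obtains K where "K >= 0" "!!\<eta> s T (\<Psi>::'a => complex). \<bar>\<eta>\<bar> <= 1 ==> 0 <= s ==> s <= T ==> \<Psi> \<in> borel_measurable (Ft s) ==>
   (!!w. w \<in> space M ==> norm (\<Psi> w) <= 1) ==>
   norm ((LINT w|M. \<Psi> w * iexp (\<eta> * Aint f s T w)) - of_real (exp (- (\<eta>\<^sup>2 * V / 2) * (T - s))) * (LINT w|M. \<Psi> w))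
    <= K * exp (\<eta>\<^sup>2 * \<bar>V\<bar> * (T - s)) * (\<bar>\<eta>\<bar> + \<bar>\<eta>\<bar>^3 * (T - s))"
proof -
 define Gk where "Gk = nmax g + nmax k"
 define K1 where "K1 = \<bar>V\<bar> / 2 * Gk + nmax f * nmax k"
 have Gk0: "Gk >= 0" "nmax f * nmax k >= 0" unfolding Gk_def using nmax(2) by (auto intro!: add_nonneg_nonneg mult_nonneg_nonneg)
 then have K10: "K1 >= 0" unfolding K1_def by simp
 show ?thesis
 proof (rule that)
  show "2 * Gk + K1 >= 0" using Gk0 K10 by simp
  fix \<eta> s T :: real and \<Psi> :: "'a => complex"
  assume \<eta>: "\<bar>\<eta>\<bar> <= 1" and sT: "0 <= s" "s <= T" and \<Psi>: "\<Psi> \<in> borel_measurable (Ft s)" "!!w. w \<in> space M ==> norm (\<Psi> w) <= 1"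
  define \<kappa> where "\<kappa> = \<eta>\<^sup>2 * V / 2"
  \<comment> \<open>The perturbed test function. In the Feynman-Kac generator the first-order terms
    cancel by the equation for \<open>g\<close>; the second-order terms leave the constant
    \<open>- \<eta>^2 V / 2\<close> by the equation for \<open>k\<close>, and
    \<open>\<kappa>\<close> compensates it.\<close>
  define h where "h i = 1 + \<i> * \<eta> * g i - of_real (\<eta>\<^sup>2 * k i)" for i
  have \<eta>2: "\<bar>\<eta>\<bar>\<^sup>2 <= \<bar>\<eta>\<bar>" "\<eta>\<^sup>2 = \<bar>\<eta>\<bar>\<^sup>2" using mult_right_mono[OF \<eta>, of "\<bar>\<eta>\<bar>"] by (simp_all add: power2_eq_square)
  have gk: "norm (\<i> * \<eta> * g i - of_real (\<eta>\<^sup>2 * k i)) <= \<bar>\<eta>\<bar> * Gk" for i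
  proof -
   have "norm (\<i> * \<eta> * g i - of_real (\<eta>\<^sup>2 * k i)) <= \<bar>\<eta>\<bar> * \<bar>g i\<bar> + \<bar>\<eta>\<bar>\<^sup>2 * \<bar>k i\<bar>"
   proof (rule order_trans[OF norm_triangle_ineq4], rule add_mono)
    show "norm (\<i> * \<eta> * g i) <= \<bar>\<eta>\<bar> * \<bar>g i\<bar>" by (simp add: norm_mult)
    show "norm (complex_of_real (\<eta>\<^sup>2 * k i)) <= \<bar>\<eta>\<bar>\<^sup>2 * \<bar>k i\<bar>" unfolding norm_of_real abs_mult by simp
   qed
   also have "... <= \<bar>\<eta>\<bar> * nmax g + \<bar>\<eta>\<bar> * nmax k"
    using nmax(1)[of g i] nmax(1)[of k i] \<eta>2(1) by (intro add_mono mult_mono) auto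
   finally show ?thesis unfolding Gk_def by (simp add: distrib_left)
  qed
  have gh: "genc h i = \<i> * \<eta> * (- f i) - of_real (\<eta>\<^sup>2 * (V / 2 - f i * g i))" for i
  proof -
   have "genc h i = of_real (\<Sum>j\<in>UNIV. Q$j$i) + \<i> * \<eta> * of_real (gen_adj Q g i) - of_real (\<eta>\<^sup>2) * of_real (gen_adj Q k i)"
    unfolding genc_def h_def gen_adj_def by (simp add: sum.distrib sum_subtractf algebra_simps sum_distrib_left)
   then show ?thesis unfolding g k generator_col_sum[OF gen] by (simp add: algebra_simps)
  qed
  have key: "norm (\<kappa> * h i + (\<i> * \<eta> * f i * h i + genc h i)) <= \<bar>\<eta>\<bar>^3 * K1" for i
  proof -
   have "\<kappa> * h i + (\<i> * \<eta> * f i * h i + genc h i) = \<kappa> * (\<i> * \<eta> * g i - of_real (\<eta>\<^sup>2 * k i)) - \<i> * of_real (\<eta>^3 * f i * k i)"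
    unfolding gh h_def \<kappa>_def by (simp add: algebra_simps power2_eq_square power3_eq_cube)
   also have "norm ... <= \<bar>\<kappa>\<bar> * (\<bar>\<eta>\<bar> * Gk) + \<bar>\<eta>\<bar>^3 * (nmax f * nmax k)"
   proof (rule order_trans[OF norm_triangle_ineq4], rule add_mono)
    show "norm (\<kappa> * (\<i> * \<eta> * g i - of_real (\<eta>\<^sup>2 * k i))) <= \<bar>\<kappa>\<bar> * (\<bar>\<eta>\<bar> * Gk)"
     unfolding norm_mult[of "of_real \<kappa>"] norm_of_real by (rule mult_left_mono[OF gk]) simp
    have "norm (\<i> * of_real (\<eta>^3 * f i * k i)) = \<bar>\<eta>\<bar>^3 * (\<bar>f i\<bar> * \<bar>k i\<bar>)"
     by (simp add: norm_mult abs_mult power_abs del: of_real_mult of_real_power)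
    also have "... <= \<bar>\<eta>\<bar>^3 * (nmax f * nmax k)"
     using nmax(1)[of f i] nmax(1)[of k i] nmax(2)[of f] by (intro mult_left_mono mult_mono) auto
    finally show "norm (\<i> * of_real (\<eta>^3 * f i * k i)) <= \<bar>\<eta>\<bar>^3 * (nmax f * nmax k)" .
   qed
   also have "... = \<bar>\<eta>\<bar>^3 * K1" unfolding \<kappa>_def K1_def by (simp add: abs_mult power2_eq_square power3_eq_cube algebra_simps)
   finally show ?thesis .
  qed
  \<comment> \<open>Here \<open>C\<close> may depend on \<open>\<eta>\<close>: it multiplies squares
    of the step only and vanishes in the telescoping sum.\<close>
  obtain C where C: "C >= 0" "!!s t (\<Phi>::'a => complex). 0 <= s ==> s <= t ==> t - s <= 1 ==> \<Phi> \<in> borel_measurable (Ft s) ==> (!!w. w \<in> space M ==> norm (\<Phi> w) <= 1)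
  ==> norm ((LINT w|M. \<Phi> w * (iexp (\<eta> * Aint f s t w) * h (Z t w))) - (LINT w|M. \<Phi> w * h (Z s w))
    - of_real (t - s) * (LINT w|M. \<Phi> w * (\<i> * \<eta> * f (Z s w) * h (Z s w) + genc h (Z s w)))) <= C * (t - s)\<^sup>2"
   using exponential_step[where \<eta> = \<eta> and f = f and h = h] by blast
  define \<Phi> where "\<Phi> t w = \<Psi> w * iexp (\<eta> * Aint f s t w)" for t w
  have \<Phi>F: "\<Phi> t \<in> borel_measurable (Ft t)" if "s <= t" for t
  proof -
   note [measurable] = Ft_measD[OF \<Psi>(1) that] Aint_Ft[OF sT(1) that, of f]
   show ?thesis unfolding \<Phi>_def by measurable
  qed
  have \<Phi>1: "norm (\<Phi> t w) <= 1" if "w \<in> space M" for t w unfolding \<Phi>_def norm_mult using \<Psi>(2)[OF that] by simp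
  define v where "v t = (LINT w|M. \<Phi> t w * (\<i> * \<eta> * f (Z t w) * h (Z t w) + genc h (Z t w)))" for t
  define u where "u t = (LINT w|M. \<Phi> t w * h (Z t w))" for t
  have mb: "(%w. \<Phi> t w * ww (Z t w)) \<in> borel_measurable M" "!!w. w \<in> space M ==> norm (\<Phi> t w * ww (Z t w)) <= nmax ww"
   if "s <= t" for t and ww :: "'s => complex"
  proof -
   have t0: "t >= 0" using that sT by simp
   note [measurable] = Ft_meas_M[OF \<Phi>F[OF that]] fZ_measM[OF t0, of ww]
   show "(%w. \<Phi> t w * ww (Z t w)) \<in> borel_measurable M" by measurable
   show "norm (\<Phi> t w * ww (Z t w)) <= nmax ww" if "w \<in> space M" for w
    using mult_mono'[OF \<Phi>1[OF that, of t] nmax(1)[of ww "Z t w"]] by (simp add: norm_mult)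
  qed
  have I: "integrable M (%w. \<Phi> t w * ww (Z t w))" if "s <= t" for t and ww :: "'s => complex"
   using mb[OF that] by (rule integrable_bounded)
  define H where "H = nmax h"
  define Vb where "Vb = nmax (%i. \<i> * \<eta> * f i * h i + genc h i)"
  have u: "norm (u t) <= H" and v: "norm (v t) <= Vb" if "s <= t" for t
   unfolding u_def v_def H_def Vb_def using mb(1)[OF that, of h] mb(2)[OF that, of _ h]
    mb(1)[OF that, of "%i. \<i> * \<eta> * f i * h i + genc h i"] mb(2)[OF that, of _ "%i. \<i> * \<eta> * f i * h i + genc h i"]
   by (auto intro!: norm_integral_le)
  have uv: "norm (\<kappa> * u t + v t) <= \<bar>\<eta>\<bar>^3 * K1" if "s <= t" for t
  proof -
   let ?w = "%i. \<kappa> * h i + (\<i> * \<eta> * f i * h i + genc h i)"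
   have "\<kappa> * u t + v t = (LINT w|M. \<Phi> t w * ?w (Z t w))"
   proof -
    have "(LINT w|M. \<Phi> t w * ?w (Z t w)) = (LINT w|M. of_real \<kappa> * (\<Phi> t w * h (Z t w)) + \<Phi> t w * (\<i> * \<eta> * f (Z t w) * h (Z t w) + genc h (Z t w)))"
     by (rule Bochner_Integration.integral_cong) (simp_all add: algebra_simps)
    also have "... = of_real \<kappa> * u t + v t" unfolding u_def v_def
     using I[OF that, of h] I[OF that, of "%i. \<i> * \<eta> * f i * h i + genc h i"]
     by (simp only: Bochner_Integration.integral_add integrable_mult_right integral_mult_right_zero)
    finally show ?thesis by simp
   qed
   also have "norm ... <= \<bar>\<eta>\<bar>^3 * K1"
   proof (rule norm_integral_le[OF mb(1)[OF that]])
    fix w assume "w \<in> space M"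
    then show "norm (\<Phi> t w * ?w (Z t w)) <= \<bar>\<eta>\<bar>^3 * K1"
     using mult_mono'[OF \<Phi>1[of w t] key[of "Z t w"]] by (simp only: norm_mult norm_ge_zero mult_1 if_True)
   qed
   finally show ?thesis .
  qed
  define E where "E = exp (\<bar>\<kappa>\<bar> * (T - s))"
  define C' where "C' = E * (\<kappa>\<^sup>2 * exp \<bar>\<kappa>\<bar> * H + \<bar>\<kappa>\<bar> * exp \<bar>\<kappa>\<bar> * Vb + exp \<bar>\<kappa>\<bar> * C)"
  have HV0: "H >= 0" "Vb >= 0" unfolding H_def Vb_def by (rule nmax)+
  have C'0: "C' >= 0" unfolding C'_def E_def using HV0 C(1) by simp
  \<comment> \<open>Formally the derivative of \<open>exp (\<kappa> * (t - s)) * u t\<close> is the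
    exponential times \<open>\<kappa> * u t + v t\<close>, which \<open>uv\<close> bounds to third
    order in \<open>\<eta>\<close>.\<close>
  have "norm (of_real (exp (\<kappa> * (T - s))) * u T - of_real (exp (\<kappa> * (s - s))) * u s) <= (E * (\<bar>\<eta>\<bar>^3 * K1)) * (T - s)"
  proof (rule telescope_bound[where C = C'])
   fix t t' assume t: "s <= t" "t <= t'" "t' <= T" "t' - t <= 1"
   define \<delta> where "\<delta> = t' - t"
   have \<delta>: "0 <= \<delta>" "\<delta> <= 1" "\<delta>\<^sup>2 = \<delta> * \<delta>" using t unfolding \<delta>_def by (auto simp: power2_eq_square)
   have t0: "0 <= t" using t sT by simp
   define R where "R = u t' - u t - of_real \<delta> * v t"
   have R: "norm R <= C * \<delta>\<^sup>2"
   proof -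
    have "u t' = (LINT w|M. \<Phi> t w * (iexp (\<eta> * Aint f t t' w) * h (Z t' w)))"
     unfolding u_def
    proof (rule Bochner_Integration.integral_cong)
     fix w assume "w \<in> space M"
     then have "Aint f s t' w = Aint f s t w + Aint f t t' w" by (rule Aint_add[OF _ sT(1) t(1,2)])
     then show "\<Phi> t' w * h (Z t' w) = \<Phi> t w * (iexp (\<eta> * Aint f t t' w) * h (Z t' w))"
      unfolding \<Phi>_def by (simp add: distrib_left exp_add)
    qed simp
    then show ?thesis using C(2)[OF t0 t(2,4) \<Phi>F[OF t(1)] \<Phi>1] unfolding R_def u_def[of t] v_def \<delta>_def by simp
   qed
   have e\<delta>: "exp (\<kappa> * (t' - s)) = exp (\<kappa> * (t - s)) * exp (\<kappa> * \<delta>)" unfolding \<delta>_def by (simp add: exp_add[symmetric] algebra_simps)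
   have eE: "exp (\<kappa> * (t - s)) <= E"
   proof -
    have "\<kappa> * (t - s) <= \<bar>\<kappa>\<bar> * (T - s)" using t by (intro mult_mono) auto
    then show ?thesis unfolding E_def by simp
   qed
   have ek: "exp \<bar>\<kappa> * \<delta>\<bar> <= exp \<bar>\<kappa>\<bar>" using \<delta> by (simp add: abs_mult mult_left_le)
   have b1: "\<bar>exp (\<kappa> * \<delta>) - 1 - \<kappa> * \<delta>\<bar> <= \<kappa>\<^sup>2 * exp \<bar>\<kappa>\<bar> * \<delta>\<^sup>2"
   proof -
    have "(\<kappa> * \<delta>)\<^sup>2 * exp \<bar>\<kappa> * \<delta>\<bar> <= (\<kappa> * \<delta>)\<^sup>2 * exp \<bar>\<kappa>\<bar>" using ek by (intro mult_left_mono) auto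
    then show ?thesis using exp_taylor_bounds(2)[of "\<kappa> * \<delta>"] by (simp add: power_mult_distrib mult_ac)
   qed
   have b2: "\<bar>exp (\<kappa> * \<delta>) - 1\<bar> <= \<bar>\<kappa>\<bar> * exp \<bar>\<kappa>\<bar> * \<delta>"
   proof -
    have "\<bar>\<kappa> * \<delta>\<bar> * exp \<bar>\<kappa> * \<delta>\<bar> <= \<bar>\<kappa> * \<delta>\<bar> * exp \<bar>\<kappa>\<bar>" using ek by (intro mult_left_mono) auto
    then show ?thesis using exp_taylor_bounds(1)[of "\<kappa> * \<delta>"] \<delta> by (simp add: abs_mult mult_ac)
   qed
   have b3: "exp (\<kappa> * \<delta>) <= exp \<bar>\<kappa>\<bar>" by (rule order_trans[OF _ ek]) simp
   have "of_real (exp (\<kappa> * (t' - s))) * u t' - of_real (exp (\<kappa> * (t - s))) * u t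
    = of_real (exp (\<kappa> * (t - s))) * (of_real \<delta> * (\<kappa> * u t + v t) + of_real (exp (\<kappa> * \<delta>) - 1 - \<kappa> * \<delta>) * u t
      + of_real ((exp (\<kappa> * \<delta>) - 1) * \<delta>) * v t + of_real (exp (\<kappa> * \<delta>)) * R)"
    unfolding e\<delta> R_def by (simp add: algebra_simps)
   also have "norm ... <= E * (\<delta> * (\<bar>\<eta>\<bar>^3 * K1) + \<kappa>\<^sup>2 * exp \<bar>\<kappa>\<bar> * \<delta>\<^sup>2 * H + \<bar>\<kappa>\<bar> * exp \<bar>\<kappa>\<bar> * \<delta> * \<delta> * Vb + exp \<bar>\<kappa>\<bar> * (C * \<delta>\<^sup>2))"
    unfolding norm_mult[of "of_real (exp (\<kappa> * (t - s)))"]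
   proof (rule mult_mono)
    show "norm (of_real \<delta> * (\<kappa> * u t + v t) + of_real (exp (\<kappa> * \<delta>) - 1 - \<kappa> * \<delta>) * u t
      + of_real ((exp (\<kappa> * \<delta>) - 1) * \<delta>) * v t + of_real (exp (\<kappa> * \<delta>)) * R)
     <= \<delta> * (\<bar>\<eta>\<bar>^3 * K1) + \<kappa>\<^sup>2 * exp \<bar>\<kappa>\<bar> * \<delta>\<^sup>2 * H + \<bar>\<kappa>\<bar> * exp \<bar>\<kappa>\<bar> * \<delta> * \<delta> * Vb + exp \<bar>\<kappa>\<bar> * (C * \<delta>\<^sup>2)"
    proof (intro norm_triangle_mono)
     show "norm (of_real \<delta> * (\<kappa> * u t + v t)) <= \<delta> * (\<bar>\<eta>\<bar>^3 * K1)"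
      using uv[OF t(1)] \<delta> unfolding norm_mult[of "of_real \<delta>"] norm_of_real by (intro mult_mono) auto
     show "norm (of_real (exp (\<kappa> * \<delta>) - 1 - \<kappa> * \<delta>) * u t) <= \<kappa>\<^sup>2 * exp \<bar>\<kappa>\<bar> * \<delta>\<^sup>2 * H"
      using b1 u[OF t(1)] HV0 unfolding norm_mult norm_of_real by (intro mult_mono) auto
     show "norm (of_real ((exp (\<kappa> * \<delta>) - 1) * \<delta>) * v t) <= \<bar>\<kappa>\<bar> * exp \<bar>\<kappa>\<bar> * \<delta> * \<delta> * Vb"
      using b2 v[OF t(1)] HV0 \<delta> unfolding norm_mult norm_of_real abs_mult[of _ \<delta>] by (intro mult_mono) auto
     show "norm (of_real (exp (\<kappa> * \<delta>)) * R) <= exp \<bar>\<kappa>\<bar> * (C * \<delta>\<^sup>2)"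
      using b3 R unfolding norm_mult norm_of_real by (intro mult_mono) auto
    qed
   qed (use eE in \<open>auto simp: E_def\<close>)
   also have "... = E * (\<bar>\<eta>\<bar>^3 * K1) * (t' - t) + C' * (t' - t)\<^sup>2"
    unfolding C'_def \<delta>_def[symmetric] \<delta>(3) by (simp add: algebra_simps)
   finally show "norm (of_real (exp (\<kappa> * (t' - s))) * u t' - of_real (exp (\<kappa> * (t - s))) * u t) <= E * (\<bar>\<eta>\<bar>^3 * K1) * (t' - t) + C' * (t' - t)\<^sup>2" .
  qed (use sT C'0 in auto)
  then have main: "norm (of_real (exp (\<kappa> * (T - s))) * u T - u s) <= E * (\<bar>\<eta>\<bar>^3 * K1) * (T - s)" by simp
  \<comment> \<open>Dropping the perturbation at either end of the interval costs a boundary term of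
    order \<open>\<bar>\<eta>\<bar>\<close>, without a factor for the length.\<close>
  have close: "norm ((LINT w|M. \<Phi> t w) - u t) <= \<bar>\<eta>\<bar> * Gk" if "s <= t" for t
  proof -
   have "(LINT w|M. \<Phi> t w) - u t = (LINT w|M. \<Phi> t w * 1) - u t" by simp
   also have "... = (LINT w|M. \<Phi> t w * (1 - h (Z t w)))" unfolding u_def
    by (subst Bochner_Integration.integral_diff[symmetric]) (use I[OF that, of "%_. 1"] I[OF that, of h] in \<open>auto simp: right_diff_distrib\<close>)
   also have "norm ... <= \<bar>\<eta>\<bar> * Gk"
   proof (rule norm_integral_le)
    show "(%w. \<Phi> t w * (1 - h (Z t w))) \<in> borel_measurable M" using mb(1)[OF that, of "%i. 1 - h i"] .
    fix w assume w: "w \<in> space M"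
    have "norm (1 - h (Z t w)) <= \<bar>\<eta>\<bar> * Gk" using gk[of "Z t w"] unfolding h_def by (subst norm_minus_commute) simp
    then show "norm (\<Phi> t w * (1 - h (Z t w))) <= \<bar>\<eta>\<bar> * Gk"
     using mult_mono'[OF \<Phi>1[OF w, of t], of "norm (1 - h (Z t w))"] by (simp add: norm_mult)
   qed
   finally show ?thesis .
  qed
  have "Aint f s s w = 0" for w unfolding Aint_def by simp
  then have \<Phi>s: "\<Phi> s = \<Psi>" unfolding \<Phi>_def by auto
  define L where "L = T - s"
  have L0: "L >= 0" using sT unfolding L_def by simp
  define e where "e = exp (- \<kappa> * L)"
  have eE: "e <= E" "e >= 0" "1 <= E" unfolding e_def E_def L_def[symmetric] using L0 mult_right_mono[of "-\<kappa>" "\<bar>\<kappa>\<bar>" L] by auto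
  have "(LINT w|M. \<Phi> T w) - of_real e * (LINT w|M. \<Psi> w)
   = ((LINT w|M. \<Phi> T w) - u T) + of_real e * (of_real (exp (\<kappa> * L)) * u T - u s) - of_real e * ((LINT w|M. \<Phi> s w) - u s)"
  proof -
   have "complex_of_real e * of_real (exp (\<kappa> * L)) = 1" unfolding e_def of_real_mult[symmetric] exp_add[symmetric] by simp
   then show ?thesis unfolding \<Phi>s by (simp add: right_diff_distrib mult.assoc[symmetric])
  qed
  also have "norm ... <= \<bar>\<eta>\<bar> * Gk + E * (E * (\<bar>\<eta>\<bar>^3 * K1) * L) + E * (\<bar>\<eta>\<bar> * Gk)"
  proof (rule order_trans[OF norm_triangle_ineq4], rule add_mono, rule norm_triangle_mono)
   show "norm ((LINT w|M. \<Phi> T w) - u T) <= \<bar>\<eta>\<bar> * Gk" by (rule close[OF sT(2)])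
   show "norm (of_real e * (of_real (exp (\<kappa> * L)) * u T - u s)) <= E * (E * (\<bar>\<eta>\<bar>^3 * K1) * L)"
    unfolding norm_mult[of "of_real e"] norm_of_real using main eE unfolding L_def by (intro mult_mono) auto
   show "norm (of_real e * ((LINT w|M. \<Phi> s w) - u s)) <= E * (\<bar>\<eta>\<bar> * Gk)"
    unfolding norm_mult norm_of_real using close[of s] eE by (intro mult_mono) auto
  qed
  also have "... <= (E * E) * (\<bar>\<eta>\<bar> * Gk) + (E * E) * (\<bar>\<eta>\<bar>^3 * K1 * L) + (E * E) * (\<bar>\<eta>\<bar> * Gk)"
  proof -
   have EE: "1 <= E * E" "E <= E * E" using eE mult_mono[of 1 E 1 E] mult_left_mono[of 1 E E] by auto
   have "1 * (\<bar>\<eta>\<bar> * Gk) <= (E * E) * (\<bar>\<eta>\<bar> * Gk)" "E * (\<bar>\<eta>\<bar> * Gk) <= (E * E) * (\<bar>\<eta>\<bar> * Gk)"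
    using EE Gk0 by (intro mult_right_mono; simp)+
   then show ?thesis by (simp add: mult_ac)
  qed
  also have "... <= (E * E) * ((2 * Gk + K1) * (\<bar>\<eta>\<bar> + \<bar>\<eta>\<bar>^3 * L))"
  proof -
   have "\<bar>\<eta>\<bar> * Gk + \<bar>\<eta>\<bar>^3 * K1 * L + \<bar>\<eta>\<bar> * Gk <= (2 * Gk + K1) * (\<bar>\<eta>\<bar> + \<bar>\<eta>\<bar>^3 * L)"
    using Gk0 K10 L0 by (simp add: algebra_simps)
   then have "(E * E) * (\<bar>\<eta>\<bar> * Gk + \<bar>\<eta>\<bar>^3 * K1 * L + \<bar>\<eta>\<bar> * Gk) <= (E * E) * ((2 * Gk + K1) * (\<bar>\<eta>\<bar> + \<bar>\<eta>\<bar>^3 * L))"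
    using eE by (intro mult_left_mono) auto
   then show ?thesis by (simp add: distrib_left)
  qed
  also have "E * E = exp (\<eta>\<^sup>2 * \<bar>V\<bar> * (T - s))" unfolding E_def \<kappa>_def exp_add[symmetric] by (simp add: abs_mult)
  finally show "norm ((LINT w|M. \<Psi> w * iexp (\<eta> * Aint f s T w)) - of_real (exp (- (\<eta>\<^sup>2 * V / 2) * (T - s))) * (LINT w|M. \<Psi> w))
    <= (2 * Gk + K1) * exp (\<eta>\<^sup>2 * \<bar>V\<bar> * (T - s)) * (\<bar>\<eta>\<bar> + \<bar>\<eta>\<bar>^3 * (T - s))"
   unfolding \<Phi>_def e_def \<kappa>_def L_def by (simp add: mult_ac)
 qed
qed

end

section \<open>Moments of additive functionals\<close>

context ctmc begin

text \<open>By the Poisson equation \<open>g (Z t)\<close> plus the integral of \<open>f\<close> is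
  a martingale: over a short step the drift of \<open>g\<close> and the increment of the integral
  cancel up to a quadratic error, and \<open>telescope_bound\<close> applies with rate 0.\<close>

lemma mart_step:
 fixes f g :: "'s => real"
 assumes g: "!!i. gen_adj Q g i = - f i"
  and st: "0 <= s" "s <= t" and \<Psi>: "\<Psi> \<in> borel_measurable (Ft s)" "!!w. w \<in> space M ==> \<bar>\<Psi> w\<bar> <= B"
 shows "(LINT w|M. \<Psi> w * (g (Z t w) - g (Z s w) + Aint f s t w)) = 0"
proof -
 obtain C1 where C1: "C1 >= 0" "!!s t (\<Phi>::'a => complex). 0 <= s ==> s <= t ==> t - s <= 1 ==> \<Phi> \<in> borel_measurable (Ft s) ==> (!!w. w \<in> space M ==> norm (\<Phi> w) <= 1)
  ==> norm ((LINT w|M. \<Phi> w * of_real (g (Z t w))) - (LINT w|M. \<Phi> w * of_real (g (Z s w))) - of_real (t - s) * (LINT w|M. \<Phi> w * genc (%i. of_real (g i)) (Z s w))) <= C1 * (t - s)\<^sup>2"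
  using generator_step[of "%i. of_real (g i)"] by blast
 obtain CJ where CJ: "CJ >= 0" "!!u v. 0 <= u ==> u <= v ==> v - u <= 1 ==>
   \<exists>J\<in>sets M. measure M J <= CJ * (v - u) \<and> (\<forall>w\<in>space M - J. \<forall>r\<in>{u..v}. Z r w = Z u w)"
  using no_jump_event by blast
 have gc: "genc (%i. of_real (g i)) i = of_real (- f i)" for i
  unfolding genc_def g[symmetric] gen_adj_def by simp
 \<comment> \<open>Normalises the weight to modulus at most 1; the maximum guards against a bound
   \<open>B\<close> that is not positive.\<close>
 define B' where "B' = max B 1"
 define \<Phi> where "\<Phi> w = \<Psi> w / B'" for w
 have B': "B' > 0" "B <= B'" unfolding B'_def by auto
 have \<Phi>: "\<Phi> \<in> borel_measurable (Ft s)" unfolding \<Phi>_def using \<Psi>(1) by measurable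
 have \<Phi>1: "\<bar>\<Phi> w\<bar> <= 1" if "w \<in> space M" for w unfolding \<Phi>_def using \<Psi>(2)[OF that] B' by simp
 define D where "D = nmax f"
 have D: "\<bar>f i\<bar> <= D" "D >= 0" for i unfolding D_def using nmax(1)[of f i] nmax(2)[of f] by auto
 define ww where "ww r = (LINT w|M. \<Phi> w * (g (Z r w) - g (Z s w) + Aint f s r w))" for r
 have I1: "integrable M (%w. \<Phi> w * u (Z r w))" if "0 <= r" for u :: "'s => real" and r
 proof (rule integrable_bounded)
  note [measurable] = fZ_measM[OF that, of u] Ft_meas_M[OF \<Phi>]
  show "(%w. \<Phi> w * u (Z r w)) \<in> borel_measurable M" by measurable
  show "norm (\<Phi> w * u (Z r w)) <= 1 * nmax u" if "w \<in> space M" for w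
   unfolding norm_mult using \<Phi>1[OF that] nmax(1)[of u] by (intro mult_mono') auto
 qed
 have I2: "integrable M (%w. \<Phi> w * Aint f a b w)" if "0 <= a" "a <= b" for a b
 proof (rule integrable_bounded)
  note [measurable] = AintM[OF that, of f] Ft_meas_M[OF \<Phi>]
  show "(%w. \<Phi> w * Aint f a b w) \<in> borel_measurable M" by measurable
  show "norm (\<Phi> w * Aint f a b w) <= 1 * (nmax f * (b - a))" if "w \<in> space M" for w
   unfolding norm_mult using \<Phi>1[OF that] Aint_nmax[OF that \<open>0 <= a\<close> \<open>a <= b\<close>, of f] by (intro mult_mono') auto
 qed
 have "norm (ww t - ww s) <= 0 * (t - s)"
 proof (rule telescope_bound[OF st(2), where C = "C1 + 2 * D * CJ"])
  show "C1 + 2 * D * CJ >= 0" using C1 CJ D by simp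
  fix r r' assume r: "s <= r" "r <= r'" "r' <= t" "r' - r <= 1"
  define \<delta> where "\<delta> = r' - r"
  have \<delta>: "\<delta> >= 0" using r unfolding \<delta>_def by simp
  have r0: "0 <= r" "0 <= r'" "s <= r'" using r st by auto
  note [measurable] = fZ_measM[OF r0(1), of f] Ft_meas_M[OF \<Phi>] AintM[OF r0(1) r(2), of f]
  obtain J where J: "J \<in> sets M" "measure M J <= CJ * \<delta>" "!!w x. w \<in> space M - J ==> x \<in> {r..r'} ==> Z x w = Z r w"
   using CJ(2)[OF r0(1) r(2,4)] unfolding \<delta>_def by blast
  let ?a = "LINT w|M. \<Phi> w * g (Z r' w)" and ?b = "LINT w|M. \<Phi> w * g (Z r w)"
  let ?c = "LINT w|M. \<Phi> w * f (Z r w)" and ?d = "LINT w|M. \<Phi> w * Aint f r r' w"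
  have G: "\<bar>?a - ?b + \<delta> * ?c\<bar> <= C1 * \<delta>\<^sup>2"
  proof -
   have "norm ((LINT w|M. of_real (\<Phi> w) * of_real (g (Z r' w))) - (LINT w|M. of_real (\<Phi> w) * of_real (g (Z r w)))
     - of_real (r' - r) * (LINT w|M. of_real (\<Phi> w) * genc (%i. of_real (g i)) (Z r w))) <= C1 * (r' - r)\<^sup>2"
   proof (rule C1(2)[OF r0(1) r(2) r(4)])
    show "(%w. complex_of_real (\<Phi> w)) \<in> borel_measurable (Ft r)" using Ft_measD[OF \<Phi> r(1)] by measurable
   qed (use \<Phi>1 in auto)
   also have "(LINT w|M. of_real (\<Phi> w) * of_real (g (Z r' w))) - (LINT w|M. of_real (\<Phi> w) * of_real (g (Z r w)))
     - of_real (r' - r) * (LINT w|M. of_real (\<Phi> w) * genc (%i. of_real (g i)) (Z r w)) = complex_of_real (?a - ?b + \<delta> * ?c)"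
    unfolding gc of_real_mult[symmetric] integral_complex_of_real \<delta>_def by simp
   finally show ?thesis unfolding norm_of_real \<delta>_def .
  qed
  have F: "\<bar>?d - \<delta> * ?c\<bar> <= 2 * D * \<delta> * (CJ * \<delta>)"
  proof -
   have "?d - \<delta> * ?c = (LINT w|M. \<Phi> w * Aint f r r' w - \<delta> * (\<Phi> w * f (Z r w)))"
    using I2[OF r0(1) r(2)] I1[OF r0(1), of f] by simp
   also have "norm ... <= 0 + 2 * D * \<delta> * measure M J"
   proof (rule norm_integral_bounded[OF _ J(1)])
    show "0 <= 2 * D * \<delta>" using D \<delta> by simp
    fix w
    show "norm (\<Phi> w * Aint f r r' w - \<delta> * (\<Phi> w * f (Z r w))) <= 0" if "w \<in> space M - J"
    proof -
     have "Aint f r r' w = f (Z r w) * \<delta>" unfolding \<delta>_def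
      by (rule Aint_const[OF r(2)]) (use J(3)[OF that] in blast)
     then show ?thesis by simp
    qed
    show "norm (\<Phi> w * Aint f r r' w - \<delta> * (\<Phi> w * f (Z r w))) <= 0 + 2 * D * \<delta>" if "w \<in> J"
    proof -
     have w: "w \<in> space M" using that sets.sets_into_space[OF J(1)] by auto
     have "\<Phi> w * Aint f r r' w - \<delta> * (\<Phi> w * f (Z r w)) = \<Phi> w * (Aint f r r' w - \<delta> * f (Z r w))" by (simp add: algebra_simps)
     also have "norm ... <= 1 * (D * \<delta> + \<delta> * D)" unfolding norm_mult
     proof (rule mult_mono')
      show "norm (\<Phi> w) <= 1" using \<Phi>1[OF w] by simp
      have "\<bar>\<delta> * f (Z r w)\<bar> <= \<delta> * D" using D(1)[of "Z r w"] \<delta> by (simp add: abs_mult mult_left_mono)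
      then show "norm (Aint f r r' w - \<delta> * f (Z r w)) <= D * \<delta> + \<delta> * D"
       using Aint_nmax[OF w r0(1) r(2), of f] unfolding D_def[symmetric] \<delta>_def[symmetric] real_norm_def by linarith
     qed auto
     finally show ?thesis by simp
    qed
   qed measurable
   also have "... <= 0 + 2 * D * \<delta> * (CJ * \<delta>)" using J(2) D \<delta> by (intro add_mono mult_left_mono) auto
   finally show ?thesis by simp
  qed
  have wr: "ww x = (LINT w|M. \<Phi> w * g (Z x w)) - (LINT w|M. \<Phi> w * g (Z s w)) + (LINT w|M. \<Phi> w * Aint f s x w)" if "s <= x" for x
   unfolding ww_def distrib_left right_diff_distrib using I1[of x g] I1[of s g] I2[of s x] that st by simp
  have "(LINT w|M. \<Phi> w * Aint f s r' w) = (LINT w|M. \<Phi> w * Aint f s r w + \<Phi> w * Aint f r r' w)"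
   by (rule Bochner_Integration.integral_cong) (use Aint_add[OF _ st(1) r(1,2), of _ f] in \<open>auto simp: distrib_left\<close>)
  also have "... = (LINT w|M. \<Phi> w * Aint f s r w) + ?d"
   by (rule Bochner_Integration.integral_add) (use I2 st r r0 in auto)
  finally have "ww r' - ww r = (?a - ?b + \<delta> * ?c) + (?d - \<delta> * ?c)" using wr[OF r(1)] wr[OF r0(3)] by simp
  then have "\<bar>ww r' - ww r\<bar> <= C1 * \<delta>\<^sup>2 + 2 * D * \<delta> * (CJ * \<delta>)" using G F by linarith
  then show "norm (ww r' - ww r) <= 0 * (r' - r) + (C1 + 2 * D * CJ) * (r' - r)\<^sup>2"
   unfolding \<delta>_def by (simp add: power2_eq_square algebra_simps)
 qed
 moreover have "ww s = 0" unfolding ww_def Aint_def by simp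
 ultimately have "ww t = 0" by simp
 moreover have "(LINT w|M. \<Psi> w * (g (Z t w) - g (Z s w) + Aint f s t w)) = B' * ww t"
  unfolding ww_def integral_mult_right_zero[symmetric] \<Phi>_def using B' by (intro Bochner_Integration.integral_cong) auto
 ultimately show ?thesis by simp
qed

text \<open>Terms linear in the last increment drop out by the martingale property. In the fourth
  power the term \<open>4 a b^3\<close> is absorbed by \<open>2 (a^2 + b^2) b^2\<close>. The
  recursion then asks for a constant \<open>c\<close> with
  \<open>c N^2 + 8 N + 3 <= c (N + 1)^2\<close>, and \<open>c = 7\<close> satisfies it.\<close>

lemma mart_moments:
 fixes X :: "nat => 'a => real" and u :: "nat => real"
 assumes u: "mono u" and X: "!!j. X j \<in> borel_measurable (Ft (u (Suc j)))"
  and K: "!!j w. w \<in> space M ==> \<bar>X j w\<bar> <= K"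
  and zero: "!!j \<Psi> B. \<Psi> \<in> borel_measurable (Ft (u j)) ==> (!!w. w \<in> space M ==> \<bar>\<Psi> w\<bar> <= B) ==> (LINT w|M. \<Psi> w * X j w) = 0"
 shows "(LINT w|M. (\<Sum>j<N. X j w)\<^sup>2) <= real N * K\<^sup>2" "(LINT w|M. (\<Sum>j<N. X j w)^4) <= 7 * (real N)\<^sup>2 * K^4"
proof -
 define S where "S N w = (\<Sum>j<N. X j w)" for N w
 have SF: "S N \<in> borel_measurable (Ft (u N))" for N
  unfolding S_def by (intro borel_measurable_sum Ft_measD[OF X] monoD[OF u]) auto
 have Sb: "\<bar>S N w\<bar> <= real N * K" if "w \<in> space M" for N w
 proof -
  have "\<bar>S N w\<bar> <= (\<Sum>j<N. K)" unfolding S_def by (intro order_trans[OF sum_abs] sum_mono K that)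
  then show ?thesis by simp
 qed
 have pb: "\<bar>S N w ^ p\<bar> <= (real N * K) ^ p" if "w \<in> space M" for N p w
  unfolding power_abs by (rule power_mono[OF Sb[OF that]]) simp
 have I: "integrable M (%w. S N w ^ p * X N w ^ q)" for N p q
 proof (rule integrable_bounded)
  note [measurable] = Ft_meas_M[OF SF] Ft_meas_M[OF X]
  show "(%w. S N w ^ p * X N w ^ q) \<in> borel_measurable M" by measurable
  show "norm (S N w ^ p * X N w ^ q) <= (real N * K) ^ p * K ^ q" if "w \<in> space M" for w
   unfolding norm_mult using pb[OF that, of N p] power_mono[OF K[OF that, of N] abs_ge_zero, of q]
   by (intro mult_mono') (auto simp: power_abs)
 qed
 have Z0: "(LINT w|M. S N w ^ p * X N w) = 0" for N p
  by (rule zero[of _ _ "(real N * K) ^ p"]) (use SF pb in auto)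
 have X2: "X N w ^ 2 <= K\<^sup>2" if "w \<in> space M" for N w using K[OF that, of N] by (simp add: abs_le_square_iff[symmetric])
 have I1: "integrable M (%w. S N w ^ p)" for N p using I[of N p 0] by simp
 have m2: "(LINT w|M. (S N w)\<^sup>2) <= real N * K\<^sup>2" for N
 proof (induction N)
  case 0 show ?case by (simp add: S_def)
 next
  case (Suc N)
  have "(LINT w|M. (S (Suc N) w)\<^sup>2) = (LINT w|M. S N w ^ 2 + 2 * (S N w ^ 1 * X N w ^ 1) + S N w ^ 0 * X N w ^ 2)"
   by (rule Bochner_Integration.integral_cong) (simp_all add: S_def power2_eq_square algebra_simps)
  also have "... = (LINT w|M. S N w ^ 2) + 2 * (LINT w|M. S N w ^ 1 * X N w ^ 1) + (LINT w|M. S N w ^ 0 * X N w ^ 2)"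
   using I[of N 1 1] I[of N 0 2] I1[of N 2]
   by (simp only: Bochner_Integration.integral_add Bochner_Integration.integrable_add integrable_mult_right integral_mult_right_zero)
  also have "... <= real N * K\<^sup>2 + 0 + K\<^sup>2"
  proof (intro add_mono Suc.IH)
   show "2 * (LINT w|M. S N w ^ 1 * X N w ^ 1) <= 0" using Z0[of N 1] by simp
   have "(LINT w|M. S N w ^ 0 * X N w ^ 2) <= (LINT w|M. K\<^sup>2)" using X2 by (intro integral_mono I) auto
   then show "(LINT w|M. S N w ^ 0 * X N w ^ 2) <= K\<^sup>2" by (simp add: prob_space)
  qed
  finally show ?case by (simp add: algebra_simps)
 qed
 then show "(LINT w|M. (\<Sum>j<N. X j w)\<^sup>2) <= real N * K\<^sup>2" unfolding S_def by simp
 have m4: "(LINT w|M. (S N w)^4) <= 7 * (real N)\<^sup>2 * K^4" for N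
 proof (induction N)
  case 0 show ?case by (simp add: S_def)
 next
  case (Suc N)
  have "(LINT w|M. (S (Suc N) w)^4) <= (LINT w|M. S N w ^ 4 + 4 * (S N w ^ 3 * X N w ^ 1) + 8 * K\<^sup>2 * (S N w ^ 2) + 3 * K^4)"
  proof (rule integral_mono)
   fix w assume w: "w \<in> space M"
   define a b where "a = S N w" and "b = X N w"
   have b2: "b\<^sup>2 <= K\<^sup>2" using X2[OF w, of N] unfolding b_def .
   have e: "S (Suc N) w = a + b" unfolding a_def b_def S_def by simp
   have "(a + b)^4 = a^4 + 4 * (a^3 * b) + 6 * (a\<^sup>2 * b\<^sup>2) + 2 * ((2 * a * b) * b\<^sup>2) + b\<^sup>2 * b\<^sup>2"
    by (simp add: power4_eq_xxxx power3_eq_cube power2_eq_square algebra_simps)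
   also have "2 * ((2 * a * b) * b\<^sup>2) <= 2 * ((a\<^sup>2 + b\<^sup>2) * b\<^sup>2)"
    using sum_squares_bound[of a b] by (intro mult_left_mono mult_right_mono) auto
   also have "a^4 + 4 * (a^3 * b) + 6 * (a\<^sup>2 * b\<^sup>2) + 2 * ((a\<^sup>2 + b\<^sup>2) * b\<^sup>2) + b\<^sup>2 * b\<^sup>2 = a^4 + 4 * (a^3 * b) + 8 * (a\<^sup>2 * b\<^sup>2) + 3 * (b\<^sup>2 * b\<^sup>2)"
    by (simp add: algebra_simps)
   also have "... <= a^4 + 4 * (a^3 * b) + 8 * (a\<^sup>2 * K\<^sup>2) + 3 * (K\<^sup>2 * K\<^sup>2)"
    using b2 by (intro order_refl add_mono mult_left_mono mult_mono) auto
   finally show "S (Suc N) w ^ 4 <= S N w ^ 4 + 4 * (S N w ^ 3 * X N w ^ 1) + 8 * K\<^sup>2 * (S N w ^ 2) + 3 * K^4"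
    unfolding e a_def b_def by (simp add: power4_eq_xxxx power2_eq_square algebra_simps)
  qed (intro Bochner_Integration.integrable_add integrable_mult_right I I1 integrable_const)+
  also have "... = (LINT w|M. S N w ^ 4) + 4 * (LINT w|M. S N w ^ 3 * X N w ^ 1) + 8 * K\<^sup>2 * (LINT w|M. S N w ^ 2) + 3 * K^4"
   using I[of N 3 1] I1[of N 2] I1[of N 4]
   by (simp only: Bochner_Integration.integral_add Bochner_Integration.integrable_add integrable_mult_right integral_mult_right_zero integrable_const lebesgue_integral_const prob_space scaleR_one)
  also have "... <= 7 * (real N)\<^sup>2 * K^4 + 0 + 8 * K\<^sup>2 * (real N * K\<^sup>2) + 3 * K^4"
   using Z0[of N 3] by (intro add_mono mult_left_mono m2 Suc.IH) auto
  also have "... <= 7 * (real (Suc N))\<^sup>2 * K^4"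
  proof -
   have "7 * (real N)\<^sup>2 + 8 * real N + 3 <= 7 * (real (Suc N))\<^sup>2" by (simp add: power2_eq_square algebra_simps)
   then have "(7 * (real N)\<^sup>2 + 8 * real N + 3) * K^4 <= 7 * (real (Suc N))\<^sup>2 * K^4" by (rule mult_right_mono) simp
   then show ?thesis by (simp add: power4_eq_xxxx power2_eq_square algebra_simps)
  qed
  finally show ?case .
 qed
 then show "(LINT w|M. (\<Sum>j<N. X j w)^4) <= 7 * (real N)\<^sup>2 * K^4" unfolding S_def by simp
qed

text \<open>Intervals of length at most 1 are trivial because \<open>f\<close> is bounded. Longer
  ones are cut into pieces of length at most 1; by \<open>mart_step\<close> the functional is a sum
  of bounded martingale increments up to the boundary term
  \<open>g (Z s w) - g (Z t w)\<close>.\<close>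

lemma additive_moments:
 fixes f g :: "'s => real"
 assumes g: "!!i. gen_adj Q g i = - f i"
 obtains C where "C >= 0" "!!s t. 0 <= s ==> s <= t ==> (LINT w|M. (Aint f s t w)^4) <= C * (t - s)\<^sup>2"
  "!!s t. 0 <= s ==> s <= t ==> (LINT w|M. (Aint f s t w)\<^sup>2) <= C * (t - s)"
proof -
 define D where "D = nmax f"
 define Gm where "Gm = nmax g"
 have D: "\<bar>f i\<bar> <= D" "D >= 0" for i unfolding D_def using nmax(1)[of f i] nmax(2)[of f] by auto
 have Gm: "\<bar>g i\<bar> <= Gm" "Gm >= 0" for i unfolding Gm_def using nmax(1)[of g i] nmax(2)[of g] by auto
 define K where "K = 2 * Gm + D"
 have K0: "K >= 0" unfolding K_def using D Gm by simp
 \<comment> \<open>28 is the 7 of \<open>mart_moments\<close> times the 4 from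
   \<open>N <= 2 (t - s)\<close>, 16 comes from \<open>(2 * Gm)^4\<close>, and 8 from the fourth
   power of a sum of two terms.\<close>
 define C where "C = D^4 + 8 * (28 * K^4 + 16 * Gm^4)"
 have C0: "C >= 0" unfolding C_def using D Gm K0 by simp
 have intA: "integrable M (%w. (Aint f s t w)^p)" if "0 <= s" "s <= t" for s t p
 proof (rule integrable_bounded)
  note [measurable] = AintM[OF that, of f]
  show "(%w. (Aint f s t w)^p) \<in> borel_measurable M" by measurable
  show "norm ((Aint f s t w)^p) <= (D * (t - s))^p" if "w \<in> space M" for w
   using power_mono[OF Aint_nmax[OF that \<open>0 <= s\<close> \<open>s <= t\<close>, of f] abs_ge_zero, of p] unfolding D_def by (simp add: power_abs)
 qed
 have four: "(LINT w|M. (Aint f s t w)^4) <= C * (t - s)\<^sup>2" if st: "0 <= s" "s <= t" for s t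
 proof (cases "t - s <= 1")
  case True
  have "(LINT w|M. (Aint f s t w)^4) <= (LINT w|M. (D * (t - s))^4)"
  proof (intro integral_mono intA st)
   fix w assume "w \<in> space M"
   from power_mono[OF Aint_nmax[OF this st, of f] abs_ge_zero, of 4]
   show "(Aint f s t w)^4 <= (D * (t - s))^4" unfolding D_def by (simp add: power_even_abs)
  qed simp
  also have "... = D^4 * (t - s)^4" by (simp add: prob_space power_mult_distrib)
  also have "... <= D^4 * (t - s)\<^sup>2" using True st by (intro mult_left_mono power_decreasing) auto
  also have "... <= C * (t - s)\<^sup>2" unfolding C_def using K0 Gm by (intro mult_right_mono) auto
  finally show ?thesis .
 next
  case False
  define N where "N = nat \<lceil>t - s\<rceil>"
  have N: "real N >= t - s" "real N < t - s + 1" "N > 0" unfolding N_def using False by linarith+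
  define h where "h = (t - s) / real N"
  have h: "h >= 0" "h <= 1" "real N * h = t - s" unfolding h_def using N st by auto
  define u where "u j = s + real j * h" for j
  have um: "mono u" unfolding u_def using h by (intro monoI add_left_mono mult_right_mono) auto
  have u0: "0 <= u j" for j unfolding u_def using st h by simp
  have uS: "u j <= u (Suc j)" "u (Suc j) - u j = h" for j using h(1) unfolding u_def by (simp_all add: algebra_simps)
  have uN: "u 0 = s" "u N = t" unfolding u_def using h by auto
  define X where "X j w = g (Z (u (Suc j)) w) - g (Z (u j) w) + Aint f (u j) (u (Suc j)) w" for j w
  have mm: "(LINT w|M. (\<Sum>j<N. X j w)^4) <= 7 * (real N)\<^sup>2 * K^4"
  proof (rule mart_moments(2)[OF um])
   fix j
   note [measurable] = fZ_meas[OF u0 order_refl, of g "Suc j"] fZ_meas[OF u0 uS(1), of g j] Aint_Ft[OF u0 uS(1), of f j]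
   show "X j \<in> borel_measurable (Ft (u (Suc j)))" unfolding X_def by measurable
   show "\<bar>X j w\<bar> <= K" if "w \<in> space M" for w
   proof -
    have "\<bar>Aint f (u j) (u (Suc j)) w\<bar> <= D * h" using Aint_nmax[OF that u0 uS(1), of f j] unfolding D_def uS(2) .
    also have "... <= D" using h D by (simp add: mult_left_le)
    finally show ?thesis unfolding X_def K_def using Gm(1)[of "Z (u (Suc j)) w"] Gm(1)[of "Z (u j) w"] by linarith
   qed
   show "(LINT w|M. \<Psi> w * X j w) = 0" if "\<Psi> \<in> borel_measurable (Ft (u j))" "!!w. w \<in> space M ==> \<bar>\<Psi> w\<bar> <= B" for \<Psi> B
    unfolding X_def by (rule mart_step[OF g u0 uS(1) that])
  qed
  have sX: "(\<Sum>j<n. X j w) = g (Z (u n) w) - g (Z s w) + Aint f s (u n) w" if "w \<in> space M" for w n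
  proof (induction n)
   case 0 show ?case by (simp add: uN Aint_def)
  next
   case (Suc n)
   have "s <= u n" unfolding u_def using h by simp
   from Aint_add[OF that st(1) this uS(1), of f] show ?case using Suc by (simp add: X_def)
  qed
  have p4: "(x + y)^4 <= 8 * (x^4 + y^4)" for x y :: real
  proof -
   have "(x+y)\<^sup>2 <= 2 * (x\<^sup>2 + y\<^sup>2)" using sum_squares_bound[of x y] by (simp add: power2_sum)
   then have "((x+y)\<^sup>2)\<^sup>2 <= (2 * (x\<^sup>2 + y\<^sup>2))\<^sup>2" by (intro power_mono) auto
   also have "... <= 4 * (2 * ((x\<^sup>2)\<^sup>2 + (y\<^sup>2)\<^sup>2))" using sum_squares_bound[of "x\<^sup>2" "y\<^sup>2"] by (simp add: power_mult_distrib power2_sum)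
   finally show ?thesis by simp
  qed
  have SI: "integrable M (%w. (\<Sum>j<N. X j w)^4)"
  proof (rule integrable_bounded)
   have t0: "0 <= t" using st by simp
   note [measurable] = fZ_measM[OF t0, of g] fZ_measM[OF st(1), of g] AintM[OF st, of f]
   have "(%w. (g (Z t w) - g (Z s w) + Aint f s t w)^4) \<in> borel_measurable M" by measurable
   then show "(%w. (\<Sum>j<N. X j w)^4) \<in> borel_measurable M"
    by (rule measurable_cong[THEN iffD1, rotated]) (simp add: sX uN)
   show "norm ((\<Sum>j<N. X j w)^4) <= (2 * Gm + D * (t - s))^4" if "w \<in> space M" for w
   proof -
    have "\<bar>\<Sum>j<N. X j w\<bar> <= 2 * Gm + D * (t - s)"
     unfolding sX[OF that] uN using Aint_nmax[OF that st, of f] Gm(1)[of "Z t w"] Gm(1)[of "Z s w"] unfolding D_def by linarith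
    from power_mono[OF this, of 4] show ?thesis by (simp add: power_even_abs)
   qed
  qed
  have "(LINT w|M. (Aint f s t w)^4) <= (LINT w|M. 8 * ((\<Sum>j<N. X j w)^4 + (2 * Gm)^4))"
  proof (rule integral_mono[OF intA[OF st]])
   show "integrable M (%w. 8 * ((\<Sum>j<N. X j w)^4 + (2 * Gm)^4))" using SI by simp
   fix w assume w: "w \<in> space M"
   have "Aint f s t w = (\<Sum>j<N. X j w) + (g (Z s w) - g (Z t w))" using sX[OF w, of N] uN by simp
   then have "(Aint f s t w)^4 <= 8 * ((\<Sum>j<N. X j w)^4 + (g (Z s w) - g (Z t w))^4)" using p4 by metis
   moreover have "\<bar>g (Z s w) - g (Z t w)\<bar> <= 2 * Gm" using Gm(1)[of "Z t w"] Gm(1)[of "Z s w"] by linarith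
   from power_mono[OF this, of 4] have "(g (Z s w) - g (Z t w))^4 <= (2 * Gm)^4" by (simp add: power_even_abs)
   then have "8 * ((\<Sum>j<N. X j w)^4 + (g (Z s w) - g (Z t w))^4) <= 8 * ((\<Sum>j<N. X j w)^4 + (2 * Gm)^4)"
    by (intro mult_left_mono add_left_mono) auto
   ultimately show "(Aint f s t w)^4 <= 8 * ((\<Sum>j<N. X j w)^4 + (2 * Gm)^4)" by (rule order_trans)
  qed
  also have "... = 8 * ((LINT w|M. (\<Sum>j<N. X j w)^4) + 16 * Gm^4)" using SI by (simp add: prob_space power_mult_distrib)
  also have "... <= 8 * (7 * (real N)\<^sup>2 * K^4 + 16 * Gm^4)" by (intro mult_left_mono add_right_mono mm) auto
  also have "... <= 8 * (28 * K^4 * (t - s)\<^sup>2 + 16 * Gm^4 * (t - s)\<^sup>2)"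
  proof -
   have "real N <= 2 * (t - s)" using N(2) False by simp
   then have "(real N)\<^sup>2 <= (2 * (t - s))\<^sup>2" by (intro power_mono) auto
   then have "(real N)\<^sup>2 <= 4 * (t - s)\<^sup>2" unfolding power_mult_distrib by simp
   then have "(7 * K^4) * (real N)\<^sup>2 <= (7 * K^4) * (4 * (t - s)\<^sup>2)" by (rule mult_left_mono) simp
   then have "7 * (real N)\<^sup>2 * K^4 <= 28 * K^4 * (t - s)\<^sup>2" by (simp only: mult_ac)
   note a = this
   have "1 <= (t - s)\<^sup>2" using False by simp
   then have "16 * Gm^4 * 1 <= 16 * Gm^4 * (t - s)\<^sup>2" by (intro mult_left_mono) auto
   then have b: "16 * Gm^4 <= 16 * Gm^4 * (t - s)\<^sup>2" by simp
   show ?thesis by (intro mult_left_mono add_mono a b) simp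
  qed
  also have "... <= C * (t - s)\<^sup>2" unfolding C_def using D by (simp add: algebra_simps)
  finally show ?thesis .
 qed
 have two: "(LINT w|M. (Aint f s t w)\<^sup>2) <= (C + 1) * (t - s)" if st: "0 <= s" "s <= t" for s t
 proof (cases "s = t")
  case True then show ?thesis by (simp add: Aint_def)
 next
  case False
  define L where "L = t - s"
  have L: "L > 0" using False st unfolding L_def by simp
  \<comment> \<open>The second moment is deduced from the fourth through
    \<open>2 x^2 L <= x^4 + L^2\<close>.\<close>
  have "(LINT w|M. (Aint f s t w)\<^sup>2) <= (LINT w|M. L / 2 + (Aint f s t w)^4 / (2 * L))"
  proof (rule integral_mono[OF intA[OF st]])
   show "integrable M (%w. L / 2 + (Aint f s t w)^4 / (2 * L))" using intA[OF st, of 4] by simp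
   fix w
   have "2 * (Aint f s t w)\<^sup>2 * L <= ((Aint f s t w)\<^sup>2)\<^sup>2 + L\<^sup>2" by (rule sum_squares_bound)
   then show "(Aint f s t w)\<^sup>2 <= L / 2 + (Aint f s t w)^4 / (2 * L)" using L by (simp add: field_simps power2_eq_square power4_eq_xxxx)
  qed
  also have "... = L / 2 + (LINT w|M. (Aint f s t w)^4) / (2 * L)" using intA[OF st, of 4] by (simp add: prob_space)
  also have "... <= L / 2 + C * L\<^sup>2 / (2 * L)" using four[OF st] L unfolding L_def[symmetric] by (intro add_mono divide_right_mono) auto
  also have "... <= (C + 1) * L" using L C0 by (simp add: field_simps power2_eq_square)
  finally show ?thesis unfolding L_def .
 qed
 show ?thesis
 proof (rule that[of "C + 1"])
  show "(LINT w|M. (Aint f s t w)^4) <= (C + 1) * (t - s)\<^sup>2" if "0 <= s" "s <= t" for s t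
   using four[OF that] by (simp add: distrib_right add_increasing2)
 qed (use C0 two in auto)
qed

end

section \<open>The Skorokhod topology\<close>

text \<open>The sign of \<open>e\<close> matters for \<open>x = - \<infinity>\<close>, which
  \<open>real_of_ereal\<close> sends to 0.\<close>

lemma real_of_ereal_le: "x <= ereal e ==> 0 <= e ==> real_of_ereal x <= e"
 by (cases x) auto

lemma skor_dist_u_le:
 assumes l: "l \<in> skor_time_changes u" and e: "0 <= e"
  and ln: "!!s t. 0 <= s ==> s < t ==> t <= u ==> \<bar>ln ((l t - l s) / (t - s))\<bar> <= e"
  and sup: "!!t. 0 <= t ==> t <= u ==> \<bar>x t - y (l t)\<bar> <= e"
 shows "skor_dist_u u x y <= e"
 unfolding skor_dist_u_def
proof (rule real_of_ereal_le[OF INF_lower2[OF l] e])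
 have "skor_lnorm u l <= ereal e" unfolding skor_lnorm_def by (rule SUP_least) (auto simp: ln)
 moreover have "(SUP t\<in>{0..u}. ereal \<bar>x t - y (l t)\<bar>) <= ereal e" by (rule SUP_least) (auto simp: sup)
 ultimately show "max (skor_lnorm u l) (SUP t\<in>{0..u}. ereal \<bar>x t - y (l t)\<bar>) <= ereal e" by simp
qed

lemma exp_integral_Ici: "has_bochner_integral lborel (%u. indicator {a..} u * exp (- u)) (exp (- a :: real))"
proof (rule has_bochner_integral_nn_integral)
 have "(\<integral>\<^sup>+u. ennreal (exp (- u)) * indicator {a..} u \<partial>lborel) = ennreal (0 - (- exp (- a)))"
 proof (rule nn_integral_FTC_atLeast)
  have "((%u::real. - exp (- u)) \<longlongrightarrow> - 0) at_top"
   by (intro tendsto_minus filterlim_compose[OF exp_at_bot filterlim_uminus_at_bot_at_top])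
  then show "((%u::real. - exp (- u)) \<longlongrightarrow> 0) at_top" by simp
 qed (auto intro!: derivative_eq_intros)
 then show "(\<integral>\<^sup>+u. ennreal (indicator {a..} u * exp (- u)) \<partial>lborel) = ennreal (exp (- a))"
  by (simp add: ennreal_mult' ennreal_indicator mult.commute)
qed (auto simp: indicator_def)

text \<open>\<open>g\<close> collects the levels \<open>u\<close> at which no good time change is
  available.\<close>

lemma skor_dist_le:
 assumes g: "integrable lborel g" "!!u. 0 <= g u" and e: "0 <= e"
  and b: "!!u. 0 < u ==> exp (- u) * min 1 (skor_dist_u u (%t. skor_cutoff u t * x t) (%t. skor_cutoff u t * y t)) <= e * exp (- u) + g u"
 shows "skor_dist x y <= e + (LINT u|lborel. g u)"
proof -
 let ?f = "%u. indicator {0<..} u *\<^sub>R (exp (- u) * min 1 (skor_dist_u u (%t. skor_cutoff u t * x t) (%t. skor_cutoff u t * y t)))"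
 have I: "integrable lborel (%u. e * (indicator {0..} u * exp (- u)) + g u)"
  using exp_integral_Ici[of 0] g by (auto simp: has_bochner_integral_iff)
 have "skor_dist x y = (LINT u|lborel. ?f u)" unfolding skor_dist_def set_lebesgue_integral_def ..
 also have "... <= (LINT u|lborel. e * (indicator {0..} u * exp (- u)) + g u)"
 proof (cases "integrable lborel ?f")
  case True
  then show ?thesis using I by (rule integral_mono) (use b g e in \<open>auto simp: indicator_def\<close>)
 next
  \<comment> \<open>Measurability of the integrand in \<open>u\<close> is not established; if it is
    not integrable, the Bochner integral is 0 by convention and the bound is trivial.\<close>
  case False
  then have "(LINT u|lborel. ?f u) = 0" by (rule not_integrable_integral_eq)
  also have "0 <= (LINT u|lborel. e * (indicator {0..} u * exp (- u)) + g u)"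
   by (rule Bochner_Integration.integral_nonneg) (use g e in auto)
  finally show ?thesis .
 qed
 also have "... = e + (LINT u|lborel. g u)"
  using exp_integral_Ici[of 0] g by (auto simp: has_bochner_integral_iff)
 finally show ?thesis .
qed

lemma skor_cutoff_alt: "skor_cutoff u t = max 0 (min 1 (u - t))"
 unfolding skor_cutoff_def by auto

lemma skor_cutoff_bounds: "0 <= skor_cutoff u t" "skor_cutoff u t <= 1" "\<bar>skor_cutoff u s - skor_cutoff u t\<bar> <= \<bar>s - t\<bar>"
 unfolding skor_cutoff_alt by auto

text \<open>With the identity as time change every level \<open>u < T\<close> contributes at most
  \<open>e\<close>; the remaining levels carry total mass \<open>exp (- T)\<close>.\<close>

lemma skor_dist_close:
 assumes T: "T >= 0" and e: "0 <= e" and xy: "!!t. 0 <= t ==> t <= T ==> \<bar>x t - y t\<bar> <= e"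
 shows "skor_dist x y <= e + exp (- T)"
proof -
 let ?g = "%u. indicator {T..} u * exp (- u) :: real"
 have g: "integrable lborel ?g" "(LINT u|lborel. ?g u) = exp (- T)"
  using exp_integral_Ici[of T] by (auto simp: has_bochner_integral_iff)
 have "skor_dist x y <= e + (LINT u|lborel. ?g u)"
 proof (rule skor_dist_le[OF g(1) _ e])
  fix u :: real assume u: "0 < u"
  let ?d = "skor_dist_u u (%t. skor_cutoff u t * x t) (%t. skor_cutoff u t * y t)"
  show "exp (- u) * min 1 ?d <= e * exp (- u) + ?g u"
  proof (cases "u < T")
   case True
   have "?d <= e"
   proof (rule skor_dist_u_le[where l = "%t. t"])
    show "(%t. t) \<in> skor_time_changes u" unfolding skor_time_changes_def by (auto simp: strict_mono_on_def)
    fix t assume t: "0 <= t" "t <= u"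
    have "\<bar>skor_cutoff u t * x t - skor_cutoff u t * y t\<bar> = skor_cutoff u t * \<bar>x t - y t\<bar>"
     using skor_cutoff_bounds(1)[of u t] by (simp add: right_diff_distrib[symmetric] abs_mult)
    also have "... <= 1 * e" using skor_cutoff_bounds[of u t] xy[of t] t True by (intro mult_mono) auto
    finally show "\<bar>skor_cutoff u t * x t - skor_cutoff u t * y t\<bar> <= e" by simp
   qed (use e in auto)
   then have "exp (- u) * min 1 ?d <= exp (- u) * e" by (intro mult_left_mono) auto
   then show ?thesis using True by (simp add: mult.commute)
  next
   case False
   have "exp (- u) * min 1 ?d <= exp (- u) * 1" by (intro mult_left_mono) auto
   then show ?thesis using False e by (simp add: add_increasing)
  qed
 qed simp
 then show ?thesis using g by simp
qed

lemma skorokhod_measurableI: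
 assumes X: "!!w. w \<in> space M ==> X w \<in> cadlag_paths"
  and U: "!!U. skor_open U ==> {w\<in>space M. X w \<in> U} \<in> sets M"
 shows "X \<in> M \<rightarrow>\<^sub>M skorokhod_borel"
 unfolding skorokhod_borel_def
proof (rule measurable_measure_of)
 show "{U. skor_open U} \<subseteq> Pow cadlag_paths" unfolding skor_open_def by auto
 show "X \<in> space M \<rightarrow> cadlag_paths" using X by auto
 show "X -` y \<inter> space M \<in> sets M" if "y \<in> {U. skor_open U}" for y
  using U[of y] that by (simp add: vimage_def Int_def conj_commute)
qed

text \<open>\<open>t < T\<close> leaves room for rational points to the right of \<open>t\<close>,
  along which the bound passes to the limit.\<close>

lemma right_continuous_le:
 assumes f: "continuous (at_right t) (f::real => real)" and tT: "t < T" and c: "!!s. s \<in> \<rat> ==> t <= s ==> s < T ==> f s <= c"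
 shows "f t <= c"
proof (rule ccontr)
 assume "\<not> f t <= c"
 then have "\<forall>\<^sub>F s in at_right t. c < f s"
  using f unfolding continuous_within by (intro order_tendstoD(1)) auto
 then obtain b where b: "b > t" "!!s. s > t ==> s < b ==> c < f s" unfolding eventually_at_right_field by blast
 obtain q where q: "q \<in> \<rat>" "t < q" "q < min b T" using Rats_dense_in_real[of t "min b T"] b tT by auto
 then show False using b(2)[of q] c[of q] by auto
qed

text \<open>The preimage of an open set is a countable union of tube events, the tubes being centred
  at step functions with rational values. Membership in a tube is tested at rational times and is
  therefore measurable; continuity places each path in a tube so thin that all its cadlag members
  stay in the open set.\<close>

lemma continuous_process_measurable:
 fixes Y :: "'a => real => real"
 assumes m: "!!t. t >= 0 ==> (%w. Y w t) \<in> borel_measurable M"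
  and cad: "!!w. w \<in> space M ==> Y w \<in> cadlag_paths"
  and cont: "!!w. w \<in> space M ==> continuous_on {0..} (Y w)"
 shows "Y \<in> M \<rightarrow>\<^sub>M skorokhod_borel"
proof (rule skorokhod_measurableI[OF cad])
 fix U assume U: "skor_open U"
 define near where "near = (%(q :: rat list, m :: nat, T :: nat, N :: nat) (y::real => real).
   \<forall>t\<in>\<rat> \<inter> {0..real T}. \<bar>y t - of_rat (q ! nat \<lfloor>real m * t\<rfloor>)\<bar> <= 1 / real (Suc N))"
 define I where "I = {p. \<forall>y\<in>cadlag_paths. near p y \<longrightarrow> y \<in> U}"
 have "{w\<in>space M. Y w \<in> U} = (\<Union>p\<in>I. {w\<in>space M. near p (Y w)})"
 proof (intro equalityI subsetI)
  fix w assume "w \<in> (\<Union>p\<in>I. {w\<in>space M. near p (Y w)})"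
  then show "w \<in> {w\<in>space M. Y w \<in> U}" using cad unfolding I_def by auto
 next
  fix w assume w: "w \<in> {w\<in>space M. Y w \<in> U}"
  then have ws: "w \<in> space M" by simp
  obtain e where e: "e > 0" "!!y. y \<in> cadlag_paths ==> skor_dist (Y w) y < e ==> y \<in> U"
   using U w unfolding skor_open_def by blast
  obtain T' :: nat where T': "exp (- real T') < e / 2"
  proof -
   have "(%n. exp (- real n)) \<longlonglongrightarrow> 0"
    by (intro filterlim_compose[OF exp_at_bot] filterlim_compose[OF filterlim_uminus_at_bot_at_top] filterlim_real_sequentially)
   then have "\<forall>\<^sub>F n in sequentially. exp (- real n) < e / 2" using e(1) by (intro order_tendstoD(2)) auto
   then show ?thesis using that by (auto simp: eventually_sequentially)
  qed
  \<comment> \<open>One extra unit of horizon: tubes are tested at rational times up to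
    \<open>T\<close>, and right-continuity extends the bound to all real times up to
    \<open>T'\<close>.\<close>
  define T where "T = Suc T'"
  obtain N :: nat where N: "1 / real (Suc N) < e / 4" using e(1) nat_approx_posE[of "e/4"] by auto
  have "uniformly_continuous_on {0..real T} (Y w)"
   by (rule compact_uniformly_continuous) (auto intro: continuous_on_subset[OF cont[OF ws]])
  then obtain d where d: "d > 0" "!!s t. s \<in> {0..real T} ==> t \<in> {0..real T} ==> dist s t < d ==> dist (Y w s) (Y w t) < 1 / (2 * real (Suc N))"
   unfolding uniformly_continuous_on_def by (metis divide_pos_pos mult_pos_pos of_nat_0_less_iff zero_less_Suc zero_less_numeral zero_less_one)
  obtain m0 :: nat where m0: "1 / real (Suc m0) < d" using d(1) nat_approx_posE by blast
  define m where "m = Suc m0"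
  have "\<exists>r. \<bar>Y w (real k / real m) - of_rat r\<bar> < 1 / (2 * real (Suc N))" for k
  proof -
   obtain r where "r \<in> \<rat>" "Y w (real k / real m) - 1 / (2 * real (Suc N)) < r" "r < Y w (real k / real m) + 1 / (2 * real (Suc N))"
    using Rats_dense_in_real[of "Y w (real k / real m) - 1 / (2 * real (Suc N))" "Y w (real k / real m) + 1 / (2 * real (Suc N))"] by auto
   moreover from this(1) obtain x where "r = of_rat x" by (rule Rats_cases)
   ultimately have "\<bar>Y w (real k / real m) - of_rat x\<bar> < 1 / (2 * real (Suc N))" unfolding abs_less_iff by linarith
   then show ?thesis ..
  qed
  then obtain r where r: "!!k. \<bar>Y w (real k / real m) - of_rat (r k)\<bar> < 1 / (2 * real (Suc N))" by metis
  define q where "q = map r [0..<Suc (m * T)]"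
  have nearY: "near (q, m, T, N) (Y w)"
   unfolding near_def
  proof (clarsimp simp del: of_nat_Suc)
   fix t :: real assume t: "0 <= t" "t <= real T"
   define k where "k = nat \<lfloor>real m * t\<rfloor>"
   have mt: "real k <= real m * t" "real m * t < real k + 1" unfolding k_def using t by (auto simp: of_nat_nat)
   have "real k <= real m * real T" using mt t by (meson mult_left_mono of_nat_0_le_iff order_trans)
   then have k: "k <= m * T" by (metis of_nat_le_iff of_nat_mult)
   have m1: "real m > 0" unfolding m_def by simp
   have a: "real k / real m <= t" "t < real k / real m + 1 / real m" using mt m1 by (auto simp: field_simps)
   have "dist t (real k / real m) < d" using a m0 unfolding dist_real_def m_def by linarith
   then have "dist (Y w t) (Y w (real k / real m)) < 1 / (2 * real (Suc N))"
    using t a by (intro d(2)) auto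
   then have "\<bar>Y w t - Y w (real k / real m)\<bar> + \<bar>Y w (real k / real m) - of_rat (r k)\<bar> < 1 / (2 * real (Suc N)) + 1 / (2 * real (Suc N))"
    using r[of k] unfolding dist_real_def by (rule add_strict_mono)
   also have "1 / (2 * real (Suc N)) + 1 / (2 * real (Suc N)) = 1 / real (Suc N)" by (simp add: field_simps)
   finally have "\<bar>Y w t - of_rat (r k)\<bar> <= 1 / real (Suc N)" by linarith
   moreover have "q ! k = r k" unfolding q_def using k by (simp add: less_Suc_eq_le del: upt_Suc)
   ultimately show "\<bar>Y w t - of_rat (q ! nat \<lfloor>real m * t\<rfloor>)\<bar> <= 1 / real (Suc N)"
    unfolding k_def[symmetric] by simp
  qed
  have "(q, m, T, N) \<in> I"
   unfolding I_def
  proof (intro CollectI ballI impI)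
   fix y assume y: "y \<in> cadlag_paths" "near (q, m, T, N) y"
   have "\<bar>Y w t - y t\<bar> <= 2 / real (Suc N)" if t: "0 <= t" "t <= real T'" for t
   proof (rule right_continuous_le[where f = "%t. \<bar>Y w t - y t\<bar>" and T = "real T"])
    show "continuous (at_right t) (%t. \<bar>Y w t - y t\<bar>)"
     using cad[OF ws] y(1) t unfolding cadlag_paths_def by (intro continuous_intros) auto
    show "t < real T" using t unfolding T_def by simp
    fix s :: real assume s: "s \<in> \<rat>" "t <= s" "s < real T"
    then have sm: "s \<in> \<rat> \<inter> {0..real T}" using t by auto
    have "\<bar>Y w s - of_rat (q ! nat \<lfloor>real m * s\<rfloor>)\<bar> <= 1 / real (Suc N)" "\<bar>y s - of_rat (q ! nat \<lfloor>real m * s\<rfloor>)\<bar> <= 1 / real (Suc N)"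
     using nearY y(2) sm unfolding near_def by (auto simp del: of_nat_Suc)
    then show "\<bar>Y w s - y s\<bar> <= 2 / real (Suc N)" by (simp add: abs_le_iff field_simps del: of_nat_Suc)
   qed
   then have "skor_dist (Y w) y <= 2 / real (Suc N) + exp (- real T')" by (intro skor_dist_close) auto
   also have "2 / real (Suc N) = 2 * (1 / real (Suc N))" by simp
   also have "2 * (1 / real (Suc N)) + exp (- real T') < e" using N T' by linarith
   finally show "y \<in> U" using e(2) y(1) by blast
  qed
  then show "w \<in> (\<Union>p\<in>I. {w\<in>space M. near p (Y w)})" using nearY ws by blast
 qed
 also have "... \<in> sets M"
 proof (rule sets.countable_UN'')
  show "countable I" by simp
  fix p :: "rat list \<times> nat \<times> nat \<times> nat"
  obtain q m T N where p: "p = (q, m, T, N)" by (cases p)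
  have "{w\<in>space M. near p (Y w)} = {w\<in>space M. \<forall>t\<in>\<rat> \<inter> {0..real T}. \<bar>Y w t - of_rat (q ! nat \<lfloor>real m * t\<rfloor>)\<bar> <= 1 / real (Suc N)}"
   unfolding p near_def by simp
  also have "... \<in> sets M"
  proof (rule sets.sets_Collect_countable_All'[rotated])
   show "countable (\<rat> \<inter> {0..real T})" by (rule countable_Int1[OF countable_rat])
   fix t assume "t \<in> \<rat> \<inter> {0..real T}"
   then have "t >= 0" by simp
   note [measurable] = m[OF this]
   show "{w \<in> space M. \<bar>Y w t - of_rat (q ! nat \<lfloor>real m * t\<rfloor>)\<bar> <= 1 / real (Suc N)} \<in> sets M" by measurable
  qed
  finally show "{w\<in>space M. near p (Y w)} \<in> sets M" .
 qed
 finally show "{w\<in>space M. Y w \<in> U} \<in> sets M" .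
qed

lemma path_from0_cadlag:
 assumes "!!t. t >= 0 ==> continuous (at_right t) f" "!!t. t > 0 ==> \<exists>l. (f \<longlongrightarrow> l) (at_left t)"
 shows "path_from0 f \<in> cadlag_paths"
 unfolding cadlag_paths_def path_from0_def
proof (intro CollectI conjI allI impI)
 fix t :: real assume t: "t >= 0"
 have "\<forall>\<^sub>F s in at_right t. f s = f (max 0 s)"
  unfolding eventually_at_right_field using t by (auto intro!: exI[of _ "t + 1"] simp: max_def)
 then have "((%s. f (max 0 s)) \<longlongrightarrow> f t) (at_right t)"
  using assms(1)[OF t] unfolding continuous_within by (rule Lim_transform_eventually[rotated])
 then show "continuous (at_right t) (%s. f (max 0 s))" using t unfolding continuous_within by (simp add: max_def)
next
 fix t :: real assume t: "t > 0"
 obtain l where l: "(f \<longlongrightarrow> l) (at_left t)" using assms(2)[OF t] by blast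
 have "\<forall>\<^sub>F s in at_left t. f s = f (max 0 s)"
  unfolding eventually_at_left_field using t by (auto intro!: exI[of _ 0] simp: max_def)
 then have "((%s. f (max 0 s)) \<longlongrightarrow> l) (at_left t)" using l by (rule Lim_transform_eventually[rotated])
 then show "\<exists>l. ((%s. f (max 0 s)) \<longlongrightarrow> l) (at_left t)" ..
qed simp

lemma path_from0_continuous:
 assumes "continuous_on {0..} f"
 shows "path_from0 f \<in> cadlag_paths" "continuous_on {0..} (path_from0 f)"
proof -
 show c: "continuous_on {0..} (path_from0 f)"
  using assms by (rule continuous_on_eq) (auto simp: path_from0_def max_def)
 show "path_from0 f \<in> cadlag_paths"
 proof (rule path_from0_cadlag)
  fix t :: real assume "t >= 0"
  then have "continuous (at t within {0..}) f" using assms by (simp add: continuous_on_eq_continuous_within)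
  then show "continuous (at_right t) f" by (rule continuous_within_subset) (use \<open>t >= 0\<close> in auto)
 next
  fix t :: real assume t: "t > 0"
  then have "isCont f t" using assms by (intro continuous_on_interior[of "{0..}"]) auto
  then show "\<exists>l. (f \<longlongrightarrow> l) (at_left t)" unfolding isCont_def by (auto intro: filterlim_at_split[THEN iffD1, THEN conjunct1])
 qed
qed

section \<open>Counting paths as functions of their jump times\<close>

lemma abs_ln_le:
 fixes y k :: real
 assumes "\<bar>y - 1\<bar> <= k" "k <= 1/2"
 shows "\<bar>ln y\<bar> <= 2 * k"
proof -
 have y: "y >= 1/2" using assms by linarith
 have "ln y <= y - 1" using y by (intro ln_le_minus_one) auto
 moreover have "ln (1/y) <= 1/y - 1" using y by (intro ln_le_minus_one) auto
 moreover have "1/y - 1 <= 2 * k"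
 proof -
  have "1/y - 1 = (1 - y) / y" using y by (simp add: field_simps)
  also have "... <= k / y" using assms y by (intro divide_right_mono) auto
  also have "... <= k / (1/2)" using assms y by (intro divide_left_mono) auto
  finally show ?thesis by simp
 qed
 ultimately show ?thesis using assms y by (simp add: ln_div abs_le_iff)
qed

text \<open>A tent of height 1 and radius \<open>r\<close> around \<open>v\<close>; sums of such
  tents deform the identity into the time change of \<open>countpath_close\<close>.\<close>

definition spike :: "real => real => real => real" where "spike r v t = max 0 (1 - \<bar>t - v\<bar> / r)"

lemma spike_props:
 assumes "r > 0"
 shows "0 <= spike r v t" "spike r v t <= 1" "spike r v v = 1" "r <= \<bar>t - v\<bar> ==> spike r v t = 0"
  "\<bar>spike r v t - spike r v s\<bar> <= \<bar>t - s\<bar> / r"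
proof -
 have "\<bar>max 0 (1 - \<bar>t - v\<bar> / r) - max 0 (1 - \<bar>s - v\<bar> / r)\<bar> <= \<bar>\<bar>t - v\<bar> / r - \<bar>s - v\<bar> / r\<bar>" by linarith
 also have "... = \<bar>\<bar>t - v\<bar> - \<bar>s - v\<bar>\<bar> / r" using assms by (simp add: diff_divide_distrib[symmetric] abs_divide)
 also have "... <= \<bar>t - s\<bar> / r" using assms by (intro divide_right_mono) auto
 finally show "\<bar>spike r v t - spike r v s\<bar> <= \<bar>t - s\<bar> / r" unfolding spike_def .
qed (use assms in \<open>auto simp: spike_def\<close>)

definition countpath :: "nat => real => (real => real) => (nat => ereal) => real => real" where
 "countpath n c \<rho> \<tau> = path_from0 (%t. c * (real (card {i. i < n \<and> \<tau> i <= ereal t}) - real n * \<rho> t))"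

text \<open>On a fixed pattern of ties the path is continuous in the jump times: a piecewise linear time change
moves the jumps of one path to those of the other.\<close>

definition same_pattern :: "nat => (nat => ereal) => (nat => ereal) => bool" where
 "same_pattern n \<tau> \<tau>' \<longleftrightarrow> (\<forall>i<n. \<forall>j<n. (\<tau> i = \<tau> j) = (\<tau>' i = \<tau>' j)) \<and>
   (\<forall>i<n. (\<tau> i <= 0) = (\<tau>' i <= 0)) \<and> (\<forall>i<n. (\<tau> i = \<infinity>) = (\<tau>' i = \<infinity>))"

text \<open>The time change is the identity plus, at each positive finite jump time, a spike whose
  height is the displacement of that jump. The radius \<open>r\<close> is at most every jump time
  and half of every gap, so 0 stays fixed and each spike vanishes at the other jump times. The
  endpoint \<open>u\<close> must be fixed too, which may fail for \<open>u\<close> within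
  \<open>r\<close> of a jump; these levels have total length at most \<open>2 r n\<close> and are
  charged to \<open>g\<close>.\<close>

lemma countpath_close:
 fixes \<tau> :: "nat => ereal"
 assumes e: "e > 0" and L: "L >= 0" "!!s t. 0 <= s ==> 0 <= t ==> \<bar>\<rho> s - \<rho> t\<bar> <= L * \<bar>s - t\<bar>" and R: "!!t. t >= 0 ==> \<bar>\<rho> t\<bar> <= R"
 obtains \<delta> where "\<delta> > 0" "!!\<tau>'. same_pattern n \<tau> \<tau>' ==> (!!i. i < n ==> 0 < \<tau> i ==> \<tau> i < \<infinity> ==> \<bar>real_of_ereal (\<tau>' i) - real_of_ereal (\<tau> i)\<bar> <= \<delta>)
  ==> skor_dist (countpath n c \<rho> \<tau>) (countpath n c \<rho> \<tau>') < e"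
proof -
 define A where "A = {i. i < n \<and> 0 < \<tau> i \<and> \<tau> i < \<infinity>}"
 define x where "x i = real_of_ereal (\<tau> i)" for i
 define S where "S = x ` A"
 have finA: "finite A" unfolding A_def by simp
 have finS: "finite S" unfolding S_def using finA by simp
 have cardS: "card S <= n"
 proof -
  have "card A <= card {..<n}" by (rule card_mono) (auto simp: A_def)
  then show ?thesis unfolding S_def using card_image_le[OF finA, of x] by simp
 qed
 have xA: "\<tau> i = ereal (x i)" "0 < x i" if "i \<in> A" for i
  using that unfolding A_def x_def by (cases "\<tau> i"; auto)+
 have Spos: "v > 0" if "v \<in> S" for v using that xA unfolding S_def by auto
 have R0: "R >= 0" using R[of 0] by linarith
 define C1 where "C1 = \<bar>c\<bar> * real n * (1 + R + L)"
 have C10: "C1 >= 0" unfolding C1_def using R0 L(1) by simp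
 define B where "B = {e / (8 * (real n + 1))} \<union> S \<union> {\<bar>v - ww\<bar> / 2 | v ww. v \<in> S \<and> ww \<in> S \<and> v ~= ww}"
 have finB: "finite B"
 proof -
  have "{\<bar>v - ww\<bar> / 2 | v ww. v \<in> S \<and> ww \<in> S \<and> v ~= ww} \<subseteq> (%(v, ww). \<bar>v - ww\<bar> / 2) ` (S \<times> S)" by force
  moreover have "finite ((%(v, ww). \<bar>v - ww\<bar> / 2) ` (S \<times> S))" using finS by simp
  ultimately have "finite {\<bar>v - ww\<bar> / 2 | v ww. v \<in> S \<and> ww \<in> S \<and> v ~= ww}" by (rule finite_subset)
  then show ?thesis unfolding B_def using finS by (intro finite_UnI) auto
 qed
 define r where "r = Min B"
 have "r \<in> B" unfolding r_def by (rule Min_in[OF finB]) (auto simp: B_def)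
 then have r0: "r > 0" unfolding B_def using e Spos by auto
 have rB: "r <= b" if "b \<in> B" for b unfolding r_def using finB that by simp
 have r1: "r <= e / (8 * (real n + 1))" "!!v. v \<in> S ==> r <= v" by (rule rB; simp add: B_def)+
 have r2: "2 * r <= \<bar>v - ww\<bar>" if "v \<in> S" "ww \<in> S" "v ~= ww" for v ww
 proof -
  have "\<bar>v - ww\<bar> / 2 \<in> B" unfolding B_def using that by blast
  from rB[OF this] show ?thesis by simp
 qed
 \<comment> \<open>The first bound keeps the slope error \<open>\<kappa>\<close> below
   \<open>1/2\<close> and \<open>e / 16\<close>; the second keeps the error
   \<open>n \<delta> C1\<close> in the values below \<open>e / 8\<close>.\<close>
 define \<delta> where "\<delta> = min (min (1/2) (e / 16) * r / (real n + 1)) (e / (8 * (real n + 1) * (C1 + 1)))"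
 have \<delta>0: "\<delta> > 0" unfolding \<delta>_def using e r0 C10 by auto
 define \<kappa> where "\<kappa> = real n * \<delta> / r"
 have \<kappa>: "0 <= \<kappa>" "\<kappa> <= 1/2" "2 * \<kappa> <= e / 8"
 proof -
  have "\<delta> <= min (1/2) (e / 16) * r / (real n + 1)" unfolding \<delta>_def by simp
  then have "real n * \<delta> <= (real n + 1) * (min (1/2) (e / 16) * r / (real n + 1))" using \<delta>0 by (intro mult_mono) auto
  also have "... = min (1/2) (e / 16) * r" by simp
  finally have "\<kappa> <= min (1/2) (e / 16)" unfolding \<kappa>_def pos_divide_le_eq[OF r0] .
  then show "\<kappa> <= 1/2" "2 * \<kappa> <= e / 8" by auto
  show "0 <= \<kappa>" unfolding \<kappa>_def using r0 \<delta>0 by simp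
 qed
 have n\<delta>: "real n * \<delta> * C1 <= e / 8"
 proof -
  have "\<delta> <= e / (8 * (real n + 1) * (C1 + 1))" unfolding \<delta>_def by simp
  then have "real n * \<delta> * C1 <= (real n + 1) * (e / (8 * (real n + 1) * (C1 + 1))) * (C1 + 1)"
   using C10 \<delta>0 e by (intro mult_mono mult_nonneg_nonneg) auto
  also have "... = e / 8"
  proof -
   have "a * (e / (8 * a * b)) * b = e / 8" if "a ~= 0" "b ~= 0" for a b :: real using that by simp
   moreover have "real n + 1 ~= 0" "C1 + 1 ~= 0" using C10 by auto
   ultimately show ?thesis by blast
  qed
  finally show ?thesis .
 qed
 show ?thesis
 proof (rule that[OF \<delta>0])
  fix \<tau>' assume pat: "same_pattern n \<tau> \<tau>'"
   and close: "!!i. i < n ==> 0 < \<tau> i ==> \<tau> i < \<infinity> ==> \<bar>real_of_ereal (\<tau>' i) - real_of_ereal (\<tau> i)\<bar> <= \<delta>"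
  define x' where "x' i = real_of_ereal (\<tau>' i)" for i
  have xA': "\<tau>' i = ereal (x' i)" "0 < x' i" if "i \<in> A" for i
  proof -
   have "\<not> \<tau>' i <= 0" "\<tau>' i ~= \<infinity>" using pat that unfolding same_pattern_def A_def by auto
   then show "\<tau>' i = ereal (x' i)" "0 < x' i" unfolding x'_def by (cases "\<tau>' i"; auto)+
  qed
  \<comment> \<open>Tied jump times share one representative; \<open>same_pattern\<close> makes the
    displaced time independent of the choice.\<close>
  define idx where "idx v = (SOME i. i \<in> A \<and> x i = v)" for v
  have idx: "idx v \<in> A" "x (idx v) = v" if "v \<in> S" for v
   using someI_ex[of "%i. i \<in> A \<and> x i = v"] that unfolding S_def idx_def by auto
  define v' where "v' v = x' (idx v)" for v
  have v'x: "v' (x i) = x' i" if i: "i \<in> A" for i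
  proof -
   have s: "x i \<in> S" using i unfolding S_def by simp
   have "\<tau> (idx (x i)) = \<tau> i" using idx[OF s] xA i by simp
   then have "\<tau>' (idx (x i)) = \<tau>' i" using pat idx(1)[OF s] i unfolding same_pattern_def A_def by auto
   then show ?thesis unfolding v'_def x'_def by simp
  qed
  have v'd: "\<bar>v' v - v\<bar> <= \<delta>" if "v \<in> S" for v
   using close[of "idx v"] idx[OF that] unfolding v'_def x'_def x_def A_def by auto
  define l where "l t = t + (\<Sum>v\<in>S. (v' v - v) * spike r v t)" for t
  have lip: "\<bar>(l t - l s) - (t - s)\<bar> <= \<kappa> * \<bar>t - s\<bar>" for s t
  proof -
   have "(l t - l s) - (t - s) = (\<Sum>v\<in>S. (v' v - v) * (spike r v t - spike r v s))"
    unfolding l_def by (simp add: sum_subtractf right_diff_distrib)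
   also have "\<bar>...\<bar> <= (\<Sum>v\<in>S. \<delta> * (\<bar>t - s\<bar> / r))"
   proof (rule order_trans[OF sum_abs], rule sum_mono)
    fix v assume "v \<in> S"
    then show "\<bar>(v' v - v) * (spike r v t - spike r v s)\<bar> <= \<delta> * (\<bar>t - s\<bar> / r)"
     unfolding abs_mult using v'd spike_props(5)[OF r0] \<delta>0 by (intro mult_mono) auto
   qed
   also have "... = real (card S) * (\<delta> * (\<bar>t - s\<bar> / r))" by simp
   also have "... <= real n * (\<delta> * (\<bar>t - s\<bar> / r))" using cardS \<delta>0 r0 by (intro mult_right_mono) auto
   finally show ?thesis unfolding \<kappa>_def by simp
  qed
  have ld: "\<bar>l t - t\<bar> <= real n * \<delta>" for t
  proof -
   have "\<bar>l t - t\<bar> <= (\<Sum>v\<in>S. \<delta>)" unfolding l_def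
   proof (simp, rule order_trans[OF sum_abs], rule order_trans[OF sum_mono])
    fix v assume "v \<in> S"
    then have "\<bar>v' v - v\<bar> * \<bar>spike r v t\<bar> <= \<delta> * 1" using v'd spike_props(1,2)[OF r0, of v t] \<delta>0 by (intro mult_mono) auto
    then show "\<bar>(v' v - v) * spike r v t\<bar> <= \<delta>" by (simp add: abs_mult)
   qed simp
   also have "... <= real n * \<delta>" using cardS \<delta>0 by (simp add: mult_right_mono)
   finally show ?thesis .
  qed
  have mono: "l s < l t" if "s < t" for s t
  proof -
   have "\<kappa> * \<bar>t - s\<bar> <= 1/2 * \<bar>t - s\<bar>" using \<kappa> by (intro mult_right_mono) auto
   then have "\<bar>(l t - l s) - (t - s)\<bar> <= 1/2 * \<bar>t - s\<bar>" by (rule order_trans[OF lip])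
   moreover have "(t - s) - (l t - l s) <= \<bar>(l t - l s) - (t - s)\<bar>" by linarith
   moreover have "\<bar>t - s\<bar> = t - s" using that by simp
   ultimately have "(t - s) - (l t - l s) <= 1/2 * (t - s)" by (metis order_trans)
   moreover have "1/2 * (t - s) < t - s" using that by simp
   ultimately have "(t - s) - (l t - l s) < t - s" by (rule le_less_trans)
   then show ?thesis by simp
  qed
  have mono': "l s <= l t \<longleftrightarrow> s <= t" for s t using mono[of s t] mono[of t s] by (cases s t rule: linorder_cases) auto
  have lcont: "continuous_on X l" for X unfolding l_def spike_def using r0 by (intro continuous_intros) auto
  have lx: "l (x i) = x' i" if i: "i \<in> A" for i
  proof -
   have s: "x i \<in> S" using i unfolding S_def by simp
   have "(\<Sum>v\<in>S. (v' v - v) * spike r v (x i)) = (\<Sum>v\<in>S. if v = x i then x' i - x i else 0)"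
   proof (rule sum.cong)
    fix v assume v: "v \<in> S"
    show "(v' v - v) * spike r v (x i) = (if v = x i then x' i - x i else 0)"
     using r2[OF s v] r0 spike_props(3,4)[OF r0] v'x[OF i] by auto
   qed simp
   then show ?thesis unfolding l_def using s finS by simp
  qed
  have l0: "l 0 = 0" unfolding l_def
  proof (simp, rule sum.neutral, intro ballI)
   fix v assume v: "v \<in> S"
   then have "r <= \<bar>0 - v\<bar>" using r1(2)[OF v] Spos[OF v] by simp
   then show "(v' v - v) * spike r v 0 = 0" by (simp only: spike_props(4)[OF r0] mult_zero_right)
  qed
  have count: "card {i. i < n \<and> \<tau>' i <= ereal (l t)} = card {i. i < n \<and> \<tau> i <= ereal t}" if t: "t >= 0" for t
  proof -
   have lt: "l t >= 0" using mono'[of 0 t] t l0 by simp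
   have "\<tau>' i <= ereal (l t) \<longleftrightarrow> \<tau> i <= ereal t" if i: "i < n" for i
   proof -
    consider "\<tau> i <= 0" | "\<tau> i = \<infinity>" | "i \<in> A" unfolding A_def using i by force
    then show ?thesis
    proof cases
     case 1
     then have "\<tau>' i <= 0" using pat i unfolding same_pattern_def by auto
     then show ?thesis using 1 t lt order_trans[of "\<tau> i" 0 "ereal t"] order_trans[of "\<tau>' i" 0 "ereal (l t)"] by auto
    next
     case 2
     then have "\<tau>' i = \<infinity>" using pat i unfolding same_pattern_def by auto
     then show ?thesis using 2 by auto
    next
     case 3
     then show ?thesis using xA[OF 3] xA'[OF 3] lx[OF 3] mono'[of "x i" t] by simp
    qed
   qed
   then have "{i. i < n \<and> \<tau>' i <= ereal (l t)} = {i. i < n \<and> \<tau> i <= ereal t}" by blast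
   then show ?thesis by simp
  qed
  define X where "X t = c * (real (card {i. i < n \<and> \<tau> i <= ereal t}) - real n * \<rho> t)" for t
  define X' where "X' t = c * (real (card {i. i < n \<and> \<tau>' i <= ereal t}) - real n * \<rho> t)" for t
  have XB: "\<bar>X t\<bar> <= \<bar>c\<bar> * (real n + real n * R)" if "t >= 0" for t
  proof -
   have "card {i. i < n \<and> \<tau> i <= ereal t} <= n" using card_mono[of "{..<n}" "{i. i < n \<and> \<tau> i <= ereal t}"] by auto
   then have "\<bar>real (card {i. i < n \<and> \<tau> i <= ereal t})\<bar> <= real n" by simp
   moreover have "\<bar>real n * \<rho> t\<bar> <= real n * R" unfolding abs_mult using R[OF that] by (simp add: mult_left_mono)
   ultimately have "\<bar>real (card {i. i < n \<and> \<tau> i <= ereal t}) - real n * \<rho> t\<bar> <= real n + real n * R" by linarith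
   then show ?thesis unfolding X_def abs_mult by (rule mult_left_mono) simp
  qed
  have XX: "\<bar>X t - X' (l t)\<bar> <= \<bar>c\<bar> * (real n * (L * \<bar>l t - t\<bar>))" if t: "t >= 0" for t
  proof -
   have lt: "l t >= 0" using mono'[of 0 t] t l0 by simp
   have "X t - X' (l t) = c * (real n * (\<rho> (l t) - \<rho> t))" unfolding X_def X'_def count[OF t] by (simp add: algebra_simps)
   also have "\<bar>...\<bar> <= \<bar>c\<bar> * (real n * (L * \<bar>l t - t\<bar>))"
   proof -
    have "\<bar>real n * (\<rho> (l t) - \<rho> t)\<bar> <= real n * (L * \<bar>l t - t\<bar>)"
     unfolding abs_mult abs_of_nat using L(2)[OF lt t] by (rule mult_left_mono) simp
    then show ?thesis unfolding abs_mult[of c] by (rule mult_left_mono) simp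
   qed
   finally show ?thesis .
  qed
  define \<epsilon> where "\<epsilon> = e / 8"
  define g where "g u = (\<Sum>v\<in>S. indicator {v - r..v + r} u :: real)" for u
  have gi: "integrable lborel g" "(LINT u|lborel. g u) = real (card S) * (2 * r)"
  proof -
   have i: "integrable lborel (indicator {v - r..v + r} :: real => real)" for v by (simp add: emeasure_lborel_Icc_eq)
   show "integrable lborel g" unfolding g_def by (intro Bochner_Integration.integrable_sum i)
   show "(LINT u|lborel. g u) = real (card S) * (2 * r)" unfolding g_def
    by (subst Bochner_Integration.integral_sum[OF i]) (use r0 in simp)
  qed
  have "skor_dist (countpath n c \<rho> \<tau>) (countpath n c \<rho> \<tau>') <= \<epsilon> + (LINT u|lborel. g u)"
  proof (rule skor_dist_le[OF gi(1)])
   show "0 <= g u" for u unfolding g_def by (intro sum_nonneg) auto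
   show "0 <= \<epsilon>" unfolding \<epsilon>_def using e by simp
   fix u :: real assume u: "0 < u"
   let ?x = "%t. skor_cutoff u t * countpath n c \<rho> \<tau> t" and ?y = "%t. skor_cutoff u t * countpath n c \<rho> \<tau>' t"
   show "exp (- u) * min 1 (skor_dist_u u ?x ?y) <= \<epsilon> * exp (- u) + g u"
   proof (cases "\<exists>v\<in>S. u \<in> {v - r..v + r}")
    case True
    then obtain v where v: "v \<in> S" "u \<in> {v - r..v + r}" by blast
    have "1 <= g u" unfolding g_def using member_le_sum[OF v(1), of "%v. indicator {v - r..v + r} u :: real"] v(2) finS by simp
    moreover have "exp (- u) * min 1 (skor_dist_u u ?x ?y) <= 1 * 1"
    proof (cases "0 <= min 1 (skor_dist_u u ?x ?y)")
     case True then show ?thesis using u by (intro mult_mono) auto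
    next
     case False then have "exp (- u) * min 1 (skor_dist_u u ?x ?y) <= 0" by (intro mult_nonneg_nonpos) auto
     then show ?thesis by simp
    qed
    moreover have "0 <= \<epsilon> * exp (- u)" unfolding \<epsilon>_def using e by simp
    ultimately show ?thesis by linarith
   next
    case False
    have lu: "l u = u" unfolding l_def
    proof (simp, rule sum.neutral, intro ballI)
     fix v assume "v \<in> S"
     then have "r <= \<bar>u - v\<bar>" using False by (force simp: abs_if)
     then show "(v' v - v) * spike r v u = 0" by (simp add: spike_props(4)[OF r0])
    qed
    have "skor_dist_u u ?x ?y <= \<epsilon>"
    proof (rule skor_dist_u_le)
     show "l \<in> skor_time_changes u" unfolding skor_time_changes_def
     proof (intro CollectI conjI lcont)
      show "strict_mono_on {0..u} l" using mono by (auto simp: strict_mono_on_def)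
      show "l ` {0..u} = {0..u}"
      proof (intro equalityI subsetI)
       fix y assume "y \<in> l ` {0..u}"
       then obtain t where t: "y = l t" "0 <= t" "t <= u" by auto
       then show "y \<in> {0..u}" using mono'[of 0 t] mono'[of t u] l0 lu by simp
      next
       fix y assume "y \<in> {0..u}"
       then have "\<exists>t\<ge>0. t <= u \<and> l t = y" using IVT'[of l 0 y u] l0 lu u lcont by auto
       then show "y \<in> l ` {0..u}" by auto
      qed
     qed
     show "0 <= \<epsilon>" unfolding \<epsilon>_def using e by simp
     show "\<bar>ln ((l t - l s) / (t - s))\<bar> <= \<epsilon>" if "0 <= s" "s < t" "t <= u" for s t
     proof -
      have "(l t - l s) / (t - s) - 1 = ((l t - l s) - (t - s)) / (t - s)" using that by (simp add: diff_divide_distrib)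
      also have "\<bar>...\<bar> <= \<kappa> * \<bar>t - s\<bar> / \<bar>t - s\<bar>" unfolding abs_divide by (rule divide_right_mono[OF lip]) simp
      also have "... = \<kappa>" using that by simp
      finally have "\<bar>ln ((l t - l s) / (t - s))\<bar> <= 2 * \<kappa>" using \<kappa>(2) by (intro abs_ln_le)
      then show ?thesis using \<kappa>(3) unfolding \<epsilon>_def by simp
     qed
     show "\<bar>?x t - ?y (l t)\<bar> <= \<epsilon>" if t: "0 <= t" "t <= u" for t
     proof -
      have lt: "l t >= 0" using mono'[of 0 t] t l0 by simp
      have cp: "countpath n c \<rho> \<tau> t = X t" "countpath n c \<rho> \<tau>' (l t) = X' (l t)"
       unfolding countpath_def path_from0_def X_def X'_def using t lt by (simp_all add: max_def)
      have "?x t - ?y (l t) = (skor_cutoff u t - skor_cutoff u (l t)) * X t + skor_cutoff u (l t) * (X t - X' (l t))"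
       unfolding cp by (simp add: algebra_simps)
      also have "\<bar>...\<bar> <= \<bar>l t - t\<bar> * (\<bar>c\<bar> * (real n + real n * R)) + 1 * (\<bar>c\<bar> * (real n * (L * \<bar>l t - t\<bar>)))"
      proof (rule order_trans[OF abs_triangle_ineq], unfold abs_mult[of _ "X t"] abs_mult[of _ "X t - X' (l t)"], rule add_mono)
       show "\<bar>skor_cutoff u t - skor_cutoff u (l t)\<bar> * \<bar>X t\<bar> <= \<bar>l t - t\<bar> * (\<bar>c\<bar> * (real n + real n * R))"
        using skor_cutoff_bounds(3)[of u t "l t"] XB[OF t(1)] by (intro mult_mono) auto
       show "\<bar>skor_cutoff u (l t)\<bar> * \<bar>X t - X' (l t)\<bar> <= 1 * (\<bar>c\<bar> * (real n * (L * \<bar>l t - t\<bar>)))"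
        using skor_cutoff_bounds(1,2)[of u "l t"] XX[OF t(1)] by (intro mult_mono) auto
      qed
      also have "... = \<bar>l t - t\<bar> * C1" unfolding C1_def by (simp add: algebra_simps)
      also have "... <= real n * \<delta> * C1" using ld C10 by (intro mult_right_mono) auto
      also have "... <= \<epsilon>" using n\<delta> unfolding \<epsilon>_def .
      finally show ?thesis .
     qed
    qed
    then have "exp (- u) * min 1 (skor_dist_u u ?x ?y) <= exp (- u) * \<epsilon>" by (intro mult_left_mono) auto
    moreover have "0 <= g u" unfolding g_def by (intro sum_nonneg) auto
    ultimately show ?thesis unfolding mult.commute[of \<epsilon>] by linarith
   qed
  qed
  also have "... <= e / 8 + real n * (2 * r)" unfolding gi \<epsilon>_def using cardS r0 by (intro add_mono mult_right_mono) auto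
  also have "... <= e / 8 + e / 4"
  proof -
   have "real n * (2 * r) <= (real n + 1) * (2 * (e / (8 * (real n + 1))))" using r1(1) r0 by (intro mult_mono) auto
   also have "... = e / 4" by (simp add: field_simps)
   finally show ?thesis by (rule add_left_mono)
  qed
  also have "... < e" using e by simp
  finally show "skor_dist (countpath n c \<rho> \<tau>) (countpath n c \<rho> \<tau>') < e" .
 qed
qed

lemma countpath_cadlag:
 assumes "continuous_on {0..} \<rho>"
 shows "countpath n c \<rho> \<tau> \<in> cadlag_paths"
 unfolding countpath_def
proof (rule path_from0_cadlag)
 define N where "N t = real (card {i. i < n \<and> \<tau> i <= ereal t})" for t
 define N' where "N' t = real (card {i. i < n \<and> \<tau> i < ereal t})" for t
 have card_eq: "(\<forall>i<n. P i = Q i) ==> card {i. i < n \<and> P i} = card {i. i < n \<and> Q i}" for P Q :: "nat => bool"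
  by (rule arg_cong[where f = card]) auto
 have ev: "\<forall>\<^sub>F s in at_right t. N s = N t" for t
 proof -
  have "\<forall>\<^sub>F s in at_right t. (\<tau> i <= ereal s) = (\<tau> i <= ereal t)" for i
  proof (cases "\<tau> i <= ereal t")
   case True
   then show ?thesis unfolding eventually_at_right_field by (auto intro!: exI[of _ "t+1"] intro: order_trans)
  next
   case False
   then have "ereal t < \<tau> i" by simp
   then obtain b where b: "ereal t < ereal b" "ereal b < \<tau> i" using ereal_dense2 by blast
   have "(\<tau> i <= ereal s) = (\<tau> i <= ereal t)" if "s < b" for s
   proof -
    have "ereal s < \<tau> i" using b that by (meson less_ereal.simps(1) less_trans)
    then show ?thesis using False by auto
   qed
   moreover have "t < b" using b(1) by simp
   ultimately show ?thesis unfolding eventually_at_right_field by blast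
  qed
  then have "\<forall>\<^sub>F s in at_right t. \<forall>i\<in>{..<n}. (\<tau> i <= ereal s) = (\<tau> i <= ereal t)" by (intro eventually_ball_finite) auto
  then show ?thesis
  proof (rule eventually_mono)
   fix s assume "\<forall>i\<in>{..<n}. (\<tau> i <= ereal s) = (\<tau> i <= ereal t)"
   then show "N s = N t" unfolding N_def by (subst card_eq[of _ "%i. \<tau> i <= ereal t"]) simp_all
  qed
 qed
 have ev': "\<forall>\<^sub>F s in at_left t. N s = N' t" for t
 proof -
  have "\<forall>\<^sub>F s in at_left t. (\<tau> i <= ereal s) = (\<tau> i < ereal t)" for i
  proof (cases "\<tau> i < ereal t")
   case False
   then have "(\<tau> i <= ereal s) = (\<tau> i < ereal t)" if "s < t" for s
    using that False order.strict_trans1[of "\<tau> i" "ereal s" "ereal t"] by auto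
   moreover have "t - 1 < t" by simp
   ultimately show ?thesis unfolding eventually_at_left_field by blast
  next
   case True
   then obtain b where b: "\<tau> i < ereal b" "ereal b < ereal t" using ereal_dense2 by blast
   have "(\<tau> i <= ereal s) = (\<tau> i < ereal t)" if "s > b" for s
    using b that True by (meson less_ereal.simps(1) less_imp_le less_trans)
   moreover have "b < t" using b(2) by simp
   ultimately show ?thesis unfolding eventually_at_left_field by blast
  qed
  then have "\<forall>\<^sub>F s in at_left t. \<forall>i\<in>{..<n}. (\<tau> i <= ereal s) = (\<tau> i < ereal t)" by (intro eventually_ball_finite) auto
  then show ?thesis
  proof (rule eventually_mono)
   fix s assume "\<forall>i\<in>{..<n}. (\<tau> i <= ereal s) = (\<tau> i < ereal t)"
   then show "N s = N' t" unfolding N_def N'_def by (subst card_eq[of _ "%i. \<tau> i < ereal t"]) simp_all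
  qed
 qed
 { fix t :: real assume t: "t >= 0"
  have "continuous (at t within {0..}) \<rho>" using assms t by (simp add: continuous_on_eq_continuous_within)
  then have "continuous (at_right t) \<rho>" by (rule continuous_within_subset) (use t in auto)
  moreover have "continuous (at_right t) N" unfolding continuous_within by (rule tendsto_eventually[OF ev])
  ultimately show "continuous (at_right t) (%t. c * (real (card {i. i < n \<and> \<tau> i <= ereal t}) - real n * \<rho> t))"
   unfolding N_def by (intro continuous_intros) }
 { fix t :: real assume t: "t > 0"
  then have "isCont \<rho> t" using assms by (intro continuous_on_interior[of "{0..}"]) auto
  then have r: "(\<rho> \<longlongrightarrow> \<rho> t) (at_left t)" unfolding isCont_def by (auto intro: filterlim_at_split[THEN iffD1, THEN conjunct1])
  have N: "(N \<longlongrightarrow> N' t) (at_left t)" by (rule tendsto_eventually[OF ev'])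
  show "\<exists>l. ((%t. c * (real (card {i. i < n \<and> \<tau> i <= ereal t}) - real n * \<rho> t)) \<longlongrightarrow> l) (at_left t)"
   by (intro exI[of _ "c * (N' t - real n * \<rho> t)"] tendsto_intros r N[unfolded N_def]) }
qed

text \<open>The covering device again, now with finite data on the default times: the pattern of
  ties, the indices with nonpositive or infinite times, and a rational interval around each
  remaining time. By \<open>countpath_close\<close> every configuration whose path lies in the open
  set has such a description that forces the path to stay there.\<close>

lemma countpath_measurable:
 fixes \<tau> :: "nat => 'a => ereal"
 assumes \<tau>: "!!i. i < n ==> \<tau> i \<in> borel_measurable M"
  and L: "L >= 0" "!!s t. 0 <= s ==> 0 <= t ==> \<bar>\<rho> s - \<rho> t\<bar> <= L * \<bar>s - t\<bar>" and R: "!!t. t >= 0 ==> \<bar>\<rho> t\<bar> <= R"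
  and cont: "continuous_on {0..} \<rho>"
 shows "(%w. countpath n c \<rho> (%i. \<tau> i w)) \<in> M \<rightarrow>\<^sub>M skorokhod_borel"
proof (rule skorokhod_measurableI[OF countpath_cadlag[OF cont]])
 fix U assume U: "skor_open U"
 define ok where "ok = (%(el :: (nat \<times> nat) list, zl :: nat list, il :: nat list, bx :: (rat \<times> rat) list) (\<sigma> :: nat => ereal).
   \<forall>i\<in>{..<n}. (\<forall>j\<in>{..<n}. (\<sigma> i = \<sigma> j) = ((i, j) \<in> set el)) \<and> (\<sigma> i <= 0) = (i \<in> set zl) \<and> (\<sigma> i = \<infinity>) = (i \<in> set il) \<and>
    (0 < \<sigma> i \<and> \<sigma> i < \<infinity> \<longrightarrow> ereal (of_rat (fst (bx ! i))) < \<sigma> i \<and> \<sigma> i < ereal (of_rat (snd (bx ! i)))))"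
 define I where "I = {p. \<forall>\<sigma>. ok p \<sigma> \<longrightarrow> countpath n c \<rho> \<sigma> \<in> U}"
 have "{w\<in>space M. countpath n c \<rho> (%i. \<tau> i w) \<in> U} = (\<Union>p\<in>I. {w\<in>space M. ok p (%i. \<tau> i w)})"
 proof (intro equalityI subsetI)
  fix w assume "w \<in> (\<Union>p\<in>I. {w\<in>space M. ok p (%i. \<tau> i w)})"
  then show "w \<in> {w\<in>space M. countpath n c \<rho> (%i. \<tau> i w) \<in> U}" unfolding I_def by auto
 next
  fix w assume w: "w \<in> {w\<in>space M. countpath n c \<rho> (%i. \<tau> i w) \<in> U}"
  define \<sigma> where "\<sigma> i = \<tau> i w" for i
  have \<sigma>U: "countpath n c \<rho> \<sigma> \<in> U" using w unfolding \<sigma>_def by simp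
  obtain e where e: "e > 0" "!!y. y \<in> cadlag_paths ==> skor_dist (countpath n c \<rho> \<sigma>) y < e ==> y \<in> U"
   using U \<sigma>U unfolding skor_open_def by blast
  obtain \<delta> where \<delta>: "\<delta> > 0" "!!\<tau>'. same_pattern n \<sigma> \<tau>' ==> (!!i. i < n ==> 0 < \<sigma> i ==> \<sigma> i < \<infinity> ==> \<bar>real_of_ereal (\<tau>' i) - real_of_ereal (\<sigma> i)\<bar> <= \<delta>)
  ==> skor_dist (countpath n c \<rho> \<sigma>) (countpath n c \<rho> \<tau>') < e"
   using countpath_close[OF e(1) L R, of n \<sigma> c] by blast
  obtain el where el: "set el = {(i, j). i < n \<and> j < n \<and> \<sigma> i = \<sigma> j}"
   using finite_list[of "{(i, j). i < n \<and> j < n \<and> \<sigma> i = \<sigma> j}"] finite_subset[of "{(i, j). i < n \<and> j < n \<and> \<sigma> i = \<sigma> j}" "{..<n} \<times> {..<n}"] by auto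
  obtain zl where zl: "set zl = {i. i < n \<and> \<sigma> i <= 0}" using finite_list[of "{i. i < n \<and> \<sigma> i <= 0}"] by auto
  obtain il where il: "set il = {i. i < n \<and> \<sigma> i = \<infinity>}" using finite_list[of "{i. i < n \<and> \<sigma> i = \<infinity>}"] by auto
  define x where "x i = real_of_ereal (\<sigma> i)" for i
  have ex: "\<exists>q. y < of_rat q \<and> of_rat q < z" if "y < z" for y z :: real
   using Rats_dense_in_real[OF that] by (auto elim!: Rats_cases)
  have "\<exists>q. x i - \<delta> < of_rat q \<and> of_rat q < x i" "\<exists>q. x i < of_rat q \<and> of_rat q < x i + \<delta>" for i
   using \<delta>(1) by (auto intro!: ex)
  then obtain a b where ab: "!!i. x i - \<delta> < of_rat (a i) \<and> of_rat (a i) < x i" "!!i. x i < of_rat (b i) \<and> of_rat (b i) < x i + \<delta>"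
   by metis
  define bx where "bx = map (%i. (a i, b i)) [0..<n]"
  have bx: "bx ! i = (a i, b i)" if "i < n" for i unfolding bx_def using that by simp
  have ok\<sigma>: "ok (el, zl, il, bx) \<sigma>"
  proof -
   have "ereal (of_rat (fst (bx ! i))) < \<sigma> i \<and> \<sigma> i < ereal (of_rat (snd (bx ! i)))"
    if i: "i < n" and fi: "0 < \<sigma> i" "\<sigma> i < \<infinity>" for i
   proof -
    have "\<sigma> i = ereal (x i)" unfolding x_def using fi by (cases "\<sigma> i") auto
    then show ?thesis using ab bx[OF i] by simp
   qed
   then show ?thesis unfolding ok_def prod.case el zl il by blast
  qed
  have "(el, zl, il, bx) \<in> I"
   unfolding I_def
  proof (intro CollectI allI impI)
   fix \<tau>' assume ok': "ok (el, zl, il, bx) \<tau>'"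
   have pat: "same_pattern n \<sigma> \<tau>'" using ok' unfolding ok_def same_pattern_def by (auto simp: el zl il)
   have "skor_dist (countpath n c \<rho> \<sigma>) (countpath n c \<rho> \<tau>') < e"
   proof (rule \<delta>(2)[OF pat])
    fix i assume i: "i < n" "0 < \<sigma> i" "\<sigma> i < \<infinity>"
    then have "\<not> \<tau>' i <= 0" "\<tau>' i ~= \<infinity>" using pat unfolding same_pattern_def by auto
    then have f: "0 < \<tau>' i" "\<tau>' i < \<infinity>" by auto
    then have t': "\<tau>' i = ereal (real_of_ereal (\<tau>' i))" by (cases "\<tau>' i") auto
    have "ereal (of_rat (fst (bx ! i))) < \<tau>' i" "\<tau>' i < ereal (of_rat (snd (bx ! i)))"
     using ok' f i(1) unfolding ok_def by auto
    then have "of_rat (a i) < real_of_ereal (\<tau>' i)" "real_of_ereal (\<tau>' i) < of_rat (b i)"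
     unfolding bx[OF i(1)] by (metis t' less_ereal.simps(1) fst_conv snd_conv)+
    then show "\<bar>real_of_ereal (\<tau>' i) - real_of_ereal (\<sigma> i)\<bar> <= \<delta>" using ab[of i] unfolding x_def by linarith
   qed
   then show "countpath n c \<rho> \<tau>' \<in> U" by (intro e(2) countpath_cadlag cont)
  qed
  then show "w \<in> (\<Union>p\<in>I. {w\<in>space M. ok p (%i. \<tau> i w)})" using ok\<sigma> w unfolding \<sigma>_def by blast
 qed
 also have "... \<in> sets M"
 proof (rule sets.countable_UN'')
  show "countable I" by simp
  fix p :: "(nat \<times> nat) list \<times> nat list \<times> nat list \<times> (rat \<times> rat) list"
  obtain el zl il bx where p: "p = (el, zl, il, bx)" by (cases p)
  show "{w\<in>space M. ok p (%i. \<tau> i w)} \<in> sets M"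
   unfolding p ok_def prod.case
  proof (rule sets.sets_Collect_finite_All)
   fix i assume i: "i \<in> {..<n}"
   then have [measurable]: "\<tau> i \<in> borel_measurable M" by (simp add: \<tau>)
   have e: "{w \<in> space M. \<forall>j\<in>{..<n}. (\<tau> i w = \<tau> j w) = ((i, j) \<in> set el)} \<in> sets M"
   proof (rule sets.sets_Collect_finite_All)
    fix j assume "j \<in> {..<n}"
    then have [measurable]: "\<tau> j \<in> borel_measurable M" by (simp add: \<tau>)
    show "{w \<in> space M. (\<tau> i w = \<tau> j w) = ((i, j) \<in> set el)} \<in> sets M" by measurable
   qed simp
   have f: "{w \<in> space M. (\<tau> i w <= 0) = (i \<in> set zl) \<and> (\<tau> i w = \<infinity>) = (i \<in> set il) \<and>
    (0 < \<tau> i w \<and> \<tau> i w < \<infinity> \<longrightarrow> ereal (of_rat (fst (bx ! i))) < \<tau> i w \<and> \<tau> i w < ereal (of_rat (snd (bx ! i))))} \<in> sets M"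
    by measurable
   show "{w \<in> space M. (\<forall>j\<in>{..<n}. (\<tau> i w = \<tau> j w) = ((i, j) \<in> set el)) \<and> (\<tau> i w <= 0) = (i \<in> set zl) \<and> (\<tau> i w = \<infinity>) = (i \<in> set il) \<and>
    (0 < \<tau> i w \<and> \<tau> i w < \<infinity> \<longrightarrow> ereal (of_rat (fst (bx ! i))) < \<tau> i w \<and> \<tau> i w < ereal (of_rat (snd (bx ! i))))} \<in> sets M"
    by (rule sets.sets_Collect_conj[OF f e])
  qed simp
 qed
 finally show "{w\<in>space M. countpath n c \<rho> (%i. \<tau> i w) \<in> U} \<in> sets M" .
qed

text \<open>\<open>min t (real k)\<close> freezes the path after time \<open>k\<close>, so that only
  the coordinates \<open>v 0\<close> to \<open>v (m * k)\<close> matter and functionals of it become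
  finite-dimensional.\<close>

definition stepfun :: "nat => nat => (nat => real) => real => real" where
 "stepfun m k v = path_from0 (%t. v (nat \<lfloor>real m * min t (real k)\<rfloor>))"

lemma stepfun_cadlag: "stepfun m k v \<in> cadlag_paths"
 unfolding stepfun_def
proof (rule path_from0_cadlag)
 fix t :: real assume t: "t >= 0"
 let ?g = "%s. real m * min s (real k)"
 have "(?g \<longlongrightarrow> ?g t) (at_right t)" by (intro tendsto_intros)
 then have "\<forall>\<^sub>F s in at_right t. ?g s < of_int \<lfloor>?g t\<rfloor> + 1" by (rule order_tendstoD(2)) linarith
 moreover have "\<forall>\<^sub>F s in at_right t. t < s" by (simp add: eventually_at_right_less)
 ultimately have "\<forall>\<^sub>F s in at_right t. v (nat \<lfloor>?g s\<rfloor>) = v (nat \<lfloor>?g t\<rfloor>)"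
 proof eventually_elim
  case (elim s)
  have "?g t <= ?g s" using elim by (intro mult_left_mono) auto
  then have "\<lfloor>?g s\<rfloor> = \<lfloor>?g t\<rfloor>" using elim by (intro floor_unique) linarith+
  then show ?case by simp
 qed
 then show "continuous (at_right t) (%t. v (nat \<lfloor>?g t\<rfloor>))" unfolding continuous_within by (rule tendsto_eventually)
next
 fix t :: real assume t: "t > 0"
 let ?g = "%s. real m * min s (real k)"
 have "\<exists>c. \<forall>\<^sub>F s in at_left t. \<lfloor>?g s\<rfloor> = c"
 proof (cases "t <= real k \<and> m > 0")
  case True
  have "(?g \<longlongrightarrow> ?g t) (at_left t)" by (intro tendsto_intros)
  then have "\<forall>\<^sub>F s in at_left t. of_int \<lceil>?g t\<rceil> - 1 < ?g s" by (rule order_tendstoD(1)) linarith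
  moreover have "\<forall>\<^sub>F s in at_left t. s < t" by (simp add: eventually_at_filter)
  \<comment> \<open>Just before \<open>t\<close> the argument is strictly below its value at
    \<open>t\<close>, so the floor is the ceiling of that value minus 1, also when the value is an
    integer.\<close>
  ultimately have "\<forall>\<^sub>F s in at_left t. \<lfloor>?g s\<rfloor> = \<lceil>?g t\<rceil> - 1"
  proof eventually_elim
   case (elim s)
   have "?g s < ?g t" using elim True by (intro mult_strict_left_mono) auto
   also have "?g t <= of_int \<lceil>?g t\<rceil>" by (rule le_of_int_ceiling)
   finally show ?case using elim by (intro floor_unique) auto
  qed
  then show ?thesis ..
 next
  case False
  then consider "real k < t" | "m = 0" by force
  then show ?thesis
  proof cases
   case 1
   have "\<forall>\<^sub>F s in at_left t. \<lfloor>?g s\<rfloor> = \<lfloor>real m * real k\<rfloor>"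
    unfolding eventually_at_left_field using 1 by (intro exI[of _ "real k"]) auto
   then show ?thesis ..
  qed auto
 qed
 then obtain c where c: "\<forall>\<^sub>F s in at_left t. \<lfloor>?g s\<rfloor> = c" ..
 have "\<forall>\<^sub>F s in at_left t. v (nat \<lfloor>?g s\<rfloor>) = v (nat c)" using c by (rule eventually_mono) simp
 then show "\<exists>l. ((%t. v (nat \<lfloor>?g t\<rfloor>)) \<longlongrightarrow> l) (at_left t)" by (intro exI tendsto_eventually)
qed

lemma stepfun_eq: "0 <= t ==> t <= real k ==> stepfun m k v t = v (nat \<lfloor>real m * t\<rfloor>)"
 unfolding stepfun_def path_from0_def by simp

lemma stepfun_idx: "nat \<lfloor>real m * min (max 0 t) (real k)\<rfloor> <= m * k"
proof -
 have "real m * min (max 0 t) (real k) <= real (m * k)" by (simp add: mult_left_mono)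
 then have "\<lfloor>real m * min (max 0 t) (real k)\<rfloor> <= int (m * k)" by (simp add: floor_le_iff)
 then show ?thesis by (simp only: nat_le_iff)
qed

text \<open>Lipschitz minorants of a Skorokhod-continuous functional; they converge to it at every path
 because uniform convergence on compacts implies Skorokhod convergence.\<close>

definition lip_set :: "((real => real) => real) => nat => (real => real) => real set" where
 "lip_set f k x = {f y + real k * r | y r. y \<in> cadlag_paths \<and> 0 <= r \<and> (\<forall>t\<in>{0..real k}. \<bar>x t - y t\<bar> <= r)}"

text \<open>The Pasch-Hausdorff inf-convolution; \<open>k\<close> is both the Lipschitz constant and
  the horizon of the uniform distance.\<close>

definition lip_min :: "((real => real) => real) => nat => (real => real) => real" where
 "lip_min f k x = Inf (lip_set f k x)"

context
 fixes f :: "(real => real) => real" and B :: real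
 assumes B: "!!x. x \<in> cadlag_paths ==> \<bar>f x\<bar> <= B"
begin

lemma lip_set_lower: "z \<in> lip_set f k x ==> - B <= z"
proof -
 assume "z \<in> lip_set f k x"
 then obtain y r where z: "z = f y + real k * r" "y \<in> cadlag_paths" "0 <= r" unfolding lip_set_def by auto
 have "0 <= real k * r" using z by simp
 then show "- B <= z" using B[OF z(2)] z(1) by linarith
qed

lemma lip_set_self: "x \<in> cadlag_paths ==> f x \<in> lip_set f k x"
 unfolding lip_set_def by (auto intro!: exI[of _ x] exI[of _ 0])

lemma lip_set_bdd: "bdd_below (lip_set f k x)"
 by (rule bdd_belowI[of _ "-B"]) (rule lip_set_lower)

lemma lip_min_le: "x \<in> cadlag_paths ==> lip_min f k x <= f x"
 unfolding lip_min_def by (rule cInf_lower[OF lip_set_self lip_set_bdd])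

lemma lip_min_ge: "x \<in> cadlag_paths ==> - B <= lip_min f k x"
 unfolding lip_min_def using lip_set_self by (intro cInf_greatest lip_set_lower) auto

lemma lip_min_bound: "x \<in> cadlag_paths ==> \<bar>lip_min f k x\<bar> <= B"
 using lip_min_le[of x k] lip_min_ge[of x k] B[of x] by (auto simp: abs_le_iff)

lemma lip_min_lipschitz:
 assumes x: "x \<in> cadlag_paths" "x' \<in> cadlag_paths" and s: "0 <= s" "!!t. 0 <= t ==> t <= real k ==> \<bar>x t - x' t\<bar> <= s"
 shows "lip_min f k x <= lip_min f k x' + real k * s"
proof -
 have "lip_min f k x - real k * s <= lip_min f k x'"
  unfolding lip_min_def[of f k x']
 proof (rule cInf_greatest)
  show "lip_set f k x' ~= {}" using lip_set_self[OF x(2)] by auto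
  fix z assume "z \<in> lip_set f k x'"
  then obtain y r where z: "z = f y + real k * r" "y \<in> cadlag_paths" "0 <= r" "\<forall>t\<in>{0..real k}. \<bar>x' t - y t\<bar> <= r"
   unfolding lip_set_def by auto
  have "f y + real k * (r + s) \<in> lip_set f k x"
   unfolding lip_set_def
  proof (intro CollectI exI[of _ y] exI[of _ "r + s"] conjI ballI)
   fix t assume "t \<in> {0..real k}"
   then have "\<bar>x t - x' t\<bar> <= s" "\<bar>x' t - y t\<bar> <= r" using s z by auto
   then show "\<bar>x t - y t\<bar> <= r + s" by linarith
  qed (use z s in auto)
  then have "lip_min f k x <= f y + real k * (r + s)" unfolding lip_min_def by (rule cInf_lower[OF _ lip_set_bdd])
  then show "lip_min f k x - real k * s <= z" unfolding z(1) by (simp add: distrib_left)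
 qed
 then show ?thesis by simp
qed

text \<open>A competitor at uniform distance at most \<open>d / 4\<close> is also Skorokhod-close
  once \<open>exp (- real k)\<close> is small, so its value under \<open>f\<close> is near
  \<open>f x\<close>; a farther one pays a penalty of at least \<open>k d / 4\<close>, which exceeds
  the oscillation \<open>2 B\<close> of \<open>f\<close>.\<close>

lemma lip_min_tendsto:
 assumes x: "x \<in> cadlag_paths" and cont: "skor_continuous f"
 shows "(%k. lip_min f k x) \<longlonglongrightarrow> f x"
proof (rule LIMSEQ_I)
 fix e :: real assume e: "e > 0"
 obtain d where d: "d > 0" "!!y. y \<in> cadlag_paths ==> skor_dist x y < d ==> \<bar>f y - f x\<bar> < e / 2"
  using cont x e unfolding skor_continuous_def by (meson half_gt_zero)
 have "(%k. exp (- real k)) \<longlonglongrightarrow> 0"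
  by (intro filterlim_compose[OF exp_at_bot] filterlim_compose[OF filterlim_uminus_at_bot_at_top] filterlim_real_sequentially)
 then have "\<forall>\<^sub>F k in sequentially. exp (- real k) < d / 2" using d(1) by (intro order_tendstoD(2)) auto
 moreover have "\<forall>\<^sub>F k in sequentially. 2 * B + e < real k * (d / 4)"
 proof -
  obtain k0 :: nat where k0: "(2 * B + e) / (d / 4) < real k0" using reals_Archimedean2 by blast
  show ?thesis
  proof (rule eventually_sequentiallyI[of k0])
   fix k assume "k0 <= k"
   then have "(2 * B + e) / (d / 4) < real k" using k0 by simp
   then show "2 * B + e < real k * (d / 4)" using d(1) by (simp add: pos_divide_less_eq)
  qed
 qed
 ultimately have ev: "\<forall>\<^sub>F k in sequentially. exp (- real k) < d / 2 \<and> 2 * B + e < real k * (d / 4)" by (rule eventually_conj)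
 have "f x - e < lip_min f k x" if k: "exp (- real k) < d / 2" "2 * B + e < real k * (d / 4)" for k
 proof -
  have "f x - e / 2 <= lip_min f k x"
   unfolding lip_min_def
  proof (rule cInf_greatest)
   show "lip_set f k x ~= {}" using lip_set_self[OF x] by auto
   fix z assume "z \<in> lip_set f k x"
   then obtain y r where z: "z = f y + real k * r" "y \<in> cadlag_paths" "0 <= r" "\<forall>t\<in>{0..real k}. \<bar>x t - y t\<bar> <= r"
    unfolding lip_set_def by auto
   show "f x - e / 2 <= z"
   proof (cases "r <= d / 4")
    case True
    have "skor_dist x y <= r + exp (- real k)" using z by (intro skor_dist_close) auto
    also have "... < d" using True k d by linarith
    finally have "\<bar>f y - f x\<bar> < e / 2" using d(2) z(2) by blast
    moreover have "0 <= real k * r" using z by simp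
    ultimately show ?thesis unfolding z(1) by linarith
   next
    case False
    then have "real k * (d / 4) <= real k * r" by (intro mult_left_mono) auto
    then show ?thesis unfolding z(1) using k(2) B[OF x] B[OF z(2)] e by linarith
   qed
  qed
  then show ?thesis using e by linarith
 qed
 then have "\<forall>\<^sub>F k in sequentially. f x - e < lip_min f k x" using ev by (auto elim: eventually_mono)
 then show "\<exists>no. \<forall>n\<ge>no. norm (lip_min f n x - f x) < e"
  using lip_min_le[OF x] unfolding eventually_sequentially by (fastforce simp: abs_less_iff)
qed

text \<open>Lipschitz dependence on finitely many coordinates implies continuity for the product
  topology, hence measurability; together these are the hypotheses of
  \<open>lipschitz_conv\<close>.\<close>

lemma lip_min_step:
 fixes m k :: nat
 defines "H \<equiv> %v. lip_min f k (stepfun m k v)"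
 shows "!!v ww r. (!!j. j < Suc (m * k) ==> \<bar>v j - ww j\<bar> <= r) ==> r >= 0 ==> \<bar>H v - H ww\<bar> <= real k * r"
  "H \<in> borel_measurable borel" "!!v. \<bar>H v\<bar> <= B"
proof -
 show lip: "\<bar>H v - H ww\<bar> <= real k * r" if "!!j. j < Suc (m * k) ==> \<bar>v j - ww j\<bar> <= r" "r >= 0" for v ww r
 proof -
  have d: "\<bar>stepfun m k v t - stepfun m k ww t\<bar> <= r" for t
   using that(1)[OF le_imp_less_Suc[OF stepfun_idx]] unfolding stepfun_def path_from0_def .
  have d': "\<bar>stepfun m k ww t - stepfun m k v t\<bar> <= r" for t
   using d[of t] by (subst abs_minus_commute)
  have "H v <= H ww + real k * r" "H ww <= H v + real k * r"
   unfolding H_def by (intro lip_min_lipschitz stepfun_cadlag d d' that(2))+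
  then show ?thesis by linarith
 qed
 show "\<bar>H v\<bar> <= B" for v unfolding H_def by (intro lip_min_bound stepfun_cadlag)
 have "isCont H v" for v
  unfolding isCont_def
 proof (rule tendstoI)
  fix e :: real assume e: "e > 0"
  have "\<forall>\<^sub>F ww in at v. \<forall>j\<in>{..m*k}. dist (ww j) (v j) < e / (real k + 1)"
  proof (rule eventually_ball_finite)
   show "\<forall>j\<in>{..m*k}. \<forall>\<^sub>F ww in at v. dist (ww j) (v j) < e / (real k + 1)"
   proof
    fix j
    have "isCont (%x::nat => real. x j) v"
    proof -
     have "continuous_on UNIV (%x::nat => real. x j)" by simp
     then show ?thesis by (metis UNIV_I continuous_on_eq_continuous_at open_UNIV)
    qed
    then have "((%ww. ww j) \<longlongrightarrow> v j) (at v)" unfolding isCont_def .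
    then show "\<forall>\<^sub>F ww in at v. dist (ww j) (v j) < e / (real k + 1)" using e by (intro tendstoD) auto
   qed
  qed simp
  then show "\<forall>\<^sub>F ww in at v. dist (H ww) (H v) < e"
  proof (rule eventually_mono)
   fix ww assume ww: "\<forall>j\<in>{..m*k}. dist (ww j) (v j) < e / (real k + 1)"
   have "\<bar>H ww - H v\<bar> <= real k * (e / (real k + 1))"
   proof (rule lip)
    fix j assume "j < Suc (m * k)"
    then show "\<bar>ww j - v j\<bar> <= e / (real k + 1)" using ww by (auto simp: dist_real_def less_Suc_eq_le intro: less_imp_le)
   qed (use e in auto)
   also have "... < e" using e by (simp add: field_simps)
   finally show "dist (H ww) (H v) < e" by (simp add: dist_real_def)
  qed
 qed
 then show "H \<in> borel_measurable borel"
  by (intro borel_measurable_continuous_onI) (simp add: continuous_at_imp_continuous_on)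
qed

end

section \<open>Weak convergence from finite-dimensional laws and equicontinuity\<close>

lemma skor_continuous_measurable:
 assumes "skor_continuous f"
 shows "f \<in> borel_measurable skorokhod_borel"
proof (rule borel_measurableI_greater)
 fix a
 have "skor_open {x\<in>cadlag_paths. a < f x}"
  unfolding skor_open_def
 proof (intro conjI ballI)
  fix x assume x: "x \<in> {x\<in>cadlag_paths. a < f x}"
  then have "\<forall>e>0. \<exists>d>0. \<forall>y\<in>cadlag_paths. skor_dist x y < d \<longrightarrow> \<bar>f y - f x\<bar> < e" "f x - a > 0"
   using assms unfolding skor_continuous_def by auto
  then obtain d where d: "d > 0" "!!y. y \<in> cadlag_paths ==> skor_dist x y < d ==> \<bar>f y - f x\<bar> < f x - a"
   by blast
  have "a < f y" if "y \<in> cadlag_paths" "skor_dist x y < d" for y using d(2)[OF that] by linarith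
  then show "\<exists>e>0. \<forall>y\<in>cadlag_paths. skor_dist x y < e \<longrightarrow> y \<in> {x\<in>cadlag_paths. a < f x}" using d(1) by blast
 qed auto
 moreover have "space skorokhod_borel = cadlag_paths" "sets skorokhod_borel = sigma_sets cadlag_paths {U. skor_open U}"
 proof -
  have sub: "{U. skor_open U} \<subseteq> Pow cadlag_paths" by (auto simp: skor_open_def)
  show "space skorokhod_borel = cadlag_paths" "sets skorokhod_borel = sigma_sets cadlag_paths {U. skor_open U}"
   by (simp_all only: skorokhod_borel_def space_measure_of[OF sub] sets_measure_of[OF sub])
 qed
 ultimately show "{x \<in> space skorokhod_borel. a < f x} \<in> sets skorokhod_borel" by (auto intro: sigma_sets.Basic)
qed

text \<open>\<open>tight\<close> is equicontinuity in probability, measured against the step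
  interpolation on the grid of mesh \<open>1 / m\<close>; its quantifiers, first \<open>m\<close>
  and then \<open>n\<close>, follow the order in which \<open>lower_bound\<close> chooses
  parameters.\<close>

locale skor_conv = M: prob_space M + M': prob_space M'
 for M :: "'a measure" and M' :: "'b measure" +
 fixes X :: "nat => 'a => real => real" and Y :: "'b => real => real"
 assumes Xm: "!!n. X n \<in> M \<rightarrow>\<^sub>M skorokhod_borel" and Ym: "Y \<in> M' \<rightarrow>\<^sub>M skorokhod_borel"
  and Xcad: "!!n w. w \<in> space M ==> X n w \<in> cadlag_paths" and Ycad: "!!w. w \<in> space M' ==> Y w \<in> cadlag_paths"
  and Ycont: "!!w. w \<in> space M' ==> continuous_on {0..} (Y w)"
  and Xt: "!!n t. t >= 0 ==> (%w. X n w t) \<in> borel_measurable M" and Yt: "!!t. t >= 0 ==> (%w. Y w t) \<in> borel_measurable M'"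
  and fdd_cos: "!!m K \<theta>. m > 0 ==> (%n. LINT w|M. cos (\<Sum>j<K. \<theta> j * X n w (real j / real m))) \<longlonglongrightarrow> (LINT w|M'. cos (\<Sum>j<K. \<theta> j * Y w (real j / real m)))"
  and fdd_sin: "!!m K \<theta>. m > 0 ==> (%n. LINT w|M. sin (\<Sum>j<K. \<theta> j * X n w (real j / real m))) \<longlonglongrightarrow> (LINT w|M'. sin (\<Sum>j<K. \<theta> j * Y w (real j / real m)))"
  and tight: "!!T s d. 0 < s ==> 0 < d ==> \<exists>m0. \<forall>m\<ge>m0. \<exists>N. \<forall>n\<ge>N. \<exists>A\<in>sets M. measure M A <= d \<and>
    (\<forall>w\<in>space M - A. \<forall>t. 0 <= t \<and> t <= real T \<longrightarrow> \<bar>X n w t - X n w (real (nat \<lfloor>real m * t\<rfloor>) / real m)\<bar> <= s)"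
begin

text \<open>A chain of comparisons: \<open>f\<close> dominates its minorant; off an event of
  probability at most \<open>d\<close>, the minorant of the path is within \<open>k s\<close> of
  that of its step interpolation; and the latter converges in mean by \<open>lipschitz_conv\<close>.
  The horizon \<open>k\<close> is fixed first, from the limit law, then the mesh \<open>m\<close>,
  then \<open>n\<close>. Five errors of at most \<open>e / 8\<close> are spent.\<close>

lemma lower_bound:
 assumes cont: "skor_continuous f" and B: "!!x. x \<in> cadlag_paths ==> \<bar>f x\<bar> <= B" and e: "e > 0"
 shows "\<exists>N. \<forall>n\<ge>N. (LINT w|M. f (X n w)) >= (LINT w|M'. f (Y w)) - e"
proof -
 have B0: "B >= 0" using B[OF stepfun_cadlag[of 1 1 "%_. 0"]] by linarith
 define P where "P m k w = stepfun m k (%j. Y w (real j / real m))" for m k w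
 define PX where "PX m k n w = stepfun m k (%j. X n w (real j / real m))" for m k n w
 note fm [measurable] = skor_continuous_measurable[OF cont]
 have Hm: "(%w. lip_min f k (P m k w)) \<in> borel_measurable M'" for m k
 proof -
  have "(%w. (%j. Y w (real j / real m))) \<in> borel_measurable M'"
   by (rule measurable_coordinatewise_then_product) (auto intro: Yt)
  then show ?thesis unfolding P_def by (rule measurable_compose[OF _ lip_min_step(2)[OF B]])
 qed
 have Pconv: "(%m. lip_min f k (P m k w)) \<longlonglongrightarrow> lip_min f k (Y w)" if w: "w \<in> space M'" for k w
 proof (rule LIMSEQ_I)
  fix r :: real assume r: "r > 0"
  define r' where "r' = r / (real k + 1)"
  have r': "r' > 0" "real k * r' < r" unfolding r'_def using r by (auto simp: field_simps)
  have "uniformly_continuous_on {0..real k} (Y w)"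
   by (rule compact_uniformly_continuous) (auto intro: continuous_on_subset[OF Ycont[OF w]])
  then obtain d where d: "d > 0" "!!s t. s \<in> {0..real k} ==> t \<in> {0..real k} ==> dist s t < d ==> dist (Y w s) (Y w t) < r'"
   using r'(1) unfolding uniformly_continuous_on_def by metis
  obtain m0 :: nat where m0: "1 / real (Suc m0) < d" using d(1) nat_approx_posE by blast
  show "\<exists>no. \<forall>m\<ge>no. norm (lip_min f k (P m k w) - lip_min f k (Y w)) < r"
  proof (intro exI[of _ "Suc m0"] allI impI)
   fix m assume m: "m >= Suc m0"
   have c: "\<bar>P m k w t - Y w t\<bar> <= r'" if t: "0 <= t" "t <= real k" for t
   proof -
    define q where "q = real (nat \<lfloor>real m * t\<rfloor>) / real m"
    have m1: "real m > 0" using m by simp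
    have "real (nat \<lfloor>real m * t\<rfloor>) = of_int \<lfloor>real m * t\<rfloor>" using t by (simp add: of_nat_nat)
    then have "real (nat \<lfloor>real m * t\<rfloor>) <= real m * t" "real m * t < real (nat \<lfloor>real m * t\<rfloor>) + 1" by linarith+
    then have q: "q <= t" "t < q + 1 / real m" "0 <= q" unfolding q_def using m1 by (auto simp: field_simps)
    have "1 / real m <= 1 / real (Suc m0)" using m by (intro divide_left_mono) auto
    then have "dist q t < d" using q m0 unfolding dist_real_def by linarith
    then have "dist (Y w q) (Y w t) < r'" using q t by (intro d(2)) auto
    then show ?thesis unfolding P_def stepfun_eq[OF t] q_def[symmetric] dist_real_def by simp
   qed
   have "lip_min f k (P m k w) <= lip_min f k (Y w) + real k * r'"
    using c r'(1) unfolding P_def by (intro lip_min_lipschitz[OF B] stepfun_cadlag Ycad w) auto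
   moreover have "lip_min f k (Y w) <= lip_min f k (P m k w) + real k * r'"
    using c r'(1) unfolding P_def by (intro lip_min_lipschitz[OF B] stepfun_cadlag Ycad w) (auto simp: abs_minus_commute)
   ultimately show "norm (lip_min f k (P m k w) - lip_min f k (Y w)) < r" using r'(2) unfolding real_norm_def by linarith
  qed
 qed
 \<comment> \<open>Measurability of the minorant along \<open>Y\<close> is obtained as that of a
   pointwise limit of its values on step interpolations.\<close>
 have Ym': "(%w. lip_min f k (Y w)) \<in> borel_measurable M'" for k
  by (rule borel_measurable_LIMSEQ_real[OF Pconv Hm])
 have "(%k. LINT w|M'. lip_min f k (Y w)) \<longlonglongrightarrow> (LINT w|M'. f (Y w))"
 proof (rule integral_dominated_convergence[where w = "%_. B"])
  show "(%w. f (Y w)) \<in> borel_measurable M'" by (rule measurable_compose[OF Ym fm])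
  show "AE x in M'. (%k. lip_min f k (Y x)) \<longlonglongrightarrow> f (Y x)" by (intro AE_I2 lip_min_tendsto[OF B] Ycad cont)
  show "AE x in M'. norm (lip_min f k (Y x)) <= B" for k using lip_min_bound[OF B Ycad] by (intro AE_I2) auto
 qed (auto simp: Ym')
 then obtain k where k: "\<bar>(LINT w|M'. lip_min f k (Y w)) - (LINT w|M'. f (Y w))\<bar> < e / 8"
  using e LIMSEQ_D[of "%k. LINT w|M'. lip_min f k (Y w)" _ "e/8"] by (metis divide_pos_pos order_refl real_norm_def zero_less_numeral)
 have PE: "(%m. LINT w|M'. lip_min f k (P m k w)) \<longlonglongrightarrow> (LINT w|M'. lip_min f k (Y w))"
 proof (rule integral_dominated_convergence[where w = "%_. B"])
  show "AE x in M'. (%m. lip_min f k (P m k x)) \<longlonglongrightarrow> lip_min f k (Y x)" by (intro AE_I2 Pconv)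
  show "AE x in M'. norm (lip_min f k (P m k x)) <= B" for m
   using lip_min_bound[OF B stepfun_cadlag] unfolding P_def by (intro AE_I2) auto
 qed (auto simp: Ym' Hm)
 define s where "s = e / (8 * (real k + 1))"
 define d where "d = e / (16 * (B + 1))"
 have s: "s > 0" "real k * s <= e / 8" unfolding s_def using e by (auto simp: field_simps)
 have d: "d > 0" "2 * B * d <= e / 8" unfolding d_def using e B0 by (auto simp: field_simps)
 obtain m0 where m0: "!!m. m >= m0 ==> \<exists>N. \<forall>n\<ge>N. \<exists>A\<in>sets M. measure M A <= d \<and>
    (\<forall>w\<in>space M - A. \<forall>t. 0 <= t \<and> t <= real k \<longrightarrow> \<bar>X n w t - X n w (real (nat \<lfloor>real m * t\<rfloor>) / real m)\<bar> <= s)"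
  using tight[OF s(1) d(1), of k] by blast
 obtain m1 where m1: "!!m. m >= m1 ==> \<bar>(LINT w|M'. lip_min f k (P m k w)) - (LINT w|M'. lip_min f k (Y w))\<bar> < e / 8"
  using LIMSEQ_D[OF PE, of "e/8"] e by auto
 define m where "m = Suc (max m0 m1)"
 obtain N1 where N1: "!!n. n >= N1 ==> \<exists>A\<in>sets M. measure M A <= d \<and>
    (\<forall>w\<in>space M - A. \<forall>t. 0 <= t \<and> t <= real k \<longrightarrow> \<bar>X n w t - X n w (real (nat \<lfloor>real m * t\<rfloor>) / real m)\<bar> <= s)"
  using m0[of m] unfolding m_def by (meson le_SucI max.cobounded1)
 interpret V: vec_conv M M' "%n w j. X n w (real j / real m)" "%w j. Y w (real j / real m)"
  by unfold_locales (auto intro: Xt Yt)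
 have "int_conv M (%n w j. X n w (real j / real m)) M' (%w j. Y w (real j / real m)) (%v. lip_min f k (stepfun m k v))"
 proof (rule V.lipschitz_conv[where K = "Suc (m * k)" and B = B and C = "real k"])
  show "int_conv M (%n w j. X n w (real j / real m)) M' (%w j. Y w (real j / real m)) (%x. cos (\<Sum>j<Suc (m * k). \<theta> j * x j))" for \<theta>
   unfolding int_conv_def by (rule fdd_cos) (simp add: m_def)
  show "int_conv M (%n w j. X n w (real j / real m)) M' (%w j. Y w (real j / real m)) (%x. sin (\<Sum>j<Suc (m * k). \<theta> j * x j))" for \<theta>
   unfolding int_conv_def by (rule fdd_sin) (simp add: m_def)
  show "(%v. lip_min f k (stepfun m k v)) \<in> borel_measurable borel" by (rule lip_min_step(2)[OF B])
  show "\<bar>lip_min f k (stepfun m k x)\<bar> <= B" for x by (rule lip_min_step(3)[OF B])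
  show "\<bar>lip_min f k (stepfun m k x) - lip_min f k (stepfun m k y)\<bar> <= real k * r"
   if "!!j. j < Suc (m * k) ==> \<bar>x j - y j\<bar> <= r" "0 <= r" for x y r by (rule lip_min_step(1)[OF B that])
 qed
 then have "(%n. LINT w|M. lip_min f k (PX m k n w)) \<longlonglongrightarrow> (LINT w|M'. lip_min f k (P m k w))"
  unfolding int_conv_def P_def PX_def .
 then obtain N2 where N2: "!!n. n >= N2 ==> \<bar>(LINT w|M. lip_min f k (PX m k n w)) - (LINT w|M'. lip_min f k (P m k w))\<bar> < e / 8"
  using LIMSEQ_D[of "%n. LINT w|M. lip_min f k (PX m k n w)" _ "e/8"] e by auto
 show ?thesis
 proof (intro exI[of _ "max N1 N2"] allI impI)
  fix n assume n: "n >= max N1 N2"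
  obtain A where A: "A \<in> sets M" "measure M A <= d"
    "!!w t. w \<in> space M - A ==> 0 <= t ==> t <= real k ==> \<bar>X n w t - X n w (real (nat \<lfloor>real m * t\<rfloor>) / real m)\<bar> <= s"
   using N1[of n] n by auto
  have pw: "lip_min f k (PX m k n w) - real k * s - 2 * B * indicator A w <= f (X n w)" if w: "w \<in> space M" for w
  proof (cases "w \<in> A")
   case True
   have "lip_min f k (PX m k n w) <= B" "- B <= f (X n w)"
    using abs_le_D1[OF lip_min_bound[OF B stepfun_cadlag]] abs_le_D2[OF B[OF Xcad[OF w, of n]]] unfolding PX_def by auto
   moreover have "0 <= real k * s" using s by simp
   ultimately show ?thesis using True by simp
  next
   case False
   have "lip_min f k (PX m k n w) <= lip_min f k (X n w) + real k * s"
    unfolding PX_def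
   proof (rule lip_min_lipschitz[OF B stepfun_cadlag Xcad[OF w] less_imp_le[OF s(1)]])
    fix t assume t: "0 <= t" "t <= real k"
    show "\<bar>stepfun m k (%j. X n w (real j / real m)) t - X n w t\<bar> <= s"
     unfolding stepfun_eq[OF t] using A(3)[of w t] w False t by (simp add: abs_minus_commute)
   qed
   then show ?thesis using False lip_min_le[where f = f and k = k, OF B Xcad[OF w, of n]] by simp
  qed
  have I1: "integrable M (%w. lip_min f k (PX m k n w))"
  proof (rule M.integrable_const_bound[of _ B])
   have "(%w. (%j. X n w (real j / real m))) \<in> borel_measurable M"
    by (rule measurable_coordinatewise_then_product) (auto intro: Xt)
   then show "(%w. lip_min f k (PX m k n w)) \<in> borel_measurable M"
    unfolding PX_def by (rule measurable_compose[OF _ lip_min_step(2)[OF B]])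
   show "AE x in M. norm (lip_min f k (PX m k n x)) <= B"
    using lip_min_bound[OF B stepfun_cadlag] unfolding PX_def by (intro AE_I2) auto
  qed
  have I2: "integrable M (%w. f (X n w))"
   by (rule M.integrable_const_bound[of _ B]) (use measurable_compose[OF Xm fm] B Xcad in auto)
  have I3: "integrable M (%w. 2 * B * indicator A w :: real)" using A(1) by (intro integrable_mult_right) (auto simp: M.emeasure_eq_measure)
  have "(LINT w|M. lip_min f k (PX m k n w) - real k * s - 2 * B * indicator A w) <= (LINT w|M. f (X n w))"
   by (intro integral_mono I2 pw Bochner_Integration.integrable_diff I1 I3) auto
  also have "(LINT w|M. lip_min f k (PX m k n w) - real k * s - 2 * B * indicator A w)
    = (LINT w|M. lip_min f k (PX m k n w)) - real k * s - 2 * B * measure M A"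
   using I1 I3 sets.sets_into_space[OF A(1)] A(1) by (simp add: M.prob_space Int_absorb1 M.emeasure_eq_measure)
  finally have main: "(LINT w|M. lip_min f k (PX m k n w)) - real k * s - 2 * B * measure M A <= (LINT w|M. f (X n w))" .
  have "2 * B * measure M A <= 2 * B * d" using A(2) B0 by (intro mult_left_mono) auto
  moreover have "m >= m1" unfolding m_def by simp
  moreover have "n >= N2" using n by simp
  ultimately show "(LINT w|M. f (X n w)) >= (LINT w|M'. f (Y w)) - e"
   using main k m1[of m] N2[of n] s(2) d(2) e by linarith
 qed
qed

text \<open>One-sided bounds suffice, since \<open>f\<close> and its negative are both bounded and
  Skorokhod-continuous.\<close>

theorem weak_convergence: "conv_dist_skorokhod M X M' Y"
 unfolding conv_dist_skorokhod_def weak_conv_skorokhod_def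
proof (intro conjI allI impI Xm Ym)
 fix f assume "skor_continuous f \<and> bounded (f ` cadlag_paths)"
 then have f: "skor_continuous f" and "bounded (f ` cadlag_paths)" by auto
 then obtain B where B: "!!x. x \<in> cadlag_paths ==> \<bar>f x\<bar> <= B" unfolding bounded_real by auto
 have f': "skor_continuous (%x. - f x)" using f unfolding skor_continuous_def by (simp add: abs_minus_commute)
 have B': "\<bar>- f x\<bar> <= B" if "x \<in> cadlag_paths" for x using B[OF that] by simp
 note fm = skor_continuous_measurable[OF f]
 have e1: "integral\<^sup>L (distr M skorokhod_borel (X n)) f = (LINT w|M. f (X n w))" for n by (rule integral_distr[OF Xm fm])
 have e2: "integral\<^sup>L (distr M' skorokhod_borel Y) f = (LINT w|M'. f (Y w))" by (rule integral_distr[OF Ym fm])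
 show "(%n. integral\<^sup>L (distr M skorokhod_borel (X n)) f) \<longlonglongrightarrow> integral\<^sup>L (distr M' skorokhod_borel Y) f"
  unfolding e1 e2
 proof (rule LIMSEQ_I)
  fix r :: real assume r: "r > 0"
  obtain N1 where N1: "!!n. n >= N1 ==> (LINT w|M. f (X n w)) >= (LINT w|M'. f (Y w)) - r / 2"
   using lower_bound[OF f B, of "r/2"] r by auto
  obtain N2 where N2: "!!n. n >= N2 ==> (LINT w|M. - f (X n w)) >= (LINT w|M'. - f (Y w)) - r / 2"
   using lower_bound[OF f' B', of "r/2"] r by auto
  show "\<exists>no. \<forall>n\<ge>no. norm ((LINT w|M. f (X n w)) - (LINT w|M'. f (Y w))) < r"
  proof (intro exI[of _ "max N1 N2"] allI impI)
   fix n assume "n >= max N1 N2"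
   then show "norm ((LINT w|M. f (X n w)) - (LINT w|M'. f (Y w))) < r" using N1[of n] N2[of n] r by (simp add: abs_less_iff)
  qed
 qed
qed

end

section \<open>The limit process\<close>

lemma char_scale:
 assumes "X \<in> borel_measurable M"
 shows "char (distr M borel (%w. a * X w)) 1 = char (distr M borel X) a"
 using assms by (simp add: char_def integral_distr)

text \<open>Evaluation at 1 with free coefficients \<open>a k\<close> amounts to the joint
  characteristic function of the increments, which independence turns into a product.\<close>

lemma gaussian_martingale_char:
 fixes s :: "nat => real"
 assumes P: "prob_space M" and G: "gaussian_martingale M G g" and s: "mono s" "!!k. s k >= 0"
 shows "char (distr M borel (%w. \<Sum>k<n. a k * (G (s (Suc k)) w - G (s k) w))) 1
  = complex_of_real (exp (- (\<Sum>k<n. (a k)\<^sup>2 * (g (s (Suc k)) - g (s k))) / 2))"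
proof -
 interpret prob_space M by (rule P)
 have [measurable]: "G t \<in> borel_measurable M" if "t >= 0" for t using G that unfolding gaussian_martingale_def by blast
 have Gm: "(%w. G (s (Suc k)) w - G (s k) w) \<in> borel_measurable M" for k using s(2) by measurable
 define ts where "ts = map s [0..<Suc n]"
 have len: "length ts - 1 = n" unfolding ts_def by simp
 have nth: "ts ! k = s k" if "k <= n" for k unfolding ts_def using that by (simp add: less_Suc_eq_le del: upt_Suc)
 have "sorted ts" unfolding ts_def sorted_iff_nth_mono using s(1) by (auto simp: nth simp del: upt_Suc dest: monoD)
 moreover have "\<forall>t\<in>set ts. t >= 0" unfolding ts_def using s(2) by auto
 ultimately have "indep_vars (%_. borel) (%k w. G (ts ! (k+1)) w - G (ts ! k) w) {..<length ts - 1}"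
  using G unfolding gaussian_martingale_def by blast
 then have "indep_vars (%_. borel) (%k w. G (s (Suc k)) w - G (s k) w) {..<n}"
  unfolding len by (rule indep_vars_cong[THEN iffD1, rotated -1]) (auto simp: nth)
 then have "indep_vars (%_. borel) (%k w. a k * (G (s (Suc k)) w - G (s k) w)) {..<n}"
  by (rule indep_vars_compose2) simp
 then have "char (distr M borel (%w. \<Sum>k<n. a k * (G (s (Suc k)) w - G (s k) w))) 1
   = (\<Prod>k<n. char (distr M borel (%w. a k * (G (s (Suc k)) w - G (s k) w))) 1)"
  by (rule char_distr_sum)
 also have "... = (\<Prod>k<n. complex_of_real (exp (- ((g (s (Suc k)) - g (s k)) * (a k)\<^sup>2 / 2))))"
 proof (rule prod.cong)
  fix k
  have "s k <= s (Suc k)" using s(1) by (simp add: mono_def)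
  then show "char (distr M borel (%w. a k * (G (s (Suc k)) w - G (s k) w))) 1 = complex_of_real (exp (- ((g (s (Suc k)) - g (s k)) * (a k)\<^sup>2 / 2)))"
   unfolding char_scale[OF Gm] using G s(2)[of k] unfolding gaussian_martingale_def by blast
 qed simp
 also have "... = complex_of_real (exp (\<Sum>k<n. - ((g (s (Suc k)) - g (s k)) * (a k)\<^sup>2 / 2)))"
  by (simp add: exp_sum)
 also have "(\<Sum>k<n. - ((g (s (Suc k)) - g (s k)) * (a k)\<^sup>2 / 2)) = - (\<Sum>k<n. (a k)\<^sup>2 * (g (s (Suc k)) - g (s k))) / 2"
  by (simp add: sum_negf sum_divide_distrib mult.commute)
 finally show ?thesis .
qed

text \<open>The regimes of \<open>\<beta>\<close> are coded by two numbers \<open>b1\<close>,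
  \<open>b2\<close> in \<open>{0, 1}\<close>, so that all cases are treated at once.
  \<open>lamV\<close> covers \<open>lam = 0\<close>, where the bracket of \<open>G\<close> is 0 by
  the convention for division by zero.\<close>

locale ou_limit = prob_space M for M :: "'b measure" +
 fixes G B Nh :: "real => 'b => real" and b1 b2 lam V :: real
 assumes lam0: "lam >= 0" and lamV: "lam = 0 ==> V = 0"
  and b: "b1 = 0 \<or> b1 = 1" "b2 = 0 \<or> b2 = 1"
  and G: "gaussian_martingale M G (%t. V / (2 * lam) * (1 - exp (- 2 * lam * t)))"
  and B: "gaussian_martingale M B (%t. 1 - exp (- lam * t))"
  and indep: "indep_var (Pi\<^sub>M {0..} (%_. borel)) (%w. restrict (%t. G t w) {0..})
     (Pi\<^sub>M {0..} (%_. borel)) (%w. restrict (%t. B t w) {0..})"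
  and Nh_cont: "!!w. w \<in> space M ==> continuous_on {0..} (%t. Nh t w)"
  and Nh_eq: "!!w t. w \<in> space M ==> t >= 0 ==> Nh t w = - lam * integral {0..t} (%s. Nh s w) + b1 * G t w + b2 * B t w"
begin

definition U :: "real => 'b => real" where "U t w = b1 * G t w + b2 * B t w"

definition u :: "real => real" where "u t = b1 * (V / (2 * lam) * (1 - exp (- 2 * lam * t))) + b2 * (1 - exp (- lam * t))"

text \<open>The bracket of \<open>exp (lam * t) * Nh t\<close>: the integral of
  \<open>exp (2 * lam * s)\<close> against the bracket \<open>u\<close> of \<open>U\<close>, with
  the division by \<open>lam\<close> carried out.\<close>

definition q :: "real => real" where "q t = b1 * V * t + b2 * (exp (lam * t) - 1)"

lemma GB_meas: "t >= 0 ==> G t \<in> borel_measurable M" "t >= 0 ==> B t \<in> borel_measurable M"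
 using G B unfolding gaussian_martingale_def by blast+

lemma U_meas: "t >= 0 ==> U t \<in> borel_measurable M"
 unfolding U_def using GB_meas by measurable

text \<open>Independence of the whole paths of \<open>G\<close> and \<open>B\<close> descends to
  combinations of their increments, and the brackets add because \<open>b1\<close> and
  \<open>b2\<close> equal their squares.\<close>

lemma U_char:
 fixes s :: "nat => real"
 assumes s: "mono s" "!!k. s k >= 0"
 shows "(LINT w|M. iexp (\<Sum>k<n. a k * (U (s (Suc k)) w - U (s k) w)))
  = complex_of_real (exp (- (\<Sum>k<n. (a k)\<^sup>2 * (u (s (Suc k)) - u (s k))) / 2))"
proof -
 define f where "f c p = (\<Sum>k<n. (c * a k) * (p (s (Suc k)) - p (s k)))" for c and p :: "real => real"
 have fm: "f c \<in> borel_measurable (Pi\<^sub>M {0..} (%_. borel))" for c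
  unfolding f_def using s(2) by (intro borel_measurable_sum borel_measurable_times borel_measurable_diff measurable_component_singleton) auto
 have "indep_var borel (f b1 \<circ> (%w. restrict (%t. G t w) {0..})) borel (f b2 \<circ> (%w. restrict (%t. B t w) {0..}))"
  by (rule indep_var_compose[OF indep fm fm])
 then have ind: "indep_var borel (%w. f b1 (%t. G t w)) borel (%w. f b2 (%t. B t w))"
  unfolding f_def comp_def using s(2) by simp
 have e: "(\<Sum>k<n. a k * (U (s (Suc k)) w - U (s k) w)) = f b1 (%t. G t w) + f b2 (%t. B t w)" for w
  unfolding f_def U_def sum.distrib[symmetric] by (rule sum.cong) (simp_all add: algebra_simps)
 have m: "(%w. f b1 (%t. G t w)) \<in> borel_measurable M" "(%w. f b2 (%t. B t w)) \<in> borel_measurable M"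
  unfolding f_def using s(2) GB_meas by measurable
 have "(LINT w|M. iexp (\<Sum>k<n. a k * (U (s (Suc k)) w - U (s k) w))) = char (distr M borel (%w. f b1 (%t. G t w) + f b2 (%t. B t w))) 1"
  unfolding e using m by (simp add: char_def integral_distr)
 also have "... = char (distr M borel (%w. f b1 (%t. G t w))) 1 * char (distr M borel (%w. f b2 (%t. B t w))) 1"
  by (rule char_distr_add[OF ind])
 also have "... = complex_of_real (exp (- (\<Sum>k<n. (b1 * a k)\<^sup>2 * (V / (2 * lam) * (1 - exp (- 2 * lam * s (Suc k))) - V / (2 * lam) * (1 - exp (- 2 * lam * s k)))) / 2))
   * complex_of_real (exp (- (\<Sum>k<n. (b2 * a k)\<^sup>2 * ((1 - exp (- lam * s (Suc k))) - (1 - exp (- lam * s k)))) / 2))"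
  unfolding f_def by (simp only: gaussian_martingale_char[OF prob_space_axioms G s] gaussian_martingale_char[OF prob_space_axioms B s])
 also have "... = complex_of_real (exp (- (\<Sum>k<n. (a k)\<^sup>2 * (u (s (Suc k)) - u (s k))) / 2))"
 proof -
  have b2: "b1\<^sup>2 = b1" "b2\<^sup>2 = b2" using b by auto
  have "(\<Sum>k<n. (a k)\<^sup>2 * (u (s (Suc k)) - u (s k))) = (\<Sum>k<n. (b1 * a k)\<^sup>2 * (V / (2 * lam) * (1 - exp (- 2 * lam * s (Suc k))) - V / (2 * lam) * (1 - exp (- 2 * lam * s k))))
   + (\<Sum>k<n. (b2 * a k)\<^sup>2 * ((1 - exp (- lam * s (Suc k))) - (1 - exp (- lam * s k))))"
   unfolding sum.distrib[symmetric] power_mult_distrib b2 u_def by (rule sum.cong) (simp_all add: algebra_simps)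
  then show ?thesis unfolding of_real_mult[symmetric] exp_add[symmetric] by (simp add: add_divide_distrib)
 qed
 finally show ?thesis .
qed

definition Kp :: "real => 'b => real" where "Kp t w = exp (lam * t) * Nh t w"

text \<open>Variation of constants, path by path. As \<open>U\<close> is \<open>Nh\<close> plus
  \<open>lam\<close> times the integral of \<open>Nh\<close>, each weighted increment of
  \<open>U\<close> differs from the increment of \<open>Kp\<close> by a multiple of
  \<open>h \<epsilon> + h^2\<close>, with \<open>h\<close> the step and \<open>\<epsilon>\<close>
  bounding the oscillation of \<open>Nh\<close> over it. Summing \<open>d / h\<close> such errors
  leaves a small total.\<close>

lemma grid_conv:
 assumes w: "w \<in> space M" and a: "a >= 0" and d: "d >= 0"
 defines "s \<equiv> %R r. a + real r * (d / real R)"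
 shows "(%R. \<Sum>r<R. exp (lam * s R r) * (U (s R (Suc r)) w - U (s R r) w)) \<longlonglongrightarrow> Kp (a + d) w - Kp a w"
proof (rule LIMSEQ_I)
 fix e :: real assume e: "e > 0"
 let ?N = "%t. Nh t w"
 have cont: "continuous_on {a..a+d} ?N" using Nh_cont[OF w] by (rule continuous_on_subset) (use a in auto)
 obtain Bd where "\<forall>y\<in>?N ` {a..a+d}. norm y <= Bd"
  using compact_imp_bounded[OF compact_continuous_image[OF cont compact_Icc]] unfolding bounded_iff by blast
 then have Bd: "\<bar>?N t\<bar> <= Bd" if "t \<in> {a..a+d}" for t using that by simp
 have Bd0: "Bd >= 0" using Bd[of a] d by force
 define E where "E = exp (lam * (a + d))"
 define C where "C = E * (lam\<^sup>2 * d\<^sup>2 * exp (lam * d) * Bd)"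
 define \<epsilon> where "\<epsilon> = e / (2 * (E * (lam * d) + 1))"
 have E0: "E * (lam * d) >= 0" unfolding E_def using lam0 d by simp
 have \<epsilon>: "\<epsilon> > 0" "E * (lam * d) * \<epsilon> <= e / 2"
 proof -
  show "\<epsilon> > 0" unfolding \<epsilon>_def using e E0 by simp
  have "E * (lam * d) * \<epsilon> <= (E * (lam * d) + 1) * \<epsilon>" using \<open>\<epsilon> > 0\<close> by (intro mult_right_mono) auto
  also have "... = e / 2"
  proof -
   have "y * (e / (2 * y)) = e / 2" if "y ~= 0" for y using that by simp
   moreover have "E * (lam * d) + 1 ~= 0" using E0 by linarith
   ultimately show ?thesis unfolding \<epsilon>_def by blast
  qed
  finally show "E * (lam * d) * \<epsilon> <= e / 2" .
 qed
 have "uniformly_continuous_on {a..a+d} ?N" by (rule compact_uniformly_continuous[OF cont]) simp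
 then obtain \<delta> where \<delta>: "\<delta> > 0" "!!x y. x \<in> {a..a+d} ==> y \<in> {a..a+d} ==> dist x y < \<delta> ==> dist (?N x) (?N y) < \<epsilon>"
  using \<epsilon>(1) unfolding uniformly_continuous_on_def by metis
 obtain R0 :: nat where R0: "max (d / \<delta>) (2 * C / e) < real R0" using reals_Archimedean2 by blast
 show "\<exists>no. \<forall>R\<ge>no. norm ((\<Sum>r<R. exp (lam * s R r) * (U (s R (Suc r)) w - U (s R r) w)) - (Kp (a + d) w - Kp a w)) < e"
 proof (intro exI[of _ R0] allI impI)
  fix R assume R: "R >= R0"
  have dR0: "0 <= d / \<delta>" using d \<delta>(1) by simp
  have Rb: "d / \<delta> < real R" "2 * C / e < real R" "real R > 0" using R0 R dR0 by (auto simp: max_less_iff_conj intro: less_le_trans le_less_trans)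
  define h where "h = d / real R"
  have h: "h >= 0" "h < \<delta>" "real R * h = d" "h <= d"
  proof -
   show "h >= 0" unfolding h_def using d by simp
   show "h < \<delta>" unfolding h_def using Rb \<delta>(1) by (simp add: pos_divide_less_eq mult.commute)
   show "real R * h = d" unfolding h_def using Rb by simp
   have "1 <= real R" using Rb(3) by simp
   then show "h <= d" unfolding h_def using d divide_left_mono[of 1 "real R" d] by simp
  qed
  define t where "t r = s R r" for r
  have t: "t r = a + real r * h" for r unfolding t_def s_def h_def ..
  have tr: "t r \<in> {a..a+d}" if "r <= R" for r
  proof -
   have "real r * h <= real R * h" using that h by (intro mult_right_mono) auto
   then show ?thesis unfolding t using h by simp
  qed
  have tS: "t (Suc r) = t r + h" for r unfolding t by (simp add: algebra_simps)
  have trm: "\<bar>exp (lam * t r) * (U (t (Suc r)) w - U (t r) w) - (Kp (t (Suc r)) w - Kp (t r) w)\<bar> <= E * (lam * h * \<epsilon> + lam\<^sup>2 * h\<^sup>2 * exp (lam * d) * Bd)"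
   if r: "r < R" for r
  proof -
   let ?x = "t r" and ?y = "t (Suc r)"
   have xy: "?x \<in> {a..a+d}" "?y \<in> {a..a+d}" "?x <= ?y" using tr[of r] tr[of "Suc r"] r tS[of r] h by auto
   have x0: "0 <= ?x" "0 <= ?y" using xy a by auto
   have intN: "?N integrable_on {0..?y}" by (rule integrable_continuous_interval[OF continuous_on_subset[OF Nh_cont[OF w]]]) auto
   have intxy: "?N integrable_on {?x..?y}" by (rule integrable_continuous_interval[OF continuous_on_subset[OF cont]]) (use xy in auto)
   have "integral {0..?y} ?N = integral {0..?x} ?N + integral {?x..?y} ?N"
    using Henstock_Kurzweil_Integration.integral_combine[OF x0(1) xy(3) intN] by simp
   then have U: "U ?y w - U ?x w = ?N ?y - ?N ?x + lam * integral {?x..?y} ?N"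
    using Nh_eq[OF w x0(1)] Nh_eq[OF w x0(2)] unfolding U_def by (simp add: algebra_simps)
   have K: "Kp ?y w = exp (lam * ?x) * (exp (lam * h) * ?N ?y)" unfolding Kp_def tS by (simp add: distrib_left exp_add)
   have "exp (lam * ?x) * (U ?y w - U ?x w) - (Kp ?y w - Kp ?x w)
     = exp (lam * ?x) * (lam * (integral {?x..?y} ?N - h * ?N ?y) - (exp (lam * h) - 1 - lam * h) * ?N ?y)"
    unfolding U K by (simp add: Kp_def algebra_simps)
   also have "\<bar>...\<bar> <= E * (lam * (\<epsilon> * h) + ((lam * h)\<^sup>2 * exp (lam * d)) * Bd)"
    unfolding abs_mult[of "exp (lam * ?x)"]
   proof (rule mult_mono)
    show "\<bar>exp (lam * ?x)\<bar> <= E" unfolding E_def using xy lam0 by (simp add: mult_left_mono)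
    have "integral {?x..?y} ?N - h * ?N ?y = integral {?x..?y} (%z. ?N z - ?N ?y)"
     using intxy xy(3) tS[of r] by (subst Henstock_Kurzweil_Integration.integral_diff) auto
    also have "norm ... <= integral {?x..?y} (%z. \<epsilon>)"
    proof (rule integral_norm_bound_integral)
     show "(%z. ?N z - ?N ?y) integrable_on {?x..?y}" by (intro Henstock_Kurzweil_Integration.integrable_diff intxy) auto
     fix z assume z: "z \<in> {?x..?y}"
     then have "dist z ?y < \<delta>" using h tS[of r] unfolding dist_real_def by auto
     then have "dist (?N z) (?N ?y) < \<epsilon>" using z xy by (intro \<delta>(2)) auto
     then show "norm (?N z - ?N ?y) <= \<epsilon>" by (simp add: dist_real_def)
    qed auto
    also have "... = \<epsilon> * h" using xy(3) tS[of r] by simp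
    finally have i: "\<bar>integral {?x..?y} ?N - h * ?N ?y\<bar> <= \<epsilon> * h" by simp
    have "\<bar>exp (lam * h) - 1 - lam * h\<bar> <= (lam * h)\<^sup>2 * exp \<bar>lam * h\<bar>" by (rule exp_taylor_bounds)
    also have "... <= (lam * h)\<^sup>2 * exp (lam * d)" using h lam0 by (intro mult_left_mono) (auto simp: abs_mult mult_left_mono)
    finally have "\<bar>exp (lam * h) - 1 - lam * h\<bar> * \<bar>?N ?y\<bar> <= ((lam * h)\<^sup>2 * exp (lam * d)) * Bd"
     using Bd[OF xy(2)] by (intro mult_mono) auto
    moreover have "lam * \<bar>integral {?x..?y} ?N - h * ?N ?y\<bar> <= lam * (\<epsilon> * h)" using i lam0 by (rule mult_left_mono)
    ultimately show "\<bar>lam * (integral {?x..?y} ?N - h * ?N ?y) - (exp (lam * h) - 1 - lam * h) * ?N ?y\<bar> <= lam * (\<epsilon> * h) + ((lam * h)\<^sup>2 * exp (lam * d)) * Bd"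
     using lam0 by (intro order_trans[OF abs_triangle_ineq4]) (simp add: abs_mult)
   qed (auto simp: E_def)
   finally show ?thesis by (simp add: power_mult_distrib mult_ac)
  qed
  have tele: "(\<Sum>r<R. Kp (t (Suc r)) w - Kp (t r) w) = Kp (a + d) w - Kp a w"
   using sum_lessThan_telescope[of "%r. Kp (t r) w" R] by (simp add: t h(3))
  have "\<bar>(\<Sum>r<R. exp (lam * t r) * (U (t (Suc r)) w - U (t r) w)) - (Kp (a + d) w - Kp a w)\<bar>
    = \<bar>\<Sum>r<R. exp (lam * t r) * (U (t (Suc r)) w - U (t r) w) - (Kp (t (Suc r)) w - Kp (t r) w)\<bar>"
   unfolding tele[symmetric] sum_subtractf ..
  also have "... <= (\<Sum>r<R. E * (lam * h * \<epsilon> + lam\<^sup>2 * h\<^sup>2 * exp (lam * d) * Bd))"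
   by (rule order_trans[OF sum_abs]) (intro sum_mono trm, simp)
  also have "... = E * (lam * d) * \<epsilon> + C / real R"
   using Rb(3) unfolding C_def h_def by (simp add: field_simps power2_eq_square)
  also have "... < e / 2 + e / 2"
  proof (rule add_le_less_mono[OF \<epsilon>(2)])
   show "C / real R < e / 2" using Rb e by (simp add: field_simps)
  qed
  finally show "norm ((\<Sum>r<R. exp (lam * s R r) * (U (s R (Suc r)) w - U (s R r) w)) - (Kp (a + d) w - Kp a w)) < e"
   unfolding t_def by simp
 qed
qed

lemma Nh_0: "w \<in> space M ==> Nh 0 w = 0"
 using Nh_eq[of w 0] G B unfolding gaussian_martingale_def by simp

text \<open>\<open>Nh\<close> is given as a pathwise solution; its measurability follows because it
  is a pointwise limit of finite combinations of values of \<open>G\<close> and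
  \<open>B\<close>.\<close>

lemma Nh_meas: "t >= 0 ==> Nh t \<in> borel_measurable M"
proof -
 assume t: "t >= 0"
 have "(%w. Kp t w) \<in> borel_measurable M"
 proof (rule borel_measurable_LIMSEQ_real)
  show "(%R. \<Sum>r<R. exp (lam * (0 + real r * (t / real R))) * (U (0 + real (Suc r) * (t / real R)) w - U (0 + real r * (t / real R)) w)) \<longlonglongrightarrow> Kp t w"
   if "w \<in> space M" for w
   using grid_conv[OF that order_refl t] Nh_0[OF that] by (simp add: Kp_def)
  show "(%w. \<Sum>r<R. exp (lam * (0 + real r * (t / real R))) * (U (0 + real (Suc r) * (t / real R)) w - U (0 + real r * (t / real R)) w)) \<in> borel_measurable M" for R
   using t by (intro borel_measurable_sum borel_measurable_times borel_measurable_diff U_meas) auto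
 qed
 then have "(%w. exp (- (lam * t)) * Kp t w) \<in> borel_measurable M" by measurable
 also have "(%w. exp (- (lam * t)) * Kp t w) = Nh t" unfolding Kp_def by (auto simp: exp_minus)
 finally show ?thesis .
qed

text \<open>Each summand splits into a part that is the same for all \<open>r\<close>, leading to
  \<open>R (1 - exp (- x / R))\<close> with limit \<open>x\<close>, and a part that telescopes up to
  a factor tending to 1.\<close>

lemma variance_conv:
 fixes a d :: real
 assumes d: "d >= 0"
 defines "s \<equiv> %R r. a + real r * (d / real R)"
 shows "(%R. \<Sum>r<R. (exp (lam * s R r))\<^sup>2 * (u (s R (Suc r)) - u (s R r))) \<longlonglongrightarrow> q (a + d) - q a"
proof -
 have lim1: "(%R. real R * (1 - exp (- (x / real R)))) \<longlonglongrightarrow> x" if x: "x >= 0" for x :: real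
 proof (rule LIMSEQ_I)
  fix e :: real assume e: "e > 0"
  obtain R0 :: nat where R0: "x\<^sup>2 * exp x / e < real R0" using reals_Archimedean2 by blast
  show "\<exists>no. \<forall>R\<ge>no. norm (real R * (1 - exp (- (x / real R))) - x) < e"
  proof (intro exI[of _ R0] allI impI)
   fix R assume R: "R >= R0"
   have nn: "0 <= x\<^sup>2 * exp x / e" using e by simp
   have Rp: "real R > 0" "x\<^sup>2 * exp x / e < real R" using R0 R nn by (auto intro: less_le_trans le_less_trans)
   define y where "y = - (x / real R)"
   have "real R * (1 - exp y) - x = - real R * (exp y - 1 - y)" unfolding y_def using Rp by (simp add: field_simps)
   also have "\<bar>...\<bar> <= real R * (y\<^sup>2 * exp \<bar>y\<bar>)"
    unfolding abs_mult using exp_taylor_bounds(2)[of y] by (simp add: mult_left_mono)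
   also have "... <= real R * (y\<^sup>2 * exp x)"
   proof -
    have "1 <= real R" using Rp(1) by simp
    then have "\<bar>y\<bar> <= x" unfolding y_def using x divide_left_mono[of 1 "real R" x] by simp
    then show ?thesis by (intro mult_left_mono) auto
   qed
   also have "... = x\<^sup>2 * exp x / real R" unfolding y_def using Rp by (simp add: power2_eq_square field_simps)
   also have "... < e" using Rp e by (simp add: field_simps)
   finally show "norm (real R * (1 - exp (- (x / real R))) - x) < e" unfolding y_def by simp
  qed
 qed
 have ev: "\<forall>\<^sub>F R in sequentially. b1 * (V / (2 * lam)) * (real R * (1 - exp (- (2 * lam * d / real R)))) + b2 * (exp (- (lam * (d / real R))) * (exp (lam * (a + d)) - exp (lam * a)))
   = (\<Sum>r<R. (exp (lam * s R r))\<^sup>2 * (u (s R (Suc r)) - u (s R r)))"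
 proof (rule eventually_sequentiallyI[of 1])
  fix R :: nat assume R: "1 <= R"
  define h where "h = d / real R"
  have sR: "s R r = a + real r * h" for r unfolding s_def h_def ..
  have hR: "real R * h = d" unfolding h_def using R by simp
  have sS: "s R (Suc r) = s R r + h" for r unfolding sR by (simp add: algebra_simps)
  have "(exp (lam * s R r))\<^sup>2 * (u (s R (Suc r)) - u (s R r)) = b1 * (V / (2 * lam)) * (1 - exp (- (2 * lam * h)))
    + b2 * exp (- (lam * h)) * (exp (lam * s R (Suc r)) - exp (lam * s R r))" for r
  proof -
   define x where "x = s R r"
   have 1: "(exp (lam * x))\<^sup>2 * exp (- 2 * lam * x) = 1" by (simp add: power2_eq_square exp_add[symmetric])
   have 2: "(exp (lam * x))\<^sup>2 * exp (- 2 * lam * (x + h)) = exp (- (2 * lam * h))" by (simp add: power2_eq_square exp_add[symmetric] algebra_simps)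
   have 3: "(exp (lam * x))\<^sup>2 * exp (- lam * x) = exp (lam * x)" by (simp add: power2_eq_square exp_add[symmetric])
   have 4: "(exp (lam * x))\<^sup>2 * exp (- lam * (x + h)) = exp (- (lam * h)) * exp (lam * x)" by (simp add: power2_eq_square exp_add[symmetric] algebra_simps)
   have 5: "exp (- (lam * h)) * exp (lam * (x + h)) = exp (lam * x)" by (simp add: exp_add[symmetric] algebra_simps)
   have "(exp (lam * x))\<^sup>2 * (u (x + h) - u x) = b1 * (V / (2 * lam)) * ((exp (lam * x))\<^sup>2 * exp (- 2 * lam * x) - (exp (lam * x))\<^sup>2 * exp (- 2 * lam * (x + h)))
     + b2 * ((exp (lam * x))\<^sup>2 * exp (- lam * x) - (exp (lam * x))\<^sup>2 * exp (- lam * (x + h)))"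
    unfolding u_def by (simp add: algebra_simps)
   also have "... = b1 * (V / (2 * lam)) * (1 - exp (- (2 * lam * h))) + b2 * (exp (- (lam * h)) * exp (lam * (x + h)) - exp (- (lam * h)) * exp (lam * x))"
    unfolding 1 2 3 4 5 ..
   finally show ?thesis unfolding sS x_def[symmetric] by (simp add: algebra_simps)
  qed
  then have "(\<Sum>r<R. (exp (lam * s R r))\<^sup>2 * (u (s R (Suc r)) - u (s R r))) = (\<Sum>r<R. b1 * (V / (2 * lam)) * (1 - exp (- (2 * lam * h))))
    + b2 * exp (- (lam * h)) * (\<Sum>r<R. exp (lam * s R (Suc r)) - exp (lam * s R r))"
   by (simp add: sum.distrib sum_distrib_left)
  also have "(\<Sum>r<R. exp (lam * s R (Suc r)) - exp (lam * s R r)) = exp (lam * (a + d)) - exp (lam * a)"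
   using sum_lessThan_telescope[of "%r. exp (lam * s R r)" R] by (simp add: sR hR)
  finally show "b1 * (V / (2 * lam)) * (real R * (1 - exp (- (2 * lam * d / real R)))) + b2 * (exp (- (lam * (d / real R))) * (exp (lam * (a + d)) - exp (lam * a)))
   = (\<Sum>r<R. (exp (lam * s R r))\<^sup>2 * (u (s R (Suc r)) - u (s R r)))"
   unfolding h_def by (simp add: mult_ac)
 qed
 have l2: "(%R. exp (- (lam * (d / real R)))) \<longlonglongrightarrow> exp (- (lam * 0))"
  by (intro tendsto_intros lim_const_over_n)
 have "(%R. b1 * (V / (2 * lam)) * (real R * (1 - exp (- (2 * lam * d / real R)))) + b2 * (exp (- (lam * (d / real R))) * (exp (lam * (a + d)) - exp (lam * a))))
   \<longlonglongrightarrow> b1 * (V / (2 * lam)) * (2 * lam * d) + b2 * (exp (- (lam * 0)) * (exp (lam * (a + d)) - exp (lam * a)))"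
  using d lam0 by (intro tendsto_add tendsto_mult tendsto_const lim1 l2) auto
 \<comment> \<open>For \<open>lam = 0\<close> the left side is 0 by division by zero, and
   \<open>lamV\<close> makes the right side 0 as well.\<close>
 also have "b1 * (V / (2 * lam)) * (2 * lam * d) + b2 * (exp (- (lam * 0)) * (exp (lam * (a + d)) - exp (lam * a))) = q (a + d) - q a"
  unfolding q_def using lamV by (cases "lam = 0") (simp_all add: algebra_simps)
 finally show ?thesis using ev by (rule Lim_transform_eventually)
qed

text \<open>Every cell is refined by \<open>R\<close> points; the weight \<open>al\<close> combines
  the coefficient of the cell, found by \<open>k div R\<close>, with the exponential at the point.
  \<open>grid_conv\<close> with dominated convergence identifies the limit of the characteristic
  functions, \<open>variance_conv\<close> that of the variances.\<close>

theorem increments_char: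
 assumes m: "m > 0"
 shows "(LINT w|M. iexp (\<Sum>l<L. \<theta> l * (Kp (real (Suc l) / real m) w - Kp (real l / real m) w)))
  = complex_of_real (exp (- (\<Sum>l<L. (\<theta> l)\<^sup>2 * (q (real (Suc l) / real m) - q (real l / real m))) / 2))"
proof -
 define d where "d = 1 / real m"
 have d: "d >= 0" unfolding d_def by simp
 let ?s = "%R l r. real l * d + real r * (d / real R)"
 define s where "s R k = real k * (d / real R)" for R k :: nat
 define al where "al R k = \<theta> (k div R) * exp (lam * s R k)" for R k
 have sm: "mono (s R)" "s R k >= 0" for R k unfolding s_def using d by (intro monoI mult_right_mono mult_nonneg_nonneg divide_nonneg_nonneg; simp)+
 have e: "real (Suc l) / real m = real l * d + d" "real l / real m = real l * d" for l unfolding d_def by (simp_all add: add_divide_distrib)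
 have sg: "s R (l * R + r) = ?s R l r" if "R > 0" for R l r
  unfolding s_def using that by (simp add: field_simps)
 have grp: "(\<Sum>k<L*R. F (al R k) (s R (Suc k)) (s R k)) = (\<Sum>l<L. \<Sum>r<R. F (\<theta> l * exp (lam * (?s R l r))) (?s R l (Suc r)) (?s R l r))"
  if R: "R > 0" for R and F :: "real => real => real => real"
 proof -
  have "(\<Sum>k<L*R. F (al R k) (s R (Suc k)) (s R k)) = (\<Sum>l<L. \<Sum>k\<in>{l*R..<l*R+R}. F (al R k) (s R (Suc k)) (s R k))"
   by (rule sum.nat_group[symmetric])
  also have "... = (\<Sum>l<L. \<Sum>r<R. F (al R (l*R+r)) (s R (Suc (l*R+r))) (s R (l*R+r)))"
  proof (rule sum.cong[OF refl])
   fix l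
   have "(\<Sum>k\<in>{l*R..<l*R+R}. g k) = (\<Sum>r<R. g (l*R+r))" for g :: "nat => real"
    using sum.shift_bounds_nat_ivl[of g 0 "l*R" R] by (simp add: add.commute lessThan_atLeast0)
   then show "(\<Sum>k\<in>{l*R..<l*R+R}. F (al R k) (s R (Suc k)) (s R k)) = (\<Sum>r<R. F (al R (l*R+r)) (s R (Suc (l*R+r))) (s R (l*R+r)))" .
  qed
  also have "... = (\<Sum>l<L. \<Sum>r<R. F (\<theta> l * exp (lam * (?s R l r))) (?s R l (Suc r)) (?s R l r))"
  proof (intro sum.cong refl)
   fix l r assume r: "r \<in> {..<R}"
   have "(l * R + r) div R = l" using r R by simp
   then show "F (al R (l*R+r)) (s R (Suc (l*R+r))) (s R (l*R+r)) = F (\<theta> l * exp (lam * (?s R l r))) (?s R l (Suc r)) (?s R l r)"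
    unfolding al_def using sg[OF R, of l r] sg[OF R, of l "Suc r"] by simp
  qed
  finally show ?thesis .
 qed
 define W where "W R w = (\<Sum>k<L*R. al R k * (U (s R (Suc k)) w - U (s R k) w))" for R w
 have Wm: "W R \<in> borel_measurable M" for R
  unfolding W_def using sm by (intro borel_measurable_sum borel_measurable_times borel_measurable_diff U_meas) auto
 have Wlim: "(%R. W R w) \<longlonglongrightarrow> (\<Sum>l<L. \<theta> l * (Kp (real (Suc l) / real m) w - Kp (real l / real m) w))" if w: "w \<in> space M" for w
 proof -
  have "(%R. \<Sum>l<L. \<theta> l * (\<Sum>r<R. exp (lam * (?s R l r)) * (U (?s R l (Suc r)) w - U (?s R l r) w)))
   \<longlonglongrightarrow> (\<Sum>l<L. \<theta> l * (Kp (real l * d + d) w - Kp (real l * d) w))"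
   using d by (intro tendsto_sum tendsto_mult tendsto_const grid_conv w) auto
  moreover have "\<forall>\<^sub>F R in sequentially. (\<Sum>l<L. \<theta> l * (\<Sum>r<R. exp (lam * (?s R l r)) * (U (?s R l (Suc r)) w - U (?s R l r) w))) = W R w"
  proof (rule eventually_sequentiallyI[of 1])
   fix R :: nat assume "1 <= R"
   then have "R > 0" by simp
   from grp[OF this, of "%c x y. c * (U x w - U y w)"]
   show "(\<Sum>l<L. \<theta> l * (\<Sum>r<R. exp (lam * (?s R l r)) * (U (?s R l (Suc r)) w - U (?s R l r) w))) = W R w"
    unfolding W_def by (simp only: sum_distrib_left mult.assoc)
  qed
  ultimately show ?thesis unfolding e(1) unfolding e(2) by (rule Lim_transform_eventually)
 qed
 let ?L = "%w. \<Sum>l<L. \<theta> l * (Kp (real (Suc l) / real m) w - Kp (real l / real m) w)"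
 have Lm: "?L \<in> borel_measurable M" by (rule borel_measurable_LIMSEQ_real[OF Wlim Wm])
 have "(%R. LINT w|M. iexp (W R w)) \<longlonglongrightarrow> (LINT w|M. iexp (?L w))"
 proof (rule integral_dominated_convergence[where w = "%_. 1"])
  show "AE x in M. (%R. iexp (W R x)) \<longlonglongrightarrow> iexp (?L x)" by (intro AE_I2 tendsto_intros Wlim)
  show "(%w. iexp (?L w)) \<in> borel_measurable M" by (rule measurable_compose[OF Lm]) measurable
  show "(%w. iexp (W R w)) \<in> borel_measurable M" for R by (rule measurable_compose[OF Wm]) measurable
 qed auto
 moreover have "(%R. LINT w|M. iexp (W R w)) \<longlonglongrightarrow> complex_of_real (exp (- (\<Sum>l<L. (\<theta> l)\<^sup>2 * (q (real (Suc l) / real m) - q (real l / real m))) / 2))"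
 proof -
  have Wc: "(LINT w|M. iexp (W R w)) = complex_of_real (exp (- (\<Sum>k<L*R. (al R k)\<^sup>2 * (u (s R (Suc k)) - u (s R k))) / 2))" for R
   unfolding W_def by (rule U_char[OF sm])
  have "(%R. \<Sum>l<L. (\<theta> l)\<^sup>2 * (\<Sum>r<R. (exp (lam * (?s R l r)))\<^sup>2 * (u (?s R l (Suc r)) - u (?s R l r))))
   \<longlonglongrightarrow> (\<Sum>l<L. (\<theta> l)\<^sup>2 * (q (real l * d + d) - q (real l * d)))"
   using d by (intro tendsto_sum tendsto_mult tendsto_const variance_conv) auto
  moreover have "\<forall>\<^sub>F R in sequentially. (\<Sum>l<L. (\<theta> l)\<^sup>2 * (\<Sum>r<R. (exp (lam * (?s R l r)))\<^sup>2 * (u (?s R l (Suc r)) - u (?s R l r))))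
   = (\<Sum>k<L*R. (al R k)\<^sup>2 * (u (s R (Suc k)) - u (s R k)))"
  proof (rule eventually_sequentiallyI[of 1])
   fix R :: nat assume "1 <= R"
   then have "R > 0" by simp
   from grp[OF this, of "%c x y. c\<^sup>2 * (u x - u y)"]
   show "(\<Sum>l<L. (\<theta> l)\<^sup>2 * (\<Sum>r<R. (exp (lam * (?s R l r)))\<^sup>2 * (u (?s R l (Suc r)) - u (?s R l r))))
   = (\<Sum>k<L*R. (al R k)\<^sup>2 * (u (s R (Suc k)) - u (s R k)))"
    by (simp only: sum_distrib_left mult.assoc power_mult_distrib)
  qed
  ultimately have "(%R. \<Sum>k<L*R. (al R k)\<^sup>2 * (u (s R (Suc k)) - u (s R k))) \<longlonglongrightarrow> (\<Sum>l<L. (\<theta> l)\<^sup>2 * (q (real (Suc l) / real m) - q (real l / real m)))"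
   unfolding e(1) unfolding e(2) by (rule Lim_transform_eventually)
  then show ?thesis unfolding Wc by (intro tendsto_of_real tendsto_exp tendsto_divide tendsto_minus tendsto_const) auto
 qed
 ultimately show ?thesis by (rule LIMSEQ_unique)
qed

end

section \<open>Conditionally independent default times\<close>

lemma sum_PiE_Suc:
 fixes f :: "(nat => nat) => 'z::comm_monoid_add"
 assumes "finite A"
 shows "(\<Sum>J\<in>{..<Suc n} \<rightarrow>\<^sub>E A. f J) = (\<Sum>y\<in>A. \<Sum>g\<in>{..<n} \<rightarrow>\<^sub>E A. f (g(n := y)))"
proof -
 have "(\<Sum>J\<in>{..<Suc n} \<rightarrow>\<^sub>E A. f J) = (\<Sum>J\<in>(%(y, g). g(n := y)) ` (A \<times> ({..<n} \<rightarrow>\<^sub>E A)). f J)"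
  unfolding lessThan_Suc PiE_insert_eq ..
 also have "... = (\<Sum>(y, g)\<in>A \<times> ({..<n} \<rightarrow>\<^sub>E A). f (g(n := y)))"
  by (subst sum.reindex) (auto intro!: inj_combinator sum.cong)
 also have "... = (\<Sum>y\<in>A. \<Sum>g\<in>{..<n} \<rightarrow>\<^sub>E A. f (g(n := y)))"
  by (rule sum.cartesian_product[symmetric])
 finally show ?thesis .
qed

text \<open>Mean of \<open>f\<close> at a sum of \<open>n\<close> independent terms with law
  \<open>p\<close> on \<open>A\<close> and values \<open>\<xi>\<close>. Written as a finite sum over
  index maps, it is an ordinary number for each path of the chain and requires no product
  measure.\<close>

definition prodmean :: "nat set => (nat => real) => (nat => real) => nat => (real => real) => real" where
 "prodmean A p \<xi> n f = (\<Sum>J\<in>{..<n} \<rightarrow>\<^sub>E A. (\<Prod>i<n. p (J i)) * f (\<Sum>i<n. \<xi> (J i)))"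

lemma prodmean_Suc:
 assumes "finite A"
 shows "prodmean A p \<xi> (Suc n) f = (\<Sum>y\<in>A. p y * prodmean A p \<xi> n (%x. f (x + \<xi> y)))"
 unfolding prodmean_def sum_PiE_Suc[OF assms] sum_distrib_left
proof (intro sum.cong refl)
 fix y and g :: "nat => nat"
 have "(\<Prod>i<n. p ((g(n := y)) i)) = (\<Prod>i<n. p (g i))" "(\<Sum>i<n. \<xi> ((g(n := y)) i)) = (\<Sum>i<n. \<xi> (g i))"
  by (rule prod.cong sum.cong; simp)+
 then show "(\<Prod>i<Suc n. p ((g(n := y)) i)) * f (\<Sum>i<Suc n. \<xi> ((g(n := y)) i)) = p y * ((\<Prod>i<n. p (g i)) * f ((\<Sum>i<n. \<xi> (g i)) + \<xi> y))"
  by (simp add: mult_ac)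
qed

lemma prodmean_add: "prodmean A p \<xi> n (%x. f x + g x) = prodmean A p \<xi> n f + prodmean A p \<xi> n g"
 unfolding prodmean_def by (simp add: distrib_left sum.distrib)

lemma prodmean_cmult: "prodmean A p \<xi> n (%x. c * f x) = c * prodmean A p \<xi> n f"
 unfolding prodmean_def by (simp add: sum_distrib_left mult_ac)

text \<open>Adding one term turns the fourth moment \<open>m4\<close> into
  \<open>m4 + 6 n v^2\<close> plus the fourth moment of a single term, since odd contributions
  vanish for centred \<open>\<xi>\<close>. The bound 1 on \<open>\<xi>\<close> makes the last part
  at most \<open>v\<close>, and \<open>6 n <= 3 (n + 1)^2 - 3 n^2\<close>.\<close>

lemma prodmean_moments:
 assumes A: "finite A" and p: "!!j. j \<in> A ==> 0 <= p j" "(\<Sum>j\<in>A. p j) = 1"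
  and \<xi>: "(\<Sum>j\<in>A. p j * \<xi> j) = 0" "!!j. j \<in> A ==> \<bar>\<xi> j\<bar> <= 1"
 defines "v \<equiv> \<Sum>j\<in>A. p j * (\<xi> j)\<^sup>2"
 shows "prodmean A p \<xi> n (%_. 1) = 1" "prodmean A p \<xi> n (%x. x) = 0" "prodmean A p \<xi> n (%x. x\<^sup>2) = real n * v"
  "prodmean A p \<xi> n (%x. x^4) <= 3 * (real n)\<^sup>2 * v\<^sup>2 + real n * v"
proof -
 let ?E = "prodmean A p \<xi>"
 have c: "?E n (%_. c) = c * ?E n (%_. 1)" for n c using prodmean_cmult[of A p \<xi> n c "%_. 1"] by simp
 show one: "?E n (%_. 1) = 1" for n
 proof (induction n)
  case 0 show ?case by (simp add: prodmean_def)
 next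
  case (Suc n) then show ?case using p by (simp add: prodmean_Suc[OF A])
 qed
 show m1: "?E n (%x. x) = 0" for n
 proof (induction n)
  case 0 show ?case by (simp add: prodmean_def)
 next
  case (Suc n) then show ?case using \<xi> by (simp add: prodmean_Suc[OF A] prodmean_add c[of n] one)
 qed
 show m2: "?E n (%x. x\<^sup>2) = real n * v" for n
 proof (induction n)
  case 0 show ?case by (simp add: prodmean_def)
 next
  case (Suc n)
  have "?E n (%x. (x + y)\<^sup>2) = ?E n (%x. x\<^sup>2) + y\<^sup>2" for y
  proof -
   have "(%x::real. (x + y)\<^sup>2) = (%x. x\<^sup>2 + (2 * y) * x + y\<^sup>2)" by (simp add: power2_sum fun_eq_iff algebra_simps)
   then show ?thesis using m1[of n] one[of n] by (simp add: prodmean_add prodmean_cmult c[of n "y\<^sup>2"])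
  qed
  then have "?E (Suc n) (%x. x\<^sup>2) = (\<Sum>y\<in>A. p y * (real n * v) + p y * (\<xi> y)\<^sup>2)"
   unfolding prodmean_Suc[OF A] Suc.IH[symmetric] by (simp add: distrib_left)
  also have "... = real n * v + v" using p unfolding sum.distrib v_def sum_distrib_right[symmetric] by simp
  finally show ?case by (simp add: algebra_simps)
 qed
 show "?E n (%x. x^4) <= 3 * (real n)\<^sup>2 * v\<^sup>2 + real n * v"
 proof (induction n)
  case 0 show ?case by (simp add: prodmean_def)
 next
  case (Suc n)
  have E4: "?E n (%x. (x + y)^4) = ?E n (%x. x^4) + (4 * y) * ?E n (%x. x^3) + 6 * y\<^sup>2 * (real n * v) + y^4" for y
  proof -
   have "(%x::real. (x + y)^4) = (%x. x^4 + (4 * y) * x^3 + (6 * y\<^sup>2) * x\<^sup>2 + (4 * y^3) * x + y^4)"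
    by (simp add: fun_eq_iff power4_eq_xxxx power3_eq_cube power2_eq_square algebra_simps)
   then show ?thesis using m1[of n] one[of n] m2[of n] by (simp add: prodmean_add prodmean_cmult c[of n "y^4"])
  qed
  have "?E (Suc n) (%x. x^4) = (\<Sum>y\<in>A. p y * ?E n (%x. x^4) + (p y * \<xi> y) * (4 * ?E n (%x. x^3)) + (p y * (\<xi> y)\<^sup>2) * (6 * (real n * v)) + p y * (\<xi> y)^4)"
   unfolding prodmean_Suc[OF A] E4 by (intro sum.cong refl) (simp add: algebra_simps)
  also have "... = ?E n (%x. x^4) + 6 * real n * v\<^sup>2 + (\<Sum>y\<in>A. p y * (\<xi> y)^4)"
   using p \<xi>(1) unfolding sum.distrib sum_distrib_right[symmetric] v_def[symmetric] by (simp add: power2_eq_square)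
  also have "(\<Sum>y\<in>A. p y * (\<xi> y)^4) <= v"
   unfolding v_def
  proof (intro sum_mono mult_left_mono p)
   fix j assume "j \<in> A"
   then have "\<bar>\<xi> j\<bar>^4 <= \<bar>\<xi> j\<bar>^2" using \<xi>(2) by (intro power_decreasing) auto
   then show "(\<xi> j)^4 <= (\<xi> j)\<^sup>2" by (simp add: power_even_abs)
  qed
  also have "?E n (%x. x^4) + 6 * real n * v\<^sup>2 + v <= 3 * (real n)\<^sup>2 * v\<^sup>2 + real n * v + 6 * real n * v\<^sup>2 + v"
   using Suc.IH by simp
  also have "... <= 3 * (real (Suc n))\<^sup>2 * v\<^sup>2 + real (Suc n) * v"
   by (simp add: power2_eq_square algebra_simps)
  finally show ?case by simp
 qed
qed

text \<open>A quantitative central limit step for \<open>n\<close> independent copies of a law on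
  finitely many cells. The mean is factored out, the centred characteristic function is compared to
  third order with \<open>1 - y\<close>, and that with \<open>exp (- y)\<close>, where
  \<open>y = c^2 v / 2\<close>. Passing to \<open>n\<close>-th powers of numbers of modulus at most
  1 costs only a factor \<open>n\<close>. \<open>2 * E\<close> bounds the centred values.\<close>

lemma zeta_power_estimate:
 fixes p \<eta> :: "nat => real"
 assumes p: "!!j. j <= K ==> 0 <= p j" "(\<Sum>j\<le>K. p j) = 1" and E: "!!j. j <= K ==> \<bar>\<eta> j\<bar> <= E"
  and c: "0 <= c" "c <= 1" "c * (2 * E) <= 1"
 defines "\<mu> \<equiv> \<Sum>j\<le>K. p j * \<eta> j"
 defines "v \<equiv> (\<Sum>j\<le>K. p j * (\<eta> j)\<^sup>2) - \<mu>\<^sup>2"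
 shows "norm ((\<Sum>j\<le>K. of_real (p j) * iexp (c * \<eta> j)) ^ n - iexp (real n * c * \<mu>) * of_real (exp (- (real n * c\<^sup>2 * v / 2))))
  <= real n * c^3 * ((2 * E)^3 + 3 * (2 * E)^4)"
  "0 <= v" "\<bar>\<mu>\<bar> <= E"
proof -
 have E0: "E >= 0" using E[of 0] by linarith
 show \<mu>E: "\<bar>\<mu>\<bar> <= E"
 proof -
  have "\<bar>\<mu>\<bar> <= (\<Sum>j\<le>K. p j * E)" unfolding \<mu>_def
   by (rule order_trans[OF sum_abs], rule sum_mono) (use p E in \<open>auto simp: abs_mult intro: mult_left_mono\<close>)
  also have "... = E" using p(2) by (simp add: sum_distrib_right[symmetric])
  finally show ?thesis .
 qed
 define \<xi> where "\<xi> j = \<eta> j - \<mu>" for j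
 have \<xi>: "\<bar>\<xi> j\<bar> <= 2 * E" if "j <= K" for j unfolding \<xi>_def using E[OF that] \<mu>E by linarith
 have s1: "(\<Sum>j\<le>K. p j * \<xi> j) = 0"
  unfolding \<xi>_def right_diff_distrib sum_subtractf sum_distrib_right[symmetric] p(2) \<mu>_def by simp
 have s2: "(\<Sum>j\<le>K. p j * (\<xi> j)\<^sup>2) = v"
 proof -
  have "(\<Sum>j\<le>K. p j * (\<xi> j)\<^sup>2) = (\<Sum>j\<le>K. p j * (\<eta> j)\<^sup>2 - 2 * \<mu> * (p j * \<eta> j) + \<mu>\<^sup>2 * p j)"
   unfolding \<xi>_def by (rule sum.cong) (simp_all add: power2_diff algebra_simps)
  also have "... = (\<Sum>j\<le>K. p j * (\<eta> j)\<^sup>2) - 2 * \<mu> * \<mu> + \<mu>\<^sup>2 * 1"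
   unfolding sum.distrib sum_subtractf sum_distrib_left[symmetric] p(2) \<mu>_def[symmetric] ..
  also have "... = v" unfolding v_def by (simp add: power2_eq_square)
  finally show ?thesis .
 qed
 show v0: "0 <= v" unfolding s2[symmetric] using p by (intro sum_nonneg mult_nonneg_nonneg) auto
 have vE: "v <= (2 * E)\<^sup>2"
 proof -
  have "v <= (\<Sum>j\<le>K. p j * (2 * E)\<^sup>2)" unfolding s2[symmetric]
  proof (intro sum_mono mult_left_mono)
   fix j assume "j \<in> {..K}"
   then show "(\<xi> j)\<^sup>2 <= (2 * E)\<^sup>2" using \<xi>[of j] E0 by (intro abs_le_square_iff[THEN iffD1]) auto
  qed (use p in auto)
  then show ?thesis using p(2) by (simp add: sum_distrib_right[symmetric])
 qed
 define y where "y = c\<^sup>2 * v / 2"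
 have y0: "0 <= y" unfolding y_def using v0 by simp
 have c2v: "c\<^sup>2 * v <= c\<^sup>2 * (2*E)\<^sup>2" using vE by (intro mult_left_mono) auto
 have cE: "(c * (2 * E))\<^sup>2 <= 1" using c E0 power_le_one[of "c * (2 * E)" 2] by simp
 have y1: "y <= 1" using c2v cE y0 unfolding y_def power_mult_distrib by simp
 define \<zeta> where "\<zeta> = (\<Sum>j\<le>K. of_real (p j) * iexp (c * \<xi> j))"
 have z1: "(\<Sum>j\<le>K. of_real (p j) * iexp (c * \<eta> j)) = iexp (c * \<mu>) * \<zeta>"
  unfolding \<zeta>_def sum_distrib_left
 proof (rule sum.cong)
  fix j
  have "c * \<eta> j = c * \<mu> + c * \<xi> j" unfolding \<xi>_def by (simp add: algebra_simps)
  then show "of_real (p j) * iexp (c * \<eta> j) = iexp (c * \<mu>) * (of_real (p j) * iexp (c * \<xi> j))"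
   by (simp add: distrib_left exp_add)
 qed simp
 have \<zeta>1: "norm \<zeta> <= 1"
 proof -
  have "norm \<zeta> <= (\<Sum>j\<le>K. p j)" unfolding \<zeta>_def
   by (rule order_trans[OF norm_sum], rule sum_mono) (use p in \<open>simp add: norm_mult\<close>)
  then show ?thesis using p(2) by simp
 qed
 have d1: "norm (\<zeta> - of_real (1 - y)) <= c^3 * (2*E)^3"
 proof -
  have "of_real (1 - y) = (\<Sum>j\<le>K. of_real (p j) * (1 + \<i> * of_real (c * \<xi> j) - of_real ((c * \<xi> j)\<^sup>2 / 2)))"
  proof -
   have "(\<Sum>j\<le>K. of_real (p j) * (1 + \<i> * of_real (c * \<xi> j) - of_real ((c * \<xi> j)\<^sup>2 / 2)))
     = of_real (\<Sum>j\<le>K. p j) + \<i> * of_real (c * (\<Sum>j\<le>K. p j * \<xi> j)) - of_real (c\<^sup>2 / 2 * (\<Sum>j\<le>K. p j * (\<xi> j)\<^sup>2))"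
    by (simp add: sum.distrib sum_subtractf sum_distrib_left algebra_simps power_mult_distrib)
   then show ?thesis unfolding s1 s2 p(2) y_def by simp
  qed
  then have "\<zeta> - of_real (1 - y) = (\<Sum>j\<le>K. of_real (p j) * (iexp (c * \<xi> j) - (1 + \<i> * of_real (c * \<xi> j) - of_real ((c * \<xi> j)\<^sup>2 / 2))))"
   unfolding \<zeta>_def by (simp only: sum_subtractf[symmetric] right_diff_distrib[symmetric])
  also have "norm ... <= (\<Sum>j\<le>K. p j * (c^3 * (2*E)^3))"
  proof (rule sum_norm_le)
   fix j assume j: "j \<in> {..K}"
   have "norm (iexp (c * \<xi> j) - (1 + \<i> * of_real (c * \<xi> j) - of_real ((c * \<xi> j)\<^sup>2 / 2))) <= \<bar>c * \<xi> j\<bar>^3 / 6"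
   proof -
    have "(\<Sum>k\<le>2. (\<i> * complex_of_real (c * \<xi> j)) ^ k / fact k) = 1 + \<i> * of_real (c * \<xi> j) - of_real ((c * \<xi> j)\<^sup>2 / 2)"
    proof -
     have sq: "\<i> * z * (\<i> * z) = - (z * z)" for z :: complex
     proof -
      have "\<i> * z * (\<i> * z) = (\<i> * \<i>) * (z * z)" by (simp only: mult_ac)
      then show ?thesis by simp
     qed
     show ?thesis by (simp add: numeral_2_eq_2 power2_eq_square sq)
    qed
    moreover have "fact (Suc 2) = (6::real)" by (simp add: numeral_2_eq_2 fact_numeral)
    ultimately show ?thesis using iexp_approx1[of "c * \<xi> j" 2] by (simp add: numeral_3_eq_3)
   qed
   also have "... <= \<bar>c * \<xi> j\<bar>^3" by simp
   also have "... <= (c * (2 * E))^3" using \<xi>[of j] j c unfolding abs_mult by (intro power_mono mult_mono) auto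
   finally have "norm (iexp (c * \<xi> j) - (1 + \<i> * of_real (c * \<xi> j) - of_real ((c * \<xi> j)\<^sup>2 / 2))) <= c^3 * (2*E)^3" by (simp add: power_mult_distrib)
   then show "norm (of_real (p j) * (iexp (c * \<xi> j) - (1 + \<i> * of_real (c * \<xi> j) - of_real ((c * \<xi> j)\<^sup>2 / 2)))) <= p j * (c^3 * (2*E)^3)"
    unfolding norm_mult using p(1)[of j] j by (simp add: mult_left_mono del: of_real_mult of_real_divide of_real_power)
  qed
  also have "... = c^3 * (2*E)^3" using p(2) by (simp only: sum_distrib_right[symmetric] mult_1)
  finally show ?thesis .
 qed
 have d2: "norm (complex_of_real (1 - y) - of_real (exp (- y))) <= c^3 * (3 * (2*E)^4)"
 proof -
  have "\<bar>exp (-y) - 1 - (-y)\<bar> <= (-y)\<^sup>2 * exp \<bar>-y\<bar>" by (rule exp_taylor_bounds)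
  also have "... <= y\<^sup>2 * 3"
  proof -
   have "exp y <= exp 1" using y1 by simp
   also have "... <= (3::real)" using exp_le by simp
   finally show ?thesis using y0 by (simp add: mult_left_mono)
  qed
  also have "... <= (c\<^sup>2 * (2*E)\<^sup>2)\<^sup>2 * 3"
  proof -
   have "y <= c\<^sup>2 * v" using v0 unfolding y_def by simp
   then show ?thesis using y0 c2v by (intro mult_right_mono power_mono) auto
  qed
  also have "... = c^4 * (3 * (2*E)^4)" by (simp add: power_mult_distrib)
  also have "... <= c^3 * (3 * (2*E)^4)" using c by (intro mult_right_mono power_decreasing) auto
  finally have "\<bar>(1 - y) - exp (- y)\<bar> <= c^3 * (3 * (2*E)^4)" by (simp add: abs_minus_commute algebra_simps)
  then show ?thesis unfolding of_real_diff[symmetric] norm_of_real .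
 qed
 have d3: "norm (\<zeta> - of_real (exp (- y))) <= c^3 * ((2*E)^3 + 3 * (2*E)^4)"
 proof -
  have "\<zeta> - of_real (exp (- y)) = (\<zeta> - of_real (1 - y)) + (of_real (1 - y) - of_real (exp (- y)))" by simp
  also have "norm ... <= c^3 * (2*E)^3 + c^3 * (3 * (2*E)^4)" by (intro order_trans[OF norm_triangle_ineq] add_mono d1 d2)
  finally show ?thesis by (simp add: distrib_left)
 qed
 have "iexp (real n * c * \<mu>) * of_real (exp (- (real n * c\<^sup>2 * v / 2))) = iexp (c * \<mu>) ^ n * of_real (exp (- y)) ^ n"
 proof -
  have "iexp (real n * c * \<mu>) = iexp (c * \<mu>) ^ n" by (simp add: exp_of_nat_mult[symmetric] mult_ac)
  moreover have "exp (- (real n * c\<^sup>2 * v / 2)) = exp (- y) ^ n" unfolding y_def by (simp add: exp_of_nat_mult[symmetric] mult_ac)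
  ultimately show ?thesis by simp
 qed
 then have "norm ((\<Sum>j\<le>K. of_real (p j) * iexp (c * \<eta> j)) ^ n - iexp (real n * c * \<mu>) * of_real (exp (- (real n * c\<^sup>2 * v / 2))))
   = norm (iexp (c * \<mu>) ^ n * (\<zeta> ^ n - of_real (exp (- y)) ^ n))"
  unfolding z1 by (simp add: power_mult_distrib right_diff_distrib)
 also have "... = norm (\<zeta> ^ n - of_real (exp (- y)) ^ n)" by (simp add: norm_mult norm_power)
 also have "... <= real n * norm (\<zeta> - of_real (exp (- y)))" by (rule norm_power_diff[OF \<zeta>1]) (use y0 in simp)
 also have "... <= real n * (c^3 * ((2*E)^3 + 3 * (2*E)^4))" by (intro mult_left_mono d3) simp
 finally show "norm ((\<Sum>j\<le>K. of_real (p j) * iexp (c * \<eta> j)) ^ n - iexp (real n * c * \<mu>) * of_real (exp (- (real n * c\<^sup>2 * v / 2))))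
  <= real n * c^3 * ((2 * E)^3 + 3 * (2 * E)^4)" by (simp add: mult.assoc)
qed

text \<open>The law of the cell of a default time, from the survival function \<open>S\<close> at
  the grid points: a cell \<open>j < K\<close> lies between grid points \<open>j\<close> and
  \<open>j + 1\<close>, and cell \<open>K\<close> stands for survival beyond the last one.\<close>

definition cellprob :: "nat => (nat => real) => nat => real" where
 "cellprob K S j = (if j < K then S j - S (Suc j) else S K)"

text \<open>Summation by parts; it expresses means over cells through survival probabilities, which
  are the quantities given by the model.\<close>

lemma sum_cellprob:
 "(\<Sum>j\<le>K. cellprob K S j * f j) = S 0 * f 0 + (\<Sum>l<K. S (Suc l) * (f (Suc l) - f l))"
proof -
 have "(\<Sum>j\<le>K. cellprob K S j * f j) = (\<Sum>j<K. (S j - S (Suc j)) * f j) + S K * f K"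
  unfolding lessThan_Suc_atMost[symmetric] by (simp add: cellprob_def)
 also have "... = S 0 * f 0 + (\<Sum>l<K. S (Suc l) * (f (Suc l) - f l))"
  by (induction K) (simp_all add: algebra_simps)
 finally show ?thesis .
qed

text \<open>The contribution of a default in cell j to the linear combination with weights theta of the increments
of the exponentially weighted process.\<close>

definition etaval :: "nat => (nat => real) => (nat => real) => nat => real" where
 "etaval K \<theta> a j = (\<Sum>l<K. \<theta> l * (a l * (if l <= j then 1 else 0) - a (Suc l) * (if Suc l <= j then 1 else 0)))"

lemma etaval_eq:
 assumes "j <= K"
 shows "etaval K \<theta> a j = (\<Sum>l<j. \<theta> l * (a l - a (Suc l))) + (if j < K then \<theta> j * a j else 0)"
proof -
 have "etaval K \<theta> a j = (\<Sum>l\<in>{..<K}. if l < j then \<theta> l * (a l - a (Suc l)) else if l = j then \<theta> j * a j else 0)"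
  unfolding etaval_def by (rule sum.cong) auto
 also have "... = (\<Sum>l\<in>{..<K} \<inter> {l. l < j}. \<theta> l * (a l - a (Suc l))) + (\<Sum>l\<in>{..<K} \<inter> - {l. l < j}. if l = j then \<theta> j * a j else 0)"
  by (subst sum.If_cases) simp_all
 also have "{..<K} \<inter> {l. l < j} = {..<j}" using assms by auto
 also have "(\<Sum>l\<in>{..<K} \<inter> - {l. l < j}. if l = j then \<theta> j * a j else 0) = (if j < K then \<theta> j * a j else 0)"
  by (subst sum.delta) auto
 finally show ?thesis .
qed

text \<open>Under the cell law the event that the cell is at least \<open>l\<close> has probability
  \<open>S l\<close>; the rest is linearity.\<close>

lemma etaval_mean:
 "(\<Sum>j\<le>K. cellprob K S j * etaval K \<theta> a j) = (\<Sum>l<K. \<theta> l * (a l * S l - a (Suc l) * S (Suc l)))"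
proof -
 define C where "C l j = (if l <= j then 1 else 0 :: real)" for l j :: nat
 have tail: "(\<Sum>j\<le>K. cellprob K S j * C l j) = S l" if "l <= K" for l
 proof (cases l)
  case 0 then show ?thesis unfolding sum_cellprob C_def by simp
 next
  case (Suc m)
  have "(\<Sum>x<K. S (Suc x) * (C l (Suc x) - C l x)) = (\<Sum>x<K. if x = m then S l else 0)"
   by (rule sum.cong) (auto simp: Suc C_def)
  then show ?thesis unfolding sum_cellprob using that Suc by (simp add: C_def)
 qed
 have "(\<Sum>j\<le>K. cellprob K S j * etaval K \<theta> a j) = (\<Sum>j\<le>K. \<Sum>l<K. \<theta> l * (a l * (cellprob K S j * C l j) - a (Suc l) * (cellprob K S j * C (Suc l) j)))"
  unfolding etaval_def C_def sum_distrib_left by (intro sum.cong refl) (simp add: algebra_simps)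
 also have "... = (\<Sum>l<K. \<Sum>j\<le>K. \<theta> l * (a l * (cellprob K S j * C l j) - a (Suc l) * (cellprob K S j * C (Suc l) j)))"
  by (rule sum.swap)
 also have "... = (\<Sum>l<K. \<theta> l * (a l * (\<Sum>j\<le>K. cellprob K S j * C l j) - a (Suc l) * (\<Sum>j\<le>K. cellprob K S j * C (Suc l) j)))"
  by (simp add: sum_distrib_left sum_subtractf right_diff_distrib)
 also have "... = (\<Sum>l<K. \<theta> l * (a l * S l - a (Suc l) * S (Suc l)))" by (intro sum.cong refl) (simp add: tail)
 finally show ?thesis .
qed

text \<open>With survival \<open>1 / a l\<close>, the survival indicator at grid point
  \<open>l\<close> times \<open>a l\<close> is a martingale in \<open>l\<close>, so the increments
  are orthogonal, with variances \<open>a (Suc l) - a l\<close>. The proof checks the resulting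
  identity by adding one cell at a time.\<close>

lemma etaval_variance:
 assumes a: "!!l. a l ~= 0" "a 0 = 1"
 shows "(\<Sum>j\<le>K. cellprob K (%l. 1 / a l) j * (etaval K \<theta> a j)\<^sup>2) = (\<Sum>l<K. (\<theta> l)\<^sup>2 * (a (Suc l) - a l))"
proof -
 define y where "y j = (\<Sum>l<j. \<theta> l * (a l - a (Suc l)))" for j
 have e1: "etaval K \<theta> a j = y j + \<theta> j * a j" if "j < K" for j using etaval_eq[of j K \<theta> a] that unfolding y_def by simp
 have e2: "etaval K \<theta> a K = y K" using etaval_eq[of K K \<theta> a] unfolding y_def by simp
 have "(\<Sum>j\<le>K. cellprob K (%l. 1 / a l) j * (etaval K \<theta> a j)\<^sup>2) = (\<Sum>j<K. (1 / a j - 1 / a (Suc j)) * (y j + \<theta> j * a j)\<^sup>2) + 1 / a K * (y K)\<^sup>2"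
  unfolding lessThan_Suc_atMost[symmetric] using e1 e2 by (simp add: cellprob_def)
 also have "... = (\<Sum>l<K. (\<theta> l)\<^sup>2 * (a (Suc l) - a l))"
 proof (induction K)
  case 0 show ?case by (simp add: y_def)
 next
  case (Suc K)
  have yS: "y (Suc K) = y K + \<theta> K * (a K - a (Suc K))" unfolding y_def by simp
  have "(1 / a K - 1 / a (Suc K)) * (y K + \<theta> K * a K)\<^sup>2 + 1 / a (Suc K) * (y (Suc K))\<^sup>2 = 1 / a K * (y K)\<^sup>2 + (\<theta> K)\<^sup>2 * (a (Suc K) - a K)"
   unfolding yS using a(1)[of K] a(1)[of "Suc K"] by (simp add: field_simps power2_eq_square)
  then show ?case using Suc by simp
 qed
 finally show ?thesis .
qed

text \<open>Grid point 0 is not counted, so every time up to \<open>t 1\<close> falls into cell 0.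
  The inequality is strict because a default exactly at a grid point counts as having occurred by
  then.\<close>

definition cellof :: "(nat => real) => nat => ereal => nat" where
 "cellof t K x = card {j. 1 <= j \<and> j <= K \<and> ereal (t j) < x}"

lemma cellof_le: "cellof t K x <= K"
proof -
 have "card {j. 1 <= j \<and> j <= K \<and> ereal (t j) < x} <= card {1..K}" by (rule card_mono) auto
 then show ?thesis unfolding cellof_def by simp
qed

lemma cellof_iff:
 assumes "mono t" "1 <= l" "l <= K"
 shows "l <= cellof t K x \<longleftrightarrow> ereal (t l) < x"
proof
 assume x: "ereal (t l) < x"
 have "{1..l} \<subseteq> {j. 1 <= j \<and> j <= K \<and> ereal (t j) < x}"
 proof
  fix j assume j: "j \<in> {1..l}"
  then have "t j <= t l" using assms(1) by (auto dest: monoD)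
  then have "ereal (t j) < x" using x by (meson ereal_less_eq(3) le_less_trans)
  then show "j \<in> {j. 1 <= j \<and> j <= K \<and> ereal (t j) < x}" using j assms by auto
 qed
 from card_mono[OF _ this] show "l <= cellof t K x" unfolding cellof_def by simp
next
 assume l: "l <= cellof t K x"
 show "ereal (t l) < x"
 proof (rule ccontr)
  assume n: "\<not> ereal (t l) < x"
  have "{j. 1 <= j \<and> j <= K \<and> ereal (t j) < x} \<subseteq> {1..<l}"
  proof
   fix j assume j: "j \<in> {j. 1 <= j \<and> j <= K \<and> ereal (t j) < x}"
   have "\<not> l <= j"
   proof
    assume "l <= j"
    then have "t l <= t j" using assms(1) by (auto dest: monoD)
    then have "ereal (t l) <= ereal (t j)" "ereal (t j) < x" using j by auto
    then have "ereal (t l) < x" by (rule le_less_trans)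
    then show False using n by simp
   qed
   then show "j \<in> {1..<l}" using j by auto
  qed
  from card_mono[OF _ this] have "cellof t K x <= l - 1" unfolding cellof_def by simp
  then show False using l assms(2) by simp
 qed
qed

text \<open>Conditional independence in integrated form: joint survival probabilities are mixtures
  of products with the random cumulative hazard \<open>Lam\<close>.\<close>

locale cond_indep = prob_space M for M :: "'a measure" +
 fixes n :: nat and \<tau> :: "nat => 'a => ereal" and Lam :: "real => 'a => real"
 assumes \<tau>_meas: "!!i. i < n ==> \<tau> i \<in> borel_measurable M"
  and Lam_meas: "!!t. t >= 0 ==> Lam t \<in> borel_measurable M"
  and Lam_0: "!!w. w \<in> space M ==> Lam 0 w = 0"
  and Lam_mono: "!!w s t. w \<in> space M ==> 0 <= s ==> s <= t ==> Lam s w <= Lam t w"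
  and surv: "!!t::nat => real. (!!i. i < n ==> t i >= 0) ==>
    measure M {w\<in>space M. \<forall>i<n. ereal (t i) < \<tau> i w} = (LINT w|M. (\<Prod>i<n. exp (- Lam (t i) w)))"
begin

lemma Lam_nonneg: "w \<in> space M ==> t >= 0 ==> Lam t w >= 0"
 using Lam_mono[of w 0 t] Lam_0[of w] by simp

lemma exp_Lam_bounds: "w \<in> space M ==> t >= 0 ==> \<bar>exp (- Lam t w)\<bar> <= 1"
 using Lam_nonneg[of w t] by simp

text \<open>This is \<open>surv\<close> with all times 0. It is what makes the survival indicator at
  grid point 0 equal to 1.\<close>

lemma \<tau>_pos: "AE w in M. \<forall>i\<in>{..<n}. 0 < \<tau> i w"
proof -
 have "measure M {w\<in>space M. \<forall>i<n. ereal 0 < \<tau> i w} = (LINT w|M. (\<Prod>i<n. exp (- Lam 0 w)))"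
  by (rule surv) simp
 also have "... = (LINT w|M. 1)" by (rule Bochner_Integration.integral_cong) (auto simp: Lam_0)
 finally have "measure M {w\<in>space M. \<forall>i<n. ereal 0 < \<tau> i w} = 1"
  by (simp add: prob_space)
 then have p: "measure M {w\<in>space M. \<forall>i\<in>{..<n}. 0 < \<tau> i w} = 1"
  by (simp only: Ball_def lessThan_iff zero_ereal_def)
 have "{w\<in>space M. \<forall>i\<in>{..<n}. 0 < \<tau> i w} \<in> sets M"
 proof (rule sets.sets_Collect_finite_All)
  fix i assume "i \<in> {..<n}"
  then have [measurable]: "\<tau> i \<in> borel_measurable M" by (simp add: \<tau>_meas)
  show "{w \<in> space M. 0 < \<tau> i w} \<in> sets M" by measurable
 qed simp
 then have "AE w in M. w \<in> {w\<in>space M. \<forall>i\<in>{..<n}. 0 < \<tau> i w}" using p prob_eq_1 by blast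
 then show ?thesis by (rule AE_mp) simp
qed

context
 fixes t :: "nat => real" and K :: nat
 assumes t: "mono t" "t 0 = 0"
begin

lemma t_nonneg: "t j >= 0" using t monoD[OF t(1), of 0 j] by simp

definition above :: "nat => ereal => real" where "above j x = (if ereal (t j) < x then 1 else 0)"

definition pcell :: "'a => nat => real" where "pcell w j = cellprob K (%l. exp (- Lam (t l) w)) j"

lemma pcell_meas: "(%w. pcell w j) \<in> borel_measurable M"
 unfolding pcell_def cellprob_def using Lam_meas[OF t_nonneg] by measurable

lemma pcell_props:
 assumes w: "w \<in> space M"
 shows "0 <= pcell w j" "(\<Sum>j\<le>K. pcell w j) = 1" "pcell w j <= 1"
proof -
 have "t j <= t (Suc j)" using t(1) by (simp add: mono_def)
 then have m: "Lam (t j) w <= Lam (t (Suc j)) w" by (intro Lam_mono w t_nonneg)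
 then show "0 <= pcell w j" unfolding pcell_def cellprob_def by auto
 have "exp (- Lam (t l) w) <= 1" for l using exp_Lam_bounds[OF w t_nonneg[of l]] by simp
 moreover have "0 < exp (- Lam (t (Suc j)) w)" by simp
 ultimately show "pcell w j <= 1" unfolding pcell_def cellprob_def by (smt (verit))
 show "(\<Sum>j\<le>K. pcell w j) = 1"
  using sum_cellprob[of K "%l. exp (- Lam (t l) w)" "%_. 1"] unfolding pcell_def by (simp add: t Lam_0[OF w])
qed

text \<open>Expanding the product over the obligors gives a sum over index maps of indicators of
  joint survival events, and \<open>surv\<close> applies to each of them.\<close>

lemma linear_product:
 fixes b :: "nat => nat => real"
 shows "(LINT w|M. (\<Prod>i<n. \<Sum>j\<le>K. b i j * above j (\<tau> i w))) = (LINT w|M. (\<Prod>i<n. \<Sum>j\<le>K. b i j * exp (- Lam (t j) w)))"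
proof -
 define I where "I = {..<n} \<rightarrow>\<^sub>E {..K}"
 have ev: "{w\<in>space M. \<forall>i<n. ereal (t (J i)) < \<tau> i w} \<in> sets M" for J
 proof -
  have "{w\<in>space M. \<forall>i\<in>{..<n}. ereal (t (J i)) < \<tau> i w} \<in> sets M"
  proof (rule sets.sets_Collect_finite_All)
   fix i assume "i \<in> {..<n}"
   then have [measurable]: "\<tau> i \<in> borel_measurable M" by (simp add: \<tau>_meas)
   show "{w \<in> space M. ereal (t (J i)) < \<tau> i w} \<in> sets M" by measurable
  qed simp
  then show ?thesis by (simp only: Ball_def lessThan_iff)
 qed
 have e1: "(\<Prod>i<n. above (J i) (\<tau> i w)) = indicator {w\<in>space M. \<forall>i<n. ereal (t (J i)) < \<tau> i w} w" if "w \<in> space M" for J w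
 proof (cases "\<forall>i<n. ereal (t (J i)) < \<tau> i w")
  case True then show ?thesis using that by (simp add: above_def)
 next
  case False
  then obtain i where "i < n" "\<not> ereal (t (J i)) < \<tau> i w" by auto
  then have "(\<Prod>i<n. above (J i) (\<tau> i w)) = 0" by (intro prod_zero) (auto simp: above_def)
  moreover have "indicat_real {w\<in>space M. \<forall>i<n. ereal (t (J i)) < \<tau> i w} w = 0" using False by simp
  ultimately show ?thesis by simp
 qed
 have "(LINT w|M. (\<Prod>i<n. \<Sum>j\<le>K. b i j * above j (\<tau> i w)))
  = (LINT w|M. (\<Sum>J\<in>I. (\<Prod>i<n. b i (J i)) * indicator {w\<in>space M. \<forall>i<n. ereal (t (J i)) < \<tau> i w} w))"
  by (rule Bochner_Integration.integral_cong) (simp_all add: prod_sum_PiE I_def prod.distrib e1)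
 also have "... = (\<Sum>J\<in>I. (\<Prod>i<n. b i (J i)) * measure M {w\<in>space M. \<forall>i<n. ereal (t (J i)) < \<tau> i w})"
 proof -
  have i: "integrable M (indicat_real {w\<in>space M. \<forall>i<n. ereal (t (J i)) < \<tau> i w})" for J
   by (rule integrable_real_indicator[OF ev]) (simp only: emeasure_eq_measure ennreal_less_top infinity_ennreal_def)
  have mi: "(LINT w|M. indicat_real {w\<in>space M. \<forall>i<n. ereal (t (J i)) < \<tau> i w} w) = measure M {w\<in>space M. \<forall>i<n. ereal (t (J i)) < \<tau> i w}" for J
  proof -
   have "{w\<in>space M. \<forall>i<n. ereal (t (J i)) < \<tau> i w} \<inter> space M = {w\<in>space M. \<forall>i<n. ereal (t (J i)) < \<tau> i w}" by blast
   then show ?thesis by (simp only: Bochner_Integration.integral_indicator)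
  qed
  show ?thesis
   by (subst Bochner_Integration.integral_sum[OF integrable_mult_right[OF i]]) (simp only: integral_mult_right_zero mi)
 qed
 also have "... = (\<Sum>J\<in>I. (\<Prod>i<n. b i (J i)) * (LINT w|M. (\<Prod>i<n. exp (- Lam (t (J i)) w))))"
  by (intro sum.cong refl) (simp add: surv t_nonneg)
 also have "... = (LINT w|M. (\<Sum>J\<in>I. (\<Prod>i<n. b i (J i)) * (\<Prod>i<n. exp (- Lam (t (J i)) w))))"
 proof -
  have i: "integrable M (%w. \<Prod>i<n. exp (- Lam (t (J i)) w))" for J
  proof (rule integrable_const_bound[of _ 1])
   show "AE w in M. norm (\<Prod>i<n. exp (- Lam (t (J i)) w)) <= 1"
    unfolding real_norm_def abs_prod using exp_Lam_bounds[OF _ t_nonneg] by (intro AE_I2 prod_le_1) auto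
   show "(%w. \<Prod>i<n. exp (- Lam (t (J i)) w)) \<in> borel_measurable M"
    by (intro borel_measurable_prod measurable_compose[OF Lam_meas[OF t_nonneg]]) measurable
  qed
  show ?thesis by (subst Bochner_Integration.integral_sum) (auto intro!: integrable_mult_right i)
 qed
 also have "... = (LINT w|M. (\<Prod>i<n. \<Sum>j\<le>K. b i j * exp (- Lam (t j) w)))"
  by (rule Bochner_Integration.integral_cong) (simp_all add: prod_sum_PiE I_def prod.distrib)
 finally show ?thesis .
qed

definition incell :: "nat => ereal => real" where "incell j x = (if cellof t K x = j then 1 else 0)"

lemma incell_meas: "i < n ==> (%w. incell j (\<tau> i w)) \<in> borel_measurable M"
proof -
 assume i: "i < n"
 note [measurable] = \<tau>_meas[OF i]
 have "(%x. cellof t K x) \<in> borel \<rightarrow>\<^sub>M count_space UNIV"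
 proof -
  have "cellof t K = (%x. \<Sum>j\<in>{1..K}. if ereal (t j) < x then 1 else 0)"
  proof
   fix x
   have "{j. 1 <= j \<and> j <= K \<and> ereal (t j) < x} = {1..K} \<inter> {j. ereal (t j) < x}" by auto
   then show "cellof t K x = (\<Sum>j\<in>{1..K}. if ereal (t j) < x then 1 else 0)" unfolding cellof_def by (simp add: sum.If_cases)
  qed
  then show ?thesis by simp
 qed
 then have "(%x. incell j x) \<in> borel_measurable borel" unfolding incell_def by measurable
 then show ?thesis by (rule measurable_compose[OF \<tau>_meas[OF i]])
qed

lemma incell_above:
 assumes "0 < x" "j <= K"
 shows "incell j x = cellprob K (%l. above l x) j"
proof -
 have a: "above l x = (if l <= cellof t K x then 1 else 0)" if "l <= K" for l
 proof (cases "l = 0")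
  case True then show ?thesis using assms(1) t(2) by (simp add: above_def zero_ereal_def[symmetric])
 next
  case False then show ?thesis using cellof_iff[OF t(1), of l K x] that by (simp add: above_def)
 qed
 show ?thesis unfolding incell_def cellprob_def using a[of j] a[of "Suc j"] a[of K] assms(2) cellof_le[of t K x] by auto
qed

text \<open>A cell indicator is a difference of two survival indicators, or a single one for the
  last cell, so this is an instance of \<open>linear_product\<close>.\<close>

lemma incell_product:
 assumes J: "!!i. i < n ==> J i <= K"
 shows "(LINT w|M. (\<Prod>i<n. incell (J i) (\<tau> i w))) = (LINT w|M. (\<Prod>i<n. pcell w (J i)))"
proof -
 define b where "b i l = (if J i < K then (if l = J i then 1 else if l = Suc (J i) then - 1 else 0) else if l = K then 1 else 0 :: real)" for i l
 have lin: "cellprob K f (J i) = (\<Sum>l\<le>K. b i l * f l)" if i: "i < n" for f i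
 proof (cases "J i < K")
  case True
  have "(\<Sum>l\<le>K. b i l * f l) = (\<Sum>l\<le>K. (if l = J i then f l else 0) + (if l = Suc (J i) then - f l else 0))"
   by (rule sum.cong) (auto simp: b_def True)
  also have "... = f (J i) - f (Suc (J i))" using True by (simp add: sum.distrib)
  finally show ?thesis using True by (simp add: cellprob_def)
 next
  case False
  have "(\<Sum>l\<le>K. b i l * f l) = (\<Sum>l\<le>K. (if l = K then f l else 0))" by (rule sum.cong) (auto simp: b_def False)
  then show ?thesis using False by (simp add: cellprob_def)
 qed
 have "(LINT w|M. (\<Prod>i<n. incell (J i) (\<tau> i w))) = (LINT w|M. (\<Prod>i<n. \<Sum>l\<le>K. b i l * above l (\<tau> i w)))"
 proof (rule integral_cong_AE)
  show "(%w. \<Prod>i<n. incell (J i) (\<tau> i w)) \<in> borel_measurable M" by (intro borel_measurable_prod incell_meas) auto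
  show "(%w. \<Prod>i<n. \<Sum>l\<le>K. b i l * above l (\<tau> i w)) \<in> borel_measurable M"
  proof (intro borel_measurable_prod borel_measurable_sum borel_measurable_times borel_measurable_const)
   fix i l assume "i \<in> {..<n}"
   then have [measurable]: "\<tau> i \<in> borel_measurable M" by (simp add: \<tau>_meas)
   show "(%w. above l (\<tau> i w)) \<in> borel_measurable M" unfolding above_def by measurable
  qed
  show "AE w in M. (\<Prod>i<n. incell (J i) (\<tau> i w)) = (\<Prod>i<n. \<Sum>l\<le>K. b i l * above l (\<tau> i w))"
   using \<tau>_pos
  proof eventually_elim
   case (elim w)
   show ?case
   proof (rule prod.cong[OF refl])
    fix i assume "i \<in> {..<n}"
    then have i: "i < n" "0 < \<tau> i w" using elim by auto
    show "incell (J i) (\<tau> i w) = (\<Sum>l\<le>K. b i l * above l (\<tau> i w))"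
     unfolding incell_above[OF i(2) J[OF i(1)]] by (rule lin[OF i(1)])
   qed
  qed
 qed
 also have "... = (LINT w|M. (\<Prod>i<n. \<Sum>l\<le>K. b i l * exp (- Lam (t l) w)))" by (rule linear_product)
 also have "... = (LINT w|M. (\<Prod>i<n. pcell w (J i)))"
  by (rule Bochner_Integration.integral_cong) (auto simp: pcell_def lin intro!: prod.cong)
 finally show ?thesis .
qed

text \<open>Any function of the cell indices is a finite sum, over index maps, of products of cell
  indicators. By \<open>incell_product\<close> the cells may therefore be treated, under the
  integral, as independent with law \<open>pcell w\<close>.\<close>

theorem cells_expectation:
 fixes F :: "(nat => nat) => 'z::{banach, second_countable_topology}"
 shows "(LINT w|M. F (restrict (%i. cellof t K (\<tau> i w)) {..<n}))
   = (LINT w|M. (\<Sum>J\<in>{..<n} \<rightarrow>\<^sub>E {..K}. (\<Prod>i<n. pcell w (J i)) *\<^sub>R F J))"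
proof -
 define I where "I = {..<n} \<rightarrow>\<^sub>E {..K}"
 have finI: "finite I" unfolding I_def by (intro finite_PiE) auto
 have e: "F (restrict (%i. cellof t K (\<tau> i w)) {..<n}) = (\<Sum>J\<in>I. (\<Prod>i<n. incell (J i) (\<tau> i w)) *\<^sub>R F J)" for w
 proof -
  let ?J0 = "restrict (%i. cellof t K (\<tau> i w)) {..<n}"
  have J0: "?J0 \<in> I" unfolding I_def using cellof_le by auto
  have "(\<Prod>i<n. incell (J i) (\<tau> i w)) = (if J = ?J0 then 1 else 0)" if "J \<in> I" for J
  proof (cases "J = ?J0")
   case True then show ?thesis by (auto simp: incell_def intro!: prod.neutral)
  next
   case False
   have "\<exists>i\<in>{..<n}. J i ~= ?J0 i"
   proof (rule ccontr)
    assume "\<not> ?thesis"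
    then have "J = ?J0" by (intro PiE_ext[OF that[unfolded I_def] J0[unfolded I_def]]) blast
    then show False using False by simp
   qed
   then obtain i where "i < n" "J i ~= ?J0 i" by blast
   then have "(\<Prod>i<n. incell (J i) (\<tau> i w)) = 0" by (intro prod_zero bexI[of _ i]) (auto simp: incell_def)
   then show ?thesis using False by simp
  qed
  then have "(\<Sum>J\<in>I. (\<Prod>i<n. incell (J i) (\<tau> i w)) *\<^sub>R F J) = (\<Sum>J\<in>I. if J = ?J0 then F J else 0)"
   by (intro sum.cong) auto
  then show ?thesis using finI J0 by simp
 qed
 have bI: "\<bar>incell j x\<bar> <= 1" for j x by (simp add: incell_def)
 have i1: "integrable M (%w. \<Prod>i<n. incell (J i) (\<tau> i w))" for J
 proof (rule integrable_const_bound[of _ 1])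
  show "AE w in M. norm (\<Prod>i<n. incell (J i) (\<tau> i w)) <= 1" unfolding real_norm_def abs_prod using bI by (intro AE_I2 prod_le_1) auto
  show "(%w. \<Prod>i<n. incell (J i) (\<tau> i w)) \<in> borel_measurable M" by (intro borel_measurable_prod incell_meas) auto
 qed
 have i2: "integrable M (%w. \<Prod>i<n. pcell w (J i))" for J
 proof (rule integrable_const_bound[of _ 1])
  show "AE w in M. norm (\<Prod>i<n. pcell w (J i)) <= 1" unfolding real_norm_def abs_prod using pcell_props by (intro AE_I2 prod_le_1) auto
  show "(%w. \<Prod>i<n. pcell w (J i)) \<in> borel_measurable M" by (intro borel_measurable_prod pcell_meas)
 qed
 have "(LINT w|M. F (restrict (%i. cellof t K (\<tau> i w)) {..<n})) = (\<Sum>J\<in>I. (LINT w|M. (\<Prod>i<n. incell (J i) (\<tau> i w))) *\<^sub>R F J)"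
  unfolding e by (subst Bochner_Integration.integral_sum) (simp_all only: integrable_scaleR_left[OF i1] integral_scaleR_left[OF i1])
 also have "... = (\<Sum>J\<in>I. (LINT w|M. (\<Prod>i<n. pcell w (J i))) *\<^sub>R F J)"
 proof (intro sum.cong refl)
  fix J assume "J \<in> I"
  then have "J i <= K" if "i < n" for i using that unfolding I_def by auto
  then show "(LINT w|M. (\<Prod>i<n. incell (J i) (\<tau> i w))) *\<^sub>R F J = (LINT w|M. (\<Prod>i<n. pcell w (J i))) *\<^sub>R F J"
   by (subst incell_product) auto
 qed
 also have "... = (LINT w|M. (\<Sum>J\<in>I. (\<Prod>i<n. pcell w (J i)) *\<^sub>R F J))"
  by (subst Bochner_Integration.integral_sum) (simp_all only: integrable_scaleR_left[OF i2] integral_scaleR_left[OF i2])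
 finally show ?thesis unfolding I_def .
qed

end

end

section \<open>Moments of the increments\<close>

lemma exp_neg_lipschitz:
 fixes a b m :: real
 assumes "- m <= a" "- m <= b"
 shows "\<bar>exp (- a) - exp (- b)\<bar> <= exp m * \<bar>a - b\<bar>"
proof -
 have ww: "exp (- x) - exp (- y) <= exp m * (y - x)" if "x <= y" "- m <= x" for x y
 proof -
  have "1 - (y - x) <= exp (- (y - x))" using exp_ge_add_one_self[of "- (y - x)"] by linarith
  then have "exp (- x) * (1 - exp (- (y - x))) <= exp m * (y - x)" using that by (intro mult_mono) auto
  moreover have "exp (- x) * exp (- (y - x)) = exp (- y)" by (simp add: exp_add[symmetric])
  ultimately show ?thesis by (simp add: right_diff_distrib)
 qed
 show ?thesis
 proof (cases "a <= b")
  case True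
  then have "exp (- b) <= exp (- a)" by simp
  then show ?thesis using ww[OF True assms(1)] True by (simp add: abs_if)
 next
  case False
  then have ba: "b <= a" by simp
  then have "exp (- a) <= exp (- b)" by simp
  then show ?thesis using ww[OF ba assms(2)] ba by (simp add: abs_if)
 qed
qed

lemma fourth_power_sum: "(x + y)^4 <= 8 * (x^4 + y^4)" for x y :: real
proof -
 have "(x+y)\<^sup>2 <= 2 * (x\<^sup>2 + y\<^sup>2)" using sum_squares_bound[of x y] by (simp add: power2_sum)
 then have "((x+y)\<^sup>2)\<^sup>2 <= (2 * (x\<^sup>2 + y\<^sup>2))\<^sup>2" by (intro power_mono) auto
 also have "... <= 4 * (2 * ((x\<^sup>2)\<^sup>2 + (y\<^sup>2)\<^sup>2))" using sum_squares_bound[of "x\<^sup>2" "y\<^sup>2"] by (simp add: power_mult_distrib power2_sum)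
 finally show ?thesis by simp
qed

text \<open>The correctors \<open>g\<close>, \<open>k\<close> and the constant \<open>V\<close>
  enter through their two Poisson equations only; the construction from the deviation matrix is kept
  outside.\<close>

locale mm_binomial = ctmc M Q Z for M :: "'a measure" and Q :: "real^'s^'s" and Z +
 fixes \<pi> lam :: "real^'s" and \<beta> :: real and \<tau> :: "nat => nat => 'a => ereal" and V :: real and g k :: "'s => real"
 assumes beta: "\<beta> > 0" and lam_nonneg: "!!i. lam $ i >= 0" and li_nonneg: "lam \<bullet> \<pi> >= 0"
  and g: "!!i. gen_adj Q g i = - (lam $ i - lam \<bullet> \<pi>)"
  and k: "!!i. gen_adj Q k i = V / 2 - (lam $ i - lam \<bullet> \<pi>) * g i"
  and tau_meas: "!!n i. i < n ==> \<tau> n i \<in> borel_measurable M"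
  and tau_surv: "!!n (t::nat => real). (!!i. i < n ==> t i >= 0) ==>
     measure M {w\<in>space M. \<forall>i<n. ereal (t i) < \<tau> n i w}
     = (LINT w|M. (\<Prod>i<n. exp (- integral {0..t i} (%s. lam $ Z (real n powr \<beta> * s) w))))"
begin

definition li :: real where "li = lam \<bullet> \<pi>"
definition f :: "'s => real" where "f i = lam $ i - li"
definition sp :: "nat => real" where "sp n = real n powr \<beta>"
definition cn :: "nat => real" where "cn n = real n powr (- (1 + max (1 - \<beta>) 0) / 2)"
definition Lam :: "nat => real => 'a => real" where "Lam n t w = integral {0..t} (%s. lam $ Z (sp n * s) w)"
definition Del :: "nat => real => 'a => real" where "Del n t w = Lam n t w - li * t"
definition Df :: real where "Df = nmax f"
definition Dl :: real where "Dl = nmax (%i. lam $ i)"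

lemma li0: "li >= 0" using li_nonneg by (simp add: li_def)
lemma Df0: "Df >= 0" unfolding Df_def by (rule nmax)
lemma Dl0: "Dl >= 0" unfolding Dl_def by (rule nmax)

lemma sp_pos: "n >= 1 ==> sp n > 0" unfolding sp_def by simp

text \<open>Change of variables to the unscaled chain. The condition on \<open>n\<close> keeps the
  speed \<open>sp n\<close> positive; at \<open>n = 0\<close> it is 0.\<close>

lemma Lam_Aint:
 assumes n: "n >= 1" and w: "w \<in> space M" and t: "t >= 0"
 shows "Lam n t w = Aint (%i. lam $ i) 0 (sp n * t) w / sp n"
proof -
 have s: "sp n > 0" by (rule sp_pos[OF n])
 have "((%r. lam $ Z r w) has_integral Aint (%i. lam $ i) 0 (sp n * t) w) {0..sp n * t}"
  unfolding Aint_def using path_integrable(1)[OF order_refl w, of "%i. lam $ i"] by (simp add: integrable_integral)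
 from has_integral_stretch_real[OF this, of "sp n"] s
 have "((%x. lam $ Z (sp n * x) w) has_integral (1 / \<bar>sp n\<bar>) *\<^sub>R Aint (%i. lam $ i) 0 (sp n * t) w) ((%x. x / sp n) ` {0..sp n * t})" by simp
 moreover have "(%x. x / sp n) ` {0..sp n * t} = {0..t}"
 proof -
  have "(%x. x / sp n) ` {0..sp n * t} = {0 / sp n..(sp n * t) / sp n}"
   using image_divide_atLeastAtMost[OF s, of 0 "sp n * t"] t s by simp
  then show ?thesis using s by simp
 qed
 ultimately show ?thesis unfolding Lam_def using s by (simp add: integral_unique)
qed

lemma Aint_linear:
 assumes "0 <= s" "w \<in> space M" "s <= t"
 shows "Aint f s t w = Aint (%i. lam $ i) s t w - li * (t - s)"
 unfolding Aint_def f_def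
 by (subst Henstock_Kurzweil_Integration.integral_diff) (use path_integrable(1)[OF assms(1,2), of "%i. lam $ i"] assms(3) in auto)

lemma Del_Aint:
 assumes n: "n >= 1" and w: "w \<in> space M" and t: "t >= 0"
 shows "Del n t w = Aint f 0 (sp n * t) w / sp n"
 unfolding Del_def Lam_Aint[OF assms] using Aint_linear[OF order_refl w, of "sp n * t"] sp_pos[OF n] t
 by (simp add: field_simps)

lemma Del_diff:
 assumes n: "n >= 1" and w: "w \<in> space M" and t: "0 <= s" "s <= t"
 shows "Del n t w - Del n s w = Aint f (sp n * s) (sp n * t) w / sp n"
proof -
 have t0: "0 <= t" using t by simp
 have "Aint f 0 (sp n * t) w = Aint f 0 (sp n * s) w + Aint f (sp n * s) (sp n * t) w"
  using sp_pos[OF n] t by (intro Aint_add w) auto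
 then show ?thesis unfolding Del_Aint[OF n w t0] Del_Aint[OF n w t(1)] by (simp add: add_divide_distrib)
qed

lemma Lam_diff:
 assumes n: "n >= 1" and w: "w \<in> space M" and t: "0 <= s" "s <= t"
 shows "0 <= Lam n t w - Lam n s w" "Lam n t w - Lam n s w <= Dl * (t - s)"
proof -
 have t0: "0 <= t" using t by simp
 note s = sp_pos[OF n]
 have st: "0 <= sp n * s" "sp n * s <= sp n * t" using s t by auto
 have "Aint (%i. lam $ i) 0 (sp n * t) w = Aint (%i. lam $ i) 0 (sp n * s) w + Aint (%i. lam $ i) (sp n * s) (sp n * t) w"
  using st by (intro Aint_add w) auto
 then have e: "Lam n t w - Lam n s w = Aint (%i. lam $ i) (sp n * s) (sp n * t) w / sp n"
  unfolding Lam_Aint[OF n w t0] Lam_Aint[OF n w t(1)] by (simp add: add_divide_distrib)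
 have "0 <= Aint (%i. lam $ i) (sp n * s) (sp n * t) w"
  unfolding Aint_def by (rule Henstock_Kurzweil_Integration.integral_nonneg[OF path_integrable(1)[OF st(1) w]]) (use lam_nonneg in auto)
 then show "0 <= Lam n t w - Lam n s w" unfolding e using s by simp
 have "Aint (%i. lam $ i) (sp n * s) (sp n * t) w <= Dl * (sp n * t - sp n * s)"
  using Aint_nmax[OF w st, of "%i. lam $ i"] unfolding Dl_def by linarith
 also have "... = Dl * (t - s) * sp n" by (simp add: algebra_simps)
 finally show "Lam n t w - Lam n s w <= Dl * (t - s)" unfolding e using s by (simp add: pos_divide_le_eq)
qed

lemma Lam_meas: "n >= 1 ==> t >= 0 ==> Lam n t \<in> borel_measurable M"
proof -
 assume n: "n >= 1" and t: "t >= 0"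
 have "(%w. Aint (%i. lam $ i) 0 (sp n * t) w / sp n) \<in> borel_measurable M"
  using AintM[of 0 "sp n * t" "%i. lam $ i"] sp_pos[OF n] t by (intro borel_measurable_divide) auto
 then show ?thesis by (rule measurable_cong[THEN iffD1, rotated]) (simp add: Lam_Aint[OF n _ t])
qed

lemma Del_meas: "n >= 1 ==> t >= 0 ==> Del n t \<in> borel_measurable M"
 unfolding Del_def using Lam_meas by measurable

lemma Del_bound: "n >= 1 ==> w \<in> space M ==> t >= 0 ==> \<bar>Del n t w\<bar> <= Df * t"
proof -
 assume a: "n >= 1" "w \<in> space M" "t >= 0"
 have "\<bar>Aint f 0 (sp n * t) w\<bar> <= Df * (sp n * t - 0)" unfolding Df_def using sp_pos[OF a(1)] a by (intro Aint_nmax) auto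
 then show ?thesis unfolding Del_Aint[OF a] abs_divide using sp_pos[OF a(1)] by (simp add: pos_divide_le_eq mult_ac)
qed

lemma Del_moments:
 obtains C where "C >= 0" "!!n s t. n >= 1 ==> 0 <= s ==> s <= t ==> (LINT w|M. (Del n t w - Del n s w)^4) <= C * (t - s)\<^sup>2 / (sp n)\<^sup>2"
  "!!n s t. n >= 1 ==> 0 <= s ==> s <= t ==> (LINT w|M. (Del n t w - Del n s w)\<^sup>2) <= C * (t - s) / sp n"
proof -
 obtain C where C: "C >= 0" "!!s t. 0 <= s ==> s <= t ==> (LINT w|M. (Aint f s t w)^4) <= C * (t - s)\<^sup>2"
  "!!s t. 0 <= s ==> s <= t ==> (LINT w|M. (Aint f s t w)\<^sup>2) <= C * (t - s)"
  using additive_moments[of g f] g unfolding f_def li_def by blast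
 show ?thesis
 proof (rule that[OF C(1)])
  fix n :: nat and s t :: real assume n: "n >= 1" and st: "0 <= s" "s <= t"
  note sp = sp_pos[OF n]
  have sst: "0 <= sp n * s" "sp n * s <= sp n * t" using sp st by auto
  have e: "(LINT w|M. (Del n t w - Del n s w)^p) = (LINT w|M. (Aint f (sp n * s) (sp n * t) w)^p) / (sp n)^p" for p
  proof -
   have "(LINT w|M. (Del n t w - Del n s w)^p) = (LINT w|M. (Aint f (sp n * s) (sp n * t) w)^p / (sp n)^p)"
    by (rule Bochner_Integration.integral_cong) (simp_all add: Del_diff[OF n _ st] power_divide)
   then show ?thesis by simp
  qed
  have "(LINT w|M. (Del n t w - Del n s w)^4) <= C * (sp n * t - sp n * s)\<^sup>2 / (sp n)^4"
   unfolding e using C(2)[OF sst] sp by (intro divide_right_mono) auto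
  also have "... = C * (t - s)\<^sup>2 / (sp n)\<^sup>2"
  proof -
   have "(sp n * t - sp n * s)\<^sup>2 = (sp n)\<^sup>2 * (t - s)\<^sup>2" by (simp add: right_diff_distrib[symmetric] power_mult_distrib)
   then show ?thesis using sp by (simp add: power4_eq_xxxx power2_eq_square)
  qed
  finally show "(LINT w|M. (Del n t w - Del n s w)^4) <= C * (t - s)\<^sup>2 / (sp n)\<^sup>2" .
  have "(LINT w|M. (Del n t w - Del n s w)\<^sup>2) <= C * (sp n * t - sp n * s) / (sp n)\<^sup>2"
   unfolding e using C(3)[OF sst] sp by (intro divide_right_mono) auto
  also have "... = C * (t - s) / sp n" using sp by (simp add: right_diff_distrib[symmetric] power2_eq_square)
  finally show "(LINT w|M. (Del n t w - Del n s w)\<^sup>2) <= C * (t - s) / sp n" .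
 qed
qed

lemma Del_0: "Del n 0 w = 0" unfolding Del_def Lam_def by simp

lemma cond_indep_n:
 assumes n: "n >= 1" shows "cond_indep M n (\<tau> n) (Lam n)"
proof
 show "\<tau> n i \<in> borel_measurable M" if "i < n" for i by (rule tau_meas[OF that])
 show "Lam n t \<in> borel_measurable M" if "t >= 0" for t by (rule Lam_meas[OF n that])
 show "Lam n 0 w = 0" for w unfolding Lam_def by simp
 show "Lam n s w <= Lam n t w" if "w \<in> space M" "0 <= s" "s <= t" for w s t using Lam_diff(1)[OF n that] by simp
 show "measure M {w\<in>space M. \<forall>i<n. ereal (t i) < \<tau> n i w} = (LINT w|M. (\<Prod>i<n. exp (- Lam n (t i) w)))"
  if "!!i. i < n ==> t i >= 0" for t :: "nat => real" unfolding Lam_def sp_def by (rule tau_surv[OF that])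
qed

text \<open>The exponent of \<open>cn n * real n\<close> is \<open>min 1 \<beta> / 2\<close>. Hence,
  in all regimes, both the default noise \<open>n cn^2\<close> and the chain noise
  \<open>(n cn)^2 / sp n\<close> are at most 1.\<close>

lemma cn_bounds:
 assumes n: "n >= 1"
 shows "0 < cn n" "cn n <= real n powr (-1/2)" "(cn n)\<^sup>2 * real n <= 1" "(cn n * real n)\<^sup>2 <= sp n" "cn n * real n <= real n powr (\<beta> / 2)"
proof -
 have n1: "1 <= real n" using n by simp
 show c0: "0 < cn n" unfolding cn_def using n1 by simp
 show c1: "cn n <= real n powr (-1/2)" unfolding cn_def using n1 by (intro powr_mono) auto
 have "(cn n)\<^sup>2 <= (real n powr (-1/2))\<^sup>2" using c0 c1 by (intro power_mono) auto
 also have "... = real n powr (-1)" by (simp add: power2_eq_square powr_add[symmetric])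
 finally show "(cn n)\<^sup>2 * real n <= 1" using n1 by (simp add: powr_minus field_simps)
 have "cn n * real n = real n powr (- (1 + max (1 - \<beta>) 0) / 2) * real n powr 1" unfolding cn_def using n1 by simp
 also have "... = real n powr (- (1 + max (1 - \<beta>) 0) / 2 + 1)" by (simp only: powr_add)
 also have "... <= real n powr (\<beta> / 2)"
 proof (intro powr_mono n1)
  show "- (1 + max (1 - \<beta>) 0) / 2 + 1 <= \<beta> / 2" by (cases "\<beta> <= 1") (simp_all add: max_def field_simps)
 qed
 finally show cb: "cn n * real n <= real n powr (\<beta> / 2)" .
 then have "(cn n * real n)\<^sup>2 <= (real n powr (\<beta> / 2))\<^sup>2" using c0 by (intro power_mono) auto
 also have "... = sp n" unfolding sp_def by (simp add: power2_eq_square powr_add[symmetric])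
 finally show "(cn n * real n)\<^sup>2 <= sp n" .
qed

definition Xp :: "nat => 'a => real => real" where
 "Xp n w t = cn n * (real (card {i. i < n \<and> \<tau> n i w <= ereal t}) - real n * (1 - exp (- li * t)))"

lemma Xp_meas: "(%w. Xp n w t) \<in> borel_measurable M"
proof -
 have "real (card {i. i < n \<and> \<tau> n i w <= ereal t}) = (\<Sum>i<n. if \<tau> n i w <= ereal t then 1 else 0)" for w
 proof -
  have "{i. i < n \<and> \<tau> n i w <= ereal t} = {..<n} \<inter> {i. \<tau> n i w <= ereal t}" by auto
  then show ?thesis by (simp add: sum.If_cases)
 qed
 moreover have "(%w. \<Sum>i<n. if \<tau> n i w <= ereal t then 1 else 0 :: real) \<in> borel_measurable M"
 proof (rule borel_measurable_sum)
  fix i assume "i \<in> {..<n}"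
  then have [measurable]: "\<tau> n i \<in> borel_measurable M" by (simp add: tau_meas)
  show "(%w. if \<tau> n i w <= ereal t then 1 else 0 :: real) \<in> borel_measurable M" by measurable
 qed
 ultimately show "(%w. Xp n w t) \<in> borel_measurable M" unfolding Xp_def by simp
qed

lemma Xp_increment:
 assumes "s <= t"
 shows "Xp n w t - Xp n w s = cn n * ((\<Sum>i<n. if ereal s < \<tau> n i w \<and> \<tau> n i w <= ereal t then 1 else 0) - real n * (exp (- li * s) - exp (- li * t)))"
proof -
 have c: "real (card {i. i < n \<and> \<tau> n i w <= ereal t}) = (\<Sum>i<n. if \<tau> n i w <= ereal t then 1 else 0)" for t
 proof -
  have "{i. i < n \<and> \<tau> n i w <= ereal t} = {..<n} \<inter> {i. \<tau> n i w <= ereal t}" by auto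
  then show ?thesis by (simp add: sum.If_cases)
 qed
 have d: "(\<Sum>i<n. if ereal s < \<tau> n i w \<and> \<tau> n i w <= ereal t then 1 else 0 :: real) = (\<Sum>i<n. if \<tau> n i w <= ereal t then 1 else 0) - (\<Sum>i<n. if \<tau> n i w <= ereal s then 1 else 0)"
  unfolding sum_subtractf[symmetric]
 proof (rule sum.cong)
  fix i
  have "\<tau> n i w <= ereal s ==> \<tau> n i w <= ereal t" using assms by (meson ereal_less_eq(3) order_trans)
  then show "(if ereal s < \<tau> n i w \<and> \<tau> n i w <= ereal t then 1 else 0 :: real) = (if \<tau> n i w <= ereal t then 1 else 0) - (if \<tau> n i w <= ereal s then 1 else 0)"
   by (auto simp: not_less)
 qed simp
 show ?thesis unfolding Xp_def c d by (simp add: algebra_simps)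
qed

lemma Xp_bound:
 assumes t: "t >= 0" and n: "n >= 1"
 shows "\<bar>Xp n w t\<bar> <= cn n * real n"
proof -
 have "card {i. i < n \<and> \<tau> n i w <= ereal t} <= card {..<n}" by (rule card_mono) auto
 then have a: "0 <= real (card {i. i < n \<and> \<tau> n i w <= ereal t})" "real (card {i. i < n \<and> \<tau> n i w <= ereal t}) <= real n" by auto
 have "0 <= 1 - exp (- li * t)" "1 - exp (- li * t) <= 1" using li0 t by auto
 then have b: "0 <= real n * (1 - exp (- li * t))" "real n * (1 - exp (- li * t)) <= real n * 1" by (intro mult_nonneg_nonneg mult_left_mono; simp)+
 then have "\<bar>real (card {i. i < n \<and> \<tau> n i w <= ereal t}) - real n * (1 - exp (- li * t))\<bar> <= real n" using a by linarith
 then show ?thesis unfolding Xp_def abs_mult using cn_bounds(1)[OF n] by (simp add: mult_left_mono)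
qed

text \<open>Since \<open>exp (- Lam n x w) = exp (- li * x) * exp (- Del n x w)\<close>, the
  deviation splits into a part driven by the increment of \<open>Del\<close> and a part in which
  \<open>Del n s w\<close> multiplies a deterministic increment, itself of order
  \<open>t - s\<close>.\<close>

lemma cellprob_dev:
 assumes n: "n >= 1" and w: "w \<in> space M" and st: "0 <= s" "s <= t" "t <= T"
 defines "p \<equiv> exp (- Lam n s w) - exp (- Lam n t w)" and "pb \<equiv> exp (- li * s) - exp (- li * t)"
 shows "(p - pb)^4 <= 8 * exp (4 * (Df * T)) * ((Del n t w - Del n s w)^4 + li^4 * (t - s)^4 * (Del n s w)^4)"
proof -
 have t0: "0 <= t" using st by simp
 define m where "m = Df * T"
 have m0: "m >= 0" unfolding m_def using Df0 st by simp
 have ds: "- m <= Del n s w" "- m <= Del n t w"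
 proof -
  have "Df * s <= m" "Df * t <= m" unfolding m_def using st Df0 by (auto intro: mult_left_mono)
  then show "- m <= Del n s w" "- m <= Del n t w"
   using Del_bound[OF n w st(1)] Del_bound[OF n w t0] by linarith+
 qed
 have eL: "exp (- Lam n x w) = exp (- li * x) * exp (- Del n x w)" for x
  unfolding Del_def exp_add[symmetric] by simp
 define A where "A = exp (- li * t) * (exp (- Del n s w) - exp (- Del n t w))"
 define B where "B = (exp (- li * t) - exp (- li * s)) * (1 - exp (- Del n s w))"
 have "p - pb = A + B" unfolding p_def pb_def A_def B_def eL by (simp add: algebra_simps)
 then have "(p - pb)^4 <= 8 * (A^4 + B^4)" using fourth_power_sum[of A B] by simp
 also have "... <= 8 * (exp (4 * m) * (Del n t w - Del n s w)^4 + exp (4 * m) * (li^4 * (t - s)^4 * (Del n s w)^4))"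
 proof (intro mult_left_mono add_mono)
  have "\<bar>A\<bar> <= 1 * (exp m * \<bar>Del n s w - Del n t w\<bar>)" unfolding A_def abs_mult
   using li0 t0 exp_neg_lipschitz[OF ds] by (intro mult_mono) auto
  from power_mono[OF this abs_ge_zero, of 4]
  show "A^4 <= exp (4 * m) * (Del n t w - Del n s w)^4"
   by (simp add: power_mult_distrib power_even_abs exp_of_nat_mult[symmetric] power4_eq_xxxx[of "Del n s w - Del n t w"] power4_eq_xxxx[of "Del n t w - Del n s w"] algebra_simps)
  have b1: "\<bar>exp (- li * t) - exp (- li * s)\<bar> <= li * (t - s)"
   using exp_neg_lipschitz[of 0 "li * t" "li * s"] li0 st t0 by (simp add: right_diff_distrib[symmetric] abs_mult)
  have b2: "\<bar>1 - exp (- Del n s w)\<bar> <= exp m * \<bar>Del n s w\<bar>"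
   using exp_neg_lipschitz[of m 0 "Del n s w"] ds m0 by simp
  have "\<bar>B\<bar> <= (li * (t - s)) * (exp m * \<bar>Del n s w\<bar>)" unfolding B_def abs_mult using b1 b2 by (intro mult_mono) auto
  from power_mono[OF this abs_ge_zero, of 4]
  show "B^4 <= exp (4 * m) * (li^4 * (t - s)^4 * (Del n s w)^4)"
   by (simp add: power_mult_distrib power_even_abs exp_of_nat_mult[symmetric] mult_ac)
 qed auto
 also have "... = 8 * exp (4 * m) * ((Del n t w - Del n s w)^4 + li^4 * (t - s)^4 * (Del n s w)^4)" by (simp add: distrib_left)
 finally show ?thesis unfolding m_def .
qed

text \<open>Given the chain, the number of defaults in \<open>(s, t]\<close> is binomial with random
  success probability \<open>P w\<close>. Its centred fourth moment is at most
  \<open>3 n^2 P^2 + n P\<close>, and the bias \<open>n (P - pb)\<close> is controlled by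
  \<open>cellprob_dev\<close>. The lower bound on the gap is used for the term linear in
  \<open>n\<close>: \<open>cn^4 n\<close> is at most \<open>1 / n\<close>, hence at most
  \<open>t - s\<close>.\<close>

lemma increment_fourth_moment:
 assumes T: "T >= 0"
 obtains C where "C >= 0" "!!n s t. n >= 1 ==> 0 <= s ==> s <= t ==> t <= T ==> 1 / real n <= t - s ==>
   (LINT w|M. (Xp n w t - Xp n w s)^4) <= C * (t - s)\<^sup>2"
proof -
 obtain C0 where C0: "C0 >= 0" "!!n s t. n >= 1 ==> 0 <= s ==> s <= t ==> (LINT w|M. (Del n t w - Del n s w)^4) <= C0 * (t - s)\<^sup>2 / (sp n)\<^sup>2"
  "!!n s t. n >= 1 ==> 0 <= s ==> s <= t ==> (LINT w|M. (Del n t w - Del n s w)\<^sup>2) <= C0 * (t - s) / sp n"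
  by (rule Del_moments) (rule that)
 define E where "E = 8 * exp (4 * (Df * T))"
 define C1 where "C1 = E * (C0 + li^4 * T^4 * C0)"
 have E0: "E >= 0" unfolding E_def by simp
 have C1: "C1 >= 0" unfolding C1_def using E0 C0 T li0 by simp
 define C where "C = 24 * Dl\<^sup>2 + 8 * Dl + 8 * C1"
 have C: "C >= 0" unfolding C_def using Dl0 C1 by simp
 show ?thesis
 proof (rule that[OF C])
  fix n :: nat and s t :: real assume n: "n >= 1" and st: "0 <= s" "s <= t" "t <= T" and gap: "1 / real n <= t - s"
  have t0: "0 <= t" using st by simp
  interpret C: cond_indep M n "\<tau> n" "Lam n" by (rule cond_indep_n[OF n])
  \<comment> \<open>Cell 1 of the grid \<open>0, s, t\<close> is the interval
    \<open>(s, t]\<close>.\<close>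
  define tt where "tt j = (if j = 0 then 0 else if j = 1 then s else t)" for j :: nat
  have tt: "mono tt" "tt 0 = 0" unfolding tt_def mono_def using st by auto
  define pb where "pb = exp (- li * s) - exp (- li * t)"
  define P where "P w = exp (- Lam n s w) - exp (- Lam n t w)" for w
  have P: "C.pcell tt 2 w 1 = P w" for w unfolding C.pcell_def[OF tt] cellprob_def P_def by (simp add: tt_def)
  have Pb: "0 <= P w" "P w <= Dl * (t - s)" if w: "w \<in> space M" for w
  proof -
   show "0 <= P w" unfolding P_def using Lam_diff(1)[OF n w st(1,2)] by simp
   have "P w <= exp 0 * \<bar>Lam n s w - Lam n t w\<bar>" unfolding P_def
    using exp_neg_lipschitz[of 0 "Lam n s w" "Lam n t w"] C.Lam_nonneg[OF w st(1)] C.Lam_nonneg[OF w t0] by simp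
   also have "... <= Dl * (t - s)" using Lam_diff[OF n w st(1,2)] by simp
   finally show "P w <= Dl * (t - s)" .
  qed
  have P1: "P w <= 1" if "w \<in> space M" for w using C.pcell_props(3)[OF tt that, of 2 1] P by simp
  define F where "F J = ((\<Sum>i<n. if J i = Suc 0 then 1 else 0) - real n * pb)^4" for J :: "nat => nat"
  have Fx: "F (restrict (%i. cellof tt 2 (\<tau> n i w)) {..<n}) = ((\<Sum>i<n. if ereal s < \<tau> n i w \<and> \<tau> n i w <= ereal t then 1 else 0) - real n * pb)^4" for w
  proof -
   have "(cellof tt 2 x = Suc 0) = (ereal s < x \<and> x <= ereal t)" for x
    using cellof_iff[OF tt(1), of 1 2 x] cellof_iff[OF tt(1), of 2 2 x] cellof_le[of tt 2 x] by (auto simp: tt_def)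
   then have "(\<Sum>i<n. if restrict (%i. cellof tt 2 (\<tau> n i w)) {..<n} i = Suc 0 then 1 else 0 :: real) = (\<Sum>i<n. if ereal s < \<tau> n i w \<and> \<tau> n i w <= ereal t then 1 else 0)"
    by (intro sum.cong) auto
   then show ?thesis unfolding F_def by presburger
  qed
  let ?A = "{..2::nat}" and ?m = "8 * (3 * (real n)\<^sup>2 * (Dl * (t - s))\<^sup>2 + real n * (Dl * (t - s)))"
  let ?S = "%w. \<Sum>J\<in>{..<n} \<rightarrow>\<^sub>E ?A. (\<Prod>i<n. C.pcell tt 2 w (J i)) *\<^sub>R F J"
  have bd: "?S w <= 8 * (3 * (real n)\<^sup>2 * (P w)\<^sup>2 + real n * P w) + 8 * (real n)^4 * (P w - pb)^4"
   if w: "w \<in> space M" for w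
  proof -
   define p where "p = C.pcell tt 2 w"
   define x where "x = P w"
   have px: "p (Suc 0) = x" unfolding p_def x_def using P by simp
   define \<xi> where "\<xi> j = (if j = Suc 0 then 1 else 0) - x" for j
   have x01: "0 <= x" "x <= 1" unfolding x_def using Pb(1)[OF w] P1[OF w] by auto
   have sp: "(\<Sum>j\<in>?A. p j) = 1" unfolding p_def using C.pcell_props(2)[OF tt w, of 2] by (simp add: atMost_def)
   have p0: "0 <= p j" for j unfolding p_def by (rule C.pcell_props(1)[OF tt w])
   have sel: "(\<Sum>j\<in>?A. p j * (if j = Suc 0 then a else 0)) = x * a" for a
   proof -
    have "(\<Sum>j\<in>?A. p j * (if j = Suc 0 then a else 0)) = (\<Sum>j\<in>?A. if j = Suc 0 then x * a else 0)"
     by (rule sum.cong) (auto simp: px)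
    then show ?thesis by simp
   qed
   have m0: "(\<Sum>j\<in>?A. p j * \<xi> j) = 0"
    unfolding \<xi>_def right_diff_distrib sum_subtractf sel sum_distrib_right[symmetric] sp by simp
   have v: "(\<Sum>j\<in>?A. p j * (\<xi> j)\<^sup>2) = x - x\<^sup>2"
   proof -
    have "(\<Sum>j\<in>?A. p j * (\<xi> j)\<^sup>2) = (\<Sum>j\<in>?A. p j * (if j = Suc 0 then 1 - 2 * x else 0) + p j * x\<^sup>2)"
     unfolding \<xi>_def by (rule sum.cong) (auto simp: power2_diff algebra_simps)
    also have "... = x * (1 - 2 * x) + 1 * x\<^sup>2" unfolding sum.distrib sel sum_distrib_right[symmetric] sp ..
    finally show ?thesis by (simp add: power2_eq_square algebra_simps)
   qed
   have v1: "(\<Sum>j\<in>?A. p j * (\<xi> j)\<^sup>2) <= x" "0 <= (\<Sum>j\<in>?A. p j * (\<xi> j)\<^sup>2)"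
    using x01 unfolding v by (auto simp: power2_eq_square mult_left_le)
   have x1: "\<bar>\<xi> j\<bar> <= 1" for j unfolding \<xi>_def using x01 by auto
   have mm: "prodmean ?A p \<xi> n (%x. x^4) <= 3 * (real n)\<^sup>2 * (\<Sum>j\<in>?A. p j * (\<xi> j)\<^sup>2)\<^sup>2 + real n * (\<Sum>j\<in>?A. p j * (\<xi> j)\<^sup>2)"
    by (rule prodmean_moments(4)) (use p0 sp m0 x1 in auto)
   also have "... <= 3 * (real n)\<^sup>2 * x\<^sup>2 + real n * x"
    using v1 by (intro add_mono mult_left_mono power_mono) auto
   finally have mm: "prodmean ?A p \<xi> n (%x. x^4) <= 3 * (real n)\<^sup>2 * x\<^sup>2 + real n * x" .
   have one: "(\<Sum>J\<in>{..<n} \<rightarrow>\<^sub>E ?A. (\<Prod>i<n. p (J i))) = 1"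
    using prodmean_moments(1)[of ?A p \<xi> n] p0 sp m0 x1 unfolding prodmean_def by simp
   have "(\<Sum>J\<in>{..<n} \<rightarrow>\<^sub>E ?A. (\<Prod>i<n. p (J i)) *\<^sub>R F J) <= (\<Sum>J\<in>{..<n} \<rightarrow>\<^sub>E ?A. (\<Prod>i<n. p (J i)) * (8 * ((\<Sum>i<n. \<xi> (J i))^4 + (real n * (x - pb))^4)))"
   proof (rule sum_mono)
    fix J
    have "(\<Sum>i<n. if J i = Suc 0 then 1 else 0) - real n * pb = (\<Sum>i<n. \<xi> (J i)) + real n * (x - pb)"
     unfolding \<xi>_def by (simp add: sum_subtractf algebra_simps)
    then have "F J <= 8 * ((\<Sum>i<n. \<xi> (J i))^4 + (real n * (x - pb))^4)" unfolding F_def using fourth_power_sum by metis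
    then show "(\<Prod>i<n. p (J i)) *\<^sub>R F J <= (\<Prod>i<n. p (J i)) * (8 * ((\<Sum>i<n. \<xi> (J i))^4 + (real n * (x - pb))^4))"
     by (simp add: mult_left_mono prod_nonneg p0)
   qed
   also have "... = 8 * prodmean ?A p \<xi> n (%x. x^4) + 8 * (real n * (x - pb))^4 * (\<Sum>J\<in>{..<n} \<rightarrow>\<^sub>E ?A. (\<Prod>i<n. p (J i)))"
    unfolding prodmean_def sum_distrib_left sum.distrib[symmetric] by (rule sum.cong) (simp_all add: algebra_simps)
   also have "... <= 8 * (3 * (real n)\<^sup>2 * x\<^sup>2 + real n * x) + 8 * (real n)^4 * (x - pb)^4"
    unfolding one using mm by (simp add: power_mult_distrib)
   finally show ?thesis unfolding p_def x_def .
  qed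
  have Dm: "Del n s \<in> borel_measurable M" "Del n t \<in> borel_measurable M" using Del_meas[OF n] st t0 by auto
  have Db: "\<bar>Del n s w\<bar> <= Df * T" "\<bar>Del n t w\<bar> <= Df * T" if "w \<in> space M" for w
   using Del_bound[OF n that st(1)] Del_bound[OF n that t0] st Df0 by (auto intro: order_trans mult_left_mono)
  have Pm: "P \<in> borel_measurable M" unfolding P_def using Lam_meas[OF n st(1)] Lam_meas[OF n t0] by measurable
  have I4: "integrable M (%w. (Del n t w - Del n s w)^4)"
  proof (rule integrable_bounded)
   show "(%w. (Del n t w - Del n s w)^4) \<in> borel_measurable M" using Dm by measurable
   show "norm ((Del n t w - Del n s w)^4) <= (2 * (Df * T))^4" if "w \<in> space M" for w
   proof -
    have "\<bar>Del n t w - Del n s w\<bar> <= 2 * (Df * T)" using Db[OF that] by linarith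
    from power_mono[OF this abs_ge_zero, of 4] show ?thesis by (simp add: power_abs)
   qed
  qed
  have I4': "integrable M (%w. (Del n s w)^4)"
  proof (rule integrable_bounded)
   show "(%w. (Del n s w)^4) \<in> borel_measurable M" using Dm by measurable
   show "norm ((Del n s w)^4) <= (Df * T)^4" if "w \<in> space M" for w
    using power_mono[OF Db(1)[OF that] abs_ge_zero, of 4] by (simp add: power_abs)
  qed
  have IP: "integrable M (%w. (P w - pb)^4)"
  proof (rule integrable_bounded)
   show "(%w. (P w - pb)^4) \<in> borel_measurable M" using Pm by measurable
   have "exp (- li * t) <= exp (- li * s)" "exp (- li * s) <= 1" using st li0 by (simp_all add: mult_left_mono)
   then have "0 <= pb" "pb <= 1" unfolding pb_def using exp_ge_zero[of "- li * t"] by linarith+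
   then have "\<bar>P w - pb\<bar> <= 1" if "w \<in> space M" for w using Pb(1)[OF that] P1[OF that] by linarith
   from power_mono[OF this abs_ge_zero, of _ 4] show "norm ((P w - pb)^4) <= 1" if "w \<in> space M" for w using that by (simp add: power_abs)
  qed
  have EP: "(LINT w|M. (P w - pb)^4) <= C1 * (t - s)\<^sup>2 / (sp n)\<^sup>2"
  proof -
   have "(LINT w|M. (P w - pb)^4) <= (LINT w|M. E * ((Del n t w - Del n s w)^4 + li^4 * (t - s)^4 * (Del n s w)^4))"
    unfolding P_def pb_def E_def using IP I4 I4' by (intro integral_mono cellprob_dev[OF n _ st]) (auto simp: P_def pb_def)
   also have "... = E * ((LINT w|M. (Del n t w - Del n s w)^4) + li^4 * (t - s)^4 * (LINT w|M. (Del n s w)^4))"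
    using I4 I4' by simp
   also have "... <= E * (C0 * (t - s)\<^sup>2 / (sp n)\<^sup>2 + li^4 * (t - s)^4 * (C0 * T\<^sup>2 / (sp n)\<^sup>2))"
   proof (intro mult_left_mono add_mono C0(2) n st E0)
    have "(LINT w|M. (Del n s w)^4) <= C0 * (s - 0)\<^sup>2 / (sp n)\<^sup>2" using C0(2)[OF n order_refl st(1)] by (simp add: Del_0)
    also have "... <= C0 * T\<^sup>2 / (sp n)\<^sup>2" using C0(1) st by (intro divide_right_mono mult_left_mono power_mono) auto
    finally show "(LINT w|M. (Del n s w)^4) <= C0 * T\<^sup>2 / (sp n)\<^sup>2" .
   qed (use li0 in auto)
   also have "... <= E * (C0 * (t - s)\<^sup>2 / (sp n)\<^sup>2 + li^4 * (T\<^sup>2 * (t - s)\<^sup>2) * (C0 * T\<^sup>2 / (sp n)\<^sup>2))"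
   proof (intro mult_left_mono add_mono mult_right_mono order_refl E0)
    have "(t - s)^4 = (t - s)\<^sup>2 * (t - s)\<^sup>2" by (simp add: power4_eq_xxxx power2_eq_square)
    also have "... <= T\<^sup>2 * (t - s)\<^sup>2" using st by (intro mult_right_mono power_mono) auto
    finally show "(t - s)^4 <= T\<^sup>2 * (t - s)\<^sup>2" .
   qed (use li0 C0 in auto)
   also have "... = C1 * (t - s)\<^sup>2 / (sp n)\<^sup>2" unfolding C1_def
    by (simp add: power4_eq_xxxx[of T] power2_eq_square[of T] distrib_left add_divide_distrib mult_ac)
   finally show ?thesis .
  qed
  note c = cn_bounds[OF n]
  have n0: "real n > 0" using n by simp
  have X4: "(LINT w|M. (Xp n w t - Xp n w s)^4) = (cn n)^4 * (LINT w|M. F (restrict (%i. cellof tt 2 (\<tau> n i w)) {..<n}))"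
   unfolding Fx Xp_increment[OF st(2)] pb_def[symmetric] by (simp add: power_mult_distrib)
  have "(LINT w|M. F (restrict (%i. cellof tt 2 (\<tau> n i w)) {..<n})) = (LINT w|M. ?S w)"
   by (rule C.cells_expectation[OF tt])
  also have "... <= (LINT w|M. ?m + 8 * (real n)^4 * (P w - pb)^4)"
  proof (rule integral_mono)
   have ip: "integrable M (%w. \<Prod>i<n. C.pcell tt 2 w (J i))" for J
   proof (rule integrable_bounded)
    show "(%w. \<Prod>i<n. C.pcell tt 2 w (J i)) \<in> borel_measurable M" by (intro borel_measurable_prod C.pcell_meas[OF tt])
    show "norm (\<Prod>i<n. C.pcell tt 2 w (J i)) <= 1" if "w \<in> space M" for w
     unfolding real_norm_def abs_prod using C.pcell_props[OF tt that] by (intro prod_le_1) auto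
   qed
   show "integrable M (%w. ?S w)"
    by (intro Bochner_Integration.integrable_sum integrable_scaleR_left ip)
   show "integrable M (%w. ?m + 8 * (real n)^4 * (P w - pb)^4)"
    using IP by simp
   fix w assume w: "w \<in> space M"
   have "8 * (3 * (real n)\<^sup>2 * (P w)\<^sup>2 + real n * P w) <= ?m"
    using Pb[OF w] by (intro mult_left_mono add_mono power_mono) auto
   then show "?S w <= ?m + 8 * (real n)^4 * (P w - pb)^4"
    using bd[OF w] by linarith
  qed
  also have "... = ?m + 8 * (real n)^4 * (LINT w|M. (P w - pb)^4)"
   using IP by (simp add: prob_space)
  also have "... <= ?m + 8 * (real n)^4 * (C1 * (t - s)\<^sup>2 / (sp n)\<^sup>2)"
   using EP by (intro add_left_mono mult_left_mono) auto
  finally have "(cn n)^4 * (LINT w|M. F (restrict (%i. cellof tt 2 (\<tau> n i w)) {..<n})) <= (cn n)^4 * (?m + 8 * (real n)^4 * (C1 * (t - s)\<^sup>2 / (sp n)\<^sup>2))"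
   using c(1) by (intro mult_left_mono) auto
  then have fin: "(LINT w|M. (Xp n w t - Xp n w s)^4) <= (cn n)^4 * (?m + 8 * (real n)^4 * (C1 * (t - s)\<^sup>2 / (sp n)\<^sup>2))"
   unfolding X4 .
  define d where "d = t - s"
  have d0: "d >= 0" unfolding d_def using st by simp
  have a1: "(cn n)^4 * (real n)\<^sup>2 <= 1"
  proof -
   have "(cn n)^4 * (real n)\<^sup>2 = ((cn n)\<^sup>2 * real n)\<^sup>2" by (simp add: power4_eq_xxxx power2_eq_square)
   also have "... <= 1" using c n0 by (intro power_le_one) auto
   finally show ?thesis .
  qed
  have a2: "(cn n)^4 * real n <= d"
  proof -
   have "(cn n)^4 * real n = ((cn n)^4 * (real n)\<^sup>2) / real n" using n0 by (simp add: power2_eq_square)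
   also have "... <= 1 / real n" using a1 n0 by (intro divide_right_mono) auto
   finally show ?thesis using gap unfolding d_def by simp
  qed
  have a3: "(cn n)^4 * (real n)^4 / (sp n)\<^sup>2 <= 1"
  proof -
   have "(cn n)^4 * (real n)^4 = ((cn n * real n)\<^sup>2)\<^sup>2" by (simp add: power_mult_distrib)
   also have "... <= (sp n)\<^sup>2" using c(4) by (intro power_mono) auto
   finally show ?thesis using sp_pos[OF n] by (simp add: pos_divide_le_eq)
  qed
  have "(cn n)^4 * (8 * (3 * (real n)\<^sup>2 * (Dl * d)\<^sup>2 + real n * (Dl * d)) + 8 * (real n)^4 * (C1 * d\<^sup>2 / (sp n)\<^sup>2))
    = ((cn n)^4 * (real n)\<^sup>2) * (24 * Dl\<^sup>2 * d\<^sup>2) + ((cn n)^4 * real n) * (8 * Dl * d) + ((cn n)^4 * (real n)^4 / (sp n)\<^sup>2) * (8 * C1 * d\<^sup>2)"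
   by (simp add: power_mult_distrib algebra_simps)
  also have "... <= 1 * (24 * Dl\<^sup>2 * d\<^sup>2) + d * (8 * Dl * d) + 1 * (8 * C1 * d\<^sup>2)"
   using a1 a2 a3 d0 Dl0 C1 by (intro add_mono mult_right_mono) auto
  also have "... = C * d\<^sup>2" unfolding C_def by (simp add: power2_eq_square algebra_simps)
  finally show "(LINT w|M. (Xp n w t - Xp n w s)^4) <= C * (t - s)\<^sup>2" using fin unfolding d_def by linarith
 qed
qed

end

section \<open>Tightness\<close>

lemma (in prob_space) fourth_moment_tail:
 assumes "integrable M (%w. (Y w)^4)" "e > (0::real)"
 shows "measure M {w\<in>space M. e <= \<bar>Y w\<bar>} <= (LINT w|M. (Y w)^4) / e^4"
proof -
 have "measure M {w\<in>space M. e^4 <= (Y w)^4} <= (LINT w|M. (Y w)^4) / e^4"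
  by (rule integral_Markov_inequality_measure[where A = "{}"]) (use assms in auto)
 moreover have "e^4 <= (Y w)^4 \<longleftrightarrow> e <= \<bar>Y w\<bar>" for w
  using power_mono_iff[of e "\<bar>Y w\<bar>" 4] assms(2) by (simp add: power_even_abs)
 ultimately show ?thesis by simp
qed

text \<open>A point of level \<open>u + 1\<close> is either a point of level \<open>u\<close> or the
  right neighbour of one, so each level costs at most one increment.\<close>

lemma dyadic_increments_bound:
 fixes x :: "nat => real"
 assumes inc: "!!u j. u <= p ==> j < 2^u ==> \<bar>x (Suc j * 2^(p - u)) - x (j * 2^(p - u))\<bar> <= e u"
  and e: "!!u. 0 <= e u"
 shows "u <= p ==> j <= 2^u ==> \<bar>x (j * 2^(p - u)) - x 0\<bar> <= (\<Sum>v\<le>u. e v)"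
proof (induction u arbitrary: j)
 case 0
 then have "j = 0 \<or> j = 1" by auto
 then show ?case using inc[of 0 0] e[of 0] by auto
next
 case (Suc u)
 have pu: "(2::nat)^(p - u) = 2 * 2^(p - Suc u)" using Suc.prems(1) by (simp add: Suc_diff_Suc flip: power_Suc)
 have IH: "\<bar>x (i * 2^(p - u)) - x 0\<bar> <= (\<Sum>v\<le>u. e v)" if "i <= 2^u" for i using Suc.IH[OF _ that] Suc.prems by simp
 show ?case
 proof (cases "even j")
  case True
  then obtain i where i: "j = 2 * i" by (elim evenE)
  then have "j * 2^(p - Suc u) = i * 2^(p - u)" unfolding pu by simp
  moreover have "i <= 2^u" using Suc.prems(2) i by simp
  ultimately show ?thesis using IH[of i] e[of "Suc u"] by simp
 next
  case False
  then obtain i where i: "j = 2 * i + 1" by (elim oddE)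
  then have i': "i <= 2^u" "2 * i < 2^Suc u" using Suc.prems(2) by auto
  have E: "(2 * i) * 2^(p - Suc u) = i * 2^(p - u)" unfolding pu by simp
  have "\<bar>x (j * 2^(p - Suc u)) - x (i * 2^(p - u))\<bar> <= e (Suc u)"
   using inc[OF Suc.prems(1) i'(2)] unfolding E i by simp
  then show ?thesis using IH[OF i'(1)] by simp
 qed
qed

text \<open>The tolerances (9/10)^u at level u are summable, and (10/9)^4 < 2 makes the union bound geometric.\<close>

lemma (in prob_space) chaining:
 fixes x :: "nat => 'a => real"
 assumes meas: "!!j. j <= 2^p ==> x j \<in> borel_measurable M"
  and int: "!!i j. i <= j ==> j <= 2^p ==> integrable M (%w. (x j w - x i w)^4)"
  and mom: "!!i j. i <= j ==> j <= 2^p ==> (LINT w|M. (x j w - x i w)^4) <= C * (real (j - i))\<^sup>2"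
  and eps: "\<epsilon> > 0" and C: "C >= 0"
 obtains A where "A \<in> sets M" "measure M A <= 50000 * C * 4^p / \<epsilon>^4" "!!w k. w \<in> space M - A ==> k <= 2^p ==> \<bar>x k w - x 0 w\<bar> <= \<epsilon>"
proof -
 \<comment> \<open>The factor \<open>1 / 10\<close> normalises the geometric series of ratio
   \<open>9 / 10\<close>, whose sum is 10, so that the tolerances add up to at most
   \<open>\<epsilon>\<close>.\<close>
 define e where "e u = \<epsilon> / 10 * (9/10)^u" for u
 have e: "e u > 0" for u unfolding e_def using eps by simp
 have es: "(\<Sum>v\<le>u. e v) <= \<epsilon>" for u
 proof -
  have "(\<Sum>v\<le>u. e v) = \<epsilon> / 10 * (\<Sum>v\<le>u. (9/10)^v)" unfolding e_def by (simp add: sum_distrib_left)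
  also have "(\<Sum>v\<le>u. (9/10::real)^v) = 10 * (1 - (9/10)^Suc u)"
   unfolding lessThan_Suc_atMost[symmetric] by (subst sum_gp_strict) simp
  also have "\<epsilon> / 10 * (10 * (1 - (9/10)^Suc u)) <= \<epsilon>" using eps by (simp add: field_simps)
  finally show ?thesis .
 qed
 define D where "D u j = {w\<in>space M. e u <= \<bar>x (Suc j * 2^(p - u)) w - x (j * 2^(p - u)) w\<bar>}" for u j
 define A where "A = (\<Union>u\<in>{..p}. \<Union>j\<in>{..<2^u}. D u j)"
 have idx: "j * 2^(p - u) <= Suc j * 2^(p - u)" "Suc j * 2^(p - u) <= 2^p" if "u <= p" "j < 2^u" for u j
 proof -
  show "j * 2^(p - u) <= Suc j * 2^(p - u)" by simp
  have "Suc j * 2^(p - u) <= 2^u * 2^(p - u)" using that by (intro mult_right_mono) auto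
  also have "... = 2^p" using that by (simp flip: power_add)
  finally show "Suc j * 2^(p - u) <= 2^p" .
 qed
 have Dm: "D u j \<in> sets M" if "u <= p" "j < 2^u" for u j
 proof -
  have [measurable]: "x (Suc j * 2^(p - u)) \<in> borel_measurable M" "x (j * 2^(p - u)) \<in> borel_measurable M"
   using meas idx[OF that] order_trans by blast+
  show ?thesis unfolding D_def by measurable
 qed
 have Dp: "measure M (D u j) <= C * (2^(p - u))\<^sup>2 / (e u)^4" if "u <= p" "j < 2^u" for u j
 proof -
  have "measure M (D u j) <= (LINT w|M. (x (Suc j * 2^(p - u)) w - x (j * 2^(p - u)) w)^4) / (e u)^4"
   unfolding D_def by (rule fourth_moment_tail[OF int[OF idx[OF that]] e])
  also have "... <= C * (2^(p - u))\<^sup>2 / (e u)^4"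
   using mom[OF idx[OF that]] e[of u] by (intro divide_right_mono) auto
  finally show ?thesis .
 qed
 \<comment> \<open>The \<open>2^u\<close> increments of length \<open>2^(p - u)\<close> at tolerance
   \<open>e u\<close> fail with total probability at most
   \<open>10000 * C * 4^p / \<epsilon>^4\<close> times the \<open>u\<close>-th power of
   \<open>(10/9)^4 / 2\<close>, a number below \<open>4/5\<close>. The series of ratio
   \<open>4/5\<close> then gives the factor 5 in the constant 50000.\<close>
 have lev: "2^u * (C * (2^(p - u))\<^sup>2 / (e u)^4) <= (10000 * C * 4^p / \<epsilon>^4) * (4/5)^u" if u: "u <= p" for u
 proof -
  define y where "y = C * 4^(p - u)"
  have y: "y * 4^u = C * 4^p" unfolding y_def using u by (simp flip: power_add)
  have y0: "y >= 0" unfolding y_def using C by simp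
  have "(2^(p - u))\<^sup>2 = (4::real)^(p - u)" by (simp add: power2_eq_square flip: power_mult_distrib)
  then have y2: "2^u * (C * (2^(p - u))\<^sup>2 / (e u)^4) = 2^u * (y / (e u)^4)" unfolding y_def by simp
  have e4: "(e u)^4 = \<epsilon>^4 / 10000 * (6561/10000)^u"
   unfolding e_def power_mult_distrib power_divide by (simp add: power_mult[symmetric] mult.commute[of u 4]) (simp add: power_mult)
  have "2^u * (y / (\<epsilon>^4 / 10000 * (6561/10000)^u)) = 10000 / \<epsilon>^4 * y * (2 / (6561/10000))^u"
   using eps unfolding power_divide[of 2] by simp
  also have "... <= 10000 / \<epsilon>^4 * y * (16/5)^u" using y0 eps by (intro mult_left_mono power_mono) auto
  also have "... = 10000 / \<epsilon>^4 * (y * 4^u) * (4/5)^u" by (simp flip: power_mult_distrib)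
  finally show ?thesis unfolding y2 unfolding e4 unfolding y by simp
 qed
 show ?thesis
 proof (rule that)
  show Am: "A \<in> sets M" unfolding A_def using Dm by (intro sets.finite_UN) auto
  have "measure M A <= (\<Sum>u\<in>{..p}. measure M (\<Union>j\<in>{..<2^u}. D u j))"
   unfolding A_def using Dm by (intro finite_measure_subadditive_finite) (auto intro!: sets.finite_UN)
  also have "... <= (\<Sum>u\<in>{..p}. (10000 * C * 4^p / \<epsilon>^4) * (4/5)^u)"
  proof (rule sum_mono)
   fix u assume u: "u \<in> {..p}"
   have "measure M (\<Union>j\<in>{..<2^u}. D u j) <= (\<Sum>j\<in>{..<2^u}. measure M (D u j))"
    using Dm u by (intro finite_measure_subadditive_finite) auto
   also have "... <= (\<Sum>j\<in>{..<(2::nat)^u}. C * (2^(p - u))\<^sup>2 / (e u)^4)" using u by (intro sum_mono Dp) auto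
   also have "... = 2^u * (C * (2^(p - u))\<^sup>2 / (e u)^4)" by simp
   finally show "measure M (\<Union>j\<in>{..<2^u}. D u j) <= (10000 * C * 4^p / \<epsilon>^4) * (4/5)^u" using lev[of u] u by auto
  qed
  also have "... = (10000 * C * 4^p / \<epsilon>^4) * (\<Sum>u\<le>p. (4/5)^u)" by (simp add: sum_distrib_left)
  also have "... <= (10000 * C * 4^p / \<epsilon>^4) * 5"
  proof (rule mult_left_mono)
   have "(\<Sum>v\<le>p. (4/5::real)^v) = 5 * (1 - (4/5)^Suc p)"
    unfolding lessThan_Suc_atMost[symmetric] by (subst sum_gp_strict) simp
   then show "(\<Sum>v\<le>p. (4/5::real)^v) <= 5" by simp
  qed (use C eps in simp)
  finally show "measure M A <= 50000 * C * 4^p / \<epsilon>^4" by simp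
 next
  fix w k assume w: "w \<in> space M - A" and k: "k <= (2::nat)^p"
  have "\<bar>x (Suc j * 2^(p - u)) w - x (j * 2^(p - u)) w\<bar> <= e u" if "u <= p" "j < 2^u" for u j
  proof -
   have "w \<notin> D u j" using w that unfolding A_def by auto
   then show ?thesis unfolding D_def using w by (simp add: not_le)
  qed
  from dyadic_increments_bound[where x = "%k. x k w" and e = e, OF this less_imp_le[OF e] order_refl k]
  have "\<bar>x k w - x 0 w\<bar> <= (\<Sum>v\<le>p. e v)" by simp
  then show "\<bar>x k w - x 0 w\<bar> <= \<epsilon>" using es[of p] by linarith
 qed
qed

context mm_binomial
begin

text \<open>The counting part never decreases, so the path can fall only through its compensator,
  whose slope is at most \<open>cn n * real n * li\<close>.\<close>

lemma Xp_lower: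
 assumes n: "n >= 1" and st: "0 <= s" "s <= t"
 shows "Xp n w s - cn n * (real n * (li * (t - s))) <= Xp n w t"
proof -
 define S where "S = (\<Sum>i<n. if ereal s < \<tau> n i w \<and> \<tau> n i w <= ereal t then 1 else 0 :: real)"
 have S: "0 <= S" unfolding S_def by (intro sum_nonneg) auto
 have t0: "0 <= t" using st by simp
 have "\<bar>exp (- (li * s)) - exp (- (li * t))\<bar> <= exp 0 * \<bar>li * s - li * t\<bar>"
  by (rule exp_neg_lipschitz) (use li0 st t0 in auto)
 also have "... = li * (t - s)" using li0 st by (simp add: right_diff_distrib[symmetric] abs_mult)
 finally have "exp (- li * s) - exp (- li * t) <= li * (t - s)" by simp
 then have "real n * (exp (- li * s) - exp (- li * t)) <= real n * (li * (t - s))" by (rule mult_left_mono) simp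
 then have "- (real n * (li * (t - s))) <= S - real n * (exp (- li * s) - exp (- li * t))" using S by linarith
 then have "cn n * - (real n * (li * (t - s))) <= cn n * (S - real n * (exp (- li * s) - exp (- li * t)))"
  using cn_bounds(1)[OF n] by (intro mult_left_mono) auto
 then show ?thesis using Xp_increment[OF st(2), of n w] unfolding S_def by simp
qed

lemma cn_tendsto_0: "cn \<longlonglongrightarrow> 0"
proof (rule tendsto_sandwich[OF _ _ tendsto_const])
 show "\<forall>\<^sub>F n in sequentially. 0 <= cn n" unfolding cn_def by simp
 show "\<forall>\<^sub>F n in sequentially. cn n <= real n powr (-1/2)"
  using eventually_ge_at_top[of 1] by eventually_elim (rule cn_bounds)
 show "(%n. real n powr (-1/2)) \<longlonglongrightarrow> 0" by (rule tendsto_neg_powr) (auto intro: filterlim_real_sequentially)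
qed

text \<open>The fourth moment bound fails for gaps below 1/n, hence the choice of p with mesh between 1/n and 2/n.\<close>

theorem Xp_tight:
 fixes T :: nat and s d :: real
 assumes s: "0 < s" and d: "0 < d"
 shows "\<exists>m0. \<forall>m\<ge>m0. \<exists>N. \<forall>n\<ge>N. \<exists>A\<in>sets M. measure M A <= d \<and>
    (\<forall>w\<in>space M - A. \<forall>t. 0 <= t \<and> t <= real T \<longrightarrow> \<bar>Xp n w t - Xp n w (real (nat \<lfloor>real m * t\<rfloor>) / real m)\<bar> <= s)"
proof -
 \<comment> \<open>The horizon is \<open>T + 1\<close> because the block of length
   \<open>1 / m\<close> that contains \<open>t\<close> may end after \<open>T\<close>.\<close>
 obtain C where C: "C >= 0" "!!n s t. n >= 1 ==> 0 <= s ==> s <= t ==> t <= real T + 1 ==> 1 / real n <= t - s ==>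
   (LINT w|M. (Xp n w t - Xp n w s)^4) <= C * (t - s)\<^sup>2"
  by (rule increment_fourth_moment[of "real T + 1"]) (auto intro: that)
 define \<epsilon> where "\<epsilon> = s / 2"
 have eps: "\<epsilon> > 0" unfolding \<epsilon>_def using s by simp
 \<comment> \<open>There will be \<open>m * (T + 1)\<close> blocks, each failing with probability at
   most \<open>50000 C / (\<epsilon>^4 m^2)\<close>; the total is at most \<open>d\<close> for
   \<open>m\<close> of this size.\<close>
 define m0 where "m0 = max 1 (nat \<lceil>50000 * C * (real T + 1) / (\<epsilon>^4 * d)\<rceil>)"
 show ?thesis
 proof (rule exI[of _ m0], intro allI impI)
  fix m assume m: "m0 <= m"
  then have m1: "m >= 1" unfolding m0_def by simp
  have mb: "50000 * C * (real T + 1) / (\<epsilon>^4 * d) <= real m" using m unfolding m0_def by linarith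
  have "\<forall>\<^sub>F n in sequentially. cn n < s / (4 * (li + 1))"
   using li0 s by (intro order_tendstoD(2)[OF cn_tendsto_0]) auto
  then obtain N1 where N1: "!!n. n >= N1 ==> cn n < s / (4 * (li + 1))" unfolding eventually_sequentially by blast
  show "\<exists>N. \<forall>n\<ge>N. \<exists>A\<in>sets M. measure M A <= d \<and>
    (\<forall>w\<in>space M - A. \<forall>t. 0 <= t \<and> t <= real T \<longrightarrow> \<bar>Xp n w t - Xp n w (real (nat \<lfloor>real m * t\<rfloor>) / real m)\<bar> <= s)"
  proof (rule exI[of _ "max m N1"], intro allI impI)
   fix n assume nN: "max m N1 <= n"
   then have nm: "m <= n" and n1: "n >= 1" and cn: "cn n < s / (4 * (li + 1))" using m1 N1[of n] by auto
   note c0 = cn_bounds(1)[OF n1]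
   define p where "p = floor_log (n div m)"
   have q1: "n div m > 0" using nm m1 by (simp add: div_greater_zero_iff)
   have p: "2^p <= n div m" "n div m < 2 * 2^p"
    unfolding p_def using floor_log_exp2_le[OF q1] floor_log_exp2_gt[of "n div m"] by auto
   have pm: "m * 2^p <= n"
   proof -
    have "m * 2^p <= m * (n div m)" using p(1) by simp
    then show ?thesis using times_div_less_eq_dividend[of m n] by linarith
   qed
   have pn: "n < 2 * (m * 2^p)"
   proof -
    have "Suc (n div m) <= 2 * 2^p" using p(2) by simp
    then have "Suc (n div m) * m <= 2 * 2^p * m" by (rule mult_right_mono) simp
    moreover have "n < Suc (n div m) * m" using m1 dividend_less_div_times[of m n] by simp
    ultimately show ?thesis by (simp add: mult_ac)
   qed
   define h where "h = 1 / (real m * 2^p)"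
   have h0: "h > 0" unfolding h_def using m1 by simp
   have pm': "real m * 2^p <= real n" "real n <= 2 * (real m * 2^p)"
   proof -
    have "real (m * 2^p) <= real n" "real n <= real (2 * (m * 2^p))" using pm less_imp_le[OF pn] of_nat_le_iff by blast+
    then show "real m * 2^p <= real n" "real n <= 2 * (real m * 2^p)" by simp_all
   qed
   have hn: "1 / real n <= h" unfolding h_def using pm' m1 n1 by (intro divide_left_mono mult_pos_pos) auto
   have hn2: "real n * h <= 2" unfolding h_def using pm'(2) m1 by (simp add: field_simps)
   have hp: "2^p * h = 1 / real m" unfolding h_def using m1 by simp
   define B where "B = m * (T + 1)"
   define r where "r i k = real i / real m + real k * h" for i k :: nat
   have r0: "0 <= r i k" for i k unfolding r_def using h0 by simp
   have rT: "r i k <= real T + 1" if "i < B" "k <= 2^p" for i k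
   proof -
    have "real k <= real (2^p)" using that(2) of_nat_le_iff by blast
    then have "real k * h <= 2^p * h" using h0 by (intro mult_right_mono) auto
    then have "r i k <= (real i + 1) / real m" unfolding r_def hp by (simp add: add_divide_distrib)
    also have "... <= real (m * (T + 1)) / real m"
    proof (rule divide_right_mono)
     have "real (Suc i) <= real (m * (T + 1))" using that(1) unfolding B_def by (simp only: of_nat_le_iff Suc_le_eq)
     then show "real i + 1 <= real (m * (T + 1))" by simp
    qed simp
    also have "... = real T + 1" using m1 by (simp add: add_divide_distrib)
    finally show ?thesis .
   qed
   have "\<exists>A. A \<in> sets M \<and> measure M A <= 50000 * (C * h\<^sup>2) * 4^p / \<epsilon>^4 \<and> (\<forall>w\<in>space M - A. \<forall>k\<le>2^p. \<bar>Xp n w (r i k) - Xp n w (r i 0)\<bar> <= \<epsilon>)"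
    if i: "i < B" for i
   proof -
    have int: "integrable M (%w. (Xp n w (r i j) - Xp n w (r i k))^4)" for j k
    proof (rule integrable_bounded)
     show "(%w. (Xp n w (r i j) - Xp n w (r i k))^4) \<in> borel_measurable M" using Xp_meas by measurable
     fix w
     have "\<bar>Xp n w (r i j) - Xp n w (r i k)\<bar> <= 2 * (cn n * real n)" using Xp_bound[OF r0 n1, of w i j] Xp_bound[OF r0 n1, of w i k] by linarith
     from power_mono[OF this abs_ge_zero, of 4] show "norm ((Xp n w (r i j) - Xp n w (r i k))^4) <= (2 * (cn n * real n))^4" by (simp add: power_even_abs)
    qed
    have mom: "(LINT w|M. (Xp n w (r i k) - Xp n w (r i j))^4) <= C * h\<^sup>2 * (real (k - j))\<^sup>2" if jk: "j <= k" "k <= 2^p" for j k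
    proof (cases "j = k")
     case False
     then have jk1: "1 <= k - j" using jk by simp
     have d1: "r i k - r i j = real (k - j) * h" unfolding r_def using jk by (simp add: of_nat_diff algebra_simps)
     have "1 * h <= real (k - j) * h" using jk1 h0 by (intro mult_right_mono) auto
     then have "h <= r i k - r i j" using d1 by simp
     then have "1 / real n <= r i k - r i j" "r i j <= r i k" using hn h0 by linarith+
     from C(2)[OF n1 r0 this(2) rT[OF i jk(2)] this(1)] show ?thesis unfolding d1 by (simp add: power_mult_distrib mult_ac)
    qed simp
    obtain A where "A \<in> sets M" "measure M A <= 50000 * (C * h\<^sup>2) * 4^p / \<epsilon>^4" "!!w k. w \<in> space M - A ==> k <= 2^p ==> \<bar>Xp n w (r i k) - Xp n w (r i 0)\<bar> <= \<epsilon>"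
     by (rule chaining[of p "%k w. Xp n w (r i k)" "C * h\<^sup>2" \<epsilon>]) (use Xp_meas int mom eps C in auto)
    then show ?thesis by blast
   qed
   then obtain A where A: "!!i. i < B ==> A i \<in> sets M" "!!i. i < B ==> measure M (A i) <= 50000 * (C * h\<^sup>2) * 4^p / \<epsilon>^4"
    "!!i w k. i < B ==> w \<in> space M - A i ==> k <= 2^p ==> \<bar>Xp n w (r i k) - Xp n w (r i 0)\<bar> <= \<epsilon>" by metis
   show "\<exists>A\<in>sets M. measure M A <= d \<and> (\<forall>w\<in>space M - A. \<forall>t. 0 <= t \<and> t <= real T \<longrightarrow> \<bar>Xp n w t - Xp n w (real (nat \<lfloor>real m * t\<rfloor>) / real m)\<bar> <= s)"
   proof (intro bexI[of _ "\<Union>i\<in>{..<B}. A i"] conjI ballI allI impI)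
    show "(\<Union>i\<in>{..<B}. A i) \<in> sets M" using A(1) by (intro sets.finite_UN) auto
    have "measure M (\<Union>i\<in>{..<B}. A i) <= (\<Sum>i\<in>{..<B}. measure M (A i))"
     using A(1) by (intro finite_measure_subadditive_finite) auto
    also have "... <= (\<Sum>i\<in>{..<B}. 50000 * (C * h\<^sup>2) * 4^p / \<epsilon>^4)" by (intro sum_mono A(2)) simp
    also have "... = real B * (50000 * C * (h\<^sup>2 * 4^p) / \<epsilon>^4)" by (simp add: mult_ac)
    also have "h\<^sup>2 * 4^p = 1 / (real m)\<^sup>2"
    proof -
     have "(2^p)\<^sup>2 = (4::real)^p" by (simp add: power2_eq_square flip: power_mult_distrib)
     then have "h\<^sup>2 * 4^p = (2^p * h)\<^sup>2" by (simp add: power_mult_distrib)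
     then show ?thesis unfolding hp by (simp add: power_divide)
    qed
    also have "real B * (50000 * C * (1 / (real m)\<^sup>2) / \<epsilon>^4) = (50000 * C * (real T + 1) / (\<epsilon>^4 * d)) * d / real m"
     unfolding B_def using m1 d eps by (simp add: power2_eq_square field_simps)
    also have "... <= real m * d / real m" using mb d m1 by (intro divide_right_mono mult_right_mono) auto
    also have "... = d" using m1 by simp
    finally show "measure M (\<Union>i\<in>{..<B}. A i) <= d" .
   next
    fix w t assume w: "w \<in> space M - (\<Union>i\<in>{..<B}. A i)" and t: "0 <= t \<and> t <= real T"
    define i where "i = nat \<lfloor>real m * t\<rfloor>"
    have mt: "0 <= real m * t" using t by simp
    have i1: "real i <= real m * t" "real m * t < real i + 1" unfolding i_def using mt by linarith+
    have "real i <= real m * real T" using i1(1) t m1 by (meson mult_left_mono of_nat_0_le_iff order_trans)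
    then have "i <= m * T" by (metis of_nat_le_iff of_nat_mult)
    then have iB: "i < B" unfolding B_def using m1 by simp
    define y where "y = t - real i / real m"
    have y: "0 <= y" "y < 1 / real m" unfolding y_def using i1 m1 by (simp_all add: pos_divide_le_eq diff_less_eq add_divide_distrib[symmetric] pos_less_divide_eq mult.commute)
    define k where "k = nat \<lfloor>y / h\<rfloor>"
    have "0 <= y / h" using y h0 by simp
    then have "real k <= y / h" "y / h < real k + 1" unfolding k_def by linarith+
    then have k2: "real k * h <= y" "y < (real k + 1) * h" using h0 by (simp_all add: field_simps)
    have "real k * h < 2^p * h" using k2(1) y(2) unfolding hp by linarith
    then have "real k < 2^p" using h0 by simp
    then have k3: "k < 2^p" by (metis of_nat_less_iff of_nat_numeral of_nat_power)
    have ra: "r i k <= t" "t <= r i (Suc k)" "t - r i k <= h" "r i (Suc k) - t <= h" "r i 0 = real i / real m"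
     using k2 unfolding r_def y_def by (simp_all add: algebra_simps)
    have ww: "cn n * (real n * (li * u)) <= s / 2" if u: "0 <= u" "u <= h" for u
    proof -
     have "real n * u <= 2" using hn2 u(2) by (meson mult_left_mono of_nat_0_le_iff order_trans)
     then have "(cn n * li) * (real n * u) <= (cn n * li) * 2" using c0 li0 by (intro mult_left_mono) auto
     also have "... <= (s / (4 * (li + 1)) * (li + 1)) * 2" using cn c0 li0 s by (intro mult_right_mono mult_mono) auto
     also have "... = s / 2" using li0 by (simp add: field_simps)
     finally show ?thesis by (simp add: mult_ac)
    qed
    \<comment> \<open>The one-sided estimate is used on both sides of \<open>t\<close>: from the
      fine grid point before it for a lower bound on the path at \<open>t\<close>, and towards the
      one after it for an upper bound.\<close>
    have "Xp n w (r i k) - cn n * (real n * (li * (t - r i k))) <= Xp n w t" by (rule Xp_lower[OF n1 r0 ra(1)])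
    moreover have "cn n * (real n * (li * (t - r i k))) <= s / 2" by (rule ww) (use ra in auto)
    moreover have "Xp n w t - cn n * (real n * (li * (r i (Suc k) - t))) <= Xp n w (r i (Suc k))" by (rule Xp_lower[OF n1 _ ra(2)]) (use t in simp)
    moreover have "cn n * (real n * (li * (r i (Suc k) - t))) <= s / 2" by (rule ww) (use ra in auto)
    moreover have "\<bar>Xp n w (r i k) - Xp n w (r i 0)\<bar> <= s / 2" "\<bar>Xp n w (r i (Suc k)) - Xp n w (r i 0)\<bar> <= s / 2"
     using A(3)[OF iB, of w k] A(3)[OF iB, of w "Suc k"] w iB k3 unfolding \<epsilon>_def by auto
    ultimately have "\<bar>Xp n w t - Xp n w (r i 0)\<bar> <= s" by linarith
    then show "\<bar>Xp n w t - Xp n w (real (nat \<lfloor>real m * t\<rfloor>) / real m)\<bar> <= s" unfolding ra(5) unfolding i_def .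
   qed
  qed
 qed
qed

end

section \<open>Finite-dimensional distributions\<close>

lemma (in prob_space) L1_le_L2:
 fixes Y :: "'a => real"
 assumes Y: "Y \<in> borel_measurable M" "!!w. w \<in> space M ==> \<bar>Y w\<bar> <= B" and c: "(LINT w|M. (Y w)\<^sup>2) <= c"
 shows "(LINT w|M. \<bar>Y w\<bar>) <= sqrt c"
proof -
 have i1: "integrable M (%w. \<bar>Y w\<bar>)" by (rule integrable_bounded[of _ B]) (use Y in auto)
 have i2: "integrable M (%w. \<bar>Y w\<bar>\<^sup>2)"
 proof (rule integrable_bounded[of _ "B\<^sup>2"])
  show "norm (\<bar>Y w\<bar>\<^sup>2) <= B\<^sup>2" if "w \<in> space M" for w using power_mono[OF Y(2)[OF that] abs_ge_zero, of 2] by simp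
 qed (use Y in measurable)
 have "0 <= variance (%w. \<bar>Y w\<bar>)" by (rule variance_positive)
 also have "... = (LINT w|M. \<bar>Y w\<bar>\<^sup>2) - (LINT w|M. \<bar>Y w\<bar>)\<^sup>2" by (rule variance_eq[OF i1 i2])
 finally have "(LINT w|M. \<bar>Y w\<bar>)\<^sup>2 <= c" using c by simp
 then show ?thesis by (rule real_le_rsqrt)
qed

lemma norm_iexp_diff: "norm (iexp x - iexp y) <= \<bar>x - y\<bar>"
proof -
 have "iexp x - iexp y = iexp y * (iexp (x - y) - 1)" by (simp add: right_diff_distrib exp_add[symmetric] algebra_simps)
 then have "norm (iexp x - iexp y) = norm (iexp (x - y) - 1)" by (simp add: norm_mult)
 also have "... <= \<bar>x - y\<bar>" using iexp_approx1[of "x - y" 0] by simp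
 finally show ?thesis .
qed

text \<open>One combination, with weights \<open>\<theta>\<close>, of increments over
  \<open>L\<close> cells of length \<open>1 / m\<close>. In it \<open>mu\<close> and
  \<open>vv\<close> are the mean and variance, given the chain, of the contribution of a single
  obligor, and \<open>vlim\<close> is the variance under the averaged intensity.\<close>

locale mm_grid = mm_binomial M Q Z \<pi> lam \<beta> \<tau> V g k
 for M :: "'a measure" and Q :: "real^'s^'s" and Z \<pi> lam \<beta> \<tau> V g k +
 fixes m L :: nat and \<theta> :: "nat => real"
 assumes m: "m > 0"
begin

definition t :: "nat => real" where "t l = real l / real m"
definition a :: "nat => real" where "a l = exp (li * t l)"
definition et :: "nat => real" where "et j = etaval L \<theta> a j"
definition E :: real where "E = (\<Sum>l<L. \<bar>\<theta> l\<bar> * (a l + a (Suc l)))"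
definition pc :: "nat => 'a => nat => real" where "pc n w j = cellprob L (%l. exp (- Lam n (t l) w)) j"
abbreviation dl :: "nat => nat => 'a => real" where "dl n l \<equiv> Del n (t l)"
abbreviation ainc :: "nat => nat => 'a => real" where "ainc n l \<equiv> Aint f (sp n * t l) (sp n * t (Suc l))"
definition mu :: "nat => 'a => real" where "mu n w = (\<Sum>j\<le>L. pc n w j * et j)"
definition vv :: "nat => 'a => real" where "vv n w = (\<Sum>j\<le>L. pc n w j * (et j)\<^sup>2) - (mu n w)\<^sup>2"
definition vlim :: real where "vlim = (\<Sum>l<L. (\<theta> l)\<^sup>2 * (a (Suc l) - a l))"
definition W :: "nat => 'a => real" where "W n w = (\<Sum>l<L. \<bar>dl n (Suc l) w\<bar>)"
definition KX :: "nat => 'a => real" where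
 "KX n w = (\<Sum>l<L. \<theta> l * (a (Suc l) * Xp n w (t (Suc l)) - a l * Xp n w (t l)))"

lemma t: "mono t" "t 0 = 0" "0 <= t l" "t l <= t (Suc l)" "t (Suc l) - t l = 1 / real m" "l <= L ==> t l <= t L"
 unfolding t_def mono_def using m by (auto intro: divide_right_mono simp: diff_divide_distrib[symmetric])

lemma a: "a l > 0" "a 0 = 1" "a l <= a (Suc l)"
 unfolding a_def using t(2,4) li0 by (auto intro: mult_left_mono)

lemma E: "0 <= E" "\<bar>et j\<bar> <= E"
proof -
 show "0 <= E" unfolding E_def using a(1) by (intro sum_nonneg mult_nonneg_nonneg add_nonneg_nonneg) (auto intro: less_imp_le)
 show "\<bar>et j\<bar> <= E" unfolding et_def etaval_def E_def
 proof (rule order_trans[OF sum_abs], rule sum_mono)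
  fix l
  have "\<bar>a l * (if l <= j then 1 else 0) - a (Suc l) * (if Suc l <= j then 1 else 0)\<bar> <= a l + a (Suc l)"
   using a(1)[of l] a(1)[of "Suc l"] by auto
  then show "\<bar>\<theta> l * (a l * (if l <= j then 1 else 0) - a (Suc l) * (if Suc l <= j then 1 else 0))\<bar> <= \<bar>\<theta> l\<bar> * (a l + a (Suc l))"
   unfolding abs_mult by (intro mult_left_mono) auto
 qed
qed

lemma pc_meas: "n >= 1 ==> (%w. pc n w j) \<in> borel_measurable M"
proof -
 assume n: "n >= 1"
 have [measurable]: "Lam n (t l) \<in> borel_measurable M" for l by (rule Lam_meas[OF n t(3)])
 show ?thesis unfolding pc_def cellprob_def by measurable
qed

lemma W_meas: "n >= 1 ==> W n \<in> borel_measurable M"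
 unfolding W_def using Del_meas[OF _ t(3)] by measurable

lemma KX_meas: "KX n \<in> borel_measurable M"
 unfolding KX_def using Xp_meas by measurable

text \<open>The weight \<open>exp (li * s)\<close> turns the compensator and the count together into
  a constant \<open>n\<close> minus weighted survival indicators; the constant cancels in
  increments.\<close>

lemma weighted_Xp:
 "exp (li * s) * Xp n w s = cn n * (real n - (\<Sum>i<n. exp (li * s) * (if ereal s < \<tau> n i w then 1 else 0)))"
proof -
 have "{i. i < n \<and> \<tau> n i w <= ereal s} = {..<n} \<inter> {i. \<tau> n i w <= ereal s}" by auto
 then have "real (card {i. i < n \<and> \<tau> n i w <= ereal s}) = (\<Sum>i<n. if \<tau> n i w <= ereal s then 1 else 0)" by (simp add: sum.If_cases)
 also have "... = (\<Sum>i<n. 1 - (if ereal s < \<tau> n i w then 1 else 0))" by (rule sum.cong) auto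
 also have "... = real n - (\<Sum>i<n. if ereal s < \<tau> n i w then 1 else 0)" by (simp add: sum_subtractf)
 finally have c: "real (card {i. i < n \<and> \<tau> n i w <= ereal s}) = real n - (\<Sum>i<n. if ereal s < \<tau> n i w then 1 else 0)" .
 define S where "S = (\<Sum>i<n. if ereal s < \<tau> n i w then 1 else 0 :: real)"
 define e where "e = exp (li * s)"
 have e: "exp (- li * s) = 1 / e" "e > 0" unfolding e_def by (simp_all add: exp_minus field_simps)
 have "e * (cn n * (real n - S - real n * (1 - 1 / e))) = cn n * (real n - e * S)" using e(2) by (simp add: field_simps)
 then show ?thesis unfolding Xp_def c e(1) sum_distrib_left[symmetric] S_def[symmetric] e_def[symmetric] .
qed

text \<open>Each obligor enters through its cell only. The identity is almost sure because the
  survival indicator at grid point 0 is 1 for positive default times only.\<close>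

lemma KX_cells:
 assumes n: "n >= 1"
 shows "AE w in M. KX n w = cn n * (\<Sum>i<n. et (cellof t L (\<tau> n i w)))"
proof -
 interpret C: cond_indep M n "\<tau> n" "Lam n" by (rule cond_indep_n[OF n])
 show ?thesis using C.\<tau>_pos
 proof (eventually_elim)
  fix w assume pos: "\<forall>i\<in>{..<n}. 0 < \<tau> n i w"
  have ind: "(if ereal (t l) < \<tau> n i w then 1 else 0 :: real) = (if l <= cellof t L (\<tau> n i w) then 1 else 0)" if "i < n" "l <= L" for i l
  proof (cases "l = 0")
   case True
   then show ?thesis using pos that(1) t(2) by (simp add: zero_ereal_def[symmetric])
  next
   case False
   then show ?thesis using cellof_iff[OF t(1), of l L "\<tau> n i w"] that(2) by simp
  qed
  have aX: "a l * Xp n w (t l) = cn n * (real n - (\<Sum>i<n. a l * (if l <= cellof t L (\<tau> n i w) then 1 else 0)))" if "l <= L" for l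
  proof -
   have "(\<Sum>i<n. a l * (if ereal (t l) < \<tau> n i w then 1 else 0)) = (\<Sum>i<n. a l * (if l <= cellof t L (\<tau> n i w) then 1 else 0))"
    by (rule sum.cong) (use ind[OF _ that] in auto)
   then show ?thesis using weighted_Xp[of "t l" n w] unfolding a_def by simp
  qed
  have "KX n w = (\<Sum>l<L. \<theta> l * (cn n * (\<Sum>i<n. a l * (if l <= cellof t L (\<tau> n i w) then 1 else 0) - a (Suc l) * (if Suc l <= cellof t L (\<tau> n i w) then 1 else 0))))"
   unfolding KX_def
  proof (rule sum.cong[OF refl])
   fix l assume "l \<in> {..<L}"
   then have l: "l <= L" "Suc l <= L" by auto
   show "\<theta> l * (a (Suc l) * Xp n w (t (Suc l)) - a l * Xp n w (t l)) = \<theta> l * (cn n * (\<Sum>i<n. a l * (if l <= cellof t L (\<tau> n i w) then 1 else 0) - a (Suc l) * (if Suc l <= cellof t L (\<tau> n i w) then 1 else 0)))"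
    unfolding aX[OF l(1)] aX[OF l(2)] sum_subtractf by (simp add: right_diff_distrib)
  qed
  also have "... = cn n * (\<Sum>l<L. \<Sum>i<n. \<theta> l * (a l * (if l <= cellof t L (\<tau> n i w) then 1 else 0) - a (Suc l) * (if Suc l <= cellof t L (\<tau> n i w) then 1 else 0)))"
   unfolding sum_distrib_left by (intro sum.cong refl) (simp add: mult_ac)
  also have "... = cn n * (\<Sum>i<n. et (cellof t L (\<tau> n i w)))"
   unfolding et_def etaval_def by (subst sum.swap) (rule refl)
  finally show "KX n w = cn n * (\<Sum>i<n. et (cellof t L (\<tau> n i w)))" .
 qed
qed

text \<open>The exponential of a sum over obligors is a product over obligors, so the finite sum in
  \<open>cells_expectation\<close> collapses to an \<open>n\<close>-th power.\<close>

lemma char_KX: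
 assumes n: "n >= 1"
 shows "(LINT w|M. iexp (KX n w)) = (LINT w|M. (\<Sum>j\<le>L. of_real (pc n w j) * iexp (cn n * et j)) ^ n)"
proof -
 interpret C: cond_indep M n "\<tau> n" "Lam n" by (rule cond_indep_n[OF n])
 define F where "F J = iexp (cn n * (\<Sum>i<n. et (J i)))" for J :: "nat => nat"
 have pce: "C.pcell t L w j = pc n w j" for w j unfolding C.pcell_def[OF t(1,2)] pc_def ..
 have FJ: "F J = (\<Prod>i<n. iexp (cn n * et (J i)))" for J
  unfolding F_def by (simp add: sum_distrib_left exp_sum)
 have Fm: "(%w. F (restrict (%i. cellof t L (\<tau> n i w)) {..<n})) \<in> borel_measurable M"
  unfolding F_def
 proof -
  have "(%w. et (cellof t L (\<tau> n i w))) \<in> borel_measurable M" if i: "i < n" for i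
  proof -
   have "(%w. \<Sum>j\<le>L. et j * C.incell t L j (\<tau> n i w)) \<in> borel_measurable M"
    by (intro borel_measurable_sum borel_measurable_times borel_measurable_const C.incell_meas[OF t(1,2) i])
   moreover have "(\<Sum>j\<le>L. et j * C.incell t L j x) = et (cellof t L x)" for x
    unfolding C.incell_def[OF t(1,2)] using cellof_le[of t L x] by (simp add: if_distrib[where f = "%y. _ * y"] sum.delta cong: if_cong)
   ultimately show ?thesis by simp
  qed
  then have "(%w. iexp (cn n * (\<Sum>i<n. et (cellof t L (\<tau> n i w))))) \<in> borel_measurable M" by measurable
  then show "(%w. iexp (cn n * (\<Sum>i<n. et (restrict (%i. cellof t L (\<tau> n i w)) {..<n} i)))) \<in> borel_measurable M" by simp
 qed
 have "(LINT w|M. iexp (KX n w)) = (LINT w|M. F (restrict (%i. cellof t L (\<tau> n i w)) {..<n}))"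
 proof (rule integral_cong_AE)
  show "(%w. iexp (KX n w)) \<in> borel_measurable M" using KX_meas by measurable
  show "AE w in M. iexp (KX n w) = F (restrict (%i. cellof t L (\<tau> n i w)) {..<n})"
   using KX_cells[OF n] by eventually_elim (simp add: F_def)
 qed (rule Fm)
 also have "... = (LINT w|M. (\<Sum>J\<in>{..<n} \<rightarrow>\<^sub>E {..L}. (\<Prod>i<n. C.pcell t L w (J i)) *\<^sub>R F J))"
  by (rule C.cells_expectation[OF t(1,2)])
 also have "... = (LINT w|M. (\<Sum>j\<le>L. of_real (pc n w j) * iexp (cn n * et j)) ^ n)"
 proof (rule Bochner_Integration.integral_cong[OF refl])
  fix w
  have "(\<Sum>j\<le>L. of_real (pc n w j) * iexp (cn n * et j)) ^ n = (\<Prod>i<n. \<Sum>j\<le>L. of_real (pc n w j) * iexp (cn n * et j))" by simp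
  also have "... = (\<Sum>J\<in>{..<n} \<rightarrow>\<^sub>E {..L}. \<Prod>i<n. of_real (pc n w (J i)) * iexp (cn n * et (J i)))" by (rule prod_sum_PiE) auto
  finally show "(\<Sum>J\<in>{..<n} \<rightarrow>\<^sub>E {..L}. (\<Prod>i<n. C.pcell t L w (J i)) *\<^sub>R F J) = (\<Sum>j\<le>L. of_real (pc n w j) * iexp (cn n * et j)) ^ n"
   unfolding FJ pce by (simp add: prod.distrib scaleR_conv_of_real)
 qed
 finally show ?thesis .
qed

lemma pc_props:
 assumes n: "n >= 1" and w: "w \<in> space M"
 shows "0 <= pc n w j" "(\<Sum>j\<le>L. pc n w j) = 1"
proof -
 interpret C: cond_indep M n "\<tau> n" "Lam n" by (rule cond_indep_n[OF n])
 have "C.pcell t L w j = pc n w j" for j unfolding C.pcell_def[OF t(1,2)] pc_def ..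
 then show "0 <= pc n w j" "(\<Sum>j\<le>L. pc n w j) = 1" using C.pcell_props[OF t(1,2) w, of L] by auto
qed

lemma zeta_est:
 assumes n: "n >= 1" and w: "w \<in> space M" and c: "cn n <= 1" "cn n * (2 * E) <= 1"
 shows "norm ((\<Sum>j\<le>L. of_real (pc n w j) * iexp (cn n * et j)) ^ n - iexp (real n * cn n * mu n w) * of_real (exp (- (real n * (cn n)\<^sup>2 * vv n w / 2))))
  <= real n * (cn n)^3 * ((2 * E)^3 + 3 * (2 * E)^4)"
 unfolding mu_def vv_def
 by (rule zeta_power_estimate(1)) (use pc_props[OF n w] E c cn_bounds(1)[OF n] in auto)

lemma mu_vv_props:
 assumes n: "n >= 1" and w: "w \<in> space M"
 shows "0 <= vv n w" "\<bar>mu n w\<bar> <= E"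
proof -
 note z = zeta_power_estimate(2,3)[where p = "pc n w" and \<eta> = et and K = L and E = E and c = 0, OF pc_props[OF n w] E(2)]
 show "0 <= vv n w" unfolding vv_def mu_def by (rule z(1)) auto
 show "\<bar>mu n w\<bar> <= E" unfolding mu_def by (rule z(2)) auto
qed

text \<open>Summation by parts moves the difference onto the survival probabilities, and
  \<open>exp (- x)\<close> is 1-Lipschitz for \<open>x >= 0\<close>.\<close>

lemma cellsum_dev:
 assumes n: "n >= 1" and w: "w \<in> space M" and h: "!!j. \<bar>h j\<bar> <= H"
 shows "\<bar>(\<Sum>j\<le>L. pc n w j * h j) - (\<Sum>j\<le>L. cellprob L (%l. 1 / a l) j * h j)\<bar> <= 2 * H * W n w"
proof -
 have S: "\<bar>exp (- Lam n (t l) w) - 1 / a l\<bar> <= \<bar>dl n l w\<bar>" for l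
 proof -
  interpret C: cond_indep M n "\<tau> n" "Lam n" by (rule cond_indep_n[OF n])
  have "\<bar>exp (- Lam n (t l) w) - exp (- (li * t l))\<bar> <= exp 0 * \<bar>Lam n (t l) w - li * t l\<bar>"
   by (rule exp_neg_lipschitz) (use C.Lam_nonneg[OF w t(3)] li0 t(3)[of l] in auto)
  then show ?thesis unfolding a_def Del_def by (simp add: exp_minus field_simps)
 qed
 have e: "(\<Sum>j\<le>L. pc n w j * h j) - (\<Sum>j\<le>L. cellprob L (%l. 1 / a l) j * h j)
  = (\<Sum>l<L. (exp (- Lam n (t (Suc l)) w) - 1 / a (Suc l)) * (h (Suc l) - h l))"
  unfolding pc_def sum_cellprob left_diff_distrib sum_subtractf using t(2) a(2) by (simp add: Lam_def)
 have "\<bar>(\<Sum>j\<le>L. pc n w j * h j) - (\<Sum>j\<le>L. cellprob L (%l. 1 / a l) j * h j)\<bar> <= (\<Sum>l<L. \<bar>dl n (Suc l) w\<bar> * (2 * H))"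
  unfolding e
 proof (rule order_trans[OF sum_abs], rule sum_mono)
  fix l
  have "\<bar>h (Suc l) - h l\<bar> <= 2 * H" using h[of l] h[of "Suc l"] by linarith
  then show "\<bar>(exp (- Lam n (t (Suc l)) w) - 1 / a (Suc l)) * (h (Suc l) - h l)\<bar> <= \<bar>dl n (Suc l) w\<bar> * (2 * H)"
   unfolding abs_mult using S by (intro mult_mono) auto
 qed
 also have "... = 2 * H * W n w" unfolding W_def by (simp add: sum_distrib_left mult_ac)
 finally show ?thesis .
qed

text \<open>Under the averaged intensity the survival probabilities are \<open>1 / a l\<close>;
  there the mean is 0 and the second moment is \<open>vlim\<close> by
  \<open>etaval_variance\<close>. The square of \<open>mu\<close> is bounded by \<open>E\<close>
  times its modulus, so only the first power of \<open>W\<close> appears.\<close>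

lemma vv_dev:
 assumes n: "n >= 1" and w: "w \<in> space M"
 shows "\<bar>vv n w - vlim\<bar> <= 4 * E\<^sup>2 * W n w"
proof -
 have v: "(\<Sum>j\<le>L. cellprob L (%l. 1 / a l) j * (et j)\<^sup>2) = vlim"
  unfolding et_def vlim_def by (rule etaval_variance) (use a in \<open>auto simp: less_imp_neq[symmetric]\<close>)
 have z: "(\<Sum>j\<le>L. cellprob L (%l. 1 / a l) j * et j) = 0"
 proof -
  have "a l * (1 / a l) = 1" for l using a(1)[of l] by simp
  then show ?thesis unfolding et_def etaval_mean by simp
 qed
 have sq: "\<bar>(et j)\<^sup>2\<bar> <= E\<^sup>2" for j using power_mono[OF E(2)[of j] abs_ge_zero, of 2] by simp
 from cellsum_dev[where h = "%j. (et j)\<^sup>2", OF n w sq] have 1: "\<bar>(\<Sum>j\<le>L. pc n w j * (et j)\<^sup>2) - vlim\<bar> <= 2 * E\<^sup>2 * W n w" unfolding v .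
 have 2: "\<bar>mu n w\<bar> <= 2 * E * W n w" using cellsum_dev[where h = et, OF n w E(2)] unfolding z mu_def by simp
 have "(mu n w)\<^sup>2 = \<bar>mu n w\<bar> * \<bar>mu n w\<bar>" by (simp add: power2_eq_square)
 also have "... <= E * (2 * E * W n w)" using 2 mu_vv_props(2)[OF n w] E(1) by (intro mult_mono) auto
 finally have 3: "(mu n w)\<^sup>2 <= 2 * E\<^sup>2 * W n w" by (simp add: power2_eq_square mult_ac)
 show ?thesis using 1 3 zero_le_power2[of "mu n w"] unfolding vv_def by linarith
qed

text \<open>The part of \<open>mu\<close> that is linear in the deviations \<open>Del\<close>;
  \<open>R\<close> below dominates the quadratic remainder.\<close>

definition D :: "nat => 'a => real" where "D n w = (\<Sum>l<L. \<theta> l * (dl n (Suc l) w - dl n l w))"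
definition R :: "nat => 'a => real" where "R n w = (\<Sum>l<L. \<bar>\<theta> l\<bar> * ((dl n l w)\<^sup>2 + (dl n (Suc l) w)\<^sup>2))"

lemma D_meas: "n >= 1 ==> D n \<in> borel_measurable M"
 unfolding D_def using Del_meas[OF _ t(3)] by measurable

lemma Del_grid: "n >= 1 ==> w \<in> space M ==> l <= L ==> \<bar>dl n l w\<bar> <= Df * t L"
 using Del_bound[of n w "t l"] t(3)[of l] t(6)[of l] Df0 by (meson mult_left_mono order_trans)

text \<open>\<open>a l\<close> times the survival probability is \<open>exp (- dl n l w)\<close>, so
  \<open>mu\<close> is a combination of differences of such exponentials. Taylor's formula has a
  uniform constant because \<open>Del\<close> is bounded on the grid.\<close>

lemma mu_dev:
 assumes n: "n >= 1" and w: "w \<in> space M"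
 shows "\<bar>mu n w - D n w\<bar> <= exp (Df * t L) * R n w"
proof -
 have aS: "a l * exp (- Lam n (t l) w) = exp (- dl n l w)" for l
  unfolding a_def Del_def exp_add[symmetric] by simp
 have q: "\<bar>exp (- dl n l w) - 1 + dl n l w\<bar> <= exp (Df * t L) * (dl n l w)\<^sup>2" if "l <= L" for l
 proof -
  have "\<bar>exp (- dl n l w) - 1 - (- dl n l w)\<bar> <= (- dl n l w)\<^sup>2 * exp \<bar>- dl n l w\<bar>" by (rule exp_taylor_bounds(2))
  also have "... <= (dl n l w)\<^sup>2 * exp (Df * t L)" using Del_grid[OF n w that] by (simp add: mult_left_mono)
  finally show ?thesis by (simp add: mult.commute)
 qed
 have e: "mu n w - D n w = (\<Sum>l<L. \<theta> l * ((exp (- dl n l w) - 1 + dl n l w) - (exp (- dl n (Suc l) w) - 1 + dl n (Suc l) w)))"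
  unfolding mu_def et_def pc_def etaval_mean aS D_def sum_subtractf[symmetric] by (rule sum.cong) (auto simp: algebra_simps)
 have "\<bar>mu n w - D n w\<bar> <= (\<Sum>l<L. \<bar>\<theta> l\<bar> * (exp (Df * t L) * (dl n l w)\<^sup>2 + exp (Df * t L) * (dl n (Suc l) w)\<^sup>2))"
  unfolding e
 proof (rule order_trans[OF sum_abs], rule sum_mono)
  fix l assume "l \<in> {..<L}"
  then have l: "l <= L" "Suc l <= L" by auto
  show "\<bar>\<theta> l * ((exp (- dl n l w) - 1 + dl n l w) - (exp (- dl n (Suc l) w) - 1 + dl n (Suc l) w))\<bar>
    <= \<bar>\<theta> l\<bar> * (exp (Df * t L) * (dl n l w)\<^sup>2 + exp (Df * t L) * (dl n (Suc l) w)\<^sup>2)"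
   unfolding abs_mult using q[OF l(1)] q[OF l(2)] by (intro mult_left_mono) linarith+
 qed
 also have "... = exp (Df * t L) * R n w" unfolding R_def sum_distrib_left by (rule sum.cong) (simp_all add: algebra_simps)
 finally show ?thesis .
qed

lemma grid_integrable:
 assumes n: "n >= 1"
 shows "l <= L ==> integrable M (%w. \<bar>dl n l w\<bar>)" "l <= L ==> integrable M (%w. (dl n l w)\<^sup>2)"
  "integrable M (W n)" "integrable M (R n)" "integrable M (%w. \<bar>D n w\<bar>)"
proof -
 have [measurable]: "dl n l \<in> borel_measurable M" for l by (rule Del_meas[OF n t(3)])
 show i1: "integrable M (%w. \<bar>dl n l w\<bar>)" if "l <= L" for l
  by (rule integrable_bounded[of _ "Df * t L"]) (use Del_grid[OF n _ that] in auto)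
 show i2: "integrable M (%w. (dl n l w)\<^sup>2)" if "l <= L" for l
 proof (rule integrable_bounded[of _ "(Df * t L)\<^sup>2"])
  show "norm ((dl n l w)\<^sup>2) <= (Df * t L)\<^sup>2" if "w \<in> space M" for w
   using power_mono[OF Del_grid[OF n that \<open>l <= L\<close>] abs_ge_zero, of 2] by simp
 qed measurable
 show "integrable M (W n)" unfolding W_def by (intro Bochner_Integration.integrable_sum i1) auto
 show "integrable M (R n)" unfolding R_def
  by (intro Bochner_Integration.integrable_sum integrable_mult_right Bochner_Integration.integrable_add i2) auto
 have iD: "integrable M (dl n l)" if "l <= L" for l
  by (rule integrable_bounded[of _ "Df * t L"]) (use Del_grid[OF n _ that] in auto)
 have "integrable M (D n)" unfolding D_def
  by (intro Bochner_Integration.integrable_sum integrable_mult_right Bochner_Integration.integrable_diff iD) auto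
 then show "integrable M (%w. \<bar>D n w\<bar>)" by simp
qed

text \<open>Second moments of \<open>Del\<close> are of order \<open>1 / sp n\<close>; the
  quantities linear in \<open>Del\<close> inherit the square root of this rate by Jensen, the
  quadratic one keeps it.\<close>

lemma Del_L1:
 obtains C where "C >= 0" "!!n. n >= 1 ==> (LINT w|M. W n w) <= C / sqrt (sp n)"
  "!!n. n >= 1 ==> (LINT w|M. \<bar>D n w\<bar>) <= C / sqrt (sp n)" "!!n. n >= 1 ==> (LINT w|M. R n w) <= C / sp n"
proof -
 obtain C0 where C0: "C0 >= 0" "!!n s t. n >= 1 ==> 0 <= s ==> s <= t ==> (LINT w|M. (Del n t w - Del n s w)^4) <= C0 * (t - s)\<^sup>2 / (sp n)\<^sup>2"
  "!!n s t. n >= 1 ==> 0 <= s ==> s <= t ==> (LINT w|M. (Del n t w - Del n s w)\<^sup>2) <= C0 * (t - s) / sp n"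
  by (rule Del_moments) (rule that)
 define c where "c = C0 * t L"
 have c0: "c >= 0" unfolding c_def using C0 t(3) by simp
 define \<Theta> where "\<Theta> = (\<Sum>l<L. \<bar>\<theta> l\<bar>)"
 have Th: "\<Theta> >= 0" unfolding \<Theta>_def by (simp add: sum_nonneg)
 define C where "C = real L * sqrt c + \<Theta> * (2 * sqrt c) + \<Theta> * (2 * c)"
 have parts: "0 <= real L * sqrt c" "0 <= \<Theta> * (2 * sqrt c)" "0 <= \<Theta> * (2 * c)" using c0 Th by auto
 have l2: "(LINT w|M. (dl n l w)\<^sup>2) <= c / sp n" if n: "n >= 1" and l: "l <= L" for n l
 proof -
  have "(LINT w|M. (dl n l w)\<^sup>2) <= C0 * (t l - 0) / sp n" using C0(3)[OF n order_refl t(3), of l] by (simp add: Del_0)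
  also have "... <= c / sp n" unfolding c_def using sp_pos[OF n] C0(1) t(6)[OF l] by (intro divide_right_mono mult_left_mono) auto
  finally show ?thesis .
 qed
 have l1: "(LINT w|M. \<bar>dl n l w\<bar>) <= sqrt c / sqrt (sp n)" if n: "n >= 1" and l: "l <= L" for n l
  using L1_le_L2[OF Del_meas[OF n t(3)] Del_grid[OF n _ l] l2[OF n l]] by (simp add: real_sqrt_divide)
 note i1 = grid_integrable(1) and i2 = grid_integrable(2)
 show ?thesis
 proof (rule that[of C])
  show "C >= 0" unfolding C_def using parts by linarith
  fix n :: nat assume n: "n >= 1"
  note s = sp_pos[OF n]
  have le: "x <= C" if "x = real L * sqrt c \<or> x = \<Theta> * (2 * sqrt c) \<or> x = \<Theta> * (2 * c)" for x
   unfolding C_def using parts that by auto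
  have "(LINT w|M. W n w) = (\<Sum>l<L. LINT w|M. \<bar>dl n (Suc l) w\<bar>)"
   unfolding W_def by (rule Bochner_Integration.integral_sum) (use i1[OF n] in auto)
  also have "... <= (\<Sum>l<L. sqrt c / sqrt (sp n))" by (intro sum_mono l1 n) auto
  also have "... = real L * sqrt c / sqrt (sp n)" by simp
  also have "... <= C / sqrt (sp n)" using s by (intro divide_right_mono le) auto
  finally show "(LINT w|M. W n w) <= C / sqrt (sp n)" .
  have "(LINT w|M. \<bar>D n w\<bar>) <= (LINT w|M. (\<Sum>l<L. \<bar>\<theta> l\<bar> * (\<bar>dl n (Suc l) w\<bar> + \<bar>dl n l w\<bar>)))"
  proof (rule integral_mono)
   show "\<bar>D n w\<bar> <= (\<Sum>l<L. \<bar>\<theta> l\<bar> * (\<bar>dl n (Suc l) w\<bar> + \<bar>dl n l w\<bar>))" for w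
    unfolding D_def by (rule order_trans[OF sum_abs], rule sum_mono) (auto simp: abs_mult intro: mult_left_mono)
   show "integrable M (%w. \<Sum>l<L. \<bar>\<theta> l\<bar> * (\<bar>dl n (Suc l) w\<bar> + \<bar>dl n l w\<bar>))"
    by (intro Bochner_Integration.integrable_sum integrable_mult_right Bochner_Integration.integrable_add i1 n) auto
  qed (rule grid_integrable(5)[OF n])
  also have "... = (\<Sum>l<L. \<bar>\<theta> l\<bar> * ((LINT w|M. \<bar>dl n (Suc l) w\<bar>) + (LINT w|M. \<bar>dl n l w\<bar>)))"
   using i1[OF n] by (subst Bochner_Integration.integral_sum) auto
  also have "... <= (\<Sum>l<L. \<bar>\<theta> l\<bar> * (sqrt c / sqrt (sp n) + sqrt c / sqrt (sp n)))"
   by (intro sum_mono mult_left_mono add_mono l1 n) auto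
  also have "... = \<Theta> * (2 * sqrt c) / sqrt (sp n)" unfolding \<Theta>_def by (simp add: sum_distrib_right sum_divide_distrib)
  also have "... <= C / sqrt (sp n)" using s by (intro divide_right_mono le) auto
  finally show "(LINT w|M. \<bar>D n w\<bar>) <= C / sqrt (sp n)" .
  have "(LINT w|M. R n w) = (\<Sum>l<L. \<bar>\<theta> l\<bar> * ((LINT w|M. (dl n l w)\<^sup>2) + (LINT w|M. (dl n (Suc l) w)\<^sup>2)))"
   unfolding R_def using i2[OF n] by (subst Bochner_Integration.integral_sum) auto
  also have "... <= (\<Sum>l<L. \<bar>\<theta> l\<bar> * (c / sp n + c / sp n))"
   by (intro sum_mono mult_left_mono add_mono l2 n) auto
  also have "... = \<Theta> * (2 * c) / sp n" unfolding \<Theta>_def by (simp add: sum_distrib_right sum_divide_distrib)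
  also have "... <= C / sp n" using s by (intro divide_right_mono le) auto
  finally show "(LINT w|M. R n w) <= C / sp n" .
 qed
qed

definition b1 :: real where "b1 = (if \<beta> <= 1 then 1 else 0)"
definition b2 :: real where "b2 = (if \<beta> >= 1 then 1 else 0)"

lemma n_cn2: "n >= 1 ==> real n * (cn n)\<^sup>2 = real n powr (- max (1 - \<beta>) 0)"
proof -
 assume n: "n >= 1"
 have "real n * (cn n)\<^sup>2 = real n powr 1 * (real n powr (- (1 + max (1 - \<beta>) 0) / 2) * real n powr (- (1 + max (1 - \<beta>) 0) / 2))"
  unfolding cn_def using n by (simp add: power2_eq_square)
 also have "... = real n powr (1 + (- (1 + max (1 - \<beta>) 0) / 2 + - (1 + max (1 - \<beta>) 0) / 2))" by (simp only: powr_add)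
 also have "1 + (- (1 + max (1 - \<beta>) 0) / 2 + - (1 + max (1 - \<beta>) 0) / 2) = - max (1 - \<beta>) 0" by (simp add: field_simps)
 finally show ?thesis .
qed

lemma n_cn2_lim: "(%n. real n * (cn n)\<^sup>2) \<longlonglongrightarrow> b2"
proof (rule Lim_transform_eventually)
 show "(%n. real n powr (- max (1 - \<beta>) 0)) \<longlonglongrightarrow> b2"
 proof (cases "\<beta> >= 1")
  case True
  have "\<forall>\<^sub>F n in sequentially. 1 = real n powr (- max (1 - \<beta>) 0)"
   using eventually_ge_at_top[of 1] by eventually_elim (use True in \<open>simp add: max_def\<close>)
  then have "(%n. real n powr (- max (1 - \<beta>) 0)) \<longlonglongrightarrow> 1" by (rule Lim_transform_eventually[OF tendsto_const])
  then show ?thesis using True unfolding b2_def by simp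
 next
  case False
  then show ?thesis unfolding b2_def by (simp add: max_def) (rule tendsto_neg_powr, auto intro: filterlim_real_sequentially)
 qed
 show "\<forall>\<^sub>F n in sequentially. real n powr (- max (1 - \<beta>) 0) = real n * (cn n)\<^sup>2"
  using eventually_ge_at_top[of 1] by eventually_elim (simp add: n_cn2)
qed

lemma sqrt_sp: "sqrt (sp n) = real n powr (\<beta> / 2)"
 unfolding sp_def by (simp add: powr_half_sqrt[symmetric] powr_powr)

lemma rate_lim: "(%n. C / sqrt (sp n)) \<longlonglongrightarrow> 0"
proof -
 have "(%n. C * real n powr (- (\<beta> / 2))) \<longlonglongrightarrow> C * 0"
  using beta by (intro tendsto_mult tendsto_const tendsto_neg_powr filterlim_real_sequentially) auto
 then show ?thesis unfolding sqrt_sp powr_minus mult_zero_right divide_inverse .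
qed

text \<open>The default noise is integrated out given the chain. Its conditional variance is
  deterministic up to a multiple of \<open>W n\<close>, so it factors off, and the characteristic
  function of the linear functional \<open>n cn D\<close> of the chain remains. Replacing
  \<open>mu\<close> by \<open>D\<close> is harmless since \<open>n cn\<close> is at most
  \<open>sqrt (sp n)\<close> while the mean of \<open>R n\<close> is of order
  \<open>1 / sp n\<close>.\<close>

lemma char_reduction:
 "(%n. (LINT w|M. iexp (KX n w)) - of_real (exp (- (b2 * vlim / 2))) * (LINT w|M. iexp (real n * cn n * D n w))) \<longlonglongrightarrow> 0"
proof -
 obtain C where C: "C >= 0" "!!n. n >= 1 ==> (LINT w|M. W n w) <= C / sqrt (sp n)"
  "!!n. n >= 1 ==> (LINT w|M. \<bar>D n w\<bar>) <= C / sqrt (sp n)" "!!n. n >= 1 ==> (LINT w|M. R n w) <= C / sp n"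
  by (rule Del_L1) (rule that)
 define c0 where "c0 = (2 * E)^3 + 3 * (2 * E)^4"
 define e where "e = exp (Df * t L)"
 have vl0: "vlim >= 0" unfolding vlim_def using a(3) by (intro sum_nonneg mult_nonneg_nonneg) auto
 define bnd where "bnd n = cn n * c0 + (e * (C / sqrt (sp n)) + 2 * E\<^sup>2 * (C / sqrt (sp n)) + \<bar>real n * (cn n)\<^sup>2 - b2\<bar> * vlim / 2)" for n
 have c00: "c0 >= 0" unfolding c0_def using E(1) by simp
 have "\<forall>\<^sub>F n in sequentially. cn n < 1 / (2 * E + 1)"
  using E(1) by (intro order_tendstoD(2)[OF cn_tendsto_0]) auto
 then have ev: "\<forall>\<^sub>F n in sequentially. n >= 1 \<and> cn n <= 1 \<and> cn n * (2 * E) <= 1"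
  using eventually_ge_at_top[of 1]
 proof eventually_elim
  case (elim n)
  then have "cn n * (2 * E + 1) < 1" using E(1) by (simp add: pos_less_divide_eq)
  moreover have "0 < cn n" "0 <= cn n * (2 * E)" using cn_bounds(1)[of n] E(1) elim by auto
  ultimately show ?case using elim by (simp add: distrib_left)
 qed
 show ?thesis
 proof (rule Lim_null_comparison[where g = bnd])
  have "bnd \<longlonglongrightarrow> 0 * c0 + (e * 0 + 2 * E\<^sup>2 * 0 + \<bar>b2 - b2\<bar> * vlim / 2)"
   unfolding bnd_def by (intro tendsto_intros cn_tendsto_0 rate_lim n_cn2_lim) simp
  then show "bnd \<longlonglongrightarrow> 0" by simp
  show "\<forall>\<^sub>F n in sequentially. norm ((LINT w|M. iexp (KX n w)) - of_real (exp (- (b2 * vlim / 2))) * (LINT w|M. iexp (real n * cn n * D n w))) <= bnd n"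
   using ev
  proof eventually_elim
   case (elim n)
   then have n: "n >= 1" and c: "cn n <= 1" "cn n * (2 * E) <= 1" by auto
   note cb = cn_bounds[OF n]
   note sp0 = sp_pos[OF n]
   define Ze where "Ze w = (\<Sum>j\<le>L. of_real (pc n w j) * iexp (cn n * et j)) ^ n" for w
   define Y where "Y w = iexp (real n * cn n * D n w)" for w
   define ww where "ww = complex_of_real (exp (- (b2 * vlim / 2)))"
   let ?x = "%w. real n * cn n * mu n w" and ?y = "%w. real n * cn n * D n w" and ?r = "\<bar>real n * (cn n)\<^sup>2 - b2\<bar> * vlim / 2"
   define G where "G w = real n * cn n * e * R n w + 2 * E\<^sup>2 * W n w + (real n * (cn n)^3 * c0 + ?r)" for w
   have Zm: "Ze \<in> borel_measurable M" unfolding Ze_def using pc_meas[OF n] by measurable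
   have Ym: "Y \<in> borel_measurable M" unfolding Y_def using D_meas[OF n] by measurable
   have pt: "norm (Ze w - ww * Y w) <= G w" if w: "w \<in> space M" for w
   proof -
    define u where "u = real n * (cn n)\<^sup>2 * vv n w / 2"
    have u0: "u >= 0" unfolding u_def using mu_vv_props(1)[OF n w] by simp
    have b0: "b2 * vlim / 2 >= 0" unfolding b2_def using vl0 by simp
    have "norm (Ze w - iexp (?x w) * of_real (exp (- u))) <= real n * (cn n)^3 * c0"
     unfolding Ze_def u_def c0_def by (rule zeta_est[OF n w c])
    moreover have "norm (iexp (?x w) * of_real (exp (- u)) - ww * Y w) <= real n * cn n * e * R n w + (2 * E\<^sup>2 * W n w + ?r)"
    proof -
     have "iexp (?x w) * of_real (exp (- u)) - ww * Y w = (iexp (?x w) - Y w) * of_real (exp (- u)) + Y w * of_real (exp (- u) - exp (- (b2 * vlim / 2)))"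
      unfolding ww_def by (simp add: algebra_simps)
     also have "norm ... <= norm (iexp (?x w) - Y w) * exp (- u) + \<bar>exp (- u) - exp (- (b2 * vlim / 2))\<bar>"
      by (rule norm_triangle_le) (simp add: norm_mult Y_def del: of_real_diff)
     also have "... <= \<bar>?x w - ?y w\<bar> * 1 + exp 0 * \<bar>u - b2 * vlim / 2\<bar>"
      unfolding Y_def using u0 b0 by (intro add_mono mult_mono norm_iexp_diff exp_neg_lipschitz) auto
     finally have 1: "norm (iexp (?x w) * of_real (exp (- u)) - ww * Y w) <= \<bar>?x w - ?y w\<bar> + \<bar>u - b2 * vlim / 2\<bar>" by simp
     have "\<bar>?x w - ?y w\<bar> = real n * cn n * \<bar>mu n w - D n w\<bar>"
      using cb(1) by (simp add: right_diff_distrib[symmetric] abs_mult)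
     also have "... <= real n * cn n * (e * R n w)" unfolding e_def using cb(1) by (intro mult_left_mono mu_dev n w) auto
     finally have 2: "\<bar>?x w - ?y w\<bar> <= real n * cn n * e * R n w" by (simp add: mult.assoc)
     have "u - b2 * vlim / 2 = real n * (cn n)\<^sup>2 * (vv n w - vlim) / 2 + (real n * (cn n)\<^sup>2 - b2) * vlim / 2" unfolding u_def by (simp add: field_simps)
     then have "\<bar>u - b2 * vlim / 2\<bar> <= \<bar>real n * (cn n)\<^sup>2 * (vv n w - vlim) / 2\<bar> + \<bar>(real n * (cn n)\<^sup>2 - b2) * vlim / 2\<bar>" by (simp only: abs_triangle_ineq)
     also have "\<bar>real n * (cn n)\<^sup>2 * (vv n w - vlim) / 2\<bar> <= 1 * (4 * E\<^sup>2 * W n w) / 2"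
     proof -
      have "(real n * (cn n)\<^sup>2) * \<bar>vv n w - vlim\<bar> <= 1 * (4 * E\<^sup>2 * W n w)"
       using vv_dev[OF n w] cb(3) by (intro mult_mono) (simp_all add: mult.commute)
      then show ?thesis by (simp add: abs_mult mult_ac)
     qed
     also have "\<bar>(real n * (cn n)\<^sup>2 - b2) * vlim / 2\<bar> = ?r" using vl0 by (simp add: abs_mult)
     finally have "\<bar>u - b2 * vlim / 2\<bar> <= 2 * E\<^sup>2 * W n w + ?r" by (simp add: mult_ac)
     then show ?thesis using 1 2 by linarith
    qed
    ultimately show ?thesis unfolding G_def using norm_triangle_ineq[of "Ze w - iexp (?x w) * of_real (exp (- u))" "iexp (?x w) * of_real (exp (- u)) - ww * Y w"] by simp
   qed
   note WI = grid_integrable(3)[OF n] and RI = grid_integrable(4)[OF n]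
   have GI: "integrable M G" unfolding G_def using WI RI by simp
   have dm: "(%w. Ze w - ww * Y w) \<in> borel_measurable M" using Zm Ym by measurable
   have dI: "integrable M (%w. Ze w - ww * Y w)"
    by (rule Bochner_Integration.integrable_bound[OF GI dm]) (intro AE_I2, use pt in \<open>simp add: order_trans[OF _ abs_ge_self]\<close>)
   have YI: "integrable M Y" by (rule integrable_bounded[of _ 1]) (use Ym in \<open>auto simp: Y_def\<close>)
   have "(LINT w|M. Ze w) = (LINT w|M. (Ze w - ww * Y w) + ww * Y w)" by simp
   also have "... = (LINT w|M. Ze w - ww * Y w) + ww * (LINT w|M. Y w)" using dI YI by (subst Bochner_Integration.integral_add) auto
   finally have "(LINT w|M. Ze w) - ww * (LINT w|M. Y w) = (LINT w|M. Ze w - ww * Y w)" by simp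
   then have "norm ((LINT w|M. Ze w) - ww * (LINT w|M. Y w)) <= (LINT w|M. norm (Ze w - ww * Y w))" by simp
   also have "... <= (LINT w|M. G w)" using dI GI pt by (intro integral_mono) auto
   also have "... = real n * cn n * e * (LINT w|M. R n w) + 2 * E\<^sup>2 * (LINT w|M. W n w) + (real n * (cn n)^3 * c0 + ?r)"
    unfolding G_def using WI RI by (simp add: prob_space)
   also have "... <= e * (C / sqrt (sp n)) + 2 * E\<^sup>2 * (C / sqrt (sp n)) + (cn n * c0 + ?r)"
   proof (intro add_mono order_refl)
    have "cn n * real n <= sqrt (sp n)" using cb(5) unfolding sqrt_sp .
    then have "(cn n * real n) * (LINT w|M. R n w) <= sqrt (sp n) * (C / sp n)"
     using C(1) C(4)[OF n] sp0 by (intro mult_mono) (auto intro!: Bochner_Integration.integral_nonneg sum_nonneg simp: R_def)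
    also have "... = C / sqrt (sp n)" using sp0 by (simp add: field_simps)
    finally have "e * ((cn n * real n) * (LINT w|M. R n w)) <= e * (C / sqrt (sp n))" unfolding e_def by (intro mult_left_mono) auto
    then show "real n * cn n * e * (LINT w|M. R n w) <= e * (C / sqrt (sp n))" by (simp add: mult_ac)
    show "2 * E\<^sup>2 * (LINT w|M. W n w) <= 2 * E\<^sup>2 * (C / sqrt (sp n))" by (intro mult_left_mono C(2) n) auto
    have "real n * (cn n)^3 = ((cn n)\<^sup>2 * real n) * cn n" by (simp add: power3_eq_cube power2_eq_square)
    also have "... <= 1 * cn n" using cb(1,3) by (intro mult_right_mono) auto
    finally show "real n * (cn n)^3 * c0 <= cn n * c0" using c00 by (intro mult_right_mono) auto
   qed
   finally show ?case unfolding char_KX[OF n] Ze_def Y_def ww_def bnd_def by simp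
  qed
 qed
qed

text \<open>Induction on the cells: the earlier increments form a weight of modulus 1 that is
  measurable at the start of the next cell. With frequency
  \<open>\<eta> = \<theta> / sqrt (sp n)\<close> and length \<open>sp n * d\<close> the product of
  \<open>\<eta>^2\<close> and the length stays fixed, so the error of \<open>char_estimate\<close>
  is of order \<open>\<bar>\<eta>\<bar>\<close>.\<close>

lemma char_additive:
 assumes b: "\<beta> <= 1"
 shows "(%n. LINT w|M. iexp (\<Sum>l<l'. \<theta> l / sqrt (sp n) * ainc n l w))
  \<longlonglongrightarrow> of_real (exp (- (\<Sum>l<l'. (\<theta> l)\<^sup>2 * (V * (t (Suc l) - t l))) / 2))"
proof (induction l')
 case 0
 then show ?case by (simp add: prob_space)
next
 case (Suc p)
 have g': "!!i. gen_adj Q g i = - f i" and k': "!!i. gen_adj Q k i = V / 2 - f i * g i" using g k unfolding f_def li_def by auto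
 have "\<exists>K\<ge>0. \<forall>\<eta> s T (\<Psi>::'a => complex). \<bar>\<eta>\<bar> <= 1 \<longrightarrow> 0 <= s \<longrightarrow> s <= T \<longrightarrow> \<Psi> \<in> borel_measurable (Ft s) \<longrightarrow>
   (\<forall>w\<in>space M. norm (\<Psi> w) <= 1) \<longrightarrow>
   norm ((LINT w|M. \<Psi> w * iexp (\<eta> * Aint f s T w)) - of_real (exp (- (\<eta>\<^sup>2 * V / 2) * (T - s))) * (LINT w|M. \<Psi> w))
    <= K * exp (\<eta>\<^sup>2 * \<bar>V\<bar> * (T - s)) * (\<bar>\<eta>\<bar> + \<bar>\<eta>\<bar>^3 * (T - s))" (is "\<exists>K\<ge>0. ?P K")
 proof (rule char_estimate[OF g' k'], goal_cases)
  case (1 K)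
  show ?case by (intro exI[of _ K] conjI allI impI 1) blast+
 qed
 then obtain K where "?P K" by blast
 note K = this[rule_format]
 define \<eta> where "\<eta> n = \<theta> p / sqrt (sp n)" for n
 define \<Psi> where "\<Psi> n w = iexp (\<Sum>l<p. \<theta> l / sqrt (sp n) * ainc n l w)" for n w
 define d where "d = t (Suc p) - t p"
 define ww where "ww = complex_of_real (exp (- ((\<theta> p)\<^sup>2 * (V * d) / 2)))"
 have \<eta>0: "\<eta> \<longlonglongrightarrow> 0" unfolding \<eta>_def by (rule rate_lim)
 have "(%n. (LINT w|M. \<Psi> n w * iexp (\<eta> n * ainc n p w)) - ww * (LINT w|M. \<Psi> n w)) \<longlonglongrightarrow> 0"
 proof (rule Lim_null_comparison)
  have "(%n. K * exp ((\<theta> p)\<^sup>2 * \<bar>V\<bar> * d) * (\<bar>\<eta> n\<bar> + \<bar>\<eta> n\<bar> * ((\<theta> p)\<^sup>2 * d))) \<longlonglongrightarrow> K * exp ((\<theta> p)\<^sup>2 * \<bar>V\<bar> * d) * (\<bar>0\<bar> + \<bar>0\<bar> * ((\<theta> p)\<^sup>2 * d))"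
   by (intro tendsto_intros \<eta>0)
  then show "(%n. K * exp ((\<theta> p)\<^sup>2 * \<bar>V\<bar> * d) * (\<bar>\<eta> n\<bar> + \<bar>\<eta> n\<bar> * ((\<theta> p)\<^sup>2 * d))) \<longlonglongrightarrow> 0" by simp
  have "\<forall>\<^sub>F n in sequentially. \<bar>\<eta> n\<bar> < 1" by (rule order_tendstoD(2)[OF tendsto_rabs_zero[OF \<eta>0]]) simp
  then show "\<forall>\<^sub>F n in sequentially. norm ((LINT w|M. \<Psi> n w * iexp (\<eta> n * ainc n p w)) - ww * (LINT w|M. \<Psi> n w))
   <= K * exp ((\<theta> p)\<^sup>2 * \<bar>V\<bar> * d) * (\<bar>\<eta> n\<bar> + \<bar>\<eta> n\<bar> * ((\<theta> p)\<^sup>2 * d))"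
   using eventually_ge_at_top[of 1]
  proof eventually_elim
   case (elim n)
   note sp0 = sp_pos[OF elim(2)]
   have Td: "sp n * t (Suc p) - sp n * t p = sp n * d" unfolding d_def by (simp add: right_diff_distrib)
   have e2: "(\<eta> n)\<^sup>2 * (sp n * d) = (\<theta> p)\<^sup>2 * d" unfolding \<eta>_def using sp0 by (simp add: power_divide)
   have \<Psi>m: "\<Psi> n \<in> borel_measurable (Ft (sp n * t p))"
    unfolding \<Psi>_def
   proof -
    have "ainc n l \<in> borel_measurable (Ft (sp n * t p))" if "l < p" for l
    proof (rule measurable_from_subalg[OF Ft_mono Aint_Ft])
     show "sp n * t (Suc l) <= sp n * t p" using sp0 monoD[OF t(1), of "Suc l" p] that by simp
     show "0 <= sp n * t l" "sp n * t l <= sp n * t (Suc l)" using sp0 t(3,4)[of l] by auto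
    qed
    then have "(%w. \<Sum>l<p. \<theta> l / sqrt (sp n) * ainc n l w) \<in> borel_measurable (Ft (sp n * t p))"
     by (intro borel_measurable_sum borel_measurable_times borel_measurable_const) auto
    then show "(%w. iexp (\<Sum>l<p. \<theta> l / sqrt (sp n) * ainc n l w)) \<in> borel_measurable (Ft (sp n * t p))" by measurable
   qed
   have "norm ((LINT w|M. \<Psi> n w * iexp (\<eta> n * ainc n p w)) - of_real (exp (- ((\<eta> n)\<^sup>2 * V / 2) * (sp n * t (Suc p) - sp n * t p))) * (LINT w|M. \<Psi> n w))
    <= K * exp ((\<eta> n)\<^sup>2 * \<bar>V\<bar> * (sp n * t (Suc p) - sp n * t p)) * (\<bar>\<eta> n\<bar> + \<bar>\<eta> n\<bar>^3 * (sp n * t (Suc p) - sp n * t p))"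
    by (rule K[OF _ _ _ \<Psi>m]) (use elim sp0 t(3,4)[of p] in \<open>auto simp: \<Psi>_def\<close>)
   also have "(\<eta> n)\<^sup>2 * \<bar>V\<bar> * (sp n * t (Suc p) - sp n * t p) = (\<theta> p)\<^sup>2 * \<bar>V\<bar> * d"
   proof -
    have "(\<eta> n)\<^sup>2 * \<bar>V\<bar> * (sp n * d) = \<bar>V\<bar> * ((\<eta> n)\<^sup>2 * (sp n * d))" by (simp only: mult_ac)
    then show ?thesis unfolding Td e2 by (simp only: mult_ac)
   qed
   also have "\<bar>\<eta> n\<bar>^3 * (sp n * t (Suc p) - sp n * t p) = \<bar>\<eta> n\<bar> * ((\<eta> n)\<^sup>2 * (sp n * d))"
    unfolding Td by (simp add: power3_eq_cube power2_eq_square)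
   also have "- ((\<eta> n)\<^sup>2 * V / 2) * (sp n * t (Suc p) - sp n * t p) = - (V * ((\<eta> n)\<^sup>2 * (sp n * d)) / 2)"
    unfolding Td by (simp add: mult_ac)
   finally show ?case unfolding e2 ww_def by (simp add: mult_ac)
  qed
 qed
 moreover have "(%n. ww * (LINT w|M. \<Psi> n w)) \<longlonglongrightarrow> ww * of_real (exp (- (\<Sum>l<p. (\<theta> l)\<^sup>2 * (V * (t (Suc l) - t l))) / 2))"
  unfolding \<Psi>_def by (intro tendsto_intros Suc.IH)
 ultimately have "(%n. ((LINT w|M. \<Psi> n w * iexp (\<eta> n * ainc n p w)) - ww * (LINT w|M. \<Psi> n w)) + ww * (LINT w|M. \<Psi> n w))
  \<longlonglongrightarrow> 0 + ww * of_real (exp (- (\<Sum>l<p. (\<theta> l)\<^sup>2 * (V * (t (Suc l) - t l))) / 2))" by (rule tendsto_add)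
 moreover have "ww * of_real (exp (- (\<Sum>l<p. (\<theta> l)\<^sup>2 * (V * (t (Suc l) - t l))) / 2)) = of_real (exp (- (\<Sum>l<Suc p. (\<theta> l)\<^sup>2 * (V * (t (Suc l) - t l))) / 2))"
  unfolding ww_def d_def of_real_mult[symmetric] exp_add[symmetric] by (simp add: add_divide_distrib)
 moreover have "\<Psi> n w * iexp (\<eta> n * ainc n p w) = iexp (\<Sum>l<Suc p. \<theta> l / sqrt (sp n) * ainc n l w)" for n w
  unfolding \<Psi>_def \<eta>_def by (simp add: exp_add[symmetric] distrib_left)
 ultimately show ?case by simp
qed

text \<open>For \<open>\<beta> <= 1\<close> the factor \<open>n cn\<close> equals
  \<open>sqrt (sp n)\<close>, the natural scale of the additive functional. For
  \<open>\<beta> > 1\<close> it is \<open>sqrt n\<close>, of smaller order than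
  \<open>sqrt (sp n)\<close>, and the chain contributes nothing in the limit.\<close>

theorem char_limit:
 "(%n. LINT w|M. iexp (KX n w)) \<longlonglongrightarrow> of_real (exp (- (\<Sum>l<L. (\<theta> l)\<^sup>2 * (b1 * V * (t (Suc l) - t l) + b2 * (a (Suc l) - a l))) / 2))"
proof -
 have D_lim: "(%n. LINT w|M. iexp (real n * cn n * D n w)) \<longlonglongrightarrow> of_real (exp (- (b1 * (\<Sum>l<L. (\<theta> l)\<^sup>2 * (V * (t (Suc l) - t l)))) / 2))"
 proof (cases "\<beta> <= 1")
  case True
  show ?thesis
  proof (rule Lim_transform_eventually)
   show "(%n. LINT w|M. iexp (\<Sum>l<L. \<theta> l / sqrt (sp n) * ainc n l w)) \<longlonglongrightarrow> of_real (exp (- (b1 * (\<Sum>l<L. (\<theta> l)\<^sup>2 * (V * (t (Suc l) - t l)))) / 2))"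
    using char_additive[OF True, of L] True unfolding b1_def by simp
   show "\<forall>\<^sub>F n in sequentially. (LINT w|M. iexp (\<Sum>l<L. \<theta> l / sqrt (sp n) * ainc n l w)) = (LINT w|M. iexp (real n * cn n * D n w))"
    using eventually_ge_at_top[of 1]
   proof eventually_elim
    case (elim n)
    have "(real n * cn n)\<^sup>2 = real n * (real n * (cn n)\<^sup>2)" by (simp add: power2_eq_square)
    also have "... = real n powr 1 * real n powr (\<beta> - 1)" unfolding n_cn2[OF elim] using True elim by (simp add: max_def)
    also have "... = sp n" unfolding powr_add[symmetric] sp_def by simp
    finally have e: "real n * cn n = sqrt (sp n)" using cn_bounds(1)[OF elim] by (simp add: real_sqrt_unique)
    note sp0 = sp_pos[OF elim]
    have "real n * cn n * D n w = (\<Sum>l<L. \<theta> l / sqrt (sp n) * ainc n l w)" if "w \<in> space M" for w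
     unfolding e D_def sum_distrib_left
    proof (rule sum.cong[OF refl])
     fix l
     have "sqrt (sp n) * (x * (y / sp n)) = x / sqrt (sp n) * y" for x y :: real
      using sp0 real_sqrt_mult_self[of "sp n"] by (simp add: field_simps)
     then show "sqrt (sp n) * (\<theta> l * (dl n (Suc l) w - dl n l w)) = \<theta> l / sqrt (sp n) * ainc n l w"
      unfolding Del_diff[OF elim that t(3,4)] .
    qed
    then show ?case by (intro Bochner_Integration.integral_cong) simp_all
   qed
  qed
 next
  case False
  obtain C where C: "C >= 0" "!!n. n >= 1 ==> (LINT w|M. W n w) <= C / sqrt (sp n)"
   "!!n. n >= 1 ==> (LINT w|M. \<bar>D n w\<bar>) <= C / sqrt (sp n)" "!!n. n >= 1 ==> (LINT w|M. R n w) <= C / sp n"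
   by (rule Del_L1) (rule that)
  have "(%n. (LINT w|M. iexp (real n * cn n * D n w)) - 1) \<longlonglongrightarrow> 0"
  proof (rule Lim_null_comparison)
   have "(%n. C * real n powr ((1 - \<beta>) / 2)) \<longlonglongrightarrow> C * 0"
    using False by (intro tendsto_mult tendsto_const tendsto_neg_powr filterlim_real_sequentially) auto
   then show "(%n. C * real n powr ((1 - \<beta>) / 2)) \<longlonglongrightarrow> 0" by simp
   show "\<forall>\<^sub>F n in sequentially. norm ((LINT w|M. iexp (real n * cn n * D n w)) - 1) <= C * real n powr ((1 - \<beta>) / 2)"
    using eventually_ge_at_top[of 1]
   proof eventually_elim
    case (elim n)
    note sp0 = sp_pos[OF elim]
    have "(real n * cn n)\<^sup>2 = real n * (real n * (cn n)\<^sup>2)" by (simp add: power2_eq_square)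
    also have "... = real n" unfolding n_cn2[OF elim] using False elim by (simp add: max_def)
    finally have e: "real n * cn n = sqrt (real n)" using cn_bounds(1)[OF elim] by (simp add: real_sqrt_unique)
    have Im: "(%w. iexp (real n * cn n * D n w)) \<in> borel_measurable M" using D_meas[OF elim] by measurable
    have I: "integrable M (%w. iexp (real n * cn n * D n w))" by (rule integrable_bounded[of _ 1, OF Im]) simp
    note DI = grid_integrable(5)[OF elim]
    have "(LINT w|M. iexp (real n * cn n * D n w)) - 1 = (LINT w|M. iexp (real n * cn n * D n w) - 1)"
     using I by (simp add: prob_space)
    also have "norm ... <= (LINT w|M. norm (iexp (real n * cn n * D n w) - 1))" by simp
    also have "... <= (LINT w|M. sqrt (real n) * \<bar>D n w\<bar>)"
    proof (rule integral_mono)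
     show "integrable M (%w. norm (iexp (real n * cn n * D n w) - 1))" using I by simp
     show "norm (iexp (real n * cn n * D n w) - 1) <= sqrt (real n) * \<bar>D n w\<bar>" for w
      using norm_iexp_diff[of "real n * cn n * D n w" 0] unfolding e by (simp add: abs_mult)
    qed (use DI in simp)
    also have "... = sqrt (real n) * (LINT w|M. \<bar>D n w\<bar>)" by simp
    also have "... <= sqrt (real n) * (C / sqrt (sp n))" by (rule mult_left_mono[OF C(3)[OF elim]]) simp
    also have "... = C * (real n powr (1/2) * real n powr (- (\<beta> / 2)))" unfolding sqrt_sp powr_half_sqrt[OF of_nat_0_le_iff] powr_minus divide_inverse[of C] by (simp only: mult_ac)
    also have "... = C * real n powr ((1 - \<beta>) / 2)" unfolding powr_add[symmetric] by (simp add: diff_divide_distrib)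
    finally show ?case .
   qed
  qed
  then show ?thesis using False unfolding b1_def by (simp add: LIM_zero_iff)
 qed
 define ww where "ww = complex_of_real (exp (- (b2 * vlim / 2)))"
 define T where "T = (\<Sum>l<L. (\<theta> l)\<^sup>2 * (V * (t (Suc l) - t l)))"
 have "(%n. ((LINT w|M. iexp (KX n w)) - ww * (LINT w|M. iexp (real n * cn n * D n w))) + ww * (LINT w|M. iexp (real n * cn n * D n w)))
   \<longlonglongrightarrow> 0 + ww * of_real (exp (- (b1 * T) / 2))"
  unfolding T_def ww_def by (intro tendsto_add char_reduction tendsto_mult tendsto_const D_lim)
 moreover have "ww * of_real (exp (- (b1 * T) / 2)) = of_real (exp (- (b1 * T + b2 * vlim) / 2))"
  unfolding ww_def of_real_mult[symmetric] exp_add[symmetric] by (simp add: add_divide_distrib)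
 moreover have "b1 * T + b2 * vlim = (\<Sum>l<L. (\<theta> l)\<^sup>2 * (b1 * V * (t (Suc l) - t l) + b2 * (a (Suc l) - a l)))"
  unfolding T_def vlim_def sum_distrib_left sum.distrib[symmetric] by (rule sum.cong) (simp_all add: algebra_simps)
 ultimately show ?thesis by simp
qed

end

section \<open>Laws at grid times, and assembly\<close>

definition abel_weight :: "real => nat => nat => (nat => real) => nat => real" where
 "abel_weight c m K \<theta> l = (\<Sum>j<K. if l < j then \<theta> j * exp (- (c * (real j / real m))) else 0)"

text \<open>Summation by parts, with \<open>x 0 = 0\<close> removing the boundary term. Prelimit and
  limit receive the same weights, so their characteristic functions can be compared
  directly.\<close>

lemma abel_weight_sum:
 fixes x :: "nat => real"
 assumes "x 0 = 0"
 shows "(\<Sum>j<K. \<theta> j * x j) = (\<Sum>l<K. abel_weight c m K \<theta> l * (exp (c * (real (Suc l) / real m)) * x (Suc l) - exp (c * (real l / real m)) * x l))"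
proof -
 define y where "y j = exp (c * (real j / real m)) * x j" for j
 have xy: "x j = exp (- (c * (real j / real m))) * y j" for j unfolding y_def by (simp add: exp_minus)
 have y: "y j = (\<Sum>l<K. if l < j then y (Suc l) - y l else 0)" if "j < K" for j
 proof -
  have "(\<Sum>l<K. if l < j then y (Suc l) - y l else 0) = (\<Sum>l\<in>{..<K} \<inter> {l. l < j}. y (Suc l) - y l)" by (simp add: sum.If_cases)
  also have "{..<K} \<inter> {l. l < j} = {..<j}" using that by auto
  also have "(\<Sum>l<j. y (Suc l) - y l) = y j" using sum_lessThan_telescope[of y j] assms by (simp add: y_def)
  finally show ?thesis by simp
 qed
 have "(\<Sum>j<K. \<theta> j * x j) = (\<Sum>j<K. \<Sum>l<K. (if l < j then \<theta> j * exp (- (c * (real j / real m))) else 0) * (y (Suc l) - y l))"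
 proof (rule sum.cong[OF refl])
  fix j assume "j \<in> {..<K}"
  then have "\<theta> j * x j = \<theta> j * exp (- (c * (real j / real m))) * (\<Sum>l<K. if l < j then y (Suc l) - y l else 0)"
   unfolding xy[of j] using y[of j] by simp
  also have "... = (\<Sum>l<K. (if l < j then \<theta> j * exp (- (c * (real j / real m))) else 0) * (y (Suc l) - y l))"
   unfolding sum_distrib_left by (rule sum.cong) auto
  finally show "\<theta> j * x j = (\<Sum>l<K. (if l < j then \<theta> j * exp (- (c * (real j / real m))) else 0) * (y (Suc l) - y l))" .
 qed
 also have "... = (\<Sum>l<K. abel_weight c m K \<theta> l * (y (Suc l) - y l))"
  unfolding abel_weight_def sum_distrib_right by (rule sum.swap)
 finally show ?thesis unfolding y_def .
qed

lemma (in prob_space) integral_cos_sin: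
 assumes "F \<in> borel_measurable M"
 shows "(LINT w|M. cos (F w)) = Re (LINT w|M. iexp (F w))" "(LINT w|M. sin (F w)) = Im (LINT w|M. iexp (F w))"
proof -
 have I: "integrable M (%w. iexp (F w))"
 proof (rule integrable_bounded[of _ 1])
  show "(%w. iexp (F w)) \<in> borel_measurable M" using assms by measurable
 qed simp
 have "Re (iexp x) = cos x" "Im (iexp x) = sin x" for x by (simp_all add: Re_exp Im_exp)
 then show "(LINT w|M. cos (F w)) = Re (LINT w|M. iexp (F w))" "(LINT w|M. sin (F w)) = Im (LINT w|M. iexp (F w))"
  using integral_Re[OF I] integral_Im[OF I] by simp_all
qed

text \<open>The passage from increments to values needs the path to vanish at time 0, which holds
  only off the null event of a nonpositive default time; hence the comparison of integrals almost
  everywhere.\<close>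

lemma (in mm_binomial) Xp_fdd:
 assumes m: "m > 0"
 defines "q \<equiv> %s. (if \<beta> <= 1 then 1 else 0) * V * s + (if \<beta> >= 1 then 1 else 0) * (exp (li * s) - 1)"
 shows "(%n. LINT w|M. iexp (\<Sum>j<K. \<theta> j * Xp n w (real j / real m)))
  \<longlonglongrightarrow> of_real (exp (- (\<Sum>l<K. (abel_weight li m K \<theta> l)\<^sup>2 * (q (real (Suc l) / real m) - q (real l / real m))) / 2))"
proof -
 interpret grid: mm_grid M Q Z \<pi> lam \<beta> \<tau> V g k m K "abel_weight li m K \<theta>" by unfold_locales (rule m)
 have qe: "grid.b1 * V * (grid.t (Suc l) - grid.t l) + grid.b2 * (grid.a (Suc l) - grid.a l) = q (real (Suc l) / real m) - q (real l / real m)" for l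
  unfolding q_def grid.b1_def grid.b2_def grid.t_def grid.a_def by (simp add: right_diff_distrib)
 show ?thesis
 proof (rule Lim_transform_eventually[OF grid.char_limit[unfolded qe]])
  show "\<forall>\<^sub>F n in sequentially. (LINT w|M. iexp (grid.KX n w)) = (LINT w|M. iexp (\<Sum>j<K. \<theta> j * Xp n w (real j / real m)))"
   using eventually_ge_at_top[of 1]
  proof eventually_elim
   case (elim n)
   interpret C: cond_indep M n "\<tau> n" "Lam n" by (rule cond_indep_n[OF elim])
   show ?case
   proof (rule integral_cong_AE)
    show "(%w. iexp (grid.KX n w)) \<in> borel_measurable M" using grid.KX_meas by measurable
    have "(%w. \<Sum>j<K. \<theta> j * Xp n w (real j / real m)) \<in> borel_measurable M" using Xp_meas by measurable
    then show "(%w. iexp (\<Sum>j<K. \<theta> j * Xp n w (real j / real m))) \<in> borel_measurable M" by measurable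
    show "AE w in M. iexp (grid.KX n w) = iexp (\<Sum>j<K. \<theta> j * Xp n w (real j / real m))"
     using C.\<tau>_pos
    proof eventually_elim
     fix w assume "\<forall>i\<in>{..<n}. 0 < \<tau> n i w"
     then have "{i. i < n \<and> \<tau> n i w <= ereal 0} = {}" by (auto simp: zero_ereal_def[symmetric] not_le)
     then have "Xp n w (real 0 / real m) = 0" unfolding Xp_def by simp
     from abel_weight_sum[where x = "%j. Xp n w (real j / real m)", OF this, of \<theta> K li m]
     show "iexp (grid.KX n w) = iexp (\<Sum>j<K. \<theta> j * Xp n w (real j / real m))"
      unfolding grid.KX_def grid.t_def grid.a_def by simp
    qed
   qed
  qed
 qed
qed

lemma (in ou_limit) Nh_fdd:
 assumes m: "m > 0"
 shows "(LINT w|M. iexp (\<Sum>j<K. \<theta> j * Nh (real j / real m) w))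
  = of_real (exp (- (\<Sum>l<K. (abel_weight lam m K \<theta> l)\<^sup>2 * (q (real (Suc l) / real m) - q (real l / real m))) / 2))"
 unfolding increments_char[OF m, symmetric]
proof (rule Bochner_Integration.integral_cong[OF refl])
 fix w assume "w \<in> space M"
 then have "Nh (real 0 / real m) w = 0" using Nh_0 by simp
 from abel_weight_sum[where x = "%j. Nh (real j / real m) w", OF this, of \<theta> K lam m]
 show "iexp (\<Sum>j<K. \<theta> j * Nh (real j / real m) w) = iexp (\<Sum>l<K. abel_weight lam m K \<theta> l * (Kp (real (Suc l) / real m) w - Kp (real l / real m) w))"
  unfolding Kp_def by simp
qed

theorem theorem5p4:
  fixes M :: "'a measure" and Q :: "real^'s^'s" and \<pi> lam :: "real^'s" and \<beta> :: real
    and Z :: "real \<Rightarrow> 'a \<Rightarrow> 's"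
    and \<tau> :: "nat \<Rightarrow> nat \<Rightarrow> 'a \<Rightarrow> ereal"
    and M' :: "'b measure" and G B Nh :: "real \<Rightarrow> 'b \<Rightarrow> real"
  defines "lam_inf \<equiv> lam \<bullet> \<pi>"
    and "V \<equiv> lam \<bullet> ((diag_mat \<pi> ** transpose (deviation_matrix Q \<pi>) + deviation_matrix Q \<pi> ** diag_mat \<pi>) *v lam)"
  assumes M: "prob_space M"
    and Q: "is_generator Q" and irr: "irreducible_gen Q" and stat: "stationary_dist Q \<pi>"
    and beta: "\<beta> > 0"
    and lam_nonneg: "\<forall>i. lam $ i \<ge> 0"
    and Z: "is_ctmc M Q Z"
    and tau_meas: "\<forall>n i. i < n \<longrightarrow> \<tau> n i \<in> borel_measurable M"
    and tau_cond: "\<forall>n (t::nat \<Rightarrow> real) A.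
          A \<in> sigma_sets (space M) {Z s -` {j} \<inter> space M | s j. s \<ge> 0} \<and> (\<forall>i<n. t i \<ge> 0) \<longrightarrow>
          measure M (A \<inter> {\<omega>\<in>space M. \<forall>i<n. ereal (t i) < \<tau> n i \<omega>})
          = (\<integral>\<omega>. indicator A \<omega> *
               (\<Prod>i<n. exp (- integral {0..t i} (\<lambda>s. lam $ Z (real n powr \<beta> * s) \<omega>))) \<partial>M)"
    and M': "prob_space M'"
    and G: "gaussian_martingale M' G (\<lambda>t. V / (2 * lam_inf) * (1 - exp (- 2 * lam_inf * t)))"
    and B: "gaussian_martingale M' B (\<lambda>t. 1 - exp (- lam_inf * t))"
    and GB_indep: "prob_space.indep_var M'
          (Pi\<^sub>M {0..} (\<lambda>_. borel)) (\<lambda>\<omega>. restrict (\<lambda>t. G t \<omega>) {0..})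
          (Pi\<^sub>M {0..} (\<lambda>_. borel)) (\<lambda>\<omega>. restrict (\<lambda>t. B t \<omega>) {0..})"
    and Nh: "\<forall>\<omega>\<in>space M'. continuous_on {0..} (\<lambda>t. Nh t \<omega>) \<and>
          (\<forall>t\<ge>0. Nh t \<omega> = - lam_inf * integral {0..t} (\<lambda>s. Nh s \<omega>)
                          + (if \<beta> \<le> 1 then G t \<omega> else 0) + (if \<beta> \<ge> 1 then B t \<omega> else 0))"
  shows "conv_dist_skorokhod M
           (\<lambda>n \<omega>. path_from0 (\<lambda>t. real n powr (- (1 + max (1 - \<beta>) 0) / 2) *
               (real (card {i. i < n \<and> \<tau> n i \<omega> \<le> ereal t}) - real n * (1 - exp (- lam_inf * t)))))
           M' (\<lambda>\<omega>. path_from0 (\<lambda>t. Nh t \<omega>))"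
proof -
 obtain g k where g: "!!i. gen_adj Q g i = - (lam $ i - lam \<bullet> \<pi>)"
  and k: "!!i. gen_adj Q k i = V / 2 - (lam $ i - lam \<bullet> \<pi>) * g i"
  and V0: "(\<forall>i. lam $ i >= 0) ==> lam \<bullet> \<pi> = 0 ==> V = 0"
  using poisson_correctors[OF Q irr stat, of lam] unfolding V_def by blast
 have li0: "lam_inf >= 0"
  unfolding lam_inf_def inner_vec_def using lam_nonneg stat by (auto simp: stationary_dist_def intro!: sum_nonneg)
 interpret P: mm_binomial M Q Z \<pi> lam \<beta> \<tau> V g k
 proof (intro mm_binomial.intro ctmc.intro mm_binomial_axioms.intro ctmc_axioms.intro M Z Q beta g k)
  show "0 <= lam $ i" for i using lam_nonneg by blast
  show "0 <= lam \<bullet> \<pi>" using li0 unfolding lam_inf_def .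
  show "\<tau> n i \<in> borel_measurable M" if "i < n" for n i using tau_meas that by blast
  fix n :: nat and t :: "nat => real" assume t: "!!i. i < n ==> t i >= 0"
  \<comment> \<open>With \<open>A = space M\<close> the conditional law is averaged over the chain
    and becomes the mixture formula of \<open>mm_binomial\<close>.\<close>
  have "measure M (space M \<inter> {w\<in>space M. \<forall>i<n. ereal (t i) < \<tau> n i w})
     = (LINT w|M. indicator (space M) w * (\<Prod>i<n. exp (- integral {0..t i} (%s. lam $ Z (real n powr \<beta> * s) w))))"
   using tau_cond sigma_sets_top[of "space M"] t by blast
  also have "... = (LINT w|M. (\<Prod>i<n. exp (- integral {0..t i} (%s. lam $ Z (real n powr \<beta> * s) w))))"
   by (rule Bochner_Integration.integral_cong) auto
  finally show "measure M {w\<in>space M. \<forall>i<n. ereal (t i) < \<tau> n i w} = (LINT w|M. (\<Prod>i<n. exp (- integral {0..t i} (%s. lam $ Z (real n powr \<beta> * s) w))))"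
   by (simp add: Int_absorb1)
 qed
 have li: "P.li = lam_inf" unfolding P.li_def lam_inf_def ..
 interpret O: ou_limit M' G B Nh "if \<beta> <= 1 then 1 else 0" "if \<beta> >= 1 then 1 else 0" lam_inf V
 proof (intro ou_limit.intro ou_limit_axioms.intro M' li0 G B GB_indep)
  show "lam_inf = 0 ==> V = 0" using V0 lam_nonneg unfolding lam_inf_def by blast
  show "continuous_on {0..} (%t. Nh t w)" if "w \<in> space M'" for w using Nh that by blast
  show "Nh t w = - lam_inf * integral {0..t} (%s. Nh s w) + (if \<beta> <= 1 then 1 else 0) * G t w + (if \<beta> >= 1 then 1 else 0) * B t w"
   if "w \<in> space M'" "t >= 0" for t w
  proof -
   have "Nh t w = - lam_inf * integral {0..t} (%s. Nh s w) + (if \<beta> <= 1 then G t w else 0) + (if \<beta> >= 1 then B t w else 0)"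
    using Nh that by blast
   then show ?thesis by simp
  qed
 qed auto
 define \<rho> where "\<rho> t = 1 - exp (- lam_inf * t)" for t
 define X where "X n w = countpath n (P.cn n) \<rho> (%i. \<tau> n i w)" for n w
 define Y where "Y w = path_from0 (%t. Nh t w)" for w
 have \<rho>c: "continuous_on {0..} \<rho>" unfolding \<rho>_def by (intro continuous_intros)
 have Xt: "X n w t = P.Xp n w t" if "t >= 0" for n w t
  unfolding X_def countpath_def path_from0_def P.Xp_def li \<rho>_def using that by simp
 have Yt: "Y w t = Nh t w" if "t >= 0" for w t unfolding Y_def path_from0_def using that by simp
 have Ycad: "Y w \<in> cadlag_paths" "continuous_on {0..} (Y w)" if "w \<in> space M'" for w
  unfolding Y_def using path_from0_continuous[OF O.Nh_cont[OF that]] by auto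
 have Ym: "(%w. Y w t) \<in> borel_measurable M'" if "t >= 0" for t using O.Nh_meas[OF that] by (simp add: Yt[OF that])
 \<comment> \<open>The common value of the characteristic functions: approached by those of
   \<open>X n\<close>, attained by that of \<open>Y\<close>.\<close>
 define ww where "ww m K \<theta> = complex_of_real (exp (- (\<Sum>l<K. (abel_weight lam_inf m K \<theta> l)\<^sup>2 * (O.q (real (Suc l) / real m) - O.q (real l / real m))) / 2))" for m K \<theta>
 have Xw: "(%n. LINT w|M. iexp (\<Sum>j<K. \<theta> j * X n w (real j / real m))) \<longlonglongrightarrow> ww m K \<theta>" if "m > 0" for m K \<theta>
  using P.Xp_fdd[OF that, of \<theta> K] unfolding ww_def li O.q_def by (simp add: Xt)
 have Yw: "(LINT w|M'. iexp (\<Sum>j<K. \<theta> j * Y w (real j / real m))) = ww m K \<theta>" if "m > 0" for m K \<theta>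
  using O.Nh_fdd[OF that, of \<theta> K] unfolding ww_def by (simp add: Yt)
 have Xm: "(%w. X n w t) \<in> borel_measurable M" if "t >= 0" for n t using P.Xp_meas by (simp add: Xt[OF that])
 have XSm: "(%w. \<Sum>j<K. \<theta> j * X n w (real j / real m)) \<in> borel_measurable M" for n K \<theta> m
  by (intro borel_measurable_sum borel_measurable_times borel_measurable_const Xm) simp
 have YSm: "(%w. \<Sum>j<K. \<theta> j * Y w (real j / real m)) \<in> borel_measurable M'" for K \<theta> m
  by (intro borel_measurable_sum borel_measurable_times borel_measurable_const Ym) simp
 interpret S: skor_conv M M' X Y
 proof (intro skor_conv.intro skor_conv_axioms.intro M M')
  show "X n \<in> M \<rightarrow>\<^sub>M skorokhod_borel" for n
   unfolding X_def
  proof (rule countpath_measurable[where L = lam_inf and R = 1])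
   show "\<tau> n i \<in> borel_measurable M" if "i < n" for i using tau_meas that by blast
   show "\<bar>\<rho> s - \<rho> t\<bar> <= lam_inf * \<bar>s - t\<bar>" if "0 <= s" "0 <= t" for s t
   proof -
    have "\<bar>exp (- (lam_inf * t)) - exp (- (lam_inf * s))\<bar> <= exp 0 * \<bar>lam_inf * t - lam_inf * s\<bar>"
     by (rule exp_neg_lipschitz) (use li0 that in auto)
    then show ?thesis unfolding \<rho>_def using li0 by (simp add: right_diff_distrib[symmetric] abs_mult abs_minus_commute)
   qed
   show "\<bar>\<rho> t\<bar> <= 1" if "t >= 0" for t unfolding \<rho>_def using li0 that by simp
  qed (rule li0 \<rho>c)+
  show "Y \<in> M' \<rightarrow>\<^sub>M skorokhod_borel" by (rule continuous_process_measurable[OF Ym Ycad])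
  show "X n w \<in> cadlag_paths" for n w unfolding X_def by (rule countpath_cadlag[OF \<rho>c])
  show "\<exists>m0. \<forall>m\<ge>m0. \<exists>N. \<forall>n\<ge>N. \<exists>A\<in>sets M. measure M A <= d \<and>
    (\<forall>w\<in>space M - A. \<forall>t. 0 <= t \<and> t <= real T \<longrightarrow> \<bar>X n w t - X n w (real (nat \<lfloor>real m * t\<rfloor>) / real m)\<bar> <= s)"
   if "0 < s" "0 < d" for T s d
   using P.Xp_tight[OF that, of T] by (simp add: Xt cong: conj_cong imp_cong)
  show "(%n. LINT w|M. cos (\<Sum>j<K. \<theta> j * X n w (real j / real m))) \<longlonglongrightarrow> (LINT w|M'. cos (\<Sum>j<K. \<theta> j * Y w (real j / real m)))"
   "(%n. LINT w|M. sin (\<Sum>j<K. \<theta> j * X n w (real j / real m))) \<longlonglongrightarrow> (LINT w|M'. sin (\<Sum>j<K. \<theta> j * Y w (real j / real m)))"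
   if "m > 0" for m K \<theta>
   unfolding P.integral_cos_sin[OF XSm] O.integral_cos_sin[OF YSm] Yw[OF that]
   by (intro tendsto_Re tendsto_Im Xw[OF that])+
 qed (use Ycad Xm Ym in auto)
 show ?thesis using S.weak_convergence unfolding X_def Y_def countpath_def P.cn_def \<rho>_def .
qed

end
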